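(* There exists a sequence $(F_n)$ of pairwise distinct real quadratic fields for which the following holds: for all $R>0$ and $\varepsilon>0$ there is a $C>0$ such that for all $n$ we have $$\operatorname{vol}\,(M_{F_n})_{\le R}\le C\,(\operatorname{vol}M_{F_n})^{1-1/10+\varepsilon},$$ where $M_F=\mathrm{SL}_2(\mathcal O_F)\backslash(\mathbb H^2\times\mathbb H^2)$ for a real quadratic field $F$.
   Context: $\mathcal O_F$ is the ring of integers of $F$, and $\mathrm{SL}_2(\mathcal O_F)$ acts on $X=\mathbb H^2\times\mathbb H^2$ via the two real embeddings of $F$. For $M=\Gamma\backslash X$, the injectivity radius at $x\in M$ is $\operatorname{inj}_x(M)=\frac12\inf_\gamma d(\tilde x,\gamma\tilde x)$, with $\tilde x\in X$ a lift of $x$ and $\gamma$ running over elements of $\Gamma$ acting non-trivially on $X$; the $R$-thin part is $(M)_{\le R}=\{x\in M:\operatorname{inj}_x(M)\le R\}$. *)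

theory Defs
  imports "HOL-Analysis.Analysis" "HOL-Computational_Algebra.Polynomial"
begin

section \<open>Real quadratic fields\<close>

interpretation rat_vs: vector_space "\<lambda>(q::rat) (x::real). of_rat q * x"
  by unfold_locales (simp_all add: algebra_simps of_rat_add of_rat_mult)

text \<open>
  A real quadratic field is normal over the rationals, so it has exactly one isomorphic copy
  inside the reals. Hence real quadratic fields are represented by subfields of the reals, and
  two of them are isomorphic iff they are equal as sets.
\<close>

definition real_subfield :: "real set \<Rightarrow> bool" where
  "real_subfield K \<longleftrightarrow> 0 \<in> K \<and> 1 \<in> K \<and>
     (\<forall>x\<in>K. \<forall>y\<in>K. x + y \<in> K \<and> x * y \<in> K) \<and> (\<forall>x\<in>K. - x \<in> K \<and> inverse x \<in> K)"

definition real_quadratic_field :: "real set \<Rightarrow> bool" where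
  "real_quadratic_field K \<longleftrightarrow> real_subfield K \<and> rat_vs.dim K = 2"

definition ring_of_integers :: "real set \<Rightarrow> real set" where
  "ring_of_integers K = {x \<in> K. algebraic_int x}"

definition real_embeddings :: "real set \<Rightarrow> (real \<Rightarrow> real) set" where
  "real_embeddings K = {\<sigma> \<in> extensional K. \<sigma> 1 = 1 \<and>
     (\<forall>x\<in>K. \<forall>y\<in>K. \<sigma> (x + y) = \<sigma> x + \<sigma> y \<and> \<sigma> (x * y) = \<sigma> x * \<sigma> y)}"

text \<open>
  For a real quadratic field there are exactly two real embeddings, one of which is the
  inclusion; \<open>second_embedding\<close> is the other one.
\<close>

definition first_embedding :: "real set \<Rightarrow> real \<Rightarrow> real" where
  "first_embedding K = restrict (\<lambda>x. x) K"

definition second_embedding :: "real set \<Rightarrow> real \<Rightarrow> real" where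
  "second_embedding K = (THE \<sigma>. \<sigma> \<in> real_embeddings K \<and> \<sigma> \<noteq> first_embedding K)"


section \<open>The product of two hyperbolic planes\<close>

definition upper_half_plane :: "complex set" where
  "upper_half_plane = {z. Im z > 0}"

definition hyp_dist :: "complex \<Rightarrow> complex \<Rightarrow> real" where
  "hyp_dist z w = arcosh (1 + (cmod (z - w))\<^sup>2 / (2 * Im z * Im w))"

definition hyp_area :: "complex measure" where
  "hyp_area = density (restrict_space lborel upper_half_plane) (\<lambda>z. ennreal (1 / (Im z)\<^sup>2))"

definition HH :: "(complex \<times> complex) set" where
  "HH = upper_half_plane \<times> upper_half_plane"

definition HH_dist :: "complex \<times> complex \<Rightarrow> complex \<times> complex \<Rightarrow> real" where
  "HH_dist x y = sqrt ((hyp_dist (fst x) (fst y))\<^sup>2 + (hyp_dist (snd x) (snd y))\<^sup>2)"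

definition HH_vol :: "(complex \<times> complex) measure" where
  "HH_vol = hyp_area \<Otimes>\<^sub>M hyp_area"

definition moebius :: "real^2^2 \<Rightarrow> complex \<Rightarrow> complex" where
  "moebius A z = (of_real (A$1$1) * z + of_real (A$1$2)) / (of_real (A$2$1) * z + of_real (A$2$2))"


section \<open>Quotients by group actions\<close>

definition orbit :: "('g \<Rightarrow> 'x \<Rightarrow> 'x) \<Rightarrow> 'g set \<Rightarrow> 'x \<Rightarrow> 'x set" where
  "orbit act \<Gamma> x = (\<lambda>g. act g x) ` \<Gamma>"

definition quotient_space :: "('g \<Rightarrow> 'x \<Rightarrow> 'x) \<Rightarrow> 'g set \<Rightarrow> 'x set \<Rightarrow> 'x set set" where
  "quotient_space act \<Gamma> X = orbit act \<Gamma> ` X"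

text \<open>
  The volume that a measure on \<open>X\<close> induces on the quotient: \<open>\<mu> U\<close> is the volume of the image of
  every measurable \<open>U\<close> that is mapped injectively to the quotient, and the volume of a general
  measurable \<open>B\<close> is the supremum over such \<open>U\<close> lying above \<open>B\<close>. No weight is given to elements
  of \<open>\<Gamma>\<close> that act trivially. By \<open>emeasure_quotient_measure_fundamental_domain\<close> below, this is
  the measure of the part of a measurable fundamental domain lying above \<open>B\<close>.
\<close>

definition quotient_volume ::
    "('g \<Rightarrow> 'x \<Rightarrow> 'x) \<Rightarrow> 'g set \<Rightarrow> 'x measure \<Rightarrow> 'x set set \<Rightarrow> ennreal" where
  "quotient_volume act \<Gamma> \<mu> B =
     (SUP U\<in>{U \<in> sets \<mu>. orbit act \<Gamma> ` U \<subseteq> B \<and> inj_on (orbit act \<Gamma>) U}. emeasure \<mu> U)"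

definition quotient_measure ::
    "('g \<Rightarrow> 'x \<Rightarrow> 'x) \<Rightarrow> 'g set \<Rightarrow> 'x measure \<Rightarrow> 'x set measure" where
  "quotient_measure act \<Gamma> \<mu> =
     measure_of (quotient_space act \<Gamma> (space \<mu>))
       {B. B \<subseteq> quotient_space act \<Gamma> (space \<mu>) \<and> orbit act \<Gamma> -` B \<inter> space \<mu> \<in> sets \<mu>}
       (quotient_volume act \<Gamma> \<mu>)"

lemma sigma_algebra_quotient:
  "sigma_algebra (quotient_space act \<Gamma> (space \<mu>))
     {B. B \<subseteq> quotient_space act \<Gamma> (space \<mu>) \<and> orbit act \<Gamma> -` B \<inter> space \<mu> \<in> sets \<mu>}"
  (is "sigma_algebra ?Q ?S")
proof -
  let ?p = "orbit act \<Gamma>"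
  have "?p -` (?Q - B) \<inter> space \<mu> \<in> sets \<mu>" if "?p -` B \<inter> space \<mu> \<in> sets \<mu>" for B
  proof -
    have "?p -` (?Q - B) \<inter> space \<mu> = space \<mu> - (?p -` B \<inter> space \<mu>)"
      by (auto simp: quotient_space_def)
    then show ?thesis using that by auto
  qed
  moreover have "?p -` (\<Union>i. A i) \<inter> space \<mu> \<in> sets \<mu>"
    if "\<And>i::nat. ?p -` (A i) \<inter> space \<mu> \<in> sets \<mu>" for A
  proof -
    have "?p -` (\<Union>i. A i) \<inter> space \<mu> = (\<Union>i. ?p -` (A i) \<inter> space \<mu>)" by auto
    also have "\<dots> \<in> sets \<mu>" using that by (intro sets.countable_UN) auto
    finally show ?thesis .
  qed
  ultimately show ?thesis
    unfolding sigma_algebra_iff2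
    by (safe; (simp del: vimage_UN vimage_Union add: image_subset_iff)?) blast+
qed

lemma space_quotient_measure [simp]:
  "space (quotient_measure act \<Gamma> \<mu>) = quotient_space act \<Gamma> (space \<mu>)"
  unfolding quotient_measure_def by (rule space_measure_of) auto

lemma sets_quotient_measure:
  "sets (quotient_measure act \<Gamma> \<mu>) =
     {B. B \<subseteq> quotient_space act \<Gamma> (space \<mu>) \<and> orbit act \<Gamma> -` B \<inter> space \<mu> \<in> sets \<mu>}"
  unfolding quotient_measure_def
  by (rule sigma_algebra.sets_measure_of_eq[OF sigma_algebra_quotient])

lemma quotient_volume_countably_additive:
  "countably_additive
     {B. B \<subseteq> quotient_space act \<Gamma> (space \<mu>) \<and> orbit act \<Gamma> -` B \<inter> space \<mu> \<in> sets \<mu>}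
     (quotient_volume act \<Gamma> \<mu>)"
proof (rule countably_additiveI)
  let ?p = "orbit act \<Gamma>" and ?v = "quotient_volume act \<Gamma> \<mu>"
  let ?I = "\<lambda>B. {U \<in> sets \<mu>. ?p ` U \<subseteq> B \<and> inj_on ?p U}"
  fix B :: "nat \<Rightarrow> 'a set set"
  assume B: "range B \<subseteq> {B. B \<subseteq> quotient_space act \<Gamma> (space \<mu>) \<and> ?p -` B \<inter> space \<mu> \<in> sets \<mu>}"
    and disj: "disjoint_family B"
  have "?v (\<Union>i. B i) \<le> (\<Sum>i. ?v (B i))"
    unfolding quotient_volume_def[of _ _ _ "\<Union>i. B i"]
  proof (rule SUP_least)
    fix U assume U: "U \<in> ?I (\<Union>i. B i)"
    let ?U = "\<lambda>i. U \<inter> (?p -` B i \<inter> space \<mu>)"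
    have m: "?U i \<in> sets \<mu>" for i using U B by auto
    have "U = (\<Union>i. ?U i)" using U sets.sets_into_space by blast
    moreover have "(\<Sum>i. emeasure \<mu> (?U i)) = emeasure \<mu> (\<Union>i. ?U i)"
    proof (rule suminf_emeasure)
      show "disjoint_family ?U" using disj by (auto simp: disjoint_family_on_def)
    qed (use m in auto)
    moreover have "emeasure \<mu> (?U i) \<le> ?v (B i)" for i
      unfolding quotient_volume_def
      using m[of i] U by (intro SUP_upper) (auto intro: inj_on_subset)
    ultimately show "emeasure \<mu> U \<le> (\<Sum>i. ?v (B i))"
      by (metis (no_types, lifting) suminf_le summableI)
  qed
  moreover have "(\<Sum>i. ?v (B i)) \<le> ?v (\<Union>i. B i)"
  proof (rule suminf_le_const)
    fix n
    have ne: "{} \<in> ?I A" for A by auto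
    let ?P = "\<lambda>i f. (\<forall>k. f k \<in> ?I (B i)) \<and> (\<lambda>k. emeasure \<mu> (f k)) \<longlonglongrightarrow> ?v (B i)"
    have ex: "\<exists>f. ?P i f" for i
    proof -
      define S where "S = emeasure \<mu> ` ?I (B i)"
      have "S \<noteq> {}" unfolding S_def using ne by blast
      from ennreal_Sup_countable_SUP[OF this]
      obtain h :: "nat \<Rightarrow> ennreal" where h: "incseq h" "range h \<subseteq> S" "Sup S = (SUP k. h k)"
        by blast
      have "\<exists>U. U \<in> ?I (B i) \<and> h k = emeasure \<mu> U" for k
      proof -
        have "h k \<in> S" using h(2) by blast
        then show ?thesis unfolding S_def by (elim imageE) (intro exI conjI)
      qed
      then have "\<forall>k. \<exists>U. U \<in> ?I (B i) \<and> h k = emeasure \<mu> U" by (rule allI)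
      from choice[OF this]
      obtain f where f: "\<forall>k. f k \<in> ?I (B i) \<and> h k = emeasure \<mu> (f k)" by (rule exE)
      then have he: "(\<lambda>k. emeasure \<mu> (f k)) = h" by auto
      have "h \<longlonglongrightarrow> ?v (B i)"
        using h(3) LIMSEQ_SUP[OF h(1)] unfolding quotient_volume_def S_def by simp
      then have "?P i f" using f unfolding he by blast
      then show ?thesis by (intro exI[of _ f])
    qed
    define f where "f i = (SOME f. ?P i f)" for i :: nat
    have P: "?P i (f i)" for i :: nat unfolding f_def by (rule someI_ex[OF ex])
    have f: "f i k \<in> ?I (B i)" "(\<lambda>k. emeasure \<mu> (f i k)) \<longlonglongrightarrow> ?v (B i)" for i :: nat and k :: nat
      using P[of i] by blast+
    have "(\<Sum>i<n. emeasure \<mu> (f i k)) \<le> ?v (\<Union>i. B i)" for k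
    proof -
      have dis: "disjoint_family_on (\<lambda>i. f i k) {..<n}"
        unfolding disjoint_family_on_def
      proof (intro ballI impI)
        fix i j :: nat assume "i \<noteq> j"
        then have "B i \<inter> B j = {}" using disj by (auto simp: disjoint_family_on_def)
        moreover have "?p ` f i k \<subseteq> B i" "?p ` f j k \<subseteq> B j" using f(1) by blast+
        ultimately show "f i k \<inter> f j k = {}" by blast
      qed
      have sub: "?p x \<in> B i" if "x \<in> f i k" for x i using f(1)[of i k] that by blast
      have "inj_on ?p (\<Union>i<n. f i k)"
      proof (rule inj_onI)
        fix x y assume x: "x \<in> (\<Union>i<n. f i k)" and y: "y \<in> (\<Union>i<n. f i k)" and e: "?p x = ?p y"
        from x y obtain i j where ij: "x \<in> f i k" "y \<in> f j k" by blast
        then have "?p x \<in> B i" "?p x \<in> B j" using sub e by metis+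
        then have "i = j" using disj by (auto simp: disjoint_family_on_def)
        then show "x = y" using ij e f(1)[of i k] by (auto dest: inj_onD)
      qed
      then have "(\<Union>i<n. f i k) \<in> ?I (\<Union>i. B i)" using f(1) by blast
      then have "emeasure \<mu> (\<Union>i<n. f i k) \<le> ?v (\<Union>i. B i)"
        unfolding quotient_volume_def by (rule SUP_upper)
      moreover have "(\<Sum>i<n. emeasure \<mu> (f i k)) = emeasure \<mu> (\<Union>i<n. f i k)"
        using f(1) dis by (intro sum_emeasure) auto
      ultimately show ?thesis by simp
    qed
    moreover have "(\<lambda>k. \<Sum>i<n. emeasure \<mu> (f i k)) \<longlonglongrightarrow> (\<Sum>i<n. ?v (B i))"
      by (intro tendsto_sum f)
    ultimately show "(\<Sum>i<n. ?v (B i)) \<le> ?v (\<Union>i. B i)"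
      by (intro LIMSEQ_le_const2) auto
  qed simp
  ultimately show "(\<Sum>i. ?v (B i)) = ?v (\<Union>i. B i)" by simp
qed

lemma emeasure_quotient_measure:
  assumes "B \<in> sets (quotient_measure act \<Gamma> \<mu>)"
  shows "emeasure (quotient_measure act \<Gamma> \<mu>) B = quotient_volume act \<Gamma> \<mu> B"
proof (rule emeasure_measure_of[OF quotient_measure_def[of act \<Gamma> \<mu>]])
  have "\<And>U. orbit act \<Gamma> ` U \<subseteq> {} \<Longrightarrow> emeasure \<mu> U = 0" by simp
  then have "quotient_volume act \<Gamma> \<mu> {} \<le> 0"
    unfolding quotient_volume_def by (intro SUP_least) auto
  then show "positive (sets (quotient_measure act \<Gamma> \<mu>)) (quotient_volume act \<Gamma> \<mu>)"
    by (simp add: positive_def)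
  show "countably_additive (sets (quotient_measure act \<Gamma> \<mu>)) (quotient_volume act \<Gamma> \<mu>)"
    unfolding sets_quotient_measure by (rule quotient_volume_countably_additive)
qed (use assms in auto)

lemma emeasure_quotient_measure_fundamental_domain:
  assumes cnt: "countable \<Gamma>"
    and orb: "\<And>g x. g \<in> \<Gamma> \<Longrightarrow> x \<in> space \<mu> \<Longrightarrow> orbit act \<Gamma> (act g x) = orbit act \<Gamma> x"
    and self: "\<And>x. x \<in> space \<mu> \<Longrightarrow> x \<in> orbit act \<Gamma> x"
    and inj: "\<And>g. g \<in> \<Gamma> \<Longrightarrow> inj_on (act g) (space \<mu>)"
    and meas: "\<And>g. g \<in> \<Gamma> \<Longrightarrow> act g \<in> measurable \<mu> \<mu>"
    and pres: "\<And>g A. g \<in> \<Gamma> \<Longrightarrow> A \<in> sets \<mu> \<Longrightarrow> emeasure \<mu> (act g -` A \<inter> space \<mu>) = emeasure \<mu> A"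
    and im: "\<And>g A. g \<in> \<Gamma> \<Longrightarrow> A \<in> sets \<mu> \<Longrightarrow> act g ` A \<in> sets \<mu>"
    and D: "D \<in> sets \<mu>" "inj_on (orbit act \<Gamma>) D"
      "orbit act \<Gamma> ` D = quotient_space act \<Gamma> (space \<mu>)"
    and B: "B \<in> sets (quotient_measure act \<Gamma> \<mu>)"
  shows "emeasure (quotient_measure act \<Gamma> \<mu>) B = emeasure \<mu> (D \<inter> orbit act \<Gamma> -` B)"
proof -
  let ?p = "orbit act \<Gamma>"
  have Dsp: "D \<subseteq> space \<mu>" using D(1) sets.sets_into_space by blast
  have pB: "?p -` B \<inter> space \<mu> \<in> sets \<mu>" using B by (simp add: sets_quotient_measure)
  have DB: "D \<inter> ?p -` B \<in> sets \<mu>"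
  proof -
    have "D \<inter> ?p -` B = D \<inter> (?p -` B \<inter> space \<mu>)" using Dsp by auto
    then show ?thesis using D(1) pB by auto
  qed
  have "emeasure \<mu> U \<le> emeasure \<mu> (D \<inter> ?p -` B)"
    if U: "U \<in> sets \<mu>" "?p ` U \<subseteq> B" "inj_on ?p U" for U
  proof (cases "\<Gamma> = {}")
    case True
    then have "space \<mu> = {}" using self by (auto simp: orbit_def)
    then show ?thesis using U(1) sets.sets_into_space by fastforce
  next
    case False
    define g where "g = from_nat_into \<Gamma>"
    have g: "g n \<in> \<Gamma>" for n unfolding g_def using False by (rule from_nat_into)
    have gsurj: "\<exists>n. g n = h" if "h \<in> \<Gamma>" for h
      unfolding g_def using cnt that by (metis from_nat_into_surj)
    have Usp: "U \<subseteq> space \<mu>" using U(1) sets.sets_into_space by blast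
    define E where "E = disjointed (\<lambda>n. act (g n) ` D)"
    have Em: "E n \<in> sets \<mu>" for n
      unfolding E_def using sets.range_disjointed_sets[of "\<lambda>n. act (g n) ` D" \<mu>] im[OF g D(1)]
      by blast
    have Edis: "disjoint_family E" unfolding E_def by (rule disjoint_family_disjointed)
    have Esub: "E n \<subseteq> act (g n) ` D" for n unfolding E_def by (rule disjointed_subset)
    have cover: "U \<subseteq> (\<Union>n. E n)"
    proof
      fix u assume u: "u \<in> U"
      then have "?p u \<in> ?p ` D" using Usp D(3) by (auto simp: quotient_space_def)
      then obtain d where d: "d \<in> D" "?p d = ?p u" by (metis imageE)
      then have "u \<in> ?p d" using self u Usp by auto
      then obtain h where "h \<in> \<Gamma>" "u = act h d" by (auto simp: orbit_def)
      then obtain n where "u = act (g n) d" using gsurj by metis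
      then have "u \<in> (\<Union>n. act (g n) ` D)" using d(1) by blast
      then show "u \<in> (\<Union>n. E n)" unfolding E_def by (simp add: UN_disjointed_eq)
    qed
    let ?W = "\<lambda>n. act (g n) -` (U \<inter> E n) \<inter> space \<mu>"
    have Wm: "?W n \<in> sets \<mu>" for n
      using measurable_sets[OF meas[OF g] sets.Int[OF U(1) Em]] by simp
    have WD: "?W n \<subseteq> D" for n
    proof
      fix x assume x: "x \<in> ?W n"
      then obtain d where "d \<in> D" "act (g n) x = act (g n) d" using Esub[of n] by blast
      then show "x \<in> D" using x Dsp inj_onD[OF inj[OF g]] by (metis IntD2 subsetD)
    qed
    have WB: "?W n \<subseteq> ?p -` B" for n
    proof
      fix x assume x: "x \<in> ?W n"
      then have "?p (act (g n) x) \<in> B" using U(2) by auto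
      then show "x \<in> ?p -` B" using orb[OF g] x by auto
    qed
    have Wdis: "disjoint_family ?W"
    proof (unfold disjoint_family_on_def, intro ballI impI)
      fix m n :: nat assume "m \<noteq> n"
      show "?W m \<inter> ?W n = {}"
      proof (rule ccontr)
        assume "?W m \<inter> ?W n \<noteq> {}"
        then obtain x where x: "x \<in> ?W m" "x \<in> ?W n" by blast
        then have "?p (act (g m) x) = ?p (act (g n) x)" using orb[OF g] by auto
        then have "act (g m) x = act (g n) x" using x inj_onD[OF U(3)] by blast
        then have "act (g m) x \<in> E m \<inter> E n" using x by auto
        then show False using Edis \<open>m \<noteq> n\<close> by (auto simp: disjoint_family_on_def)
      qed
    qed
    have "U = (\<Union>n. U \<inter> E n)" using cover by blast
    then have "emeasure \<mu> U = emeasure \<mu> (\<Union>n. U \<inter> E n)" by simp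
    also have "\<dots> = (\<Sum>n. emeasure \<mu> (U \<inter> E n))"
      using Edis U(1) Em by (intro suminf_emeasure[symmetric]) (auto simp: disjoint_family_on_def)
    also have "\<dots> = (\<Sum>n. emeasure \<mu> (?W n))"
      by (intro suminf_cong pres[OF g, symmetric] sets.Int[OF U(1) Em])
    also have "\<dots> = emeasure \<mu> (\<Union>n. ?W n)"
      using Wm Wdis by (intro suminf_emeasure) auto
    also have "\<dots> \<le> emeasure \<mu> (D \<inter> ?p -` B)"
      using WD WB DB by (intro emeasure_mono) blast+
    finally show ?thesis .
  qed
  then have "quotient_volume act \<Gamma> \<mu> B \<le> emeasure \<mu> (D \<inter> ?p -` B)"
    unfolding quotient_volume_def by (intro SUP_least) blast
  moreover have "emeasure \<mu> (D \<inter> ?p -` B) \<le> quotient_volume act \<Gamma> \<mu> B"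
    unfolding quotient_volume_def
    using DB D(2) by (intro SUP_upper) (auto intro: inj_on_subset)
  ultimately show ?thesis using emeasure_quotient_measure[OF B] by simp
qed


section \<open>Hilbert modular surfaces\<close>

definition SL2 :: "real set \<Rightarrow> (real^2^2) set" where
  "SL2 S = {A. (\<forall>i j. A$i$j \<in> S) \<and> det A = 1}"

definition hilbert_act ::
    "real set \<Rightarrow> real^2^2 \<Rightarrow> complex \<times> complex \<Rightarrow> complex \<times> complex" where
  "hilbert_act K A x =
     (moebius (\<chi> i j. first_embedding K (A$i$j)) (fst x),
      moebius (\<chi> i j. second_embedding K (A$i$j)) (snd x))"

abbreviation hilbert_modular_group :: "real set \<Rightarrow> (real^2^2) set" where
  "hilbert_modular_group K \<equiv> SL2 (ring_of_integers K)"

definition hilbert_modular_surface :: "real set \<Rightarrow> (complex \<times> complex) set set" where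
  "hilbert_modular_surface K = quotient_space (hilbert_act K) (hilbert_modular_group K) HH"

definition hilbert_modular_vol :: "real set \<Rightarrow> (complex \<times> complex) set measure" where
  "hilbert_modular_vol K = quotient_measure (hilbert_act K) (hilbert_modular_group K) HH_vol"

text \<open>The value does not depend on the chosen lift, since the group acts by isometries.\<close>

definition injectivity_radius :: "real set \<Rightarrow> (complex \<times> complex) set \<Rightarrow> real" where
  "injectivity_radius K x =
     (let z = (SOME z. z \<in> HH \<and> orbit (hilbert_act K) (hilbert_modular_group K) z = x)
      in 1 / 2 * (INF \<gamma>\<in>{\<gamma> \<in> hilbert_modular_group K. \<exists>y\<in>HH. hilbert_act K \<gamma> y \<noteq> y}.
                    HH_dist z (hilbert_act K \<gamma> z)))"

definition thin_part :: "real set \<Rightarrow> real \<Rightarrow> (complex \<times> complex) set set" where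
  "thin_part K R = {x \<in> hilbert_modular_surface K. injectivity_radius K x \<le> R}"

end

theory Submission
  imports Defs "HOL-Computational_Algebra.Primes"
begin

text \<open>For \<open>F\<^sub>n\<close> take the fields generated by \<open>s = sqrt p\<close>, with \<open>p\<close> a prime congruent to 3 modulo 4, so
  that the ring of integers is \<open>Zs = {a + b * s}\<close>. The volume of the thin part is
  \<open>O(p powr (6/5))\<close>, whereas the total volume is at least a constant times \<open>p powr (3/2)\<close>.

  An element \<open>g\<close> that moves a point by at most \<open>2 * R\<close> in each factor has a trace whose two conjugates
  are bounded in terms of \<open>R\<close>. Hence for large \<open>p\<close> the trace is a rational integer \<open>t\<close>, with finitely many
  possible values. By Minkowski's theorem the point has both heights at least \<open>1 / (6 * s)\<close> in the coordinates
  of some cusp \<open>- d / c\<close>. Conjugate \<open>g\<close> into these coordinates.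

  If \<open>t\<^sup>2 \<noteq> 4\<close>, the lower left entry \<open>\<delta>\<close> of the conjugate is a non-zero element of \<open>Zs\<close> of size
  \<open>O(s)\<close> contained in the ideal of the cusp, and the lower right entry solves \<open>k\<^sup>2 - t * k + 1 = 0\<close> modulo an
  ideal containing \<open>\<delta>\<close>. The numbers of ideals and of solutions are bounded by powers of the divisor function of the norm of
  \<open>\<delta>\<close>, and every solution contributes a rectangle of area \<open>O(p / \<bar>\<delta> * cj \<delta>\<bar>)\<close>. If \<open>t\<^sup>2 = 4\<close>, the cusp can be chosen
  as the fixed point of \<open>g\<close>, and the corresponding region has area \<open>O(s * ln p)\<close> for each of the
  \<open>O(s * p powr \<epsilon>)\<close> ideals of norm at most \<open>4 * s\<close>.\<close>

text \<open>Only ideals enter, never ideal classes, units or values of L-functions: two generating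
  pairs of one ideal are related by the Hilbert modular group (\<open>SL2_transitive\<close>), so
  cusps are listed by ideals of norm at most \<open>4 * s\<close>, and what units would save is
  replaced by a dyadic decomposition costing a factor of order \<open>ln p\<close>. Square roots of
  \<open>p\<close> modulo \<open>m\<close> and solutions of the congruence for \<open>k\<close> are
  counted by the same device: attach to a solution the gcd, respectively the ideal, generated by the
  modulus and its distance from a fixed solution; solutions sharing it agree up to a factor that is
  essentially the discriminant. This fails for discriminant 0, hence the separate treatment of
  parabolic elements. The lower bound for the volume comes from an explicit region that embeds into
  the quotient, not from a volume formula. The target exponent leaves room, since
  \<open>6/5 = 3/2 * 4/5\<close> and \<open>4/5 < 9/10\<close>; divisor bounds and logarithms are
  therefore estimated wastefully. The finitely many \<open>p\<close> with
  \<open>s \<le> 3 * L\<close>, where a trace might be irrational, are covered by a crude bound for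
  the total volume.\<close>

text \<open>If \<open>v\<close> is the denominator of \<open>q\<close> in lowest terms, then
  \<open>v ^ n\<close> divides the fixed integer \<open>D\<close> for every \<open>n\<close>, which
  is impossible for \<open>v \<ge> 2\<close>. In \<open>ring_of_integers_K\<close> this is applied
  to norms.\<close>

lemma Rats_power_denominators:
  fixes q D :: real
  assumes q: "q \<in> \<rat>" and D: "D \<noteq> 0" and pw: "\<And>n. q ^ n * D \<in> \<int>"
  shows "q \<in> \<int>"
proof -
  obtain u v :: int where v: "v > 0" "coprime u v" and quv: "q = of_int u / of_int v"
    by (metis q Rats_cases' less_irrefl)
  obtain d :: int where d: "D = of_int d" using pw[of 0] by (auto elim: Ints_cases)
  have dvd: "v ^ n dvd d" for n
  proof -
    obtain m :: int where m: "q ^ n * D = of_int m" using pw[of n] by (auto elim: Ints_cases)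
    have "real_of_int (u ^ n * d) = real_of_int (m * v ^ n)"
      using m v(1) unfolding quv d by (simp add: power_divide field_simps)
    then have "u ^ n * d = m * v ^ n" using of_int_eq_iff by blast
    then have "v ^ n dvd u ^ n * d" by simp
    moreover have "coprime (v ^ n) (u ^ n)" using v(2) by (simp add: ac_simps)
    ultimately show ?thesis using coprime_dvd_mult_right_iff by blast
  qed
  have "v = 1"
  proof (rule ccontr)
    assume "v \<noteq> 1"
    then have "v \<ge> 2" using v by simp
    have "d \<noteq> 0" using D d by simp
    define n where "n = nat \<bar>d\<bar>"
    have "int n < int (2 ^ n)" using less_exp[of n] by (simp only: of_nat_less_iff)
    then have "\<bar>d\<bar> < 2 ^ n" by (simp add: n_def)
    also have "(2::int) ^ n \<le> v ^ n" using \<open>v \<ge> 2\<close> by (intro power_mono) auto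
    also have "v ^ n \<le> \<bar>d\<bar>" using dvd_imp_le_int[OF \<open>d \<noteq> 0\<close> dvd[of n]] v by simp
    finally show False by simp
  qed
  then show ?thesis by (simp add: quv)
qed

section \<open>Arithmetic of the field and its ring of integers\<close>

locale real_quadratic =
  fixes p :: nat
  assumes prime_p: "prime p" and p_mod_4: "p mod 4 = 3"
begin

definition s :: real where "s = sqrt (real p)"

definition K :: "real set" where "K = {a + b * s | a b. a \<in> \<rat> \<and> b \<in> \<rat>}"

definition Zs :: "real set" where "Zs = {of_int a + of_int b * s | a b. True}"

text \<open>The non-trivial automorphism of \<open>K\<close>, read off from the coordinates with
  respect to \<open>1, s\<close>. Outside \<open>K\<close> the value is unspecified, which is why
  the simplification rules below ask for membership in \<open>K\<close>.\<close>

definition cj :: "real \<Rightarrow> real" where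
  "cj x = (THE y. \<exists>a\<in>\<rat>. \<exists>b\<in>\<rat>. x = a + b * s \<and> y = a - b * s)"

lemma p_ge_3: "p \<ge> 3" using p_mod_4 by (metis mod_less_eq_dividend)

lemma s_sq: "s * s = real p" by (simp add: s_def)

lemma s_gt_1: "s > 1"
  using p_ge_3 unfolding s_def by simp

lemma s_pos: "s > 0" using s_gt_1 by simp

lemma s_notin_Rats: "s \<notin> \<rat>"
proof
  assume "s \<in> \<rat>"
  moreover have "algebraic_int s" unfolding s_def by (intro algebraic_int_sqrt) auto
  ultimately have "s \<in> \<int>" using rational_algebraic_int_is_int by blast
  then obtain m :: int where m: "s = of_int m" by (auto elim: Ints_cases)
  then have "real_of_int (m * m) = real_of_int (int p)" using s_sq by simp
  then have "m * m = int p" using of_int_eq_iff by blast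
  then have "nat \<bar>m\<bar> * nat \<bar>m\<bar> = p" by (metis abs_ge_zero abs_mult nat_int nat_mult_distrib of_nat_0_le_iff abs_of_nonneg)
  then show False using prime_p
    by (metis One_nat_def nat_mult_1_right prime_nat_iff dvd_triv_left mult_eq_self_implies_10 not_prime_0 not_prime_1)
qed

lemma rep_unique:
  assumes "a \<in> \<rat>" "b \<in> \<rat>" "c \<in> \<rat>" "d \<in> \<rat>" and e: "a + b * s = c + d * s"
  shows "a = c \<and> b = d"
proof -
  have "b = d"
  proof (rule ccontr)
    assume "b \<noteq> d"
    then have "s = (c - a) / (b - d)" using e by (simp add: field_simps)
    then show False using s_notin_Rats assms by simp
  qed
  then show ?thesis using e by simp
qed

lemma cj_rep: "a \<in> \<rat> \<Longrightarrow> b \<in> \<rat> \<Longrightarrow> cj (a + b * s) = a - b * s"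
  unfolding cj_def by (rule the_equality) (blast, metis rep_unique)

lemma K_I: "a \<in> \<rat> \<Longrightarrow> b \<in> \<rat> \<Longrightarrow> a + b * s \<in> K" by (auto simp: K_def)

lemma K_E: assumes "x \<in> K" obtains a b where "a \<in> \<rat>" "b \<in> \<rat>" "x = a + b * s" "cj x = a - b * s"
  using assms cj_rep unfolding K_def by blast

lemma Rats_K: "a \<in> \<rat> \<Longrightarrow> a \<in> K" using K_I[of a 0] by simp

lemma cj_Rats: "a \<in> \<rat> \<Longrightarrow> cj a = a" using cj_rep[of a 0] by simp

lemma cj_of_int [simp]: "cj (of_int n) = of_int n" by (simp add: cj_Rats)
lemma cj_0 [simp]: "cj 0 = 0" by (simp add: cj_Rats)
lemma cj_1 [simp]: "cj 1 = 1" by (simp add: cj_Rats)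
lemma cj_s [simp]: "cj s = - s" using cj_rep[of 0 1] by simp

lemma K_0 [simp]: "0 \<in> K" by (simp add: Rats_K)
lemma K_1 [simp]: "1 \<in> K" by (simp add: Rats_K)
lemma K_of_int [simp]: "of_int n \<in> K" by (simp add: Rats_K)
lemma K_of_nat [simp]: "of_nat n \<in> K" by (simp add: Rats_K)

lemma K_cj_add: "x \<in> K \<Longrightarrow> y \<in> K \<Longrightarrow> x + y \<in> K \<and> cj (x + y) = cj x + cj y"
proof (elim K_E)
  fix a b c d
  assume h: "a \<in> \<rat>" "b \<in> \<rat>" "c \<in> \<rat>" "d \<in> \<rat>" "x = a + b * s" "cj x = a - b * s" "y = c + d * s" "cj y = c - d * s"
  have "x + y = (a + c) + (b + d) * s" "cj x + cj y = (a + c) - (b + d) * s"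
    unfolding h(6,8) unfolding h(5,7) by (simp_all add: algebra_simps)
  then show ?thesis using h(1-4) cj_rep[of "a + c" "b + d"] K_I[of "a + c" "b + d"] by simp
qed

lemma K_cj_mult: "x \<in> K \<Longrightarrow> y \<in> K \<Longrightarrow> x * y \<in> K \<and> cj (x * y) = cj x * cj y"
proof (elim K_E)
  fix a b c d
  assume h: "a \<in> \<rat>" "b \<in> \<rat>" "c \<in> \<rat>" "d \<in> \<rat>" "x = a + b * s" "cj x = a - b * s" "y = c + d * s" "cj y = c - d * s"
  have "x * y = (a * c + real p * (b * d)) + (a * d + b * c) * s"
    "cj x * cj y = (a * c + real p * (b * d)) - (a * d + b * c) * s"
    unfolding s_sq[symmetric] h(6,8) unfolding h(5,7) by (simp_all add: algebra_simps)
  then show ?thesis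
    using h(1-4) cj_rep[of "a * c + real p * (b * d)" "a * d + b * c"]
      K_I[of "a * c + real p * (b * d)" "a * d + b * c"] by simp
qed

lemmas K_add [simp] = K_cj_add[THEN conjunct1]
lemmas cj_add [simp] = K_cj_add[THEN conjunct2]
lemmas K_mult [simp] = K_cj_mult[THEN conjunct1]
lemmas cj_mult [simp] = K_cj_mult[THEN conjunct2]

lemma K_uminus [simp]: "x \<in> K \<Longrightarrow> - x \<in> K"
  using K_mult[OF K_of_int[of "-1"], of x] by simp
lemma cj_uminus [simp]: "x \<in> K \<Longrightarrow> cj (- x) = - cj x"
  using cj_mult[OF K_of_int[of "-1"], of x] cj_of_int[of "-1"] by simp
lemma cj_diff [simp]: "x \<in> K \<Longrightarrow> y \<in> K \<Longrightarrow> cj (x - y) = cj x - cj y"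
  using cj_add[of x "- y"] by simp
lemma K_power [simp]: "x \<in> K \<Longrightarrow> x ^ n \<in> K" by (induction n) auto
lemma cj_power [simp]: "x \<in> K \<Longrightarrow> cj (x ^ n) = cj x ^ n" by (induction n) auto
lemma K_s [simp]: "s \<in> K" using K_I[of 0 1] by simp

lemma K_cj [simp]: "x \<in> K \<Longrightarrow> cj x \<in> K"
  by (elim K_E) (use K_I[of _ "- _"] in auto)

lemma cj_cj [simp]: "x \<in> K \<Longrightarrow> cj (cj x) = x"
proof (elim K_E)
  fix a b assume "a \<in> \<rat>" "b \<in> \<rat>" "x = a + b * s" "cj x = a - b * s"
  then show ?thesis using cj_rep[of a "- b"] by simp
qed

lemma cj_eq_0 [simp]: "x \<in> K \<Longrightarrow> cj x = 0 \<longleftrightarrow> x = 0"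
  using cj_cj by fastforce

lemma norm_Rats: "x \<in> K \<Longrightarrow> x * cj x \<in> \<rat>"
proof (elim K_E)
  fix a b assume h: "a \<in> \<rat>" "b \<in> \<rat>" "x = a + b * s" "cj x = a - b * s"
  have "x * cj x = a * a - b * b * real p" unfolding s_sq[symmetric] h(4) unfolding h(3) by (simp add: algebra_simps)
  then show ?thesis using h by simp
qed

lemma K_inverse [simp]: "x \<in> K \<Longrightarrow> inverse x \<in> K"
proof (cases "x = 0")
  case False assume x: "x \<in> K"
  have "inverse x = cj x * inverse (x * cj x)" using False x by (simp add: field_simps)
  then show ?thesis using norm_Rats[OF x] x Rats_K by (metis K_cj K_mult Rats_inverse)
qed simp

lemma cj_inverse [simp]: "x \<in> K \<Longrightarrow> cj (inverse x) = inverse (cj x)"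
proof (cases "x = 0")
  case False assume x: "x \<in> K"
  have "cj x * cj (inverse x) = 1" using False x cj_mult[of x "inverse x"] by simp
  then show ?thesis using x False by (simp add: field_simps)
qed simp

lemma K_divide [simp]: "x \<in> K \<Longrightarrow> y \<in> K \<Longrightarrow> x / y \<in> K" by (simp add: divide_inverse)
lemma cj_divide [simp]: "x \<in> K \<Longrightarrow> y \<in> K \<Longrightarrow> cj (x / y) = cj x / cj y" by (simp add: divide_inverse)

lemma Zs_I [simp]: "of_int a + of_int b * s \<in> Zs" by (auto simp: Zs_def)

lemma Zs_E: assumes "x \<in> Zs" obtains a b where "x = of_int a + of_int b * s" "cj x = of_int a - of_int b * s"
  using assms cj_rep[OF Rats_of_int Rats_of_int] unfolding Zs_def by blast

lemma Zs_K: "x \<in> Zs \<Longrightarrow> x \<in> K" by (auto simp: Zs_def)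

lemma Zs_of_int [simp]: "of_int n \<in> Zs" using Zs_I[of n 0] by simp
lemma Zs_of_nat [simp]: "of_nat n \<in> Zs" using Zs_of_int[of "int n"] by simp
lemma Zs_0 [simp]: "0 \<in> Zs" using Zs_of_int[of 0] by simp
lemma Zs_1 [simp]: "1 \<in> Zs" using Zs_of_int[of 1] by simp
lemma Zs_s [simp]: "s \<in> Zs" using Zs_I[of 0 1] by simp
lemma Zs_numeral [simp]: "numeral n \<in> Zs" using Zs_of_int[of "numeral n"] by simp

lemma Zs_add [simp]: "x \<in> Zs \<Longrightarrow> y \<in> Zs \<Longrightarrow> x + y \<in> Zs"
proof (elim Zs_E)
  fix a b c d assume "x = of_int a + of_int b * s" "y = of_int c + of_int d * s"
  then show ?thesis using Zs_I[of "a + c" "b + d"] by (simp add: algebra_simps)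
qed

lemma Zs_mult [simp]: "x \<in> Zs \<Longrightarrow> y \<in> Zs \<Longrightarrow> x * y \<in> Zs"
proof (elim Zs_E)
  fix a b c d assume h: "x = of_int a + of_int b * s" "y = of_int c + of_int d * s"
  have "x * y = of_int (a * c + int p * (b * d)) + of_int (a * d + b * c) * s"
    unfolding h by (simp add: algebra_simps flip: s_sq)
  then show ?thesis by (metis Zs_I)
qed

lemma Zs_uminus [simp]: "x \<in> Zs \<Longrightarrow> - x \<in> Zs"
  using Zs_mult[OF Zs_of_int[of "-1"], of x] by simp
lemma Zs_diff [simp]: "x \<in> Zs \<Longrightarrow> y \<in> Zs \<Longrightarrow> x - y \<in> Zs"
  using Zs_add[of x "- y"] by simp
lemma Zs_cj [simp]: "x \<in> Zs \<Longrightarrow> cj x \<in> Zs"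
proof (elim Zs_E)
  fix a b assume "cj x = of_int a - of_int b * s"
  then show ?thesis using Zs_I[of a "- b"] by simp
qed

lemma norm_Ints: "x \<in> Zs \<Longrightarrow> x * cj x \<in> \<int>"
proof (elim Zs_E)
  fix a b assume h: "x = of_int a + of_int b * s" "cj x = of_int a - of_int b * s"
  have "x * cj x = of_int (a * a - b * b * int p)"
    unfolding h(2) unfolding h(1) by (simp add: algebra_simps flip: s_sq)
  then show ?thesis by simp
qed

lemma trace_Ints: "x \<in> Zs \<Longrightarrow> x + cj x \<in> \<int>"
  by (elim Zs_E) auto

text \<open>Here the residue of \<open>p\<close> modulo 4 enters. For \<open>x = a + b * s\<close>
  the number \<open>2 * a\<close> is an integer, and so is \<open>2 * b\<close> because
  \<open>p\<close> is square-free; a congruence modulo 4 then forces both to be even.\<close>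

lemma Zs_if_trace_norm:
  assumes x: "x \<in> K" and tr: "x + cj x \<in> \<int>" and nm: "x * cj x \<in> \<int>"
  shows "x \<in> Zs"
proof -
  obtain a b where ab: "a \<in> \<rat>" "b \<in> \<rat>" "x = a + b * s" "cj x = a - b * s" by (rule K_E[OF x])
  obtain A :: int where A: "2 * a = of_int A" using tr ab by (auto elim: Ints_cases)
  obtain N :: int where N: "x * cj x = of_int N" using nm by (auto elim: Ints_cases)
  have N': "a * a - b * b * real p = of_int N"
    using N unfolding s_sq[symmetric] ab(4) unfolding ab(3) by (simp add: algebra_simps)
  have "real p * (2 * b) ^ 2 = (2 * a) ^ 2 - 4 * of_int N" using N' by (simp add: power2_eq_square algebra_simps)
  then have e: "real p * (2 * b) ^ 2 = of_int (A\<^sup>2 - 4 * N)" using A by simp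
  obtain u v :: int where v: "v > 0" "coprime u v" and uv: "2 * b = of_int u / of_int v"
    by (metis ab(2) Rats_cases' Rats_mult Rats_number_of less_irrefl)
  have "real_of_int (int p * u\<^sup>2) = real_of_int ((A\<^sup>2 - 4 * N) * v\<^sup>2)"
    using e v(1) unfolding uv by (simp add: power_divide field_simps)
  then have e2: "int p * u\<^sup>2 = (A\<^sup>2 - 4 * N) * v\<^sup>2" using of_int_eq_iff by blast
  \<comment> \<open>The square of the denominator would divide the prime \<open>p\<close>.\<close>
  have "v = 1"
  proof (rule ccontr)
    assume "v \<noteq> 1"
    then obtain q where q: "prime q" "q dvd v" using v
      by (metis abs_of_pos one_dvd prime_factor_int zdvd1_eq)
    have "coprime (v\<^sup>2) (u\<^sup>2)" using v(2) by (simp add: ac_simps)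
    then have "v\<^sup>2 dvd int p" using e2 by (metis coprime_dvd_mult_left_iff dvd_triv_right)
    then have "q * q dvd int p" using q(2) by (metis dvd_trans mult_dvd_mono power2_eq_square)
    moreover have "q dvd int p" using calculation by (metis dvd_mult_left)
    then have "q = int p" using q(1) prime_p
      by (metis primes_dvd_imp_eq prime_nat_int_transfer)
    ultimately show False using p_ge_3 by simp
  qed
  then have B: "2 * b = of_int u" and e3: "int p * u\<^sup>2 = A\<^sup>2 - 4 * N" using uv e2 by auto
  \<comment> \<open>Squares are 0 or 1 modulo 4, so the congruence of \<open>3 * u\<^sup>2\<close>
    and \<open>A\<^sup>2\<close> leaves only 0 for both.\<close>
  have "even A \<and> even u"
  proof -
    have "int p mod 4 = 3" using p_mod_4 by presburger
    then have "(3 * u\<^sup>2) mod 4 = A\<^sup>2 mod 4"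
      using e3 by (metis (no_types) mod_mult_left_eq mod_diff_right_eq mod_mult_self1_is_0 diff_zero)
    moreover have sq: "w\<^sup>2 mod 4 = (if even w then 0 else 1)" for w :: int
    proof (cases "even w")
      case True then obtain k where "w = 2 * k" by auto
      then show ?thesis by (simp add: power2_eq_square)
    next
      case False then obtain k where "w = 2 * k + 1" by (auto elim: oddE)
      then have "w\<^sup>2 = 4 * (k * k + k) + 1" by (simp add: power2_eq_square algebra_simps)
      then show ?thesis using False by presburger
    qed
    ultimately have m: "(3 * w) mod 4 = v mod 4" if "w = u\<^sup>2" "v = A\<^sup>2" for v w using that by simp
    show ?thesis
    proof (rule ccontr)
      assume "\<not> ?thesis"
      then have "u\<^sup>2 mod 4 = 1 \<and> A\<^sup>2 mod 4 = 0 \<or> u\<^sup>2 mod 4 = 0 \<and> A\<^sup>2 mod 4 = 1 \<or> u\<^sup>2 mod 4 = 1 \<and> A\<^sup>2 mod 4 = 1"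
        using sq[of u] sq[of A] by (auto split: if_splits)
      then show False using m[OF refl refl] by presburger
    qed
  qed
  then obtain A' u' where "A = 2 * A'" "u = 2 * u'" by (meson evenE)
  then have "a = of_int A'" "b = of_int u'" using A B by auto
  then show ?thesis using ab(3) by simp
qed

subsection \<open>Ideals generated by two elements\<close>

definition idl :: "real \<Rightarrow> real \<Rightarrow> real set" where
  "idl c d = {\<alpha> * c + \<beta> * d | \<alpha> \<beta>. \<alpha> \<in> Zs \<and> \<beta> \<in> Zs}"

text \<open>The inverse of the fractional ideal generated by \<open>c\<close> and \<open>d\<close>.
  The set \<open>inv2\<close> below is the inverse of its square, the lattice of translations at the
  cusp \<open>- d / c\<close> (see \<open>cusp_translation\<close>).\<close>

definition inv1 :: "real \<Rightarrow> real \<Rightarrow> real set" where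
  "inv1 c d = {x \<in> K. x * c \<in> Zs \<and> x * d \<in> Zs}"

definition inv2 :: "real \<Rightarrow> real \<Rightarrow> real set" where
  "inv2 c d = {x \<in> K. x * (c * c) \<in> Zs \<and> x * (c * d) \<in> Zs \<and> x * (d * d) \<in> Zs}"

text \<open>The content of the norm form of \<open>X * c + Y * d\<close> in the variables
  \<open>X\<close> and \<open>Y\<close>. By Gauss's lemma it is the norm of the ideal; as a gcd of
  three integers it gives divisibility and a representation by generators directly.\<close>

definition idl_norm :: "real \<Rightarrow> real \<Rightarrow> int" where
  "idl_norm c d = gcd (gcd \<lfloor>c * cj c\<rfloor> \<lfloor>d * cj d\<rfloor>) \<lfloor>c * cj d + d * cj c\<rfloor>"

lemma cross_Ints:
  assumes "c \<in> Zs" "d \<in> Zs" shows "c * cj d + d * cj c \<in> \<int>"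
proof -
  have "cj (c * cj d) = d * cj c" using assms[THEN Zs_K] by simp
  then show ?thesis using trace_Ints[OF Zs_mult[OF assms(1) Zs_cj[OF assms(2)]]] by simp
qed

lemma idl_norm_generators:
  assumes "c \<in> Zs" "d \<in> Zs"
  shows "\<exists>i j l. real_of_int (idl_norm c d) =
           of_int i * (c * cj c) + of_int j * (d * cj d) + of_int l * (c * cj d + d * cj c)"
proof -
  let ?A = "\<lfloor>c * cj c\<rfloor>" and ?B = "\<lfloor>d * cj d\<rfloor>" and ?C = "\<lfloor>c * cj d + d * cj c\<rfloor>"
  obtain u v where uv: "u * ?A + v * ?B = gcd ?A ?B" using bezout_int by blast
  obtain w l where wl: "w * gcd ?A ?B + l * ?C = idl_norm c d"
    unfolding idl_norm_def using bezout_int by blast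
  have "idl_norm c d = (w * u) * ?A + (w * v) * ?B + l * ?C"
    unfolding wl[symmetric] uv[symmetric] by (simp add: algebra_simps)
  then have "real_of_int (idl_norm c d) = of_int (w * u) * of_int ?A + of_int (w * v) * of_int ?B + of_int l * of_int ?C"
    by (metis of_int_add of_int_mult)
  then show ?thesis using norm_Ints[OF assms(1)] norm_Ints[OF assms(2)] cross_Ints[OF assms]
    by (metis Ints_cases floor_of_int)
qed

lemma idl_norm_pos:
  assumes "c \<in> Zs" "d \<in> Zs" "c \<noteq> 0 \<or> d \<noteq> 0" shows "idl_norm c d > 0"
proof -
  have "\<lfloor>c * cj c\<rfloor> \<noteq> 0 \<or> \<lfloor>d * cj d\<rfloor> \<noteq> 0"
  proof -
    have "\<lfloor>x * cj x\<rfloor> \<noteq> 0" if x: "x \<in> Zs" "x \<noteq> 0" for x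
    proof -
      obtain m :: int where m: "x * cj x = of_int m" using norm_Ints[OF x(1)] by (auto elim: Ints_cases)
      have "x * cj x \<noteq> 0" using x Zs_K by simp
      then show ?thesis using m by simp
    qed
    then show ?thesis using assms by blast
  qed
  then show ?thesis unfolding idl_norm_def by (auto simp: gcd_pos_int)
qed

lemma idl_norm_dvd:
  assumes "c \<in> Zs" "d \<in> Zs" "c \<noteq> 0 \<or> d \<noteq> 0"
  shows "c * cj c / of_int (idl_norm c d) \<in> \<int>" "d * cj d / of_int (idl_norm c d) \<in> \<int>"
    "(c * cj d + d * cj c) / of_int (idl_norm c d) \<in> \<int>"
proof -
  have *: "x / of_int k \<in> \<int>" if x: "x \<in> \<int>" "k dvd \<lfloor>x\<rfloor>" "k > 0" for x :: real and k :: int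
  proof -
    obtain m where m: "x = of_int m" using x(1) by (rule Ints_cases)
    then obtain q where "m = k * q" using x by auto
    then show ?thesis using m x(3) by simp
  qed
  show "c * cj c / of_int (idl_norm c d) \<in> \<int>" "d * cj d / of_int (idl_norm c d) \<in> \<int>"
    "(c * cj d + d * cj c) / of_int (idl_norm c d) \<in> \<int>"
    using idl_norm_pos[OF assms]
    by (intro * norm_Ints cross_Ints assms; simp add: idl_norm_def gcd_dvdI1 gcd_dvdI2; fail)+
qed

lemma Ints_Zs: "x \<in> \<int> \<Longrightarrow> x \<in> Zs"
  by (metis Ints_cases Zs_of_int)

text \<open>The quotient is integral because its trace and its norm are; this uses that \<open>Zs\<close> is
  integrally closed and is what makes the ideal generated by \<open>c\<close> and \<open>d\<close> invertible.\<close>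

lemma cross_quotient:
  assumes "c \<in> Zs" "d \<in> Zs" "c \<noteq> 0 \<or> d \<noteq> 0"
  shows "c * cj d / of_int (idl_norm c d) \<in> Zs"
proof (rule Zs_if_trace_norm)
  let ?k = "of_int (idl_norm c d) :: real"
  have K: "c \<in> K" "d \<in> K" using assms Zs_K by auto
  show "c * cj d / ?k \<in> K" using K by simp
  have "c * cj d / ?k + cj (c * cj d / ?k) = (c * cj d + d * cj c) / ?k"
    using K by (simp add: add_divide_distrib mult.commute)
  then show "c * cj d / ?k + cj (c * cj d / ?k) \<in> \<int>" using idl_norm_dvd[OF assms] by simp
  have "(c * cj d / ?k) * cj (c * cj d / ?k) = (c * cj c / ?k) * (d * cj d / ?k)"
    using K by simp
  also have "\<dots> \<in> \<int>" by (intro Ints_mult idl_norm_dvd[OF assms])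
  finally show "(c * cj d / ?k) * cj (c * cj d / ?k) \<in> \<int>" .
qed

text \<open>The inverse of an ideal is its conjugate divided by its norm: the products that have to
  be integral are two norms and the quotients of \<open>cross_quotient\<close>.\<close>

lemma generators_in_inv1:
  assumes cd: "c \<in> Zs" "d \<in> Zs" "c \<noteq> 0 \<or> d \<noteq> 0"
  shows "cj c / of_int (idl_norm c d) \<in> inv1 c d" "cj d / of_int (idl_norm c d) \<in> inv1 c d"
proof -
  have K: "c \<in> K" "d \<in> K" using cd Zs_K by auto
  have sw: "idl_norm d c = idl_norm c d" by (simp add: idl_norm_def gcd.commute add.commute)
  show "cj c / of_int (idl_norm c d) \<in> inv1 c d" "cj d / of_int (idl_norm c d) \<in> inv1 c d"
    unfolding inv1_def
    using K Ints_Zs[OF idl_norm_dvd(1)[OF cd]] Ints_Zs[OF idl_norm_dvd(2)[OF cd]]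
      cross_quotient[OF cd] cross_quotient[of d c] cd sw
    by (auto simp: mult.commute)
qed

lemma inv1_add: "x \<in> inv1 c d \<Longrightarrow> y \<in> inv1 c d \<Longrightarrow> x + y \<in> inv1 c d"
  by (simp add: inv1_def distrib_right)

lemma inv1_mult: "x \<in> inv1 c d \<Longrightarrow> a \<in> Zs \<Longrightarrow> a * x \<in> inv1 c d"
  by (simp add: inv1_def mult.assoc Zs_K)

lemma inv2_mult: "x \<in> inv2 c d \<Longrightarrow> a \<in> Zs \<Longrightarrow> a * x \<in> inv2 c d"
  by (simp add: inv2_def mult.assoc Zs_K)

lemma inv2_add: "x \<in> inv2 c d \<Longrightarrow> y \<in> inv2 c d \<Longrightarrow> x + y \<in> inv2 c d"
  by (simp add: inv2_def distrib_right)

lemma Zs_inv2: "c \<in> Zs \<Longrightarrow> d \<in> Zs \<Longrightarrow> x \<in> Zs \<Longrightarrow> x \<in> inv2 c d"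
  by (simp add: inv2_def Zs_K)

lemma idl_conj_quotient:
  assumes cd: "c \<in> Zs" "d \<in> Zs" "c \<noteq> 0 \<or> d \<noteq> 0" and y: "y \<in> idl c d"
  shows "cj y / of_int (idl_norm c d) \<in> inv1 c d"
proof -
  obtain \<alpha> \<beta> where ab: "y = \<alpha> * c + \<beta> * d" "\<alpha> \<in> Zs" "\<beta> \<in> Zs" using y by (auto simp: idl_def)
  let ?k = "of_int (idl_norm c d) :: real"
  have "cj y / ?k = cj \<alpha> * (cj c / ?k) + cj \<beta> * (cj d / ?k)"
    using ab cd by (simp add: Zs_K add_divide_distrib)
  moreover have "cj \<alpha> * (cj c / ?k) + cj \<beta> * (cj d / ?k) \<in> inv1 c d"
    by (intro inv1_add inv1_mult generators_in_inv1[OF cd] Zs_cj ab)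
  ultimately show ?thesis by simp
qed

text \<open>Divide the representation of the norm in \<open>idl_norm_generators\<close> by the norm;
  the cross term is shared between the two coefficients.\<close>

lemma bezout_inv1:
  assumes cd: "c \<in> Zs" "d \<in> Zs" "c \<noteq> 0 \<or> d \<noteq> 0"
  shows "\<exists>x\<in>inv1 c d. \<exists>y\<in>inv1 c d. x * c + y * d = 1"
proof -
  obtain i j l where k: "real_of_int (idl_norm c d) =
      of_int i * (c * cj c) + of_int j * (d * cj d) + of_int l * (c * cj d + d * cj c)"
    using idl_norm_generators[OF cd(1,2)] by blast
  let ?k = "of_int (idl_norm c d) :: real"
  let ?x = "of_int i * (cj c / ?k) + of_int l * (cj d / ?k)"
  let ?y = "of_int j * (cj d / ?k) + of_int l * (cj c / ?k)"
  have "?x \<in> inv1 c d" "?y \<in> inv1 c d"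
    by (intro inv1_add inv1_mult generators_in_inv1[OF cd] Zs_of_int)+
  moreover have "?x * c + ?y * d = ?k / ?k"
    by (subst (5) k) (simp add: add_divide_distrib algebra_simps)
  then have "?x * c + ?y * d = 1" using idl_norm_pos[OF cd] by simp
  ultimately show ?thesis by blast
qed

lemma idl_gens: "c \<in> idl c d" "d \<in> idl c d"
proof -
  show "c \<in> idl c d" unfolding idl_def by (rule CollectI, rule exI[of _ 1], rule exI[of _ 0]) simp
  show "d \<in> idl c d" unfolding idl_def by (rule CollectI, rule exI[of _ 0], rule exI[of _ 1]) simp
qed

lemma inv1_idl: "x \<in> inv1 c d \<Longrightarrow> y \<in> idl c d \<Longrightarrow> x * y \<in> Zs"
proof -
  assume x: "x \<in> inv1 c d" and "y \<in> idl c d"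
  then obtain \<alpha> \<beta> where ab: "y = \<alpha> * c + \<beta> * d" "\<alpha> \<in> Zs" "\<beta> \<in> Zs" by (auto simp: idl_def)
  have "x * y = \<alpha> * (x * c) + \<beta> * (x * d)" unfolding ab by (simp add: algebra_simps)
  then show ?thesis using x ab by (simp add: inv1_def)
qed

text \<open>Complete both rows to matrices of determinant 1 over \<open>K\<close> with upper rows
  \<open>(y, - x)\<close> and \<open>(y', - x')\<close>. The matrix sought is the inverse of the
  first times the second. Its entries are sums of products of an element of the ideal and an element
  of its inverse, hence integral.\<close>

lemma SL2_transitive:
  assumes cd: "c \<in> Zs" "d \<in> Zs" "c \<noteq> 0 \<or> d \<noteq> 0"
    and cd': "c' \<in> Zs" "d' \<in> Zs" "c' \<noteq> 0 \<or> d' \<noteq> 0"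
    and e: "idl c d = idl c' d'"
  shows "\<exists>\<alpha>\<in>Zs. \<exists>\<beta>\<in>Zs. \<exists>\<gamma>\<in>Zs. \<exists>\<delta>\<in>Zs. \<alpha> * \<delta> - \<beta> * \<gamma> = 1 \<and> c * \<alpha> + d * \<gamma> = c' \<and> c * \<beta> + d * \<delta> = d'"
proof -
  obtain x y where xy: "x \<in> inv1 c d" "y \<in> inv1 c d" "x * c + y * d = 1" using bezout_inv1[OF cd] by blast
  obtain x' y' where xy': "x' \<in> inv1 c' d'" "y' \<in> inv1 c' d'" "x' * c' + y' * d' = 1"
    using bezout_inv1[OF cd'] by blast
  have m: "x * c' \<in> Zs" "x * d' \<in> Zs" "y * c' \<in> Zs" "y * d' \<in> Zs"
    using xy idl_gens(1)[of c' d'] idl_gens(2)[of d' c'] e inv1_idl by auto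
  have m': "x' * c \<in> Zs" "x' * d \<in> Zs" "y' * c \<in> Zs" "y' * d \<in> Zs"
    using xy' idl_gens(1)[of c d] idl_gens(2)[of d c] e inv1_idl by auto
  let ?A = "x * c' + y' * d" and ?B = "x * d' - x' * d"
    and ?C = "y * c' - y' * c" and ?D = "y * d' + x' * c"
  have "?A * ?D - ?B * ?C = (x * c + y * d) * (x' * c' + y' * d')" by (simp add: algebra_simps)
  then have 1: "?A * ?D - ?B * ?C = 1" using xy xy' by simp
  have "c * ?A + d * ?C = (x * c + y * d) * c'" "c * ?B + d * ?D = (x * c + y * d) * d'"
    by (simp_all add: algebra_simps)
  then have 2: "c * ?A + d * ?C = c'" "c * ?B + d * ?D = d'" using xy by simp_all
  have Z: "?A \<in> Zs" "?B \<in> Zs" "?C \<in> Zs" "?D \<in> Zs" using m m' by (auto simp: mult.commute)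
  show ?thesis
    by (intro bexI[OF _ Z(1)] bexI[OF _ Z(2)] bexI[OF _ Z(3)] bexI[OF _ Z(4)] conjI 1 2)
qed

text \<open>Each of the three integers in the gcd is multiplied by the rational number
  \<open>x * cj x\<close>. Written as \<open>u / v\<close>, this becomes homogeneity of the gcd
  under \<open>u\<close> and under \<open>v\<close>.\<close>

lemma idl_norm_scale:
  assumes cd: "c \<in> Zs" "d \<in> Zs" "c \<noteq> 0 \<or> d \<noteq> 0" and x: "x \<in> K" "x \<noteq> 0" "x * c \<in> Zs" "x * d \<in> Zs"
  shows "real_of_int (idl_norm (x * c) (x * d)) = \<bar>x * cj x\<bar> * of_int (idl_norm c d)"
proof -
  have K: "c \<in> K" "d \<in> K" using cd Zs_K by auto
  have xcd: "x * c \<noteq> 0 \<or> x * d \<noteq> 0" using x cd by auto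
  obtain u v :: int where v: "v > 0" and uv: "x * cj x = of_int u / of_int v"
    by (metis norm_Rats[OF x(1)] Rats_cases' less_irrefl)
  have sc: "v * \<lfloor>z'\<rfloor> = u * \<lfloor>z\<rfloor>" if zz: "z \<in> \<int>" "z' \<in> \<int>" "z' = x * cj x * z" for z z' :: real
  proof -
    obtain m m' where m: "z = of_int m" "z' = of_int m'" using zz(1,2) by (metis Ints_cases)
    have "real_of_int (v * m') = of_int (u * m)" using zz(3) v unfolding m uv by (simp add: field_simps)
    then have "v * m' = u * m" using of_int_eq_iff by blast
    then show ?thesis by (simp add: m)
  qed
  have 1: "v * \<lfloor>(x * c) * cj (x * c)\<rfloor> = u * \<lfloor>c * cj c\<rfloor>"
    using x cd K by (intro sc norm_Ints) (auto simp: algebra_simps)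
  have 2: "v * \<lfloor>(x * d) * cj (x * d)\<rfloor> = u * \<lfloor>d * cj d\<rfloor>"
    using x cd K by (intro sc norm_Ints) (auto simp: algebra_simps)
  have 3: "v * \<lfloor>(x * c) * cj (x * d) + (x * d) * cj (x * c)\<rfloor> = u * \<lfloor>c * cj d + d * cj c\<rfloor>"
    using x cd K by (intro sc cross_Ints) (auto simp: algebra_simps)
  have gm: "\<bar>w\<bar> * gcd (gcd i j) k = gcd (gcd (w * i) (w * j)) (w * k)" for w i j k :: int
  proof -
    have "gcd (\<bar>w\<bar> * gcd i j) (w * k) = gcd (w * gcd i j) (w * k)"
      by (cases "w \<ge> 0") auto
    then show ?thesis unfolding gcd_mult_distrib_int[symmetric] by simp
  qed
  have "\<bar>v\<bar> * idl_norm (x * c) (x * d) = \<bar>u\<bar> * idl_norm c d"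
    unfolding idl_norm_def gm 1 2 3 ..
  then have "real_of_int (v * idl_norm (x * c) (x * d)) = of_int (\<bar>u\<bar> * idl_norm c d)" using v by simp
  then show ?thesis using v unfolding uv by (simp add: field_simps)
qed

subsection \<open>Hermite normal form and the number of ideals\<close>

definition isideal :: "real set \<Rightarrow> bool" where
  "isideal a \<longleftrightarrow> a \<subseteq> Zs \<and> 0 \<in> a \<and> (\<forall>x\<in>a. \<forall>y\<in>a. x + y \<in> a) \<and> (\<forall>x\<in>a. \<forall>r\<in>Zs. r * x \<in> a)"

lemma isidealD:
  assumes "isideal a"
  shows "x \<in> a \<Longrightarrow> x \<in> Zs" "0 \<in> a" "x \<in> a \<Longrightarrow> y \<in> a \<Longrightarrow> x + y \<in> a"
    "x \<in> a \<Longrightarrow> y \<in> a \<Longrightarrow> x - y \<in> a" "x \<in> a \<Longrightarrow> r \<in> Zs \<Longrightarrow> r * x \<in> a"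
proof -
  show "x \<in> a \<Longrightarrow> x \<in> Zs" "0 \<in> a" "x \<in> a \<Longrightarrow> y \<in> a \<Longrightarrow> x + y \<in> a"
    and m: "x \<in> a \<Longrightarrow> r \<in> Zs \<Longrightarrow> r * x \<in> a" for x y r
    using assms by (auto simp: isideal_def)
  show "x \<in> a \<Longrightarrow> y \<in> a \<Longrightarrow> x - y \<in> a"
    using m[of y "of_int (-1)"] assms by (auto simp: isideal_def dest: bspec[of _ _ "-y"])
qed

lemma isideal_idl: "c \<in> Zs \<Longrightarrow> d \<in> Zs \<Longrightarrow> isideal (idl c d)"
  unfolding isideal_def
proof (intro conjI ballI)
  assume cd: "c \<in> Zs" "d \<in> Zs"
  show "idl c d \<subseteq> Zs" using cd by (auto simp: idl_def)
  show "0 \<in> idl c d" unfolding idl_def by (intro CollectI exI[of _ 0]) auto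
next
  fix x y assume "x \<in> idl c d" "y \<in> idl c d"
  then obtain a b a' b' where h: "x = a * c + b * d" "y = a' * c + b' * d" "a \<in> Zs" "b \<in> Zs" "a' \<in> Zs" "b' \<in> Zs"
    unfolding idl_def by blast
  have "x + y = (a + a') * c + (b + b') * d" unfolding h by (simp add: algebra_simps)
  then show "x + y \<in> idl c d" unfolding idl_def using h Zs_add by blast
next
  fix x r assume "x \<in> idl c d" "r \<in> Zs"
  then obtain a b where h: "x = a * c + b * d" "a \<in> Zs" "b \<in> Zs" unfolding idl_def by blast
  have "r * x = (r * a) * c + (r * b) * d" unfolding h by (simp add: algebra_simps)
  then show "r * x \<in> idl c d" unfolding idl_def using h \<open>r \<in> Zs\<close> Zs_mult by blast
qed

text \<open>The lattice spanned by \<open>g * m\<close> and \<open>g * (b + s)\<close>, of index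
  \<open>g * g * m\<close> in \<open>Zs\<close> when \<open>g\<close> and \<open>m\<close> are
  positive; membership of \<open>b\<close> in \<open>roots m\<close> makes it an ideal.\<close>

definition hnf :: "nat \<times> nat \<times> nat \<Rightarrow> real set" where
  "hnf = (\<lambda>(g, m, b). {of_int (i * int (g * m) + j * int (g * b)) + of_int (j * int g) * s | i j. True})"

definition roots :: "nat \<Rightarrow> nat set" where
  "roots m = {b. b < m \<and> int m dvd (int b)\<^sup>2 - int p}"

lemma Zs_rep_eq: "of_int a + of_int b * s = of_int c + of_int d * s \<longleftrightarrow> a = c \<and> b = d"
  using rep_unique[of "of_int a" "of_int b" "of_int c" "of_int d"] by auto

text \<open>\<open>g\<close> is the least positive coefficient of \<open>s\<close> occurring in the
  ideal and \<open>g * m\<close> the least positive rational integer in it, so the latter divides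
  \<open>n\<close>. Stability under multiplication by \<open>s\<close> yields the remaining
  divisibilities.\<close>

lemma ideal_hnf:
  assumes a: "isideal a" and n: "real n \<in> a" "n > 0"
  shows "\<exists>g m b. a = hnf (g, m, b) \<and> g dvd n \<and> m dvd n \<and> b \<in> roots m \<and> g > 0 \<and> m > 0"
proof -
  note A = isidealD[OF a]
  define Y where "Y j \<longleftrightarrow> (\<exists>i. of_int i + of_int j * s \<in> a)" for j :: int
  have nY: "Y (int n)" unfolding Y_def using A(5)[OF n(1) Zs_s] by (intro exI[of _ 0]) (simp add: mult.commute)
  define g where "g = (LEAST g. g > 0 \<and> Y (int g))"
  have g: "g > 0" "Y (int g)" using LeastI[of "\<lambda>g. g > 0 \<and> Y (int g)" n] nY n unfolding g_def by auto
  have g_least: "g \<le> h" if "h > 0" "Y (int h)" for h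
    unfolding g_def using that by (intro Least_le) simp
  define m0 where "m0 = (LEAST m. m > 0 \<and> real m \<in> a)"
  have m0: "m0 > 0" "real m0 \<in> a" using LeastI[of "\<lambda>m. m > 0 \<and> real m \<in> a" n] n unfolding m0_def by auto
  have m0_least: "m0 \<le> h" if "h > 0" "real h \<in> a" for h
    unfolding m0_def using that by (intro Least_le) simp
  obtain i0 where i0: "of_int i0 + of_int (int g) * s \<in> a" using g(2) Y_def by auto
  have Yg: "int g dvd j" if Yj: "Y j" for j
  proof -
    obtain i where i: "of_int i + of_int j * s \<in> a" using Yj Y_def by auto
    have "of_int i + of_int j * s - of_int (j div int g) * (of_int i0 + of_int (int g) * s) \<in> a"
      by (intro A(4) A(5) i i0 Zs_of_int)
    also have "of_int i + of_int j * s - of_int (j div int g) * (of_int i0 + of_int (int g) * s)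
        = of_int (i - (j div int g) * i0) + of_int (j - (j div int g) * int g) * s"
      by (simp add: algebra_simps)
    finally have "Y (j mod int g)" unfolding Y_def minus_div_mult_eq_mod by blast
    then have "Y (int (nat (j mod int g)))" using g by simp
    then have "\<not> nat (j mod int g) > 0" using g_least[of "nat (j mod int g)"] g(1)
        pos_mod_bound[of "int g" j] by linarith
    moreover have "j mod int g \<ge> 0" using g(1) by simp
    ultimately have "j mod int g = 0" by simp
    then show ?thesis by auto
  qed
  have Im: "int m0 dvd i" if i: "real_of_int i \<in> a" for i
  proof -
    have "of_int i - of_int (i div int m0) * real m0 \<in> a"
      by (intro A(4) A(5) i m0 Zs_of_int)
    also have "of_int i - of_int (i div int m0) * real m0 = real_of_int (i - (i div int m0) * int m0)"
      by simp
    also have "\<dots> = real (nat (i mod int m0))" unfolding minus_div_mult_eq_mod using m0 by simp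
    finally have "\<not> nat (i mod int m0) > 0" using m0_least[of "nat (i mod int m0)"] m0(1)
        pos_mod_bound[of "int m0" i] by linarith
    moreover have "i mod int m0 \<ge> 0" using m0(1) by simp
    ultimately have "i mod int m0 = 0" by simp
    then show ?thesis by auto
  qed
  have "Y (int m0)" unfolding Y_def using A(5)[OF m0(2) Zs_s] by (intro exI[of _ 0]) (simp add: mult.commute)
  then obtain m where m: "m0 = g * m" using Yg
    by (metis dvdE int_dvd_int_iff)
  \<comment> \<open>Multiplying by \<open>s\<close> turns \<open>i0\<close> into a coefficient of
    \<open>s\<close>, so \<open>g\<close> divides it.\<close>
  have "s * (of_int i0 + of_int (int g) * s) = of_int (int (p * g)) + of_int i0 * s"
    by (simp add: algebra_simps flip: s_sq)
  then have "Y i0" unfolding Y_def using A(5)[OF i0 Zs_s] by metis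
  then obtain b0 where b0: "i0 = int g * b0" using Yg by (auto elim: dvdE)
  \<comment> \<open>Multiplication by \<open>b0 - s\<close> produces a rational integer of the
    ideal; its divisibility by \<open>g * m\<close> is the congruence that defines
    \<open>roots m\<close>.\<close>
  have "(of_int b0 + of_int (-1) * s) * (of_int i0 + of_int (int g) * s) = of_int (int g * (b0\<^sup>2 - int p))"
    unfolding b0 by (simp add: algebra_simps power2_eq_square flip: s_sq)
  moreover have "(of_int b0 + of_int (-1) * s) * (of_int i0 + of_int (int g) * s) \<in> a"
    by (intro A(5) i0 Zs_I)
  ultimately have "real_of_int (int g * (b0\<^sup>2 - int p)) \<in> a" by metis
  then have "int m0 dvd int g * (b0\<^sup>2 - int p)" by (rule Im)
  then have md: "int m dvd b0\<^sup>2 - int p" using g(1) by (simp add: m)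
  have mpos: "m > 0" using m m0 by (auto intro: ccontr)
  define b where "b = nat (b0 mod int m)"
  have bi: "int b = b0 mod int m" using mpos by (simp add: b_def)
  have bm: "b < m" using mpos bi by (metis of_nat_0_less_iff of_nat_less_iff pos_mod_bound)
  have "((int b)\<^sup>2 - int p) mod int m = (b0\<^sup>2 - int p) mod int m"
    unfolding bi by (metis mod_diff_left_eq power_mod)
  then have "b \<in> roots m" using md bm unfolding roots_def by (simp add: dvd_eq_mod_eq_0)
  moreover have gn: "g * m dvd n"
    using Im[of "int n"] n(1) m by (metis int_dvd_int_iff of_int_of_nat_eq)
  moreover have "a = hnf (g, m, b)"
  proof -
    have e: "of_int (int g * int b) + of_int (int g) * s \<in> a"
    proof -
      have "of_int i0 + of_int (int g) * s - of_int (b0 div int m) * real m0 \<in> a"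
        by (intro A(4) A(5) i0 m0 Zs_of_int)
      also have "of_int i0 + of_int (int g) * s - of_int (b0 div int m) * real m0
         = of_int (int g * (b0 - b0 div int m * int m)) + of_int (int g) * s"
        unfolding b0 m by (simp add: algebra_simps)
      finally show ?thesis unfolding minus_div_mult_eq_mod bi .
    qed
    have "x \<in> hnf (g, m, b)" if x: "x \<in> a" for x
    proof -
      obtain i j where ij: "x = of_int i + of_int j * s" using A(1)[OF x] by (auto elim: Zs_E)
      then have "Y j" using x Y_def by auto
      then obtain q where q: "j = int g * q" using Yg by (auto elim: dvdE)
      have "x - of_int q * (of_int (int g * int b) + of_int (int g) * s) \<in> a"
        by (intro A(4) A(5) x e Zs_of_int)
      also have "x - of_int q * (of_int (int g * int b) + of_int (int g) * s) = of_int (i - q * (int g * int b))"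
        unfolding ij q by (simp add: algebra_simps)
      finally have "int m0 dvd i - q * (int g * int b)" by (rule Im)
      then obtain r where r: "i - q * (int g * int b) = int m0 * r" by (rule dvdE)
      have "x = of_int (r * int (g * m) + q * int (g * b)) + of_int (q * int g) * s"
      proof -
        have "i = r * int (g * m) + q * int (g * b)" using r unfolding m by (simp add: algebra_simps)
        then show ?thesis unfolding ij q by (simp add: mult.commute)
      qed
      then show ?thesis unfolding hnf_def by blast
    qed
    moreover have "x \<in> a" if x: "x \<in> hnf (g, m, b)" for x
    proof -
      obtain i j where "x = of_int (i * int (g * m) + j * int (g * b)) + of_int (j * int g) * s"
        using x by (auto simp: hnf_def)
      then have "x = of_int i * real m0 + of_int j * (of_int (int g * int b) + of_int (int g) * s)"
        unfolding m by (simp add: algebra_simps)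
      then show ?thesis using A(3)[OF A(5)[OF m0(2) Zs_of_int[of i]] A(5)[OF e Zs_of_int[of j]]] by simp
    qed
    ultimately show ?thesis by blast
  qed
  ultimately show ?thesis using g(1) mpos
    by (intro exI[of _ g] exI[of _ m] exI[of _ b]) (auto dest: dvd_mult_left dvd_mult_right)
qed

end

section \<open>Divisor function and counting by fibers\<close>

definition ndiv :: "nat \<Rightarrow> nat" where "ndiv n = card {d. d dvd n}"

lemma finite_divs: "n > 0 \<Longrightarrow> finite {d. d dvd (n::nat)}" by (rule finite_divisors_nat) simp

lemma ndiv_mono: "m dvd n \<Longrightarrow> n > 0 \<Longrightarrow> ndiv m \<le> ndiv n"
  unfolding ndiv_def by (intro card_mono finite_divs) auto

lemma fiber_representatives:
  assumes "finite T" "\<psi> ` A \<subseteq> T"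
  shows "\<exists>R. R \<subseteq> A \<and> finite R \<and> card R \<le> card T \<and> (\<forall>x\<in>A. \<exists>y\<in>R. \<psi> y = \<psi> x)"
proof -
  define c where "c t = (SOME x. x \<in> A \<and> \<psi> x = t)" for t
  have c: "c (\<psi> x) \<in> A \<and> \<psi> (c (\<psi> x)) = \<psi> x" if "x \<in> A" for x
    unfolding c_def by (rule someI[of "\<lambda>y. y \<in> A \<and> \<psi> y = \<psi> x" x]) (use that in simp)
  have fin: "finite (\<psi> ` A)" using assms finite_subset by blast
  show ?thesis
  proof (intro exI[of _ "c ` \<psi> ` A"] conjI ballI)
    show "c ` \<psi> ` A \<subseteq> A" using c by auto
    show "finite (c ` \<psi> ` A)" using fin by simp
    show "card (c ` \<psi> ` A) \<le> card T"
      using card_image_le[OF fin, of c] card_mono[OF assms] by linarith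
    fix x assume "x \<in> A"
    then show "\<exists>y\<in>c ` \<psi> ` A. \<psi> y = \<psi> x" using c by blast
  qed
qed

lemma card_le_fibers:
  assumes "finite T" "\<phi> ` A \<subseteq> T" "finite A" "\<And>t. t \<in> T \<Longrightarrow> card {x \<in> A. \<phi> x = t} \<le> k"
  shows "card A \<le> card T * k"
proof -
  have "A = (\<Union>t\<in>T. {x \<in> A. \<phi> x = t})" using assms(2) by auto
  then have "card A \<le> (\<Sum>t\<in>T. card {x \<in> A. \<phi> x = t})" using card_UN_le[OF assms(1)] by metis
  also have "\<dots> \<le> card T * k" using sum_bounded_above[of T _ k] assms(4) by simp
  finally show ?thesis .
qed

context real_quadratic begin

text \<open>Two square roots \<open>b\<close>, \<open>b1\<close> of \<open>p\<close> modulo \<open>m\<close> with the same greatest common divisor of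
  \<open>b - b0\<close> and \<open>m\<close> are congruent up to a factor dividing \<open>4 p\<close>.\<close>

lemma roots_fiber:
  assumes b: "b \<in> roots m" "b1 \<in> roots m" "b0 \<in> roots m" and m: "m > 0"
    and e: "gcd (int b - int b0) (int m) = gcd (int b1 - int b0) (int m)"
  shows "int m dvd 4 * (int b - int b1)"
proof -
  let ?X = "int b - int b0" and ?X1 = "int b1 - int b0" and ?T = "2 * int b0"
  have r: "int m dvd (int x)\<^sup>2 - int p" if "x \<in> roots m" for x using that by (simp add: roots_def)
  have sq: "int m dvd (int x - int b0) * (int x - int b0 + ?T)" if "x \<in> roots m" for x
  proof -
    have "(int x - int b0) * (int x - int b0 + ?T) = ((int x)\<^sup>2 - int p) - ((int b0)\<^sup>2 - int p)"
      by (simp add: algebra_simps power2_eq_square)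
    then show ?thesis using r[OF that] r[OF b(3)] by (metis dvd_diff)
  qed
  \<comment> \<open>\<open>Y\<close> is a multiple of the common gcd, which is a combination of
    \<open>Y'\<close> and \<open>m\<close>; so \<open>Y'\<close> may be exchanged for
    \<open>Y\<close> in a product divisible by \<open>m\<close>.\<close>
  have cross: "int m dvd Y * Z" if g: "gcd Y (int m) = gcd Y' (int m)" and z: "int m dvd Y' * Z" for Y Y' Z
  proof -
    obtain u v where uv: "u * Y' + v * int m = gcd Y' (int m)" using bezout_int by blast
    obtain q where q: "Y = gcd Y' (int m) * q" using g by (metis gcd_dvd1 dvdE)
    have "Y * Z = (q * u) * (Y' * Z) + int m * (q * v * Z)"
      by (subst q, subst uv[symmetric]) (simp add: algebra_simps)
    then show ?thesis using z by simp
  qed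
  have c1: "int m dvd ?X * (?X1 + ?T)" by (rule cross[OF e]) (rule sq[OF b(2)])
  have c2: "int m dvd ?X1 * (?X + ?T)" by (rule cross[OF e[symmetric]]) (rule sq[OF b(1)])
  have "?T * (int b - int b1) = ?X * (?X1 + ?T) - ?X1 * (?X + ?T)" by (simp add: algebra_simps)
  then have T: "int m dvd ?T * (int b - int b1)" using c1 c2 by (metis dvd_diff)
  \<comment> \<open>The square of \<open>?T\<close> is \<open>4 * p\<close> modulo \<open>m\<close>,
    so multiplying by \<open>?T\<close> once more leaves the factor \<open>4 * p\<close>.\<close>
  have "int m dvd ?T * (?T * (int b - int b1)) - 4 * (int b - int b1) * ((int b0)\<^sup>2 - int p)"
    by (intro dvd_diff dvd_mult T r b)
  also have "?T * (?T * (int b - int b1)) - 4 * (int b - int b1) * ((int b0)\<^sup>2 - int p)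
      = int p * (4 * (int b - int b1))"
    by (simp add: algebra_simps power2_eq_square)
  finally have P: "int m dvd int p * (4 * (int b - int b1))" .
  have pp: "prime (int p)" using prime_p by simp
  show ?thesis
  \<comment> \<open>This removes the factor \<open>p\<close>. If \<open>p\<close> divides
    \<open>m\<close>, it divides all roots, and it divides \<open>m\<close> only once because
    \<open>p\<close> is not divisible by its square.\<close>
  proof (cases "p dvd m")
    case False
    then have "coprime (int m) (int p)" using pp
      by (metis coprime_commute int_dvd_int_iff prime_imp_coprime)
    then show ?thesis using P coprime_dvd_mult_right_iff by blast
  next
    case True
    then obtain m1 where m1: "m = p * m1" by blast
    have pd: "int p dvd int x" if x: "x \<in> roots m" for x
    proof -
      have "int p dvd (int x)\<^sup>2 - int p" using r[OF x] m1 by (metis dvd_mult_left of_nat_mult)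
      then have "int p dvd (int x)\<^sup>2" using dvd_add[of "int p" "(int x)\<^sup>2 - int p" "int p"] by simp
      then show ?thesis using pp prime_dvd_power by blast
    qed
    have "\<not> p dvd m1"
    proof
      assume "p dvd m1"
      then have "int p * int p dvd (int b0)\<^sup>2 - int p" using r[OF b(3)] m1
        by (metis dvd_trans mult_dvd_mono dvd_refl of_nat_dvd_iff of_nat_mult)
      moreover have "int p * int p dvd (int b0)\<^sup>2" using pd[OF b(3)] by (simp add: power2_eq_square mult_dvd_mono)
      ultimately have "int p * int p dvd int p"
        using dvd_diff[of "int p * int p" "(int b0)\<^sup>2" "(int b0)\<^sup>2 - int p"] by simp
      then have "p * p dvd p" by (metis int_dvd_int_iff of_nat_mult)
      then show False using p_ge_3 by (simp add: dvd_mult_cancel1)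
    qed
    then have "coprime (int m1) (int p)" using pp by (metis coprime_commute int_dvd_int_iff prime_imp_coprime)
    moreover have "int m1 dvd 4 * (int b - int b1)" using P p_ge_3 unfolding m1 by simp
    moreover have "int p dvd 4 * (int b - int b1)" using pd[OF b(1)] pd[OF b(2)] by simp
    ultimately show ?thesis unfolding m1 of_nat_mult
      by (metis divides_mult mult.commute)
  qed
qed

lemma finite_roots: "finite (roots m)" unfolding roots_def by simp

text \<open>There are at most \<open>ndiv m\<close> gcds of \<open>m\<close> with the distance from
  a fixed root, and at most 7 roots for each: by \<open>roots_fiber\<close> the number
  \<open>4 * (b - b1)\<close> is a multiple of \<open>m\<close>, and residues below \<open>m\<close>
  make the quotient lie in \<open>{-3..3}\<close>.\<close>

lemma card_roots: assumes m: "m > 0" shows "card (roots m) \<le> 7 * ndiv m"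
proof (cases "roots m = {}")
  case False
  then obtain b0 where b0: "b0 \<in> roots m" by blast
  define \<phi> where "\<phi> b = nat (gcd (int b - int b0) (int m))" for b
  have "card (roots m) \<le> card {d. d dvd m} * 7"
  proof (rule card_le_fibers[where \<phi> = \<phi>])
    show "finite {d. d dvd m}" using m by (rule finite_divs)
    show "\<phi> ` roots m \<subseteq> {d. d dvd m}" unfolding \<phi>_def
      by (auto simp flip: int_dvd_int_iff)
    show "finite (roots m)" by (rule finite_roots)
    fix t
    show "card {x \<in> roots m. \<phi> x = t} \<le> 7"
    proof (cases "{x \<in> roots m. \<phi> x = t} = {}")
      case False
      then obtain b1 where b1: "b1 \<in> roots m" "\<phi> b1 = t" by blast
      let ?h = "\<lambda>b. (4 * (int b - int b1)) div int m"
      have d: "int m dvd 4 * (int b - int b1)" if "b \<in> roots m" "\<phi> b = t" for b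
        using roots_fiber[OF that(1) b1(1) b0 m] that(2) b1(2) unfolding \<phi>_def
        by (metis gcd_ge_0_int nat_eq_iff2 eq_nat_nat_iff)
      have "inj_on ?h {x \<in> roots m. \<phi> x = t}"
      proof (rule inj_onI)
        fix x y assume "x \<in> {x \<in> roots m. \<phi> x = t}" "y \<in> {x \<in> roots m. \<phi> x = t}" "?h x = ?h y"
        then have "4 * (int x - int b1) = 4 * (int y - int b1)" using d[of x] d[of y] m
          by (metis (mono_tags, lifting) mem_Collect_eq dvd_div_mult_self)
        then show "x = y" by simp
      qed
      moreover have "?h ` {x \<in> roots m. \<phi> x = t} \<subseteq> {-3..3}"
      proof (rule image_subsetI)
        fix x assume x: "x \<in> {x \<in> roots m. \<phi> x = t}"
        then obtain q where q: "4 * (int x - int b1) = int m * q" using d[of x] by blast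
        have "x < m" "b1 < m" using x b1 by (auto simp: roots_def)
        then have "4 * (int x - int b1) < int m * 4" "int m * (-4) < 4 * (int x - int b1)" by simp_all
        then have "int m * q < int m * 4" "int m * (-4) < int m * q" unfolding q .
        then have "q < 4" "-4 < q" using m by (simp_all only: mult_less_cancel_left_pos of_nat_0_less_iff)
        then show "?h x \<in> {-3..3}" using q m by simp
      qed
      ultimately have "card {x \<in> roots m. \<phi> x = t} \<le> card {-3..3::int}"
        by (intro card_inj_on_le) auto
      then show ?thesis by simp
    qed (simp only: card.empty)
  qed
  then show ?thesis by (simp add: ndiv_def mult.commute)
qed simp

definition ideals :: "nat \<Rightarrow> real set set" where
  "ideals n = {a. isideal a \<and> real n \<in> a}"

text \<open>By \<open>ideal_hnf\<close> an ideal containing \<open>n\<close> is given by two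
  divisors \<open>g\<close> and \<open>m\<close> of \<open>n\<close> and one of the at most
  \<open>7 * ndiv m\<close> roots modulo \<open>m\<close>.\<close>

lemma ideals_finite_card:
  assumes n: "n > 0"
  shows "finite (ideals n) \<and> card (ideals n) \<le> 7 * ndiv n ^ 3"
proof -
  let ?D = "{d. d dvd n}"
  let ?S = "?D \<times> (SIGMA m:?D. roots m)"
  have fin: "finite ?D" using n by (rule finite_divs)
  have sub: "ideals n \<subseteq> hnf ` ?S"
  proof
    fix a assume "a \<in> ideals n"
    then obtain g m b where "a = hnf (g, m, b)" "g dvd n" "m dvd n" "b \<in> roots m"
      using ideal_hnf[of a n] n unfolding ideals_def by blast
    then show "a \<in> hnf ` ?S" by auto
  qed
  have finS: "finite ?S" using fin finite_roots by blast
  have "card (ideals n) \<le> card ?S" using surj_card_le[OF finS sub] .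
  also have "\<dots> = ndiv n * (\<Sum>m\<in>?D. card (roots m))"
    using fin finite_roots by (simp add: card_cartesian_product ndiv_def)
  also have "\<dots> \<le> ndiv n * (\<Sum>m\<in>?D. 7 * ndiv n)"
  proof (intro mult_left_mono sum_mono)
    fix m assume m: "m \<in> ?D"
    then have "m > 0" using n by (auto intro: Nat.gr0I)
    then show "card (roots m) \<le> 7 * ndiv n" using card_roots[of m] ndiv_mono[of m n] m n by fastforce
  qed simp
  also have "\<dots> = 7 * ndiv n ^ 3" by (simp add: ndiv_def power3_eq_cube)
  finally show ?thesis using finS sub finite_surj by blast
qed

subsection \<open>Roots of quadratic congruences modulo an ideal\<close>

text \<open>The argument of \<open>roots_fiber\<close> with ideals in place of integers: the gcd
  becomes the ideal \<open>dd \<kappa>\<close> generated by \<open>b\<close> and the distance from a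
  fixed solution, and it contains \<open>n\<close>. Solutions with equal \<open>dd\<close> agree
  modulo \<open>b\<close> after multiplication by the discriminant, so a fiber meets at most the
  square of its absolute value many classes.\<close>

lemma quadratic_roots_mod_ideal:
  fixes t :: int
  assumes b: "isideal b" and n: "real n \<in> b" "n > 0" and t: "t\<^sup>2 \<noteq> 4"
  shows "\<exists>R. R \<subseteq> Zs \<and> finite R \<and> card R \<le> 7 * ndiv n ^ 3 * (nat \<bar>t\<^sup>2 - 4\<bar>)\<^sup>2 \<and>
    (\<forall>\<kappa>\<in>Zs. \<kappa>\<^sup>2 - of_int t * \<kappa> + 1 \<in> b \<longrightarrow> (\<exists>\<kappa>0\<in>R. \<kappa> - \<kappa>0 \<in> b))"
proof -
  note B = isidealD[OF b]
  define \<Delta> where "\<Delta> = t\<^sup>2 - 4"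
  define f where "f \<kappa> = \<kappa>\<^sup>2 - of_int t * \<kappa> + 1" for \<kappa> :: real
  define A where "A = {\<kappa>\<in>Zs. f \<kappa> \<in> b}"
  have d0: "\<Delta> \<noteq> 0" using t by (simp add: \<Delta>_def)
  obtain g m c where hb: "b = hnf (g, m, c)" using ideal_hnf[OF b n] by blast
  show ?thesis
  proof (cases "A = {}")
    case True
    then show ?thesis unfolding A_def f_def by (intro exI[of _ "{}"]) auto
  next
    case False
    then obtain \<kappa>0 where k0: "\<kappa>0 \<in> Zs" "f \<kappa>0 \<in> b" unfolding A_def by blast
    define dd where "dd \<kappa> = {(\<kappa> - \<kappa>0) * \<alpha> + \<beta> | \<alpha> \<beta>. \<alpha> \<in> Zs \<and> \<beta> \<in> b}" for \<kappa>
    have dd_ideal: "dd \<kappa> \<in> ideals n" if k: "\<kappa> \<in> A" for \<kappa>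
    proof -
      have kZ: "\<kappa> - \<kappa>0 \<in> Zs" using k k0 by (simp add: A_def)
      have mem: "z \<in> dd \<kappa>" if "z = (\<kappa> - \<kappa>0) * \<alpha> + \<beta>" "\<alpha> \<in> Zs" "\<beta> \<in> b" for z \<alpha> \<beta>
        unfolding dd_def using that by blast
      have "real n \<in> dd \<kappa>" "0 \<in> dd \<kappa>" using n B(2) by (auto intro: mem[of _ 0])
      moreover have "dd \<kappa> \<subseteq> Zs" unfolding dd_def using kZ B(1) by auto
      moreover have "x + y \<in> dd \<kappa>" if x: "x \<in> dd \<kappa>" and y: "y \<in> dd \<kappa>" for x y
      proof -
        obtain \<alpha> \<beta> where 1: "x = (\<kappa> - \<kappa>0) * \<alpha> + \<beta>" "\<alpha> \<in> Zs" "\<beta> \<in> b" using x unfolding dd_def by blast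
        obtain \<alpha>' \<beta>' where 2: "y = (\<kappa> - \<kappa>0) * \<alpha>' + \<beta>'" "\<alpha>' \<in> Zs" "\<beta>' \<in> b" using y unfolding dd_def by blast
        show ?thesis using 1 2 B(3) by (intro mem[of _ "\<alpha> + \<alpha>'" "\<beta> + \<beta>'"]) (auto simp: algebra_simps)
      qed
      moreover have "r * x \<in> dd \<kappa>" if x: "x \<in> dd \<kappa>" and r: "r \<in> Zs" for x r
      proof -
        obtain \<alpha> \<beta> where 1: "x = (\<kappa> - \<kappa>0) * \<alpha> + \<beta>" "\<alpha> \<in> Zs" "\<beta> \<in> b" using x unfolding dd_def by blast
        have "r * x = (\<kappa> - \<kappa>0) * (r * \<alpha>) + r * \<beta>" unfolding 1(1) by (simp add: algebra_simps)
        then show ?thesis by (rule mem) (use 1 r B(5) in auto)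
      qed
      ultimately show ?thesis by (auto simp: ideals_def isideal_def)
    qed
    have fiber: "of_int \<Delta> * (\<kappa> - \<kappa>1) \<in> b" if k: "\<kappa> \<in> A" "\<kappa>1 \<in> A" and e: "dd \<kappa> = dd \<kappa>1" for \<kappa> \<kappa>1
    proof -
      let ?T = "2 * \<kappa>0 - of_int t"
      have Z: "\<kappa> \<in> Zs" "\<kappa>1 \<in> Zs" using k by (auto simp: A_def)
      have self: "\<kappa> - \<kappa>0 \<in> dd \<kappa>" for \<kappa>
        unfolding dd_def by (rule CollectI, rule exI[of _ 1], rule exI[of _ 0]) (simp add: B(2))
      have sq: "(\<kappa> - \<kappa>0) * (\<kappa> - \<kappa>0 + ?T) \<in> b" if "\<kappa> \<in> A" for \<kappa>
      proof -
        have "(\<kappa> - \<kappa>0) * (\<kappa> - \<kappa>0 + ?T) = f \<kappa> - f \<kappa>0" by (simp add: f_def algebra_simps power2_eq_square)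
        then show ?thesis using B(4) that k0 by (simp add: A_def)
      qed
      have cross: "(\<kappa> - \<kappa>0) * (\<kappa>' - \<kappa>0 + ?T) \<in> b" if k': "\<kappa> \<in> A" "\<kappa>' \<in> A" "dd \<kappa> = dd \<kappa>'" for \<kappa> \<kappa>'
      proof -
        obtain \<alpha> \<beta> where ab: "\<kappa> - \<kappa>0 = (\<kappa>' - \<kappa>0) * \<alpha> + \<beta>" "\<alpha> \<in> Zs" "\<beta> \<in> b"
          using self[of \<kappa>] unfolding k'(3) unfolding dd_def by blast
        have "(\<kappa> - \<kappa>0) * (\<kappa>' - \<kappa>0 + ?T) = \<alpha> * ((\<kappa>' - \<kappa>0) * (\<kappa>' - \<kappa>0 + ?T)) + (\<kappa>' - \<kappa>0 + ?T) * \<beta>"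
          unfolding ab(1) by (simp add: algebra_simps)
        moreover have "\<kappa>' - \<kappa>0 + ?T \<in> Zs" using k' k0 by (simp add: A_def)
        ultimately show ?thesis using B(3) B(5) sq[OF k'(2)] ab by simp
      qed
      have "?T * (\<kappa> - \<kappa>1) = (\<kappa> - \<kappa>0) * (\<kappa>1 - \<kappa>0 + ?T) - (\<kappa>1 - \<kappa>0) * (\<kappa> - \<kappa>0 + ?T)"
        by (simp add: algebra_simps)
      then have Tb: "?T * (\<kappa> - \<kappa>1) \<in> b" using B(4) cross[OF k e] cross[OF k(2,1) e[symmetric]] by simp
      \<comment> \<open>\<open>?T\<close> is the derivative of \<open>f\<close> at
        \<open>\<kappa>0\<close>; its square minus \<open>4 * f \<kappa>0\<close> is the
        discriminant.\<close>
      have "of_int \<Delta> * (\<kappa> - \<kappa>1) = ?T * (?T * (\<kappa> - \<kappa>1)) - (4 * (\<kappa> - \<kappa>1)) * f \<kappa>0"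
        by (simp add: \<Delta>_def f_def algebra_simps power2_eq_square)
      moreover have "?T \<in> Zs" using k0 by simp
      moreover have "4 * (\<kappa> - \<kappa>1) \<in> Zs" using Z by simp
      ultimately show ?thesis using B(4) B(5) Tb k0 by simp
    qed
    have "\<exists>R. R \<subseteq> {\<kappa> \<in> A. dd \<kappa> = I} \<and> finite R \<and> card R \<le> (nat \<bar>\<Delta>\<bar>)\<^sup>2 \<and>
        (\<forall>\<kappa>\<in>{\<kappa> \<in> A. dd \<kappa> = I}. \<exists>\<kappa>0\<in>R. \<kappa> - \<kappa>0 \<in> b)" (is "\<exists>R. ?P I R") for I
    proof (cases "{\<kappa> \<in> A. dd \<kappa> = I} = {}")
      case True then show ?thesis by (intro exI[of _ "{}"]) auto
    next
      case False
      then obtain \<kappa>1 where k1: "\<kappa>1 \<in> A" "dd \<kappa>1 = I" by blast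
      have "\<exists>i j. of_int \<Delta> * (\<kappa> - \<kappa>1) = of_int (i * int (g * m) + j * int (g * c)) + of_int (j * int g) * s"
        if "\<kappa> \<in> A" "dd \<kappa> = I" for \<kappa>
        using fiber[OF that(1) k1(1)] that k1 unfolding hb hnf_def by auto
      then obtain i j where ij: "\<And>\<kappa>. \<kappa> \<in> A \<Longrightarrow> dd \<kappa> = I \<Longrightarrow>
          of_int \<Delta> * (\<kappa> - \<kappa>1) = of_int (i \<kappa> * int (g * m) + j \<kappa> * int (g * c)) + of_int (j \<kappa> * int g) * s"
        by metis
      \<comment> \<open>These are coordinates in the lattice basis of \<open>b\<close>. If those of
        two solutions agree modulo the discriminant, the difference can be divided by it inside
        \<open>b\<close>.\<close>
      define \<psi> where "\<psi> \<kappa> = (i \<kappa> mod \<bar>\<Delta>\<bar>, j \<kappa> mod \<bar>\<Delta>\<bar>)" for \<kappa>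
      have T: "\<psi> ` {\<kappa> \<in> A. dd \<kappa> = I} \<subseteq> {0..<\<bar>\<Delta>\<bar>} \<times> {0..<\<bar>\<Delta>\<bar>}" using d0 by (auto simp: \<psi>_def)
      obtain R where R: "R \<subseteq> {\<kappa> \<in> A. dd \<kappa> = I}" "finite R" "card R \<le> card ({0..<\<bar>\<Delta>\<bar>} \<times> {0..<\<bar>\<Delta>\<bar>})"
          "\<forall>x\<in>{\<kappa> \<in> A. dd \<kappa> = I}. \<exists>y\<in>R. \<psi> y = \<psi> x"
        using fiber_representatives[OF _ T] by auto
      have "\<kappa> - \<kappa>' \<in> b" if k: "\<kappa> \<in> A" "dd \<kappa> = I" "\<kappa>' \<in> A" "dd \<kappa>' = I" "\<psi> \<kappa>' = \<psi> \<kappa>" for \<kappa> \<kappa>'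
      proof -
        have "\<Delta> dvd i \<kappa> - i \<kappa>'" "\<Delta> dvd j \<kappa> - j \<kappa>'"
          using k(5) unfolding \<psi>_def by (auto simp: mod_eq_dvd_iff dvd_diff_commute)
        then obtain u v where uv: "i \<kappa> = i \<kappa>' + \<Delta> * u" "j \<kappa> = j \<kappa>' + \<Delta> * v"
          by (metis dvdE add.commute diff_add_cancel)
        have "of_int \<Delta> * (\<kappa> - \<kappa>') = of_int \<Delta> * (\<kappa> - \<kappa>1) - of_int \<Delta> * (\<kappa>' - \<kappa>1)" by (simp add: algebra_simps)
        also have "\<dots> = of_int \<Delta> * (of_int (u * int (g * m) + v * int (g * c)) + of_int (v * int g) * s)"
          unfolding ij[OF k(1,2)] ij[OF k(3,4)] uv by (simp add: algebra_simps)
        finally have "\<kappa> - \<kappa>' = of_int (u * int (g * m) + v * int (g * c)) + of_int (v * int g) * s" using d0 by simp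
        then show ?thesis unfolding hb hnf_def by blast
      qed
      moreover have "card ({0..<\<bar>\<Delta>\<bar>} \<times> {0..<\<bar>\<Delta>\<bar>}) = (nat \<bar>\<Delta>\<bar>)\<^sup>2" by (simp add: card_cartesian_product power2_eq_square)
      ultimately show ?thesis using R by (intro exI[of _ R]) (simp, blast)
    qed
    then have "\<forall>I. \<exists>R. ?P I R" by (rule allI)
    from choice[OF this] obtain R where R0: "\<forall>I. ?P I (R I)" by (rule exE)
    have R: "\<And>I. R I \<subseteq> {\<kappa> \<in> A. dd \<kappa> = I}" "\<And>I. finite (R I)" "\<And>I. card (R I) \<le> (nat \<bar>\<Delta>\<bar>)\<^sup>2"
        "\<And>I \<kappa>. \<kappa> \<in> A \<Longrightarrow> dd \<kappa> = I \<Longrightarrow> \<exists>\<kappa>0\<in>R I. \<kappa> - \<kappa>0 \<in> b"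
      using R0 by simp_all
    have fi: "finite (ideals n)" "card (ideals n) \<le> 7 * ndiv n ^ 3" using ideals_finite_card n by auto
    have "card (\<Union>I\<in>ideals n. R I) \<le> (\<Sum>I\<in>ideals n. card (R I))" by (rule card_UN_le[OF fi(1)])
    also have "\<dots> \<le> card (ideals n) * (nat \<bar>\<Delta>\<bar>)\<^sup>2" using sum_bounded_above[of "ideals n" "\<lambda>I. card (R I)"] R(3) by simp
    also have "\<dots> \<le> 7 * ndiv n ^ 3 * (nat \<bar>\<Delta>\<bar>)\<^sup>2" using fi(2) by simp
    finally have card: "card (\<Union>I\<in>ideals n. R I) \<le> 7 * ndiv n ^ 3 * (nat \<bar>t\<^sup>2 - 4\<bar>)\<^sup>2" unfolding \<Delta>_def .
    show ?thesis
    proof (intro exI[of _ "\<Union>I\<in>ideals n. R I"] conjI card ballI impI)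
      show "(\<Union>I\<in>ideals n. R I) \<subseteq> Zs" using R(1) unfolding A_def by blast
      show "finite (\<Union>I\<in>ideals n. R I)" using fi R(2) by blast
      fix \<kappa> assume "\<kappa> \<in> Zs" "\<kappa>\<^sup>2 - of_int t * \<kappa> + 1 \<in> b"
      then have k: "\<kappa> \<in> A" unfolding A_def f_def by simp
      show "\<exists>\<kappa>0\<in>\<Union>I\<in>ideals n. R I. \<kappa> - \<kappa>0 \<in> b" using R(4)[OF k refl] dd_ideal[OF k] by blast
    qed
  qed
qed

text \<open>In products of the basis elements \<open>m\<close> and \<open>b + s\<close> with
  conjugates, only the norm of \<open>b + s\<close> is not visibly divisible by \<open>m\<close>;
  its divisibility is the condition in \<open>roots m\<close>.\<close>

lemma hnf_conj_mult:
  assumes x: "x \<in> hnf (g, m, b)" and y: "y \<in> hnf (g, m, b)" and b: "b \<in> roots m"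
  shows "\<exists>z\<in>Zs. x * cj y = of_int (int (g * g * m)) * z"
proof -
  obtain q where q: "(int b)\<^sup>2 - int p = int m * q" using b by (auto simp: roots_def)
  obtain i j where ij: "x = of_int (i * int (g * m) + j * int (g * b)) + of_int (j * int g) * s"
    using x by (auto simp: hnf_def)
  obtain i' j' where ij': "y = of_int (i' * int (g * m) + j' * int (g * b)) + of_int (j' * int g) * s"
    using y by (auto simp: hnf_def)
  have cy: "cj y = of_int (i' * int (g * m) + j' * int (g * b)) - of_int (j' * int g) * s"
    unfolding ij' by (rule cj_rep) auto
  have q': "real b * real b - s * s = real m * of_int q"
    unfolding s_sq using arg_cong[OF q, of real_of_int] by (simp add: power2_eq_square)
  let ?z = "of_int (i * i') * real m + of_int (i * j') * (real b - s) + of_int (j * i') * (real b + s) + of_int (j * j') * of_int q"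
  have "x * cj y = real g * real g * (of_int (i * i') * (real m * real m) + of_int (i * j') * real m * (real b - s)
      + of_int (j * i') * real m * (real b + s) + of_int (j * j') * (real b * real b - s * s))"
    unfolding cy unfolding ij by (simp add: algebra_simps)
  also have "\<dots> = of_int (int (g * g * m)) * ?z" unfolding q' by (simp add: algebra_simps)
  finally show ?thesis by (intro bexI[of _ ?z]) auto
qed

text \<open>\<open>idl_norm\<close> is an integral combination of products \<open>x * cj y\<close>
  with \<open>x\<close> and \<open>y\<close> in the ideal. Hence the index is at most the norm, as
  the pigeonhole argument below requires.\<close>

lemma hnf_index_dvd_norm:
  assumes cd: "c \<in> Zs" "d \<in> Zs" and e: "idl c d = hnf (g, m, b)" and b: "b \<in> roots m"
    and pos: "g > 0" "m > 0"
  shows "int (g * g * m) dvd idl_norm c d"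
proof -
  obtain i j l where k: "real_of_int (idl_norm c d) =
      of_int i * (c * cj c) + of_int j * (d * cj d) + of_int l * (c * cj d + d * cj c)"
    using idl_norm_generators[OF cd] by blast
  have mem: "c \<in> hnf (g, m, b)" "d \<in> hnf (g, m, b)" using idl_gens(1)[of c d] idl_gens(2)[of d c] e by auto
  obtain z1 z2 z3 z4 where z: "z1 \<in> Zs" "z2 \<in> Zs" "z3 \<in> Zs" "z4 \<in> Zs"
    "c * cj c = of_int (int (g * g * m)) * z1" "d * cj d = of_int (int (g * g * m)) * z2"
    "c * cj d = of_int (int (g * g * m)) * z3" "d * cj c = of_int (int (g * g * m)) * z4"
    using hnf_conj_mult[OF mem(1,1) b] hnf_conj_mult[OF mem(2,2) b] hnf_conj_mult[OF mem(1,2) b]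
      hnf_conj_mult[OF mem(2,1) b] by blast
  let ?z = "of_int i * z1 + of_int j * z2 + of_int l * (z3 + z4)"
  have "real_of_int (idl_norm c d) = of_int (int (g * g * m)) * ?z"
    unfolding k z by (simp add: algebra_simps)
  moreover have "?z \<in> Zs" using z by simp
  then obtain u v where uv: "?z = of_int u + of_int v * s" by (rule Zs_E)
  ultimately have "real_of_int (idl_norm c d) = of_int (int (g * g * m)) * (of_int u + of_int v * s)"
    by (simp only: uv)
  then have "of_int (idl_norm c d) + of_int 0 * s
      = of_int (int (g * g * m) * u) + of_int (int (g * g * m) * v) * s"
    by (simp add: distrib_left)
  then have "idl_norm c d = int (g * g * m) * u" unfolding Zs_rep_eq by blast
  then show ?thesis by simp
qed

text \<open>Pigeonhole principle: there are more than \<open>k\<close> points \<open>i + j s\<close> with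
  \<open>0 \<le> i \<le> k / 2\<close> and \<open>0 \<le> j s \<le> k / 2\<close>, but the ideal has at most \<open>k\<close> residue classes.\<close>

lemma small_ideal_element:
  assumes cd: "c \<in> Zs" "d \<in> Zs" "c \<noteq> 0 \<or> d \<noteq> 0" and k: "k = real_of_int (idl_norm c d)" "k > 4 * s"
  shows "\<exists>y\<in>idl c d. y \<noteq> 0 \<and> \<bar>y\<bar> \<le> k \<and> \<bar>cj y\<bar> \<le> k \<and> \<bar>y * cj y\<bar> < k * k"
proof -
  have kpos: "k > 0" "idl_norm c d > 0" using k s_pos idl_norm_pos[OF cd] by auto
  obtain n where n: "real n \<in> idl c d" "n > 0"
  proof -
    obtain w where w: "w \<in> idl c d" "w \<in> Zs" "w \<noteq> 0"
      using cd idl_gens(1)[of c d] idl_gens(2)[of d c] by blast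
    obtain u :: int where u: "w * cj w = of_int u" using norm_Ints[OF w(2)] by (rule Ints_cases)
    have "w * cj w \<noteq> 0" using w Zs_K by simp
    then have "u \<noteq> 0" using u by auto
    have "of_int (sgn u) * (cj w * w) \<in> idl c d"
      using w isidealD(5)[OF isideal_idl[OF cd(1,2)]] by simp
    moreover have "of_int (sgn u) * (cj w * w) = real (nat \<bar>u\<bar>)"
    proof -
      have "of_int (sgn u) * (cj w * w) = of_int (sgn u * u)" using u by (simp add: mult.commute)
      also have "sgn u * u = \<bar>u\<bar>" by (simp add: abs_sgn mult.commute)
      finally show ?thesis by simp
    qed
    ultimately show ?thesis using that[of "nat \<bar>u\<bar>"] \<open>u \<noteq> 0\<close> by simp
  qed
  obtain g m b where h: "idl c d = hnf (g, m, b)" "b \<in> roots m" "g > 0" "m > 0"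
    using ideal_hnf[OF isideal_idl[OF cd(1,2)] n] by blast
  have idx: "real (g * g * m) \<le> k"
    using zdvd_imp_le[OF hnf_index_dvd_norm[OF cd(1,2) h] kpos(2)] unfolding k(1) by linarith
  define M where "M = nat \<lfloor>k / 2\<rfloor>"
  define N where "N = nat \<lfloor>k / (2 * s)\<rfloor>"
  have M: "real M \<le> k / 2" "k / 2 < real (Suc M)" unfolding M_def using kpos by linarith+
  have "k / (2 * s) > 0" using kpos s_pos by simp
  then have N: "real N \<le> k / (2 * s)" "k / (2 * s) < real (Suc N)" unfolding N_def by linarith+
  then have Ns: "real N * s \<le> k / 2" using s_pos by (simp add: field_simps)
  \<comment> \<open>This is the hypothesis \<open>k > 4 * s\<close>, and it is the origin of the
    norm bound \<open>4 * s\<close> for cusps.\<close>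
  have "k < k / 2 * (k / (2 * s))" using kpos k s_pos by (simp add: field_simps)
  also have "\<dots> < real (Suc M) * real (Suc N)" using M N kpos s_pos by (intro mult_strict_mono) auto
  finally have big: "g * g * m < Suc M * Suc N" using idx by (metis le_less_trans of_nat_less_iff of_nat_mult)
  \<comment> \<open>The residue class of \<open>i + j * s\<close> modulo the lattice: subtract the
    multiple of \<open>g * (b + s)\<close> that reduces \<open>j\<close> modulo \<open>g\<close>,
    then reduce the rational part modulo \<open>g * m\<close>.\<close>
  define \<psi> where "\<psi> = (\<lambda>(i::nat, j::nat). ((int i - int j div int g * (int g * int b)) mod int (g * m), int j mod int g))"
  have "\<not> inj_on \<psi> ({..M} \<times> {..N})"
  proof
    assume "inj_on \<psi> ({..M} \<times> {..N})"
    then have "card ({..M} \<times> {..N}) \<le> card ({0..<int (g * m)} \<times> {0..<int g})"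
    proof (rule card_inj_on_le)
      show "\<psi> ` ({..M} \<times> {..N}) \<subseteq> {0..<int (g * m)} \<times> {0..<int g}" using h by (auto simp: \<psi>_def)
    qed simp
    then show False using big by (simp add: card_cartesian_product mult.commute mult.left_commute nat_mult_distrib)
  qed
  then obtain i j i' j' where p: "i \<le> M" "i' \<le> M" "j \<le> N" "j' \<le> N" "(i, j) \<noteq> (i', j')" "\<psi> (i, j) = \<psi> (i', j')"
    unfolding inj_on_def by auto
  define y where "y = of_int (int i - int i') + of_int (int j - int j') * s"
  have cy: "cj y = of_int (int i - int i') - of_int (int j - int j') * s" unfolding y_def by (rule cj_rep) auto
  have "y \<in> idl c d"
  proof -
    have e: "int j mod int g = int j' mod int g"
      "(int i - int j div int g * (int g * int b)) mod int (g * m) = (int i' - int j' div int g * (int g * int b)) mod int (g * m)"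
      using p(6) by (auto simp: \<psi>_def)
    let ?q = "int j div int g - int j' div int g"
    have 1: "int j - int j' = ?q * int g"
      using div_mult_mod_eq[of "int j" "int g"] div_mult_mod_eq[of "int j'" "int g"] e(1)
      unfolding left_diff_distrib by linarith
    obtain r where "(int i - int j div int g * (int g * int b)) - (int i' - int j' div int g * (int g * int b)) = int (g * m) * r"
      using e(2) by (metis mod_eq_dvd_iff dvdE)
    then have 2: "int i - int i' = r * int (g * m) + ?q * int (g * b)" by (simp add: algebra_simps)
    show ?thesis unfolding h(1) hnf_def y_def 1 2 by blast
  qed
  moreover have "y \<noteq> 0"
  proof
    assume "y = 0"
    then have "of_int (int i - int i') + of_int (int j - int j') * s = of_int 0 + of_int 0 * s" by (simp add: y_def)
    then show False using p(5) unfolding Zs_rep_eq by simp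
  qed
  moreover have bi: "\<bar>of_int (int i - int i')\<bar> \<le> k / 2"
  proof -
    have "\<bar>real_of_int (int i - int i')\<bar> \<le> real M" using p(1,2) by simp
    then show ?thesis using M(1) by linarith
  qed
  moreover have bj: "\<bar>of_int (int j - int j') * s\<bar> \<le> k / 2"
  proof -
    have "\<bar>real_of_int (int j - int j')\<bar> \<le> real N" using p(3,4) by simp
    then have "\<bar>real_of_int (int j - int j')\<bar> * s \<le> real N * s" using s_pos by (intro mult_right_mono) auto
    then have "\<bar>of_int (int j - int j') * s\<bar> \<le> real N * s" using s_pos by (simp only: abs_mult abs_of_pos)
    then show ?thesis using Ns by linarith
  qed
  \<comment> \<open>A difference of two squares, each at most a quarter of \<open>k * k\<close>.
    Strictness makes the norm drop in \<open>exists_small_norm\<close>.\<close>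
  moreover have "\<bar>y * cj y\<bar> < k * k"
  proof -
    have "y * cj y = (of_int (int i - int i'))\<^sup>2 - (of_int (int j - int j') * s)\<^sup>2"
      unfolding cy unfolding y_def by (simp add: power2_eq_square algebra_simps)
    moreover have "(of_int (int i - int i'))\<^sup>2 \<le> (k / 2)\<^sup>2" "(of_int (int j - int j') * s)\<^sup>2 \<le> (k / 2)\<^sup>2"
      using bi bj by (metis abs_le_square_iff abs_of_pos half_gt_zero kpos(1))+
    moreover have "(k / 2)\<^sup>2 < k * k" using kpos by (simp add: power2_eq_square)
    ultimately show ?thesis
      by (smt (verit) zero_le_power2)
  qed
  moreover have "\<bar>y\<bar> \<le> k" "\<bar>cj y\<bar> \<le> k" using bi bj unfolding cy unfolding y_def by linarith+
  ultimately show ?thesis by blast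
qed

text \<open>Descent on the norm: if it exceeds \<open>4 * s\<close>, multiply the pair by
  \<open>cj y / k\<close> with \<open>y\<close> from \<open>small_ideal_element\<close>. The pair
  stays integral, both conjugates of the factor have absolute value at most 1, and the norm drops.
  \<open>P\<close> will consist of bounds on \<open>J\<close> and linear conditions, which such a
  factor preserves.\<close>

lemma exists_small_norm:
  assumes P: "\<And>c d. P c d \<Longrightarrow> c \<in> Zs \<and> d \<in> Zs \<and> (c \<noteq> 0 \<or> d \<noteq> 0)"
    and cl: "\<And>c d x. P c d \<Longrightarrow> x \<in> K \<Longrightarrow> x \<noteq> 0 \<Longrightarrow> \<bar>x\<bar> \<le> 1 \<Longrightarrow> \<bar>cj x\<bar> \<le> 1 \<Longrightarrow>
      x * c \<in> Zs \<Longrightarrow> x * d \<in> Zs \<Longrightarrow> P (x * c) (x * d)"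
    and ex: "P c0 d0"
  shows "\<exists>c d. P c d \<and> real_of_int (idl_norm c d) \<le> 4 * s"
proof -
  obtain c d where min: "P c d" "\<And>c' d'. P c' d' \<Longrightarrow> nat (idl_norm c d) \<le> nat (idl_norm c' d')"
    using ex_has_least_nat[of "\<lambda>(c, d). P c d" "(c0, d0)" "\<lambda>(c, d). nat (idl_norm c d)"] ex by auto
  note cd = P[OF min(1)]
  show ?thesis
  proof (cases "real_of_int (idl_norm c d) \<le> 4 * s")
    case False
    let ?k = "real_of_int (idl_norm c d)"
    obtain y where y: "y \<in> idl c d" "y \<noteq> 0" "\<bar>y\<bar> \<le> ?k" "\<bar>cj y\<bar> \<le> ?k" "\<bar>y * cj y\<bar> < ?k * ?k"
      using small_ideal_element[of c d ?k] cd False by auto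
    have kp: "?k > 0" using False s_pos by linarith
    have yK: "y \<in> K" using isidealD(1)[OF isideal_idl] cd y Zs_K by blast
    define x where "x = cj y / ?k"
    have x: "x \<in> inv1 c d" unfolding x_def using idl_conj_quotient cd y by blast
    have xK: "x \<in> K" "x * c \<in> Zs" "x * d \<in> Zs" using x by (auto simp: inv1_def)
    have cx: "cj x = y / ?k" unfolding x_def using yK by simp
    have x0: "x \<noteq> 0" unfolding x_def using y yK kp by simp
    have b: "\<bar>x\<bar> \<le> 1" "\<bar>cj x\<bar> \<le> 1" using y kp unfolding cx by (simp_all add: x_def)
    have nx: "\<bar>x * cj x\<bar> < 1" unfolding cx unfolding x_def using y(5) kp by (simp add: abs_mult mult.commute)
    have Px: "P (x * c) (x * d)" using cl[OF min(1) xK(1) x0 b xK(2,3)] .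
    have "real_of_int (idl_norm (x * c) (x * d)) = \<bar>x * cj x\<bar> * ?k"
      using idl_norm_scale cd xK x0 by blast
    also have "\<dots> < ?k" using nx kp by simp
    finally have "idl_norm (x * c) (x * d) < idl_norm c d" by simp
    moreover have "nat (idl_norm c d) \<le> nat (idl_norm (x * c) (x * d))" using min(2)[OF Px] .
    ultimately show ?thesis using kp by linarith
  qed (use min in blast)
qed

end

section \<open>Hyperbolic area and its invariance\<close>

abbreviation UH :: "complex set" where "UH \<equiv> upper_half_plane"

lemma UH_iff: "z \<in> UH \<longleftrightarrow> Im z > 0" by (simp add: upper_half_plane_def)

lemma UH_borel [measurable]: "UH \<in> sets borel"
  unfolding upper_half_plane_def by measurable

lemma Complex_measurable [measurable]:
  assumes [measurable]: "f \<in> borel_measurable M" "g \<in> borel_measurable M"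
  shows "(\<lambda>x. Complex (f x) (g x)) \<in> borel_measurable M"
  unfolding Complex_eq by measurable

lemma lborel_complex: "(lborel :: complex measure) = distr (lborel \<Otimes>\<^sub>M lborel) borel (\<lambda>(x, y). Complex x y)"
proof (rule lborel_eqI)
  fix l u :: complex assume le: "\<And>b. b \<in> Basis \<Longrightarrow> l \<bullet> b \<le> u \<bullet> b"
  have le': "Re l \<le> Re u" "Im l \<le> Im u" using le[of 1] le[of \<i>] by (auto simp: Basis_complex_def)
  have [measurable]: "(\<lambda>(x, y). Complex x y) \<in> borel_measurable (lborel \<Otimes>\<^sub>M lborel)"
    by (simp add: case_prod_unfold)
  have "(\<lambda>(x, y). Complex x y) -` box l u \<inter> space (lborel \<Otimes>\<^sub>M lborel) = {Re l<..<Re u} \<times> {Im l<..<Im u}"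
    by (auto simp: box_def Basis_complex_def space_pair_measure)
  then have "emeasure (distr (lborel \<Otimes>\<^sub>M lborel) borel (\<lambda>(x, y). Complex x y)) (box l u)
     = emeasure (lborel \<Otimes>\<^sub>M lborel) ({Re l<..<Re u} \<times> {Im l<..<Im u})"
    by (subst emeasure_distr) auto
  also have "\<dots> = ennreal (Re u - Re l) * ennreal (Im u - Im l)"
    using le' by (subst lborel.emeasure_pair_measure_Times) auto
  also have "\<dots> = (\<Prod>b\<in>Basis. (u - l) \<bullet> b)"
    using le' by (simp add: Basis_complex_def ennreal_mult)
  finally show "emeasure (distr (lborel \<Otimes>\<^sub>M lborel) borel (\<lambda>(x, y). Complex x y)) (box l u)
    = ennreal (\<Prod>b\<in>Basis. (u - l) \<bullet> b)" .
qed simp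

lemma nn_integral_complex:
  assumes [measurable]: "f \<in> borel_measurable (borel :: complex measure)"
  shows "(\<integral>\<^sup>+z. f z \<partial>lborel) = (\<integral>\<^sup>+y. \<integral>\<^sup>+x. f (Complex x y) \<partial>lborel \<partial>lborel)"
proof -
  have [measurable]: "(\<lambda>(x, y). Complex x y) \<in> borel_measurable (lborel \<Otimes>\<^sub>M lborel)"
    by (simp add: case_prod_unfold)
  have "(\<integral>\<^sup>+z. f z \<partial>lborel) = (\<integral>\<^sup>+p. f (Complex (fst p) (snd p)) \<partial>(lborel \<Otimes>\<^sub>M lborel))"
    by (subst lborel_complex, subst nn_integral_distr) (auto simp: case_prod_unfold)
  also have "\<dots> = (\<integral>\<^sup>+y. \<integral>\<^sup>+x. f (Complex x y) \<partial>lborel \<partial>lborel)"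
    by (subst lborel_pair.nn_integral_snd[symmetric]) auto
  finally show ?thesis .
qed

text \<open>The substitution \<open>y = exp t\<close>, carried out on the compact intervals
  \<open>?A n\<close> and extended to the half-line by monotone convergence.\<close>

lemma nn_integral_exp:
  assumes [measurable]: "f \<in> borel_measurable (borel :: real measure)"
  shows "(\<integral>\<^sup>+y. f y * ennreal (1 / y) * indicator {0<..} y \<partial>lborel) = (\<integral>\<^sup>+t. f (exp t) \<partial>lborel)"
proof -
  let ?g = "\<lambda>y. f y * ennreal (1 / y)"
  let ?A = "\<lambda>n. {exp (- real (Suc n))..exp (real (Suc n))}"
  have A_mono: "?A m \<subseteq> ?A n" if "m \<le> n" for m n
    using that by (intro atLeastatMost_subset_iff[THEN iffD2] disjI2) simp
  have "indicator (?A m) x \<le> (indicator (?A n) x :: ennreal)" if "m \<le> n" for m n x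
    by (rule indicator_leI) (use A_mono[OF that] in blast)
  then have mono: "incseq (\<lambda>n x. ?g x * indicator (?A n) x)"
    unfolding incseq_def le_fun_def by (intro allI impI mult_left_mono) simp_all
  have sup: "(SUP n. ?g x * indicator {exp (- real (Suc n))..exp (real (Suc n))} x) = ?g x * indicator {0<..} x" for x
  proof (cases "x > 0")
    case True
    obtain n :: nat where n: "\<bar>ln x\<bar> \<le> real n" using real_arch_simple by blast
    have "exp (- real (Suc n)) \<le> exp (ln x)" "exp (ln x) \<le> exp (real (Suc n))" using n by (simp_all only: exp_le_cancel_iff)
    then have "x \<in> {exp (- real (Suc n))..exp (real (Suc n))}" using True by simp
    then have "?g x * indicator {exp (- real (Suc n))..exp (real (Suc n))} x = ?g x" by simp
    then show ?thesis using True
      by (intro antisym SUP_least) (auto split: split_indicator intro!: SUP_upper2[of n])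
  next
    case False
    then have "x \<notin> {exp (- real (Suc n))..exp (real (Suc n))}" for n
      by (metis atLeastAtMost_iff exp_gt_zero less_le_trans)
    then show ?thesis using False by simp
  qed
  have s: "(\<integral>\<^sup>+x. ?g x * indicator {exp (- real (Suc n))..exp (real (Suc n))} x \<partial>lborel)
      = (\<integral>\<^sup>+t. f (exp t) * indicator {- real (Suc n)..real (Suc n)} t \<partial>lborel)" for n
  proof -
    have "(\<integral>\<^sup>+x. ?g x * indicator {exp (- real (Suc n))..exp (real (Suc n))} x \<partial>lborel)
      = (\<integral>\<^sup>+t. ?g (exp t) * ennreal (exp t) * indicator {- real (Suc n)..real (Suc n)} t \<partial>lborel)"
      by (rule nn_integral_substitution_aux) (auto intro!: derivative_eq_intros continuous_intros)
    also have "\<dots> = (\<integral>\<^sup>+t. f (exp t) * indicator {- real (Suc n)..real (Suc n)} t \<partial>lborel)"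
      by (intro nn_integral_cong) (simp add: mult.assoc ennreal_mult[symmetric])
    finally show ?thesis .
  qed
  have mono2: "incseq (\<lambda>n t. f (exp t) * indicator {- real (Suc n)..real (Suc n)} t)"
    by (auto simp: incseq_def le_fun_def split: split_indicator)
  have sup2: "(SUP n. f (exp t) * indicator {- real (Suc n)..real (Suc n)} t) = f (exp t)" for t
  proof -
    obtain n :: nat where n: "\<bar>t\<bar> \<le> real n" using real_arch_simple by blast
    then have "t \<in> {- real (Suc n)..real (Suc n)}" by (simp add: abs_le_iff)
    then have "f (exp t) * indicator {- real (Suc n)..real (Suc n)} t = f (exp t)"
      by (simp only: indicator_simps mult_1_right)
    then show ?thesis
      by (intro antisym SUP_least) (auto split: split_indicator intro!: SUP_upper2[of n])
  qed
  have "(\<integral>\<^sup>+y. ?g y * indicator {0<..} y \<partial>lborel)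
      = (SUP n. \<integral>\<^sup>+x. ?g x * indicator {exp (- real (Suc n))..exp (real (Suc n))} x \<partial>lborel)"
    unfolding sup[symmetric] by (intro nn_integral_monotone_convergence_SUP mono) auto
  also have "\<dots> = (SUP n. \<integral>\<^sup>+t. f (exp t) * indicator {- real (Suc n)..real (Suc n)} t \<partial>lborel)"
    unfolding s ..
  also have "\<dots> = (\<integral>\<^sup>+t. (SUP n. f (exp t) * indicator {- real (Suc n)..real (Suc n)} t) \<partial>lborel)"
    by (intro nn_integral_monotone_convergence_SUP[symmetric] mono2) measurable
  finally show ?thesis unfolding sup2 .
qed

lemma space_hyp_area [simp]: "space hyp_area = UH"
  by (simp add: hyp_area_def)

lemma sets_hyp_area: "sets hyp_area = sets (restrict_space borel UH)"
  by (simp add: hyp_area_def sets_restrict_space)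

lemma nn_integral_hyp_area:
  assumes [measurable]: "f \<in> borel_measurable (borel :: complex measure)"
  shows "(\<integral>\<^sup>+z. f z \<partial>hyp_area) = (\<integral>\<^sup>+z. f z * ennreal (1 / (Im z)\<^sup>2) * indicator UH z \<partial>lborel)"
proof -
  have "f \<in> borel_measurable lborel" "(\<lambda>z. ennreal (1 / (Im z)\<^sup>2)) \<in> borel_measurable lborel"
    by measurable
  then have [measurable]: "f \<in> borel_measurable (restrict_space lborel UH)"
    "(\<lambda>z. ennreal (1 / (Im z)\<^sup>2)) \<in> borel_measurable (restrict_space lborel UH)"
    by (blast intro: measurable_restrict_space1)+
  have "(\<integral>\<^sup>+z. f z \<partial>hyp_area) = (\<integral>\<^sup>+z. ennreal (1 / (Im z)\<^sup>2) * f z \<partial>restrict_space lborel UH)"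
    unfolding hyp_area_def by (rule nn_integral_density) fact+
  also have "\<dots> = (\<integral>\<^sup>+z. ennreal (1 / (Im z)\<^sup>2) * f z * indicator UH z \<partial>lborel)"
    by (subst nn_integral_restrict_space) (auto simp: mult.assoc intro: UH_borel)
  finally show ?thesis by (simp add: mult_ac)
qed

text \<open>In the coordinates \<open>u = x / y\<close> and \<open>t = ln y\<close> the hyperbolic area is \<open>du dt\<close>, and both
  dilations and \<open>z \<mapsto> - 1 / z\<close> act by reflections and translations of the coordinate \<open>t\<close>.\<close>

lemma nn_integral_hyp_area_log:
  assumes [measurable]: "f \<in> borel_measurable (borel :: complex measure)"
  shows "(\<integral>\<^sup>+z. f z \<partial>hyp_area) = (\<integral>\<^sup>+u. \<integral>\<^sup>+t. f (Complex (u * exp t) (exp t)) \<partial>lborel \<partial>lborel)"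
proof -
  have "(\<integral>\<^sup>+z. f z \<partial>hyp_area) =
      (\<integral>\<^sup>+y. \<integral>\<^sup>+x. f (Complex x y) * ennreal (1 / y\<^sup>2) * indicator {0<..} y \<partial>lborel \<partial>lborel)"
    by (subst nn_integral_hyp_area, simp, subst nn_integral_complex)
      (auto simp: UH_iff intro!: nn_integral_cong split: split_indicator)
  also have "\<dots> = (\<integral>\<^sup>+y. \<integral>\<^sup>+u. f (Complex (u * y) y) * ennreal (1 / y) * indicator {0<..} y \<partial>lborel \<partial>lborel)"
  proof (rule nn_integral_cong)
    fix y :: real
    show "(\<integral>\<^sup>+x. f (Complex x y) * ennreal (1 / y\<^sup>2) * indicator {0<..} y \<partial>lborel)
      = (\<integral>\<^sup>+u. f (Complex (u * y) y) * ennreal (1 / y) * indicator {0<..} y \<partial>lborel)"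
    proof (cases "y > 0")
      case True
      have e: "ennreal y * ennreal (1 / y\<^sup>2) = ennreal (1 / y)"
        using True by (simp add: ennreal_mult[symmetric] power2_eq_square)
      have "(\<integral>\<^sup>+x. f (Complex x y) * ennreal (1 / y\<^sup>2) * indicator {0<..} y \<partial>lborel)
         = ennreal \<bar>y\<bar> * (\<integral>\<^sup>+u. f (Complex (0 + y * u) y) * ennreal (1 / y\<^sup>2) * indicator {0<..} y \<partial>lborel)"
        by (rule nn_integral_real_affine) (use True in auto)
      also have "\<dots> = (\<integral>\<^sup>+u. ennreal y * (f (Complex (y * u) y) * ennreal (1 / y\<^sup>2)) \<partial>lborel)"
        using True by (subst nn_integral_cmult) auto
      also have "\<dots> = (\<integral>\<^sup>+u. f (Complex (u * y) y) * ennreal (1 / y) * indicator {0<..} y \<partial>lborel)"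
        using True by (intro nn_integral_cong) (simp add: e[symmetric] mult_ac)
      finally show ?thesis .
    qed simp
  qed
  also have "\<dots> = (\<integral>\<^sup>+u. \<integral>\<^sup>+y. f (Complex (u * y) y) * ennreal (1 / y) * indicator {0<..} y \<partial>lborel \<partial>lborel)"
    by (rule lborel_pair.Fubini') measurable
  also have "\<dots> = (\<integral>\<^sup>+u. \<integral>\<^sup>+t. f (Complex (u * exp t) (exp t)) \<partial>lborel \<partial>lborel)"
    by (intro nn_integral_cong nn_integral_exp[of "\<lambda>y. f (Complex (_ * y) y)"]) measurable
  finally show ?thesis .
qed

definition area_preserving :: "(complex \<Rightarrow> complex) \<Rightarrow> bool" where
  "area_preserving T \<longleftrightarrow> T \<in> measurable hyp_area hyp_area \<and> distr hyp_area hyp_area T = hyp_area"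

lemma area_preserving_comp:
  assumes "area_preserving S" "area_preserving T" shows "area_preserving (S \<circ> T)"
  using assms distr_distr[of S hyp_area hyp_area T hyp_area]
  unfolding area_preserving_def by (auto intro: measurable_comp)

lemma area_preserving_cong:
  assumes "area_preserving S" "\<And>z. z \<in> UH \<Longrightarrow> S z = T z" shows "area_preserving T"
  using assms measurable_cong[of hyp_area S T hyp_area] distr_cong[of hyp_area hyp_area hyp_area hyp_area S T]
  unfolding area_preserving_def by simp

lemma area_preservingI:
  assumes T: "T \<in> borel_measurable borel" "\<And>z. z \<in> UH \<Longrightarrow> T z \<in> UH"
    and i: "\<And>f :: complex \<Rightarrow> ennreal. f \<in> borel_measurable borel \<Longrightarrow> (\<integral>\<^sup>+z. f (T z) \<partial>hyp_area) = (\<integral>\<^sup>+z. f z \<partial>hyp_area)"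
  shows "area_preserving T"
  unfolding area_preserving_def
proof
  have "T \<in> measurable (restrict_space borel UH) (restrict_space borel UH)"
    using T by (intro measurable_restrict_space3) auto
  then show m: "T \<in> measurable hyp_area hyp_area"
    by (simp add: measurable_cong_sets[OF sets_hyp_area sets_hyp_area])
  show "distr hyp_area hyp_area T = hyp_area"
  proof (rule measure_eqI)
    fix A assume "A \<in> sets (distr hyp_area hyp_area T)"
    then have A: "A \<in> sets hyp_area" by simp
    then have Ab: "A \<in> sets borel" using UH_borel by (auto simp: sets_hyp_area sets_restrict_space)
    have "emeasure (distr hyp_area hyp_area T) A = (\<integral>\<^sup>+z. indicator A z \<partial>distr hyp_area hyp_area T)"
      using A by (subst nn_integral_indicator) auto
    also have "\<dots> = (\<integral>\<^sup>+z. indicator A (T z) \<partial>hyp_area)"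
      using m A by (subst nn_integral_distr) auto
    also have "\<dots> = (\<integral>\<^sup>+z. indicator A z \<partial>hyp_area)" using Ab by (intro i) auto
    also have "\<dots> = emeasure hyp_area A" using A by simp
    finally show "emeasure (distr hyp_area hyp_area T) A = emeasure hyp_area A" .
  qed simp
qed

lemma area_preserving_translation: "area_preserving (\<lambda>z. of_real b + z)"
proof (rule area_preservingI)
  fix f :: "complex \<Rightarrow> ennreal" assume [measurable]: "f \<in> borel_measurable borel"
  let ?g = "\<lambda>z. f z * ennreal (1 / (Im z)\<^sup>2) * indicator UH z"
  have "(\<integral>\<^sup>+z. f z \<partial>hyp_area) = (\<integral>\<^sup>+z. ?g z \<partial>lborel)" by (rule nn_integral_hyp_area) simp
  also have "\<dots> = (\<integral>\<^sup>+z. ?g z \<partial>distr lborel borel ((+) (of_real b)))"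
    by (simp add: lborel_distr_plus)
  also have "\<dots> = (\<integral>\<^sup>+z. ?g (of_real b + z) \<partial>lborel)" by (subst nn_integral_distr) auto
  also have "\<dots> = (\<integral>\<^sup>+z. f (of_real b + z) \<partial>hyp_area)"
    by (subst nn_integral_hyp_area) (auto simp: UH_iff intro!: nn_integral_cong split: split_indicator)
  finally show "(\<integral>\<^sup>+z. f (of_real b + z) \<partial>hyp_area) = (\<integral>\<^sup>+z. f z \<partial>hyp_area)" by simp
qed (auto simp: UH_iff)

lemma area_preserving_dilation: assumes k: "k > 0" shows "area_preserving (\<lambda>z. of_real k * z)"
proof (rule area_preservingI)
  fix f :: "complex \<Rightarrow> ennreal" assume [measurable]: "f \<in> borel_measurable borel"
  have "(\<integral>\<^sup>+z. f (of_real k * z) \<partial>hyp_area)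
      = (\<integral>\<^sup>+u. \<integral>\<^sup>+t. f (of_real k * Complex (u * exp t) (exp t)) \<partial>lborel \<partial>lborel)"
    by (rule nn_integral_hyp_area_log) measurable
  also have "\<dots> = (\<integral>\<^sup>+u. \<integral>\<^sup>+t. f (Complex (u * exp (ln k + 1 * t)) (exp (ln k + 1 * t))) \<partial>lborel \<partial>lborel)"
    using k by (intro nn_integral_cong arg_cong[of _ _ f]) (simp add: complex_eq_iff exp_add)
  also have "\<dots> = (\<integral>\<^sup>+u. \<integral>\<^sup>+t. f (Complex (u * exp t) (exp t)) \<partial>lborel \<partial>lborel)"
    by (subst (2) nn_integral_real_affine[where t = "ln k" and c = 1]) auto
  also have "\<dots> = (\<integral>\<^sup>+z. f z \<partial>hyp_area)" by (rule nn_integral_hyp_area_log[symmetric]) simp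
  finally show "(\<integral>\<^sup>+z. f (of_real k * z) \<partial>hyp_area) = (\<integral>\<^sup>+z. f z \<partial>hyp_area)" .
qed (use k in \<open>auto simp: UH_iff\<close>)

lemma area_preserving_inversion: "area_preserving (\<lambda>z. - 1 / z)"
proof (rule area_preservingI)
  fix f :: "complex \<Rightarrow> ennreal" assume [measurable]: "f \<in> borel_measurable borel"
  \<comment> \<open>In the coordinates \<open>(u, t)\<close> the inversion is
    \<open>(- u, - ln (1 + u\<^sup>2) - t)\<close>: for fixed \<open>u\<close> a reflection in
    \<open>t\<close>, combined with a change of sign of \<open>u\<close>.\<close>
  have e: "- 1 / Complex (u * exp t) (exp t) =
      Complex ((- u) * exp (- ln (1 + u\<^sup>2) - t)) (exp (- ln (1 + u\<^sup>2) - t))" for u t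
  proof -
    have p: "1 + u\<^sup>2 > 0" by (metis add_pos_nonneg zero_le_power2 zero_less_one)
    have x: "exp (- ln (1 + u\<^sup>2) - t) = 1 / ((1 + u\<^sup>2) * exp t)"
      using p by (simp add: exp_diff exp_minus field_simps)
    have q: "(u * exp t)\<^sup>2 + (exp t)\<^sup>2 = (1 + u\<^sup>2) * exp t * exp t" by (simp add: power2_eq_square algebra_simps)
    have ri: "Re (- 1 / Complex a b) = - a / (a\<^sup>2 + b\<^sup>2)" "Im (- 1 / Complex a b) = b / (a\<^sup>2 + b\<^sup>2)" for a b
      by (simp_all add: Re_divide Im_divide)
    have "- (u * exp t) / ((1 + u\<^sup>2) * exp t * exp t) = - u * (1 / ((1 + u\<^sup>2) * exp t))"
      "exp t / ((1 + u\<^sup>2) * exp t * exp t) = 1 / ((1 + u\<^sup>2) * exp t)"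
      by simp_all
    then show ?thesis unfolding x complex_eq_iff ri q by simp
  qed
  have "(\<integral>\<^sup>+z. f (- 1 / z) \<partial>hyp_area)
      = (\<integral>\<^sup>+u. \<integral>\<^sup>+t. f (- 1 / Complex (u * exp t) (exp t)) \<partial>lborel \<partial>lborel)"
    by (rule nn_integral_hyp_area_log) measurable
  also have "\<dots> = (\<integral>\<^sup>+u. \<integral>\<^sup>+t. f (Complex ((- u) * exp (- ln (1 + u\<^sup>2) + (- 1) * t)) (exp (- ln (1 + u\<^sup>2) + (- 1) * t))) \<partial>lborel \<partial>lborel)"
    unfolding e by simp
  also have "\<dots> = (\<integral>\<^sup>+u. \<integral>\<^sup>+t. f (Complex ((- u) * exp t) (exp t)) \<partial>lborel \<partial>lborel)"
  proof (rule nn_integral_cong)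
    fix u
    show "(\<integral>\<^sup>+t. f (Complex ((- u) * exp (- ln (1 + u\<^sup>2) + (- 1) * t)) (exp (- ln (1 + u\<^sup>2) + (- 1) * t))) \<partial>lborel)
       = (\<integral>\<^sup>+t. f (Complex ((- u) * exp t) (exp t)) \<partial>lborel)"
      by (subst (2) nn_integral_real_affine[where t = "- ln (1 + u\<^sup>2)" and c = "-1"]) auto
  qed
  also have "\<dots> = (\<integral>\<^sup>+u. \<integral>\<^sup>+t. f (Complex ((0 + (- 1) * u) * exp t) (exp t)) \<partial>lborel \<partial>lborel)" by simp
  also have "\<dots> = (\<integral>\<^sup>+u. \<integral>\<^sup>+t. f (Complex (u * exp t) (exp t)) \<partial>lborel \<partial>lborel)"
    by (subst (3) nn_integral_real_affine[where t = 0 and c = "-1"]) auto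
  also have "\<dots> = (\<integral>\<^sup>+z. f z \<partial>hyp_area)" by (rule nn_integral_hyp_area_log[symmetric]) simp
  finally show "(\<integral>\<^sup>+z. f (- 1 / z) \<partial>hyp_area) = (\<integral>\<^sup>+z. f z \<partial>hyp_area)" .
qed (auto simp: UH_iff Im_divide power2_eq_square intro!: divide_pos_pos add_nonneg_pos)

lemma emeasure_hyp_area_borel:
  assumes A: "A \<in> sets borel" "A \<subseteq> UH"
  shows "A \<in> sets hyp_area" "emeasure hyp_area A = (\<integral>\<^sup>+y. \<integral>\<^sup>+x. indicator A (Complex x y) * ennreal (1 / y\<^sup>2) \<partial>lborel \<partial>lborel)"
proof -
  show m: "A \<in> sets hyp_area" using A UH_borel by (auto simp: sets_hyp_area sets_restrict_space_iff)
  have [measurable]: "A \<in> sets borel" by fact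
  have "emeasure hyp_area A = (\<integral>\<^sup>+z. indicator A z \<partial>hyp_area)" using m by simp
  also have "\<dots> = (\<integral>\<^sup>+z. indicator A z * ennreal (1 / (Im z)\<^sup>2) * indicator UH z \<partial>lborel)"
    by (rule nn_integral_hyp_area) measurable
  also have "\<dots> = (\<integral>\<^sup>+z. indicator A z * ennreal (1 / (Im z)\<^sup>2) \<partial>lborel)"
    using A(2) by (intro nn_integral_cong) (auto split: split_indicator)
  also have "\<dots> = (\<integral>\<^sup>+y. \<integral>\<^sup>+x. indicator A (Complex x y) * ennreal (1 / (Im (Complex x y))\<^sup>2) \<partial>lborel \<partial>lborel)"
    by (rule nn_integral_complex) measurable
  also have "\<dots> = (\<integral>\<^sup>+y. \<integral>\<^sup>+x. indicator A (Complex x y) * ennreal (1 / y\<^sup>2) \<partial>lborel \<partial>lborel)"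
    by simp
  finally show "emeasure hyp_area A = \<dots>" .
qed

lemma emeasure_Re_interval_Im_set:
  assumes ab: "a \<le> b" and Y: "Y \<in> sets borel" "Y \<subseteq> {0<..}"
  defines "A \<equiv> {z. a \<le> Re z \<and> Re z \<le> b \<and> Im z \<in> Y}"
  shows "A \<in> sets hyp_area"
    "emeasure hyp_area A = ennreal (b - a) * (\<integral>\<^sup>+y. ennreal (1 / y\<^sup>2) * indicator Y y \<partial>lborel)"
proof -
  have [measurable]: "Y \<in> sets borel" by fact
  have A: "A \<in> sets borel" "A \<subseteq> UH" unfolding A_def using Y(2) by (measurable, auto simp: UH_iff)
  show "A \<in> sets hyp_area" by (rule emeasure_hyp_area_borel(1)[OF A])
  have "emeasure hyp_area A = (\<integral>\<^sup>+y. \<integral>\<^sup>+x. (ennreal (1 / y\<^sup>2) * indicator Y y) * indicator {a..b} x \<partial>lborel \<partial>lborel)"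
    unfolding emeasure_hyp_area_borel(2)[OF A]
    by (intro nn_integral_cong) (auto simp: A_def split: split_indicator)
  also have "\<dots> = (\<integral>\<^sup>+y. (ennreal (1 / y\<^sup>2) * indicator Y y) * ennreal (b - a) \<partial>lborel)"
    using ab by (simp add: nn_integral_cmult_indicator)
  also have "\<dots> = (\<integral>\<^sup>+y. ennreal (1 / y\<^sup>2) * indicator Y y \<partial>lborel) * ennreal (b - a)"
    by (rule nn_integral_multc) measurable
  finally show "emeasure hyp_area A = ennreal (b - a) * (\<integral>\<^sup>+y. ennreal (1 / y\<^sup>2) * indicator Y y \<partial>lborel)"
    by (simp add: mult.commute)
qed

definition strip :: "real \<Rightarrow> real \<Rightarrow> real \<Rightarrow> complex set" where
  "strip a b h = {z. a \<le> Re z \<and> Re z \<le> b \<and> Im z \<in> {h..}}"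

lemma strip_area:
  assumes "a \<le> b" "h > 0"
  shows "strip a b h \<in> sets hyp_area" "emeasure hyp_area (strip a b h) = ennreal ((b - a) / h)"
proof -
  have Y: "{h..} \<in> sets borel" "{h..} \<subseteq> {0<..}" using assms by auto
  show "strip a b h \<in> sets hyp_area" unfolding strip_def by (rule emeasure_Re_interval_Im_set(1)[OF assms(1) Y])
  have lim: "((\<lambda>y::real. - (1 / y)) \<longlongrightarrow> 0) at_top"
    using tendsto_minus[OF tendsto_inverse_0_at_top[OF filterlim_ident]] by (simp add: divide_inverse)
  have "(\<integral>\<^sup>+y. ennreal (1 / y\<^sup>2) * indicator {h..} y \<partial>lborel) = ennreal (0 - (- (1 / h)))"
    by (rule nn_integral_FTC_atLeast[OF _ _ _ lim])
      (use assms in \<open>auto intro!: derivative_eq_intros simp: power2_eq_square\<close>)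
  then show "emeasure hyp_area (strip a b h) = ennreal ((b - a) / h)"
    unfolding strip_def using emeasure_Re_interval_Im_set(2)[OF assms(1) Y] assms by (simp add: ennreal_mult[symmetric])
qed

lemma rect_area:
  assumes "a \<le> b" "0 < h" "h \<le> k"
  shows "{z. a \<le> Re z \<and> Re z \<le> b \<and> Im z \<in> {h..k}} \<in> sets hyp_area"
    "emeasure hyp_area {z. a \<le> Re z \<and> Re z \<le> b \<and> Im z \<in> {h..k}} = ennreal ((b - a) * (1 / h - 1 / k))"
proof -
  have Y: "{h..k} \<in> sets borel" "{h..k} \<subseteq> {0<..}" using assms by auto
  show "{z. a \<le> Re z \<and> Re z \<le> b \<and> Im z \<in> {h..k}} \<in> sets hyp_area" by (rule emeasure_Re_interval_Im_set(1)[OF assms(1) Y])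
  have "(\<integral>\<^sup>+y. ennreal (1 / y\<^sup>2) * indicator {h..k} y \<partial>lborel) = ennreal (- (1 / k) - (- (1 / h)))"
    by (rule nn_integral_FTC_Icc)
      (use assms in \<open>auto intro!: derivative_eq_intros simp: power2_eq_square\<close>)
  then show "emeasure hyp_area {z. a \<le> Re z \<and> Re z \<le> b \<and> Im z \<in> {h..k}} = ennreal ((b - a) * (1 / h - 1 / k))"
    using emeasure_Re_interval_Im_set(2)[OF assms(1) Y] assms by (simp add: ennreal_mult[symmetric] field_simps)
qed

lemma sigma_finite_hyp_area: "sigma_finite_measure hyp_area"
proof
  show "\<exists>A. countable A \<and> A \<subseteq> sets hyp_area \<and> \<Union> A = space hyp_area \<and> (\<forall>a\<in>A. emeasure hyp_area a \<noteq> \<infinity>)"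
  proof (intro exI[of _ "range (\<lambda>n. strip (- real n) (real n) (1 / real (Suc n)))"] conjI ballI)
    show "range (\<lambda>n. strip (- real n) (real n) (1 / real (Suc n))) \<subseteq> sets hyp_area"
      using strip_area(1) by auto
    show "\<Union> (range (\<lambda>n. strip (- real n) (real n) (1 / real (Suc n)))) = space hyp_area"
    proof (intro equalityI subsetI)
      fix z assume "z \<in> space hyp_area"
      then have z: "Im z > 0" by (simp add: UH_iff)
      obtain n :: nat where n: "max \<bar>Re z\<bar> (1 / Im z) \<le> real n" using real_arch_simple by blast
      have "1 / real (Suc n) \<le> Im z"
      proof -
        have "1 / Im z \<le> real (Suc n)" using n by simp
        then show ?thesis using z by (simp add: field_simps)
      qed
      then have "z \<in> strip (- real n) (real n) (1 / real (Suc n))" using n by (auto simp: strip_def)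
      then show "z \<in> \<Union> (range (\<lambda>n. strip (- real n) (real n) (1 / real (Suc n))))" by blast
    next
      fix z assume "z \<in> \<Union> (range (\<lambda>n. strip (- real n) (real n) (1 / real (Suc n))))"
      then obtain n where n: "1 / real (Suc n) \<le> Im z" by (auto simp: strip_def)
      have "0 < 1 / real (Suc n)" by simp
      then show "z \<in> space hyp_area" using n unfolding space_hyp_area UH_iff by linarith
    qed
    fix a assume "a \<in> range (\<lambda>n. strip (- real n) (real n) (1 / real (Suc n)))"
    then show "emeasure hyp_area a \<noteq> \<infinity>" using strip_area(2) by auto
  qed simp
qed

interpretation hyp: sigma_finite_measure hyp_area by (rule sigma_finite_hyp_area)

lemma space_HH_vol [simp]: "space HH_vol = HH" by (simp add: HH_vol_def HH_def space_pair_measure)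

lemma emeasure_HH_vol_Times:
  assumes "A \<in> sets hyp_area" "B \<in> sets hyp_area"
  shows "A \<times> B \<in> sets HH_vol" "emeasure HH_vol (A \<times> B) = emeasure hyp_area A * emeasure hyp_area B"
  using assms unfolding HH_vol_def by (auto simp: hyp.emeasure_pair_measure_Times)

lemma area_preserving_vimage:
  assumes "area_preserving T" "A \<in> sets hyp_area"
  shows "T -` A \<inter> UH \<in> sets hyp_area" "emeasure hyp_area (T -` A \<inter> UH) = emeasure hyp_area A"
  using assms emeasure_distr[of T hyp_area hyp_area A] measurable_sets[of T hyp_area hyp_area A]
  unfolding area_preserving_def by auto

lemma HH_vol_preserving:
  assumes "area_preserving S" "area_preserving T"
  shows "(\<lambda>x. (S (fst x), T (snd x))) \<in> measurable HH_vol HH_vol"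
    "A \<in> sets HH_vol \<Longrightarrow> emeasure HH_vol ((\<lambda>x. (S (fst x), T (snd x))) -` A \<inter> HH) = emeasure HH_vol A"
proof -
  have [measurable]: "S \<in> measurable hyp_area hyp_area" "T \<in> measurable hyp_area hyp_area"
    and d: "distr hyp_area hyp_area S = hyp_area" "distr hyp_area hyp_area T = hyp_area"
    using assms by (auto simp: area_preserving_def)
  show m: "(\<lambda>x. (S (fst x), T (snd x))) \<in> measurable HH_vol HH_vol"
    unfolding HH_vol_def by measurable
  have "distr HH_vol HH_vol (\<lambda>x. (S (fst x), T (snd x))) = HH_vol"
    using pair_measure_distr[of S hyp_area hyp_area T hyp_area hyp_area] d sigma_finite_hyp_area
    by (simp add: HH_vol_def case_prod_unfold)
  then show "A \<in> sets HH_vol \<Longrightarrow> emeasure HH_vol ((\<lambda>x. (S (fst x), T (snd x))) -` A \<inter> HH) = emeasure HH_vol A"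
    using emeasure_distr[OF m, of A] by simp
qed

section \<open>Comparison of volumes under group actions\<close>

text \<open>Cut \<open>U\<close> into countably many pieces, each carried into \<open>S\<close> by
  one group element. The images are disjoint because \<open>U\<close> has at most one point on each
  orbit. This serves for the Hilbert modular group and, in \<open>minkowski_linear_forms\<close>,
  for a lattice of translations.\<close>

lemma emeasure_le_cover:
  fixes act :: "'g \<Rightarrow> 'x \<Rightarrow> 'x"
  assumes cnt: "countable \<Gamma>"
    and meas: "\<And>g. g \<in> \<Gamma> \<Longrightarrow> act g \<in> measurable \<mu> \<mu>"
    and pres: "\<And>g A. g \<in> \<Gamma> \<Longrightarrow> A \<in> sets \<mu> \<Longrightarrow> emeasure \<mu> (act g -` A \<inter> space \<mu>) = emeasure \<mu> A"
    and inv: "\<And>g. g \<in> \<Gamma> \<Longrightarrow> \<exists>h\<in>\<Gamma>. \<forall>x\<in>space \<mu>. act h (act g x) = x \<and> act g (act h x) = x"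
    and U: "U \<in> sets \<mu>"
    and inj: "\<And>g h u v. g \<in> \<Gamma> \<Longrightarrow> h \<in> \<Gamma> \<Longrightarrow> u \<in> U \<Longrightarrow> v \<in> U \<Longrightarrow> act g u = act h v \<Longrightarrow> u = v"
    and S: "S \<in> sets \<mu>" and cov: "\<And>u. u \<in> U \<Longrightarrow> \<exists>g\<in>\<Gamma>. act g u \<in> S"
  shows "emeasure \<mu> U \<le> emeasure \<mu> S"
proof (cases "\<Gamma> = {}")
  case True
  then have "U = {}" using cov by auto
  then show ?thesis by simp
next
  case False
  have im: "act g ` A \<in> sets \<mu> \<and> emeasure \<mu> (act g ` A) = emeasure \<mu> A" if gA: "g \<in> \<Gamma>" "A \<in> sets \<mu>" for g A
  proof -
    obtain h where h: "h \<in> \<Gamma>" "\<And>x. x \<in> space \<mu> \<Longrightarrow> act h (act g x) = x \<and> act g (act h x) = x" using inv[OF gA(1)] by blast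
    have Asp: "A \<subseteq> space \<mu>" using gA sets.sets_into_space by blast
    have gsp: "act g x \<in> space \<mu>" if "x \<in> space \<mu>" for x using measurable_space[OF meas[OF gA(1)] that] .
    have "act g ` A = act h -` A \<inter> space \<mu>"
    proof (intro equalityI subsetI)
      fix y assume "y \<in> act g ` A" then show "y \<in> act h -` A \<inter> space \<mu>" using Asp h(2) gsp by auto
    next
      fix y assume "y \<in> act h -` A \<inter> space \<mu>"
      then show "y \<in> act g ` A" using h(2)[of y] by (intro image_eqI[of _ _ "act h y"]) auto
    qed
    then show ?thesis using pres[OF h(1) gA(2)] measurable_sets[OF meas[OF h(1)] gA(2)] by simp
  qed
  define e where "e = from_nat_into \<Gamma>"
  have e: "e n \<in> \<Gamma>" for n unfolding e_def using False by (rule from_nat_into)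
  define E where "E n = U \<inter> (act (e n) -` S \<inter> space \<mu>)" for n
  have Em: "E n \<in> sets \<mu>" for n unfolding E_def using U measurable_sets[OF meas[OF e] S] by auto
  define D where "D = disjointed E"
  have Dm: "D n \<in> sets \<mu>" for n
    unfolding D_def using sets.range_disjointed_sets[of E \<mu>] Em by blast
  have DE: "D n \<subseteq> E n" for n unfolding D_def by (rule disjointed_subset)
  have Ddis: "disjoint_family D" unfolding D_def by (rule disjoint_family_disjointed)
  have "U = (\<Union>n. E n)"
  proof (intro equalityI subsetI)
    fix u assume u: "u \<in> U"
    obtain g where g: "g \<in> \<Gamma>" "act g u \<in> S" using cov[OF u] by blast
    obtain n where "e n = g" unfolding e_def using cnt g(1) by (metis from_nat_into_surj)
    then show "u \<in> (\<Union>n. E n)" using u g sets.sets_into_space[OF U] by (auto simp: E_def)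
  qed (auto simp: E_def)
  then have UD: "U = (\<Union>n. D n)" unfolding D_def UN_disjointed_eq by simp
  have Vdis: "disjoint_family (\<lambda>n. act (e n) ` D n)"
    unfolding disjoint_family_on_def
  proof (intro ballI impI)
    fix m n :: nat assume mn: "m \<noteq> n"
    show "act (e m) ` D m \<inter> act (e n) ` D n = {}"
    proof (rule ccontr)
      assume "act (e m) ` D m \<inter> act (e n) ` D n \<noteq> {}"
      then obtain u v where uv: "u \<in> D m" "v \<in> D n" "act (e m) u = act (e n) v" by blast
      then have "u = v" using inj[OF e e _ _ uv(3)] UD by blast
      then show False using uv mn Ddis by (auto simp: disjoint_family_on_def)
    qed
  qed
  have "emeasure \<mu> U = (\<Sum>n. emeasure \<mu> (D n))"
    unfolding UD using Dm Ddis by (intro suminf_emeasure[symmetric]) auto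
  also have "\<dots> = (\<Sum>n. emeasure \<mu> (act (e n) ` D n))" using im[OF e Dm] by simp
  also have "\<dots> = emeasure \<mu> (\<Union>n. act (e n) ` D n)"
    using im[OF e Dm] Vdis by (intro suminf_emeasure) auto
  also have "\<dots> \<le> emeasure \<mu> S"
  proof (rule emeasure_mono[OF _ S])
    show "(\<Union>n. act (e n) ` D n) \<subseteq> S" using DE by (fastforce simp: E_def)
  qed
  finally show ?thesis .
qed

lemma emeasure_le_sum_cover:
  fixes act :: "'g \<Rightarrow> 'x \<Rightarrow> 'x"
  assumes cnt: "countable \<Gamma>"
    and meas: "\<And>g. g \<in> \<Gamma> \<Longrightarrow> act g \<in> measurable \<mu> \<mu>"
    and pres: "\<And>g A. g \<in> \<Gamma> \<Longrightarrow> A \<in> sets \<mu> \<Longrightarrow> emeasure \<mu> (act g -` A \<inter> space \<mu>) = emeasure \<mu> A"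
    and inv: "\<And>g. g \<in> \<Gamma> \<Longrightarrow> \<exists>h\<in>\<Gamma>. \<forall>x\<in>space \<mu>. act h (act g x) = x \<and> act g (act h x) = x"
    and U: "U \<in> sets \<mu>"
    and inj: "\<And>g h u v. g \<in> \<Gamma> \<Longrightarrow> h \<in> \<Gamma> \<Longrightarrow> u \<in> U \<Longrightarrow> v \<in> U \<Longrightarrow> act g u = act h v \<Longrightarrow> u = v"
    and I: "finite I" and S: "\<And>i. i \<in> I \<Longrightarrow> S i \<in> sets \<mu>"
    and cov: "\<And>u. u \<in> U \<Longrightarrow> \<exists>i\<in>I. \<exists>g\<in>\<Gamma>. act g u \<in> S i"
  shows "emeasure \<mu> U \<le> (\<Sum>i\<in>I. emeasure \<mu> (S i))"
proof -
  define V where "V i = (\<Union>g\<in>\<Gamma>. U \<inter> (act g -` S i \<inter> space \<mu>))" for i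
  have Vm: "V i \<in> sets \<mu>" if "i \<in> I" for i
    unfolding V_def using U measurable_sets[OF meas S[OF that]] cnt by (intro sets.countable_UN') auto
  have "U \<subseteq> (\<Union>i\<in>I. V i)" using cov sets.sets_into_space[OF U] unfolding V_def by fast
  then have "emeasure \<mu> U \<le> emeasure \<mu> (\<Union>i\<in>I. V i)" using Vm I by (intro emeasure_mono) auto
  also have "\<dots> \<le> (\<Sum>i\<in>I. emeasure \<mu> (V i))" using Vm I by (intro emeasure_subadditive_finite) auto
  also have "\<dots> \<le> (\<Sum>i\<in>I. emeasure \<mu> (S i))"
  proof (rule sum_mono)
    fix i assume i: "i \<in> I"
    show "emeasure \<mu> (V i) \<le> emeasure \<mu> (S i)"
    proof (rule emeasure_le_cover[OF cnt meas pres inv Vm[OF i] _ S[OF i]])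
      fix g h u v assume "g \<in> \<Gamma>" "h \<in> \<Gamma>" "u \<in> V i" "v \<in> V i" "act g u = act h v"
      then show "u = v" using inj[of g h u v] unfolding V_def by blast
    qed (auto simp: V_def)
  qed
  finally show ?thesis .
qed

subsection \<open>Moebius transformations\<close>

definition mob :: "real \<Rightarrow> real \<Rightarrow> real \<Rightarrow> real \<Rightarrow> complex \<Rightarrow> complex" where
  "mob a b c d z = (of_real a * z + of_real b) / (of_real c * z + of_real d)"

lemma moebius_mob: "moebius A z = mob (A$1$1) (A$1$2) (A$2$1) (A$2$2) z"
  by (simp add: moebius_def mob_def)

lemma denom_nonzero:
  assumes "Im z > 0" "c \<noteq> 0 \<or> d \<noteq> 0" shows "of_real c * z + of_real d \<noteq> 0"
proof
  assume "of_real c * z + of_real d = 0"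
  then have "Im (of_real c * z + of_real d) = 0" "Re (of_real c * z + of_real d) = 0" by simp_all
  then show False using assms by auto
qed

lemma Im_mob:
  assumes "a * d - b * c = 1" "Im z > 0"
  shows "Im (mob a b c d z) = Im z / (cmod (of_real c * z + of_real d))\<^sup>2"
proof -
  have "Im (mob a b c d z) = (a * d - b * c) * Im z / (cmod (of_real c * z + of_real d))\<^sup>2"
    unfolding mob_def Im_complex_div_eq_0 cmod_power2 Im_divide
    by (simp add: algebra_simps)
  then show ?thesis using assms by simp
qed

lemma mob_UH:
  assumes "a * d - b * c = 1" "z \<in> UH" shows "mob a b c d z \<in> UH"
proof -
  have "of_real c * z + of_real d \<noteq> 0" using assms by (intro denom_nonzero) (auto simp: UH_iff)
  then show ?thesis using assms by (simp add: UH_iff Im_mob)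
qed

lemma mob_comp:
  assumes "a' * d' - b' * c' = 1" "a * d - b * c = 1" "Im z > 0"
  shows "mob a b c d (mob a' b' c' d' z) =
    mob (a * a' + b * c') (a * b' + b * d') (c * a' + d * c') (c * b' + d * d') z"
proof -
  let ?D = "of_real c' * z + of_real d' :: complex"
  have D: "?D \<noteq> 0" using assms by (intro denom_nonzero) auto
  show ?thesis unfolding mob_def using D by (simp add: divide_simps) (simp add: algebra_simps)
qed

lemma mob_id: "mob 1 0 0 1 z = z" by (simp add: mob_def)

lemma area_preserving_mob:
  assumes det: "a * d - b * c = 1" shows "area_preserving (mob a b c d)"
proof (cases "c = 0")
  case True
  then have ad: "a * d = 1" using det by simp
  then have nz: "a \<noteq> 0" "d \<noteq> 0" by auto
  have "area_preserving ((\<lambda>z. of_real (b / d) + z) \<circ> (\<lambda>z. of_real (a / d) * z))"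
  proof (intro area_preserving_comp area_preserving_translation area_preserving_dilation)
    have "a / d = a * a" using ad nz by (simp add: field_simps)
    then show "0 < a / d" using nz by (metis not_real_square_gt_zero)
  qed
  then show ?thesis
    by (rule area_preserving_cong) (use True nz in \<open>simp add: mob_def add_divide_distrib\<close>)
next
  case False
  have "area_preserving ((\<lambda>z. of_real (a / c) + z) \<circ> ((\<lambda>z. of_real (1 / c\<^sup>2) * z) \<circ> ((\<lambda>z. - 1 / z) \<circ> (\<lambda>z. of_real (d / c) + z))))"
    using False by (intro area_preserving_comp area_preserving_translation area_preserving_dilation area_preserving_inversion) auto
  then show ?thesis
  proof (rule area_preserving_cong)
    fix z assume "z \<in> UH"
    then have n1: "of_real c * z + of_real d \<noteq> 0" using False by (intro denom_nonzero) (auto simp: UH_iff)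
    have e: "of_real (d / c) + z = (of_real c * z + of_real d) / of_real c" using False by (simp add: field_simps)
    have "of_real (a / c) + of_real (1 / c\<^sup>2) * (- 1 / ((of_real c * z + of_real d) / of_real c))
       = (of_real a * (of_real c * z + of_real d) - 1) / (of_real c * (of_real c * z + of_real d))"
      using False n1 by (simp add: divide_simps power2_eq_square)
    also have "of_real a * (of_real c * z + of_real d) - 1 = of_real c * (of_real a * z + of_real b)"
    proof -
      have "a * d = 1 + b * c" using det by simp
      then have "complex_of_real (a * d) = of_real (1 + b * c)" by (rule arg_cong)
      then have "complex_of_real a * of_real d = 1 + of_real b * of_real c" by simp
      then show ?thesis by (simp add: distrib_left mult.left_commute mult.commute)
    qed
    also have "of_real c * (of_real a * z + of_real b) / (of_real c * (of_real c * z + of_real d)) = mob a b c d z"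
      unfolding mob_def by (rule nonzero_mult_divide_mult_cancel_left) (use False in simp)
    finally show "((\<lambda>z. of_real (a / c) + z) \<circ> ((\<lambda>z. of_real (1 / c\<^sup>2) * z) \<circ> ((\<lambda>z. - 1 / z) \<circ> (\<lambda>z. of_real (d / c) + z)))) z = mob a b c d z"
      by (simp only: o_def e)
  qed
qed

text \<open>The reciprocal of the height of \<open>z\<close> as seen from the cusp
  \<open>- d / c\<close> (see \<open>Im_mob_J\<close>). For fixed \<open>z\<close> in the upper
  half-plane it is a positive definite quadratic form in \<open>(c, d)\<close>.\<close>

definition J :: "real \<Rightarrow> real \<Rightarrow> complex \<Rightarrow> real" where
  "J c d z = (cmod (of_real c * z + of_real d))\<^sup>2 / Im z"

lemma J_nonneg: "z \<in> UH \<Longrightarrow> 0 \<le> J c d z" by (simp add: J_def UH_iff)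

lemma J_pos: "z \<in> UH \<Longrightarrow> c \<noteq> 0 \<or> d \<noteq> 0 \<Longrightarrow> 0 < J c d z"
  using denom_nonzero[of z c d] by (simp add: J_def UH_iff)

lemma Im_mob_J: "a * d - b * c = 1 \<Longrightarrow> z \<in> UH \<Longrightarrow> Im (mob a b c d z) = 1 / J c d z"
  by (simp add: Im_mob J_def UH_iff)

lemma J_scale: "J (x * c) (x * d) z = x\<^sup>2 * J c d z"
proof -
  have "of_real (x * c) * z + of_real (x * d) = of_real x * (of_real c * z + of_real d)" by (simp add: algebra_simps)
  then show ?thesis by (simp add: J_def norm_mult power_mult_distrib)
qed

lemma J_add: assumes "z \<in> UH" shows "J (c + c') (d + d') z \<le> 2 * J c d z + 2 * J c' d' z"
proof -
  let ?u = "of_real c * z + of_real d" and ?v = "of_real c' * z + of_real d'"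
  have "(cmod (?u + ?v))\<^sup>2 \<le> (cmod ?u + cmod ?v)\<^sup>2" by (intro power_mono norm_triangle_ineq) simp
  also have "\<dots> \<le> 2 * (cmod ?u)\<^sup>2 + 2 * (cmod ?v)\<^sup>2"
    using zero_le_power2[of "cmod ?u - cmod ?v"] by (simp add: power2_eq_square algebra_simps)
  finally have "(cmod (?u + ?v))\<^sup>2 / Im z \<le> (2 * (cmod ?u)\<^sup>2 + 2 * (cmod ?v)\<^sup>2) / Im z"
    using assms by (intro divide_right_mono) (auto simp: UH_iff)
  moreover have "?u + ?v = of_real (c + c') * z + of_real (d + d')" by (simp add: algebra_simps)
  ultimately show ?thesis by (simp add: J_def add_divide_distrib)
qed

lemma J_mob:
  assumes det: "a * d - b * c = 1" and z: "z \<in> UH"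
  shows "J c' d' (mob a b c d z) = J (c' * a + d' * c) (c' * b + d' * d) z"
proof -
  let ?D = "of_real c * z + of_real d :: complex"
  have D: "?D \<noteq> 0" using det z by (intro denom_nonzero) (auto simp: UH_iff)
  have "of_real c' * mob a b c d z + of_real d' = (of_real (c' * a + d' * c) * z + of_real (c' * b + d' * d)) / ?D"
    unfolding mob_def using D by (simp add: divide_simps) (simp add: algebra_simps)
  then show ?thesis using D z det unfolding J_def
    by (simp add: norm_divide power_divide Im_mob UH_iff)
qed

text \<open>On the upper half-plane an algebraic form of
  \<open>cosh (hyp_dist z w) \<le> 1 + \<kappa> / 2\<close>.\<close>

definition near :: "real \<Rightarrow> complex \<Rightarrow> complex \<Rightarrow> bool" where
  "near \<kappa> z w \<longleftrightarrow> (cmod (z - w))\<^sup>2 \<le> \<kappa> * Im z * Im w"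

lemma near_if_dist:
  assumes z: "z \<in> UH" "w \<in> UH" and d: "hyp_dist z w < r" and k: "\<kappa> = 2 * (cosh r - 1)"
  shows "near \<kappa> z w"
proof -
  let ?X = "(cmod (z - w))\<^sup>2 / (2 * Im z * Im w)"
  have X: "?X \<ge> 0" using z by (simp add: UH_iff)
  have r: "r \<ge> 0" using d X unfolding hyp_dist_def by (smt (verit) arcosh_nonneg_real)
  have "1 + ?X = cosh (arcosh (1 + ?X))" using X by simp
  also have "\<dots> \<le> cosh r" using d X r unfolding hyp_dist_def by (subst cosh_real_nonneg_le_iff) auto
  finally have "?X \<le> cosh r - 1" by simp
  then show ?thesis using z unfolding near_def k by (simp add: UH_iff field_simps)
qed

lemma near_mob:
  assumes det: "a * d - b * c = 1" and z: "z \<in> UH" "w \<in> UH" and n: "near \<kappa> z w"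
  shows "near \<kappa> (mob a b c d z) (mob a b c d w)"
proof -
  let ?D = "of_real c * z + of_real d :: complex" and ?E = "of_real c * w + of_real d :: complex"
  have cd: "c \<noteq> 0 \<or> d \<noteq> 0" using det by auto
  have D: "?D \<noteq> 0" "?E \<noteq> 0" using denom_nonzero[of z c d] denom_nonzero[of w c d] cd z by (simp_all add: UH_iff)
  have "complex_of_real (a * d) - of_real (b * c) = 1" using det by (metis of_real_1 of_real_diff)
  then have e: "(complex_of_real a * z + of_real b) * ?E - (of_real a * w + of_real b) * ?D = z - w"
  proof -
    assume h: "complex_of_real (a * d) - of_real (b * c) = 1"
    have "(complex_of_real a * z + of_real b) * ?E - (of_real a * w + of_real b) * ?D
        = (complex_of_real (a * d) - of_real (b * c)) * (z - w)" by (simp add: algebra_simps)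
    then show ?thesis using h by simp
  qed
  have "mob a b c d z - mob a b c d w = (z - w) / (?D * ?E)"
    unfolding mob_def using D by (simp add: diff_frac_eq e)
  then have "(cmod (mob a b c d z - mob a b c d w))\<^sup>2 = (cmod (z - w))\<^sup>2 / ((cmod ?D)\<^sup>2 * (cmod ?E)\<^sup>2)"
    by (simp add: norm_divide norm_mult power_divide power_mult_distrib)
  also have "\<dots> \<le> (\<kappa> * Im z * Im w) / ((cmod ?D)\<^sup>2 * (cmod ?E)\<^sup>2)"
    using n unfolding near_def by (intro divide_right_mono) auto
  also have "\<dots> = \<kappa> * Im (mob a b c d z) * Im (mob a b c d w)"
    using z det by (simp add: Im_mob UH_iff)
  finally show ?thesis unfolding near_def .
qed

lemma near_Im_ratio:
  assumes z: "z \<in> UH" "w \<in> UH" and n: "near \<kappa> z w"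
  shows "Im z \<le> (\<kappa> + 2) * Im w"
proof -
  have p: "Im z > 0" "Im w > 0" using z by (auto simp: UH_iff)
  have "(Im z - Im w)\<^sup>2 \<le> (cmod (z - w))\<^sup>2"
    using abs_Im_le_cmod[of "z - w"] by (metis abs_le_square_iff abs_norm_cancel minus_complex.simps(2))
  also have "\<dots> \<le> \<kappa> * Im z * Im w" using n by (simp add: near_def)
  finally have "Im z * Im z \<le> Im z * ((\<kappa> + 2) * Im w)" using p
    by (simp add: power2_eq_square algebra_simps) (smt (verit) mult_pos_pos)
  then show ?thesis using p by simp
qed

lemma near_sym: "near \<kappa> z w \<Longrightarrow> near \<kappa> w z"
  by (simp add: near_def norm_minus_commute mult_ac)

text \<open>Write \<open>c * w + d\<close> as \<open>c * z + d\<close> plus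
  \<open>c * (w - z)\<close>. The second term is controlled because \<open>c\<^sup>2 * Im z\<close>
  is at most \<open>J c d z\<close>, and \<open>near_Im_ratio\<close> compares the imaginary
  parts.\<close>

lemma J_near:
  assumes z: "z \<in> UH" "w \<in> UH" and n: "near \<kappa> z w" and k: "\<kappa> \<ge> 0"
  shows "J c d w \<le> 4 * (\<kappa> + 2) * J c d z"
proof -
  have p: "Im z > 0" "Im w > 0" using z by (auto simp: UH_iff)
  let ?u = "of_real c * z + of_real d"
  have e: "of_real c * w + of_real d = ?u + of_real c * (w - z)" by (simp add: algebra_simps)
  have "(cmod (of_real c * w + of_real d))\<^sup>2 \<le> (cmod ?u + cmod (of_real c * (w - z)))\<^sup>2"
    unfolding e by (intro power_mono norm_triangle_ineq) simp
  also have "\<dots> \<le> 2 * (cmod ?u)\<^sup>2 + 2 * (cmod (of_real c * (w - z)))\<^sup>2"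
    using zero_le_power2[of "cmod ?u - cmod (of_real c * (w - z))"] by (simp add: power2_eq_square algebra_simps)
  also have "(cmod (of_real c * (w - z)))\<^sup>2 = c\<^sup>2 * (cmod (w - z))\<^sup>2" by (simp add: norm_mult power_mult_distrib)
  also have "c\<^sup>2 * (cmod (w - z))\<^sup>2 \<le> c\<^sup>2 * (\<kappa> * Im w * Im z)"
    using near_sym[OF n] unfolding near_def by (intro mult_left_mono) auto
  finally have 1: "(cmod (of_real c * w + of_real d))\<^sup>2 \<le> 2 * (cmod ?u)\<^sup>2 + 2 * (c\<^sup>2 * (\<kappa> * Im w * Im z))" by simp
  have "\<bar>c * Im z\<bar> \<le> cmod ?u" using abs_Im_le_cmod[of ?u] by simp
  then have "(c * Im z)\<^sup>2 \<le> (cmod ?u)\<^sup>2" by (metis abs_le_square_iff abs_norm_cancel)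
  then have 2: "c\<^sup>2 * Im z \<le> J c d z" using p by (simp add: J_def field_simps power2_eq_square)
  have "J c d w \<le> (2 * (cmod ?u)\<^sup>2 + 2 * (c\<^sup>2 * (\<kappa> * Im w * Im z))) / Im w"
    unfolding J_def using 1 p by (intro divide_right_mono) auto
  also have "\<dots> = 2 * J c d z * (Im z / Im w) + 2 * \<kappa> * (c\<^sup>2 * Im z)"
    using p by (simp add: J_def field_simps)
  also have "\<dots> \<le> 2 * J c d z * (\<kappa> + 2) + 2 * \<kappa> * J c d z"
    using near_Im_ratio[OF z n] J_nonneg[OF z(1)] p k 2
    by (intro add_mono mult_left_mono) (auto simp: field_simps)
  also have "\<dots> \<le> 4 * (\<kappa> + 2) * J c d z" using J_nonneg[OF z(1), of c d] by (simp add: algebra_simps)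
  finally show ?thesis .
qed

text \<open>Comparing the heights of \<open>w\<close> and its image bounds the denominator
  \<open>e * w + k\<close>. The displacement times the denominator is the quadratic polynomial
  \<open>?Q\<close>, whose roots are the fixed points; its size relative to \<open>Im w\<close>
  gives the other bounds.\<close>

lemma displacement_bounds:
  assumes det: "A * k - B * e = 1" and w: "w \<in> UH" and n: "near \<kappa> w (mob A B e k w)" and k0: "\<kappa> \<ge> 0"
  shows "\<bar>e\<bar> * Im w \<le> \<kappa> + 2" "\<bar>2 * e * Re w + k - A\<bar> \<le> \<kappa> + 2" "\<bar>A + k\<bar> \<le> 3 * (\<kappa> + 2)"
    "e = 0 \<Longrightarrow> \<bar>k\<bar> \<le> \<kappa> + 2"
    "e = 0 \<Longrightarrow> A = k \<Longrightarrow> \<bar>B\<bar> \<le> (\<kappa> + 2) * Im w"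
proof -
  let ?D = "of_real e * w + of_real k :: complex"
  have D: "?D \<noteq> 0" using det w by (intro denom_nonzero) (auto simp: UH_iff)
  have p: "Im w > 0" using w by (simp add: UH_iff)
  have w': "mob A B e k w \<in> UH" by (rule mob_UH[OF det w])
  have I: "Im (mob A B e k w) = Im w / (cmod ?D)\<^sup>2" using det p by (simp add: Im_mob)
  \<comment> \<open>Square roots are given away so that the single constant
    \<open>\<kappa> + 2\<close> serves in all estimates.\<close>
  have le: "x \<le> \<kappa> + 2" if "x\<^sup>2 \<le> \<kappa> + 2" for x :: real
  proof (rule power2_le_imp_le)
    have "(\<kappa> + 2) * 1 \<le> (\<kappa> + 2) * (\<kappa> + 2)" using k0 by (intro mult_left_mono) auto
    then show "x\<^sup>2 \<le> (\<kappa> + 2)\<^sup>2" using that by (simp add: power2_eq_square)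
  qed (use k0 in simp)
  have D2: "(cmod ?D)\<^sup>2 \<le> \<kappa> + 2"
  proof -
    have "Im w * (cmod ?D)\<^sup>2 \<le> Im w * (\<kappa> + 2)"
      using near_Im_ratio[OF w w' n] D unfolding I by (simp add: field_simps)
    then show ?thesis using p by simp
  qed
  have Dle: "cmod ?D \<le> \<kappa> + 2" by (rule le[OF D2])
  show 1: "\<bar>e\<bar> * Im w \<le> \<kappa> + 2"
    using abs_Im_le_cmod[of ?D] Dle p by (simp add: abs_mult)
  have re: "\<bar>e * Re w + k\<bar> \<le> \<kappa> + 2" using abs_Re_le_cmod[of ?D] Dle by simp
  show "e = 0 \<Longrightarrow> \<bar>k\<bar> \<le> \<kappa> + 2" using re by simp
  let ?Q = "of_real e * w * w + (of_real k - of_real A) * w - of_real B :: complex"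
  have "w - mob A B e k w = ?Q / ?D"
    unfolding mob_def using D by (simp add: divide_simps) (simp add: algebra_simps)
  then have "(cmod ?Q)\<^sup>2 / (cmod ?D)\<^sup>2 \<le> \<kappa> * Im w * (Im w / (cmod ?D)\<^sup>2)"
    using n unfolding near_def I by (simp add: norm_divide power_divide)
  then have "(cmod ?Q)\<^sup>2 \<le> \<kappa> * Im w * Im w" using D by (simp add: field_simps)
  then have "(cmod ?Q / Im w)\<^sup>2 \<le> \<kappa> + 2" using p by (simp add: power_divide power2_eq_square field_simps add_increasing2)
  then have Q: "cmod ?Q \<le> (\<kappa> + 2) * Im w" using le[of "cmod ?Q / Im w"] p by (simp add: field_simps)
  have "Im ?Q = (2 * e * Re w + k - A) * Im w" by (simp add: algebra_simps)
  then have "\<bar>2 * e * Re w + k - A\<bar> * Im w \<le> (\<kappa> + 2) * Im w"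
    using abs_Im_le_cmod[of ?Q] Q p by (metis abs_mult abs_of_pos order_trans)
  then show 2: "\<bar>2 * e * Re w + k - A\<bar> \<le> \<kappa> + 2" using p by simp
  \<comment> \<open>The trace is twice \<open>e * Re w + k\<close> minus
    \<open>2 * e * Re w + k - A\<close>.\<close>
  show "\<bar>A + k\<bar> \<le> 3 * (\<kappa> + 2)" using 2 re by (simp add: abs_le_iff)
  assume "e = 0" "A = k"
  then have "?Q = - of_real B" by simp
  then show "\<bar>B\<bar> \<le> (\<kappa> + 2) * Im w" using Q by simp
qed

lemma emeasure_lborel_Times:
  fixes A :: "'a::euclidean_space set" and B :: "'b::euclidean_space set"
  assumes "A \<in> sets borel" "B \<in> sets borel"
  shows "emeasure lborel (A \<times> B) = emeasure lborel A * emeasure lborel B"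
  using assms by (subst lborel_prod[symmetric]) (simp add: lborel.emeasure_pair_measure_Times)

context real_quadratic begin

subsection \<open>The real embeddings\<close>

lemma real_subfield_K: "real_subfield K"
  unfolding real_subfield_def by simp

lemma real_quadratic_field_K: "real_quadratic_field K"
  unfolding real_quadratic_field_def
proof
  show "rat_vs.dim K = 2"
  proof (rule rat_vs.dim_unique[of "{1, s}"])
    show "{1, s} \<subseteq> K" by simp
    show "K \<subseteq> rat_vs.span {1, s}"
    proof
      fix x assume "x \<in> K"
      then obtain a b where x: "a \<in> \<rat>" "b \<in> \<rat>" "x = a + b * s" by (rule K_E)
      obtain a' b' where r: "a = of_rat a'" "b = of_rat b'" using x by (metis Rats_cases)
      have "of_rat a' * 1 + of_rat b' * s \<in> rat_vs.span {1, s}"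
        by (intro rat_vs.span_add rat_vs.span_scale rat_vs.span_base) auto
      then show "x \<in> rat_vs.span {1, s}" using x r by simp
    qed
    show "rat_vs.independent {1, s}"
    proof (rule rat_vs.independent_insertI)
      show "rat_vs.independent {s}" using s_pos by (simp add: rat_vs.independent_insert)
      show "1 \<notin> rat_vs.span {s}"
      proof
        assume "1 \<in> rat_vs.span {s}"
        then obtain q where "1 = of_rat q * s" by (auto simp: rat_vs.span_singleton)
        then have "1 + 0 * s = 0 + of_rat q * s" by simp
        then show False using rep_unique[of 1 0 0 "of_rat q"] by simp
      qed
    qed
    show "card {1, s} = 2" using s_gt_1 by simp
  qed
qed (rule real_subfield_K)

lemma embedding_cases:
  assumes \<sigma>: "\<sigma> \<in> real_embeddings K"
  shows "(\<forall>x\<in>K. \<sigma> x = x) \<or> (\<forall>x\<in>K. \<sigma> x = cj x)"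
proof -
  have one: "\<sigma> 1 = 1" and add: "\<And>x y. x \<in> K \<Longrightarrow> y \<in> K \<Longrightarrow> \<sigma> (x + y) = \<sigma> x + \<sigma> y"
    and mult: "\<And>x y. x \<in> K \<Longrightarrow> y \<in> K \<Longrightarrow> \<sigma> (x * y) = \<sigma> x * \<sigma> y"
    using \<sigma> by (auto simp: real_embeddings_def)
  have zero: "\<sigma> 0 = 0" using add[of 0 0] by simp
  have minus: "\<sigma> (- x) = - \<sigma> x" if "x \<in> K" for x using add[of x "- x"] that zero by simp
  have nat: "\<sigma> (of_nat n) = of_nat n" for n by (induction n) (simp_all add: zero one add)
  have int: "\<sigma> (of_int n) = of_int n" for n
    by (cases n) (use nat minus in \<open>simp_all del: of_nat_Suc\<close>)
  have rat: "\<sigma> q = q" if q: "q \<in> \<rat>" for q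
  proof -
    obtain a b :: int where ab: "b > 0" "q = of_int a / of_int b" using q by (metis Rats_cases' less_irrefl)
    have "\<sigma> (q * of_int b) = \<sigma> q * of_int b" using mult[of q "of_int b"] q Rats_K int by simp
    moreover have "q * of_int b = of_int a" using ab by simp
    ultimately have "\<sigma> q * of_int b = q * of_int b" using int[of a] by metis
    then show ?thesis using ab(1) by simp
  qed
  have "\<sigma> s * \<sigma> s = \<sigma> (s * s)" using mult[OF K_s K_s] by simp
  also have "\<dots> = s * s" unfolding s_sq by (rule nat)
  finally have "\<sigma> s * \<sigma> s = s * s" .
  then have "\<sigma> s = s \<or> \<sigma> s = - s" by (metis square_eq_iff)
  moreover have lin: "\<sigma> (a + b * s) = a + b * \<sigma> s" if "a \<in> \<rat>" "b \<in> \<rat>" for a b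
    using that add[of a "b * s"] mult[of b s] rat Rats_K by simp
  have "\<sigma> x = x" if "\<sigma> s = s" "x \<in> K" for x
    using that(2) by (rule K_E) (simp add: lin that(1))
  moreover have "\<sigma> x = cj x" if "\<sigma> s = - s" "x \<in> K" for x
    using that(2) by (rule K_E) (metis lin that(1) mult_minus_right diff_conv_add_uminus)
  ultimately show ?thesis by blast
qed

lemma second_embedding_K: "x \<in> K \<Longrightarrow> second_embedding K x = cj x"
proof -
  assume x: "x \<in> K"
  have "second_embedding K = restrict cj K"
    unfolding second_embedding_def
  proof (rule the_equality)
    have "restrict cj K s \<noteq> first_embedding K s" using s_pos by (simp add: first_embedding_def)
    moreover have "restrict cj K \<in> real_embeddings K" by (auto simp: real_embeddings_def)
    ultimately show "restrict cj K \<in> real_embeddings K \<and> restrict cj K \<noteq> first_embedding K" by metis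
    fix \<sigma> assume \<sigma>: "\<sigma> \<in> real_embeddings K \<and> \<sigma> \<noteq> first_embedding K"
    then have e: "\<sigma> \<in> extensional K" by (simp add: real_embeddings_def)
    have "\<not> (\<forall>x\<in>K. \<sigma> x = x)" using \<sigma> e unfolding first_embedding_def
      by (metis extensionalityI restrict_apply' restrict_extensional)
    then have "\<forall>x\<in>K. \<sigma> x = cj x" using embedding_cases \<sigma> by blast
    then show "\<sigma> = restrict cj K" using e by (intro extensionalityI[of _ K]) auto
  qed
  then show ?thesis using x by simp
qed

lemma first_embedding_K: "x \<in> K \<Longrightarrow> first_embedding K x = x"
  by (simp add: first_embedding_def)

text \<open>All powers of an algebraic integer have a common denominator with respect to the basis
  \<open>1, s\<close>, so its norm and the norm of its successor are integers.\<close>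

lemma ring_of_integers_K: "ring_of_integers K = Zs"
proof (intro equalityI subsetI)
  fix x assume "x \<in> Zs"
  then obtain a b where x: "x = of_int a + of_int b * s" "cj x = of_int a - of_int b * s" by (rule Zs_E)
  define q where "q = [:of_int (a * a - b * b * int p), - of_int (2 * a), 1 :: real:]"
  have "algebraic_int x"
  proof (rule algebraic_int.intros[of q])
    show "lead_coeff q = 1" by (simp add: q_def)
    show "\<forall>i. coeff q i \<in> \<int>"
    proof
      fix i
      have "coeff q i = 0 \<or> coeff q i = of_int (a * a - b * b * int p) \<or> coeff q i = - of_int (2 * a) \<or> coeff q i = 1"
        unfolding q_def by (auto simp: coeff_pCons split: nat.splits)
      then show "coeff q i \<in> \<int>" by auto
    qed
    have "poly q x = x * x - 2 * of_int a * x + of_int a * of_int a - of_int b * of_int b * (s * s)"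
      unfolding s_sq by (simp add: q_def algebra_simps)
    also have "\<dots> = 0" unfolding x(1) by (simp add: algebra_simps)
    finally show "poly q x = 0" .
  qed
  then show "x \<in> ring_of_integers K" using \<open>x \<in> Zs\<close> Zs_K by (simp add: ring_of_integers_def)
next
  fix x assume "x \<in> ring_of_integers K"
  then have x: "x \<in> K" "algebraic_int x" by (auto simp: ring_of_integers_def)
  obtain q where q: "lead_coeff q = 1" "\<forall>i. coeff q i \<in> \<int>" "poly q x = 0"
    using x(2) by (auto elim: algebraic_int.cases)
  define n where "n = degree q"
  define c where "c i = \<lfloor>coeff q i\<rfloor>" for i
  have c: "coeff q i = of_int (c i)" for i using q(2) unfolding c_def by (metis Ints_cases floor_of_int)
  have top: "x ^ n = - (\<Sum>i<n. of_int (c i) * x ^ i)"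
  proof -
    have "0 = (\<Sum>i\<le>n. coeff q i * x ^ i)" using q(3) by (simp add: poly_altdef n_def)
    also have "\<dots> = (\<Sum>i<n. of_int (c i) * x ^ i) + x ^ n"
      using q(1) by (simp add: lessThan_Suc_atMost[symmetric] c n_def)
    finally show ?thesis by simp
  qed
  have "\<exists>D::int. D > 0 \<and> of_int D * y \<in> Zs" if y: "y \<in> K" for y
  proof -
    obtain a b where ab: "a \<in> \<rat>" "b \<in> \<rat>" "y = a + b * s" using y by (rule K_E)
    obtain u v u' v' :: int where uv: "v > 0" "a = of_int u / of_int v" "v' > 0" "b = of_int u' / of_int v'"
      using ab by (metis Rats_cases' less_irrefl)
    have "of_int (v * v') * y = of_int (u * v') + of_int (u' * v) * s"
      unfolding ab uv using uv(1,3) by (simp add: field_simps)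
    then show ?thesis using uv by (intro exI[of _ "v * v'"]) auto
  qed
  then have "\<forall>i. \<exists>D::int. D > 0 \<and> of_int D * x ^ i \<in> Zs" using x(1) by simp
  from choice[OF this] obtain D where D: "\<And>i. (D i :: int) > 0" "\<And>i. of_int (D i) * x ^ i \<in> Zs" by blast
  \<comment> \<open>A common denominator of the powers below the degree is one for all powers, by
    the monic equation \<open>top\<close>.\<close>
  define E where "E = (\<Prod>i<n. D i)"
  have E0: "E > 0" unfolding E_def using D by (intro prod_pos) auto
  have Ei: "of_int E * x ^ i \<in> Zs" if "i < n" for i
  proof -
    have "of_int E * x ^ i = of_int (\<Prod>j\<in>{..<n} - {i}. D j) * (of_int (D i) * x ^ i)"
      unfolding E_def using that by (subst prod.remove[of _ i]) auto
    also have "\<dots> \<in> Zs" by (intro Zs_mult Zs_of_int D)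
    finally show ?thesis .
  qed
  have Em: "of_int E * x ^ i \<in> Zs" for i
  proof (induction i rule: less_induct)
    case (less i)
    show ?case
    proof (cases "i < n")
      case False
      have "x ^ i = x ^ n * x ^ (i - n)" using False by (simp flip: power_add)
      also have "\<dots> = - (\<Sum>j<n. of_int (c j) * x ^ (j + (i - n)))"
        unfolding top by (simp add: sum_distrib_right power_add mult.assoc)
      finally have "of_int E * x ^ i = - (\<Sum>j<n. of_int (c j) * (of_int E * x ^ (j + (i - n))))"
        by (simp add: sum_distrib_left mult.left_commute)
      moreover have "(\<Sum>j\<in>A. of_int (c j) * (of_int E * x ^ (j + (i - n)))) \<in> Zs" if "finite A" "A \<subseteq> {..<n}" for A
        using that by (induction rule: finite_induct) (use less False in auto)
      ultimately show ?thesis by simp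
    qed (rule Ei)
  qed
  have nm: "y * cj y \<in> \<int>" if y: "y \<in> K" "\<And>i. of_int E * y ^ i \<in> Zs" for y
  proof (rule Rats_power_denominators)
    show "y * cj y \<in> \<rat>" by (rule norm_Rats[OF y(1)])
    show "of_int (E * E) \<noteq> (0::real)" using E0 by simp
    fix i
    have "(of_int E * y ^ i) * cj (of_int E * y ^ i) \<in> \<int>" by (rule norm_Ints[OF y(2)])
    then show "(y * cj y) ^ i * of_int (E * E) \<in> \<int>" using y(1) by (simp add: power_mult_distrib mult_ac)
  qed
  have "of_int E * (x + 1) ^ i \<in> Zs" for i
  proof -
    have "of_int E * (x + 1) ^ i = (\<Sum>k\<le>i. of_nat (i choose k) * (of_int E * x ^ k))"
      by (simp add: binomial_ring sum_distrib_left mult.left_commute)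
    moreover have "(\<Sum>k\<in>A. of_nat (i choose k) * (of_int E * x ^ k)) \<in> Zs" if "finite A" for A
      using that by (induction rule: finite_induct) (use Em in auto)
    ultimately show ?thesis by simp
  qed
  then have "(x + 1) * cj (x + 1) \<in> \<int>" using x(1) by (intro nm) auto
  moreover have n0: "x * cj x \<in> \<int>" using Em x(1) by (intro nm) auto
  moreover have "x + cj x = (x + 1) * cj (x + 1) - x * cj x - 1" using x(1) by (simp add: algebra_simps)
  ultimately have "x + cj x \<in> \<int>" by simp
  then show "x \<in> Zs" using Zs_if_trace_norm x(1) n0 by blast
qed

subsection \<open>The lattice of integers and a theorem of Minkowski\<close>

text \<open>A multiple of \<open>s\<close> brings the difference of the coordinates into
  \<open>{0..2 * s}\<close>; a rational integer, which moves both coordinates equally, then brings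
  the first into \<open>{0..1}\<close>. The area \<open>2 * s + 1\<close> slightly exceeds the
  covolume \<open>2 * s\<close>.\<close>

lemma Zs_translate_into_rectangle:
  "\<exists>c\<in>Zs. x1 + c \<in> {0..1} \<and> x2 + cj c \<in> {- 2 * s..1}"
proof -
  define v where "v = - \<lfloor>(x1 - x2) / (2 * s)\<rfloor>"
  define u where "u = - \<lfloor>x1 + of_int v * s\<rfloor>"
  let ?c = "of_int u + of_int v * s"
  have cc: "cj ?c = of_int u - of_int v * s" by (rule cj_rep) auto
  have "0 \<le> (x1 - x2) / (2 * s) + of_int v" "(x1 - x2) / (2 * s) + of_int v \<le> 1" unfolding v_def by linarith+
  then have "0 \<le> ((x1 - x2) / (2 * s) + of_int v) * (2 * s)" "((x1 - x2) / (2 * s) + of_int v) * (2 * s) \<le> 1 * (2 * s)"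
    using s_pos by (auto intro!: mult_right_mono mult_nonneg_nonneg)
  moreover have "((x1 - x2) / (2 * s) + of_int v) * (2 * s) = x1 - x2 + 2 * of_int v * s" using s_pos by (simp add: field_simps)
  ultimately have 1: "0 \<le> x1 - x2 + 2 * of_int v * s" "x1 - x2 + 2 * of_int v * s \<le> 2 * s" by auto
  have 2: "0 \<le> x1 + of_int v * s + of_int u" "x1 + of_int v * s + of_int u \<le> 1" unfolding u_def by linarith+
  show ?thesis using 1 2 by (intro bexI[of _ ?c]) (auto simp: cc)
qed

lemma countable_Zs: "countable Zs"
proof -
  have "Zs = (\<lambda>(a, b). of_int a + of_int b * s) ` (UNIV :: (int \<times> int) set)" by (auto simp: Zs_def)
  then show ?thesis by simp
qed

text \<open>Blichfeldt's argument: without a solution the box \<open>U\<close> would inject into the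
  quotient of four-dimensional space by the lattice of values of the forms, although the translates
  of \<open>S\<close>, of volume \<open>(2 * s + 1)\<^sup>2\<close>, cover the space.\<close>

lemma minkowski_linear_forms:
  assumes pos: "A1 > 0" "A2 > 0" "B1 > 0" "B2 > 0" and big: "A1 * A2 * B1 * B2 > (2 * s + 1)\<^sup>2"
  shows "\<exists>c\<in>Zs. \<exists>d\<in>Zs. (c \<noteq> 0 \<or> d \<noteq> 0) \<and> \<bar>c\<bar> \<le> A1 \<and> \<bar>cj c\<bar> \<le> A2 \<and> \<bar>c * x1 + d\<bar> \<le> B1 \<and> \<bar>cj c * x2 + cj d\<bar> \<le> B2"
proof (rule ccontr)
  assume neg: "\<not> ?thesis"
  let ?\<Gamma> = "Zs \<times> Zs"
  define lat where "lat = (\<lambda>(c, d). (c, cj c, c * x1 + d, cj c * x2 + cj d))"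
  define act where "act g = (+) (lat g)" for g
  \<comment> \<open>The sides are \<open>{0..A1}\<close> and not \<open>{- A1..A1}\<close>, since it
    is the differences of points of \<open>U\<close> that have to satisfy the bounds.\<close>
  define U where "U = {0..A1} \<times> {0..A2} \<times> {0..B1} \<times> {0..B2}"
  define S :: "(real \<times> real \<times> real \<times> real) set"
    where "S = {0..1} \<times> {- 2 * s..1} \<times> {0..1} \<times> {- 2 * s..1}"
  have lat_diff: "lat (c, d) - lat (c', d') = lat (c - c', d - d')" if "c \<in> Zs" "c' \<in> Zs" "d \<in> Zs" "d' \<in> Zs" for c d c' d'
    using that by (simp add: lat_def Zs_K algebra_simps)
  have "emeasure lborel U \<le> emeasure lborel S"
  proof (rule emeasure_le_cover[where \<Gamma> = ?\<Gamma> and act = act])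
    show "countable ?\<Gamma>" using countable_Zs by simp
    show "act g \<in> measurable lborel lborel" for g unfolding act_def by simp
    show "emeasure lborel (act g -` A \<inter> space lborel) = emeasure lborel A" if "A \<in> sets lborel" for g A
    proof -
      have "emeasure lborel A = emeasure (distr lborel borel ((+) (lat g))) A" by (simp add: lborel_distr_plus)
      also have "\<dots> = emeasure lborel ((+) (lat g) -` A \<inter> space lborel)" using that by (subst emeasure_distr) auto
      finally show ?thesis by (simp add: act_def)
    qed
    show "\<exists>h\<in>?\<Gamma>. \<forall>x\<in>space lborel. act h (act g x) = x \<and> act g (act h x) = x" if gG: "g \<in> ?\<Gamma>" for g
    proof -
      obtain c d where g: "g = (c, d)" "c \<in> Zs" "d \<in> Zs" using gG by auto
      have "lat (- c, - d) = - lat (c, d)" using g by (simp add: lat_def Zs_K)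
      then show ?thesis using g by (intro bexI[of _ "(- c, - d)"]) (auto simp: act_def)
    qed
    show "U \<in> sets lborel" "S \<in> sets lborel" unfolding U_def S_def by (auto intro!: borel_closed closed_Times)
    show "u = v" if h: "g \<in> ?\<Gamma>" "h \<in> ?\<Gamma>" "u \<in> U" "v \<in> U" "act g u = act h v" for g h u v
    proof -
      obtain c d c' d' where gh: "g = (c, d)" "h = (c', d')" "c \<in> Zs" "d \<in> Zs" "c' \<in> Zs" "d' \<in> Zs" using h by auto
      have "u - v = lat h - lat g" using h(5) unfolding act_def by (simp add: algebra_simps)
      then have e: "u - v = lat (c' - c, d' - d)" using gh lat_diff by simp
      obtain u1 u2 u3 u4 v1 v2 v3 v4 where uv: "u = (u1, u2, u3, u4)" "v = (v1, v2, v3, v4)" by (metis prod_cases4)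
      have "\<bar>c' - c\<bar> \<le> A1 \<and> \<bar>cj (c' - c)\<bar> \<le> A2 \<and> \<bar>(c' - c) * x1 + (d' - d)\<bar> \<le> B1 \<and> \<bar>cj (c' - c) * x2 + cj (d' - d)\<bar> \<le> B2"
        using e h(3,4) unfolding uv lat_def U_def by (auto simp: abs_le_iff)
      then have "c' - c = 0 \<and> d' - d = 0" using neg gh Zs_diff by blast
      then have "u - v = 0" using e by (simp add: lat_def zero_prod_def)
      then show "u = v" by simp
    qed
    show "\<exists>g\<in>?\<Gamma>. act g u \<in> S" if "u \<in> U" for u
    proof -
      obtain u1 u2 u3 u4 where u: "u = (u1, u2, u3, u4)" by (metis prod_cases4)
      obtain c where c: "c \<in> Zs" "u1 + c \<in> {0..1}" "u2 + cj c \<in> {- 2 * s..1}" using Zs_translate_into_rectangle by blast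
      obtain d where d: "d \<in> Zs" "(c * x1 + u3) + d \<in> {0..1}" "(cj c * x2 + u4) + cj d \<in> {- 2 * s..1}"
        using Zs_translate_into_rectangle by blast
      show ?thesis using c d by (intro bexI[of _ "(c, d)"]) (auto simp: act_def lat_def S_def u algebra_simps)
    qed
  qed
  moreover have "emeasure lborel U = ennreal (A1 * (A2 * (B1 * B2)))"
    unfolding U_def using pos by (simp add: emeasure_lborel_Times borel_closed closed_Times ennreal_mult)
  moreover have "emeasure lborel S = ennreal ((1 + 2 * s) * (1 + 2 * s))"
    unfolding S_def using s_pos by (simp add: emeasure_lborel_Times borel_closed closed_Times ennreal_mult)
  ultimately have "A1 * (A2 * (B1 * B2)) \<le> (1 + 2 * s) * (1 + 2 * s)" using s_pos by (simp add: ennreal_le_iff)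
  then show False using big by (simp add: power2_eq_square algebra_simps)
qed

lemma short_vector:
  assumes z: "z1 \<in> UH" "z2 \<in> UH"
  shows "\<exists>c\<in>Zs. \<exists>d\<in>Zs. (c \<noteq> 0 \<or> d \<noteq> 0) \<and> J c d z1 \<le> 6 * s \<and> J (cj c) (cj d) z2 \<le> 6 * s"
proof -
  \<comment> \<open>Minkowski's condition is \<open>\<rho> > 2 * s + 1\<close>, true as
    \<open>s > 1\<close>. \<open>J\<close> is a sum of two terms of size at most
    \<open>\<rho>\<close>, hence the bound \<open>6 * s\<close>.\<close>
  define \<rho> where "\<rho> = 3 * s"
  have r: "\<rho> > 0" using s_pos by (simp add: \<rho>_def)
  have y: "Im z1 > 0" "Im z2 > 0" using z by (auto simp: UH_iff)
  have "sqrt (\<rho> / Im z1) * sqrt (\<rho> / Im z2) * sqrt (\<rho> * Im z1) * sqrt (\<rho> * Im z2) = \<rho>\<^sup>2"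
    using r y by (simp add: real_sqrt_mult real_sqrt_divide power2_eq_square field_simps)
  also have "\<dots> > (2 * s + 1)\<^sup>2" unfolding \<rho>_def using s_gt_1 by (intro power_strict_mono) auto
  finally obtain c d where cd: "c \<in> Zs" "d \<in> Zs" "c \<noteq> 0 \<or> d \<noteq> 0"
      "\<bar>c\<bar> \<le> sqrt (\<rho> / Im z1)" "\<bar>cj c\<bar> \<le> sqrt (\<rho> / Im z2)"
      "\<bar>c * Re z1 + d\<bar> \<le> sqrt (\<rho> * Im z1)" "\<bar>cj c * Re z2 + cj d\<bar> \<le> sqrt (\<rho> * Im z2)"
    using minkowski_linear_forms[of "sqrt (\<rho> / Im z1)" "sqrt (\<rho> / Im z2)" "sqrt (\<rho> * Im z1)" "sqrt (\<rho> * Im z2)" "Re z1" "Re z2"]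
      r y by auto
  have J: "J c d z \<le> 6 * s" if h: "Im z > 0" "\<bar>c\<bar> \<le> sqrt (\<rho> / Im z)" "\<bar>c * Re z + d\<bar> \<le> sqrt (\<rho> * Im z)" for c d z
  proof -
    have "\<bar>c\<bar>\<^sup>2 \<le> (sqrt (\<rho> / Im z))\<^sup>2" "\<bar>c * Re z + d\<bar>\<^sup>2 \<le> (sqrt (\<rho> * Im z))\<^sup>2"
      using h by (intro power_mono; simp)+
    then have "c\<^sup>2 \<le> \<rho> / Im z" "(c * Re z + d)\<^sup>2 \<le> \<rho> * Im z" using r h by simp_all
    then have "(c * Re z + d)\<^sup>2 + c\<^sup>2 * (Im z)\<^sup>2 \<le> \<rho> * Im z + \<rho> / Im z * (Im z)\<^sup>2"
      by (intro add_mono mult_right_mono) auto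
    also have "\<dots> = (6 * s) * Im z" using h by (simp add: \<rho>_def power2_eq_square)
    finally show ?thesis using h unfolding J_def by (simp add: cmod_power2 power_mult_distrib field_simps)
  qed
  show ?thesis using cd J[OF y(1)] J[OF y(2)] by blast
qed

subsection \<open>The Hilbert modular group\<close>

definition GK :: "(real \<times> real \<times> real \<times> real) set" where
  "GK = {(a, b, c, d). a \<in> K \<and> b \<in> K \<and> c \<in> K \<and> d \<in> K \<and> a * d - b * c = 1}"

definition Gam :: "(real \<times> real \<times> real \<times> real) set" where
  "Gam = {(a, b, c, d). a \<in> Zs \<and> b \<in> Zs \<and> c \<in> Zs \<and> d \<in> Zs \<and> a * d - b * c = 1}"

definition gmul :: "real \<times> real \<times> real \<times> real \<Rightarrow> real \<times> real \<times> real \<times> real \<Rightarrow> real \<times> real \<times> real \<times> real" where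
  "gmul = (\<lambda>(a, b, c, d) (a', b', c', d'). (a * a' + b * c', a * b' + b * d', c * a' + d * c', c * b' + d * d'))"

definition ginv :: "real \<times> real \<times> real \<times> real \<Rightarrow> real \<times> real \<times> real \<times> real" where
  "ginv = (\<lambda>(a, b, c, d). (d, - b, - c, a))"

definition act :: "real \<times> real \<times> real \<times> real \<Rightarrow> complex \<times> complex \<Rightarrow> complex \<times> complex" where
  "act = (\<lambda>(a, b, c, d) z. (mob a b c d (fst z), mob (cj a) (cj b) (cj c) (cj d) (snd z)))"

lemma Gam_GK: "g \<in> Gam \<Longrightarrow> g \<in> GK" by (auto simp: Gam_def GK_def Zs_K)

lemma cj_det: "a \<in> K \<Longrightarrow> b \<in> K \<Longrightarrow> c \<in> K \<Longrightarrow> d \<in> K \<Longrightarrow> a * d - b * c = 1 \<Longrightarrow>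
    cj a * cj d - cj b * cj c = 1"
  using cj_diff[of "a * d" "b * c"] by simp

lemma GK_E:
  assumes "g \<in> GK"
  obtains a b c d where "g = (a, b, c, d)" "a \<in> K" "b \<in> K" "c \<in> K" "d \<in> K" "a * d - b * c = 1"
    "cj a * cj d - cj b * cj c = 1"
  using assms cj_det by (auto simp: GK_def)

lemma HH_iff: "z \<in> HH \<longleftrightarrow> fst z \<in> UH \<and> snd z \<in> UH"
  by (cases z) (simp add: HH_def)

lemma act_HH: "g \<in> GK \<Longrightarrow> z \<in> HH \<Longrightarrow> act g z \<in> HH"
  by (elim GK_E) (simp add: act_def HH_iff mob_UH)

lemma gmul_GK: "g \<in> GK \<Longrightarrow> h \<in> GK \<Longrightarrow> gmul g h \<in> GK"
proof (elim GK_E)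
  fix a b c d a' b' c' d' assume h: "g = (a, b, c, d)" "h = (a', b', c', d')" "a \<in> K" "b \<in> K" "c \<in> K" "d \<in> K"
    "a' \<in> K" "b' \<in> K" "c' \<in> K" "d' \<in> K" and det: "a * d - b * c = 1" "a' * d' - b' * c' = 1"
  have "(a * a' + b * c') * (c * b' + d * d') - (a * b' + b * d') * (c * a' + d * c') = (a * d - b * c) * (a' * d' - b' * c')"
    by (simp add: algebra_simps)
  then show ?thesis using h det by (simp add: GK_def gmul_def)
qed

lemma gmul_Gam: "g \<in> Gam \<Longrightarrow> h \<in> Gam \<Longrightarrow> gmul g h \<in> Gam"
  using gmul_GK[of g h] Gam_GK[of g] Gam_GK[of h]
  by (auto simp: Gam_def GK_def gmul_def)

lemma ginv_Gam: "g \<in> Gam \<Longrightarrow> ginv g \<in> Gam"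
  by (auto simp: Gam_def ginv_def mult.commute)

lemma act_gmul: "g \<in> GK \<Longrightarrow> h \<in> GK \<Longrightarrow> z \<in> HH \<Longrightarrow> act g (act h z) = act (gmul g h) z"
  by (elim GK_E) (simp add: act_def gmul_def mob_comp HH_iff UH_iff)

lemma act_1: "act (1, 0, 0, 1) z = z" by (simp add: act_def mob_id)

lemma gmul_ginv: "g \<in> GK \<Longrightarrow> gmul g (ginv g) = (1, 0, 0, 1)" "g \<in> GK \<Longrightarrow> gmul (ginv g) g = (1, 0, 0, 1)"
  by (auto simp: GK_def gmul_def ginv_def algebra_simps)

lemma gmul_assoc: "gmul (gmul f g) h = gmul f (gmul g h)"
  by (cases f; cases g; cases h) (simp add: gmul_def algebra_simps)

lemma gmul_1: "gmul (1, 0, 0, 1) g = g" "gmul g (1, 0, 0, 1) = g"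
  by (cases g; simp add: gmul_def)+

lemma ginv_GK: "g \<in> GK \<Longrightarrow> ginv g \<in> GK"
  by (auto simp: GK_def ginv_def mult.commute)

lemma act_ginv: "g \<in> GK \<Longrightarrow> z \<in> HH \<Longrightarrow> act (ginv g) (act g z) = z \<and> act g (act (ginv g) z) = z"
  by (simp add: act_gmul ginv_GK gmul_ginv act_1)

lemma act_preserving:
  assumes "g \<in> GK"
  shows "act g \<in> measurable HH_vol HH_vol"
    "A \<in> sets HH_vol \<Longrightarrow> emeasure HH_vol (act g -` A \<inter> HH) = emeasure HH_vol A"
proof -
  obtain a b c d where g: "g = (a, b, c, d)" "a * d - b * c = 1" "cj a * cj d - cj b * cj c = 1"
    using assms by (rule GK_E)
  have e: "act g = (\<lambda>z. (mob a b c d (fst z), mob (cj a) (cj b) (cj c) (cj d) (snd z)))" by (simp add: act_def g)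
  note p = HH_vol_preserving[OF area_preserving_mob[OF g(2)] area_preserving_mob[OF g(3)]]
  show "act g \<in> measurable HH_vol HH_vol" unfolding e by (rule p(1))
  show "A \<in> sets HH_vol \<Longrightarrow> emeasure HH_vol (act g -` A \<inter> HH) = emeasure HH_vol A" unfolding e by (rule p(2))
qed

lemma act_vimage_Times:
  assumes "g \<in> GK" "A \<in> sets hyp_area" "B \<in> sets hyp_area"
  shows "act g -` (A \<times> B) \<inter> HH \<in> sets HH_vol"
    "emeasure HH_vol (act g -` (A \<times> B) \<inter> HH) = emeasure hyp_area A * emeasure hyp_area B"
  using measurable_sets[OF act_preserving(1)[OF assms(1)] emeasure_HH_vol_Times(1)[OF assms(2,3)]]
    act_preserving(2)[OF assms(1) emeasure_HH_vol_Times(1)[OF assms(2,3)]] emeasure_HH_vol_Times(2)[OF assms(2,3)]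
  by auto

lemma countable_Gam: "countable Gam"
proof (rule countable_subset)
  show "Gam \<subseteq> Zs \<times> Zs \<times> Zs \<times> Zs" by (auto simp: Gam_def)
  show "countable (Zs \<times> Zs \<times> Zs \<times> Zs)" using countable_Zs by simp
qed

subsection \<open>The quotient\<close>

abbreviation orb :: "complex \<times> complex \<Rightarrow> (complex \<times> complex) set" where
  "orb \<equiv> orbit (hilbert_act K) (hilbert_modular_group K)"

definition entries :: "real^2^2 \<Rightarrow> real \<times> real \<times> real \<times> real" where
  "entries A = (A$1$1, A$1$2, A$2$1, A$2$2)"

lemma hilbert_act_entries: "A \<in> SL2 Zs \<Longrightarrow> hilbert_act K A z = act (entries A) z"
  by (simp add: hilbert_act_def moebius_mob act_def entries_def SL2_def first_embedding_K second_embedding_K Zs_K)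

lemma entries_SL2: "entries ` SL2 Zs = Gam"
proof (intro equalityI subsetI)
  fix g assume "g \<in> entries ` SL2 Zs"
  then show "g \<in> Gam" by (auto simp: entries_def SL2_def Gam_def det_2)
next
  fix g assume "g \<in> Gam"
  then obtain a b c d where g: "g = (a, b, c, d)" "a \<in> Zs" "b \<in> Zs" "c \<in> Zs" "d \<in> Zs" "a * d - b * c = 1"
    by (auto simp: Gam_def)
  let ?A = "vector [vector [a, b], vector [c, d]] :: real^2^2"
  have "?A \<in> SL2 Zs" using g by (simp add: SL2_def forall_2 det_2)
  moreover have "entries ?A = g" by (simp add: entries_def g)
  ultimately show "g \<in> entries ` SL2 Zs" by (metis imageI)
qed

lemma orb_eq: "orb z = (\<lambda>g. act g z) ` Gam"
  unfolding orbit_def ring_of_integers_K entries_SL2[symmetric] image_image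
  by (rule image_cong) (simp_all add: hilbert_act_entries)

lemma orb_self: "z \<in> HH \<Longrightarrow> z \<in> orb z"
  unfolding orb_eq by (rule image_eqI[of _ _ "(1, 0, 0, 1)"]) (auto simp: act_1 Gam_def)

lemma orb_act: assumes g: "g \<in> Gam" and z: "z \<in> HH" shows "orb (act g z) = orb z"
proof -
  have sub: "orb (act g z) \<subseteq> orb z" if "g \<in> Gam" "z \<in> HH" for g z
    unfolding orb_eq using that by (auto simp: act_gmul Gam_GK intro!: image_eqI[OF _ gmul_Gam])
  have "orb (act (ginv g) (act g z)) \<subseteq> orb (act g z)"
    using g z by (intro sub ginv_Gam act_HH Gam_GK)
  then show ?thesis using sub[OF g z] act_ginv[OF Gam_GK[OF g] z] by auto
qed

lemma orb_eqD: "z \<in> HH \<Longrightarrow> orb w = orb z \<Longrightarrow> \<exists>g\<in>Gam. z = act g w"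
  using orb_self[of z] by (auto simp: orb_eq)

text \<open>The quotient volume is a supremum over sets \<open>U\<close> meeting each orbit at most
  once, and \<open>emeasure_le_sum_cover\<close> bounds each of them.\<close>

lemma hilbert_vol_le:
  assumes I: "finite I" and S: "\<And>i. i \<in> I \<Longrightarrow> S i \<in> sets HH_vol"
    and cov: "\<And>z. z \<in> HH \<Longrightarrow> orb z \<in> B \<Longrightarrow> \<exists>i\<in>I. \<exists>g\<in>Gam. act g z \<in> S i"
  shows "emeasure (hilbert_modular_vol K) B \<le> (\<Sum>i\<in>I. emeasure HH_vol (S i))"
proof (cases "B \<in> sets (hilbert_modular_vol K)")
  case True
  then have "emeasure (hilbert_modular_vol K) B = quotient_volume (hilbert_act K) (hilbert_modular_group K) HH_vol B"
    unfolding hilbert_modular_vol_def by (rule emeasure_quotient_measure)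
  also have "\<dots> \<le> (\<Sum>i\<in>I. emeasure HH_vol (S i))"
    unfolding quotient_volume_def
  proof (rule SUP_least)
    fix U assume "U \<in> {U \<in> sets HH_vol. orb ` U \<subseteq> B \<and> inj_on orb U}"
    then have U: "U \<in> sets HH_vol" "orb ` U \<subseteq> B" "inj_on orb U" by auto
    have UH: "U \<subseteq> HH" using sets.sets_into_space[OF U(1)] by simp
    show "emeasure HH_vol U \<le> (\<Sum>i\<in>I. emeasure HH_vol (S i))"
    proof (rule emeasure_le_sum_cover[where \<Gamma> = Gam and act = act])
      show "\<exists>h\<in>Gam. \<forall>x\<in>space HH_vol. act h (act g x) = x \<and> act g (act h x) = x" if "g \<in> Gam" for g
        unfolding space_HH_vol using act_ginv[OF Gam_GK[OF that]] ginv_Gam[OF that] by blast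
      show "u = v" if "g \<in> Gam" "h \<in> Gam" "u \<in> U" "v \<in> U" "act g u = act h v" for g h u v
        using that orb_act[of g u] orb_act[of h v] UH inj_onD[OF U(3)] by (metis subsetD)
      show "\<exists>i\<in>I. \<exists>g\<in>Gam. act g u \<in> S i" if "u \<in> U" for u using that U(2) UH cov by blast
    qed (use countable_Gam act_preserving Gam_GK U I S in auto)
  qed
  finally show ?thesis .
next
  \<comment> \<open>The measure of a non-measurable set is 0 by convention, so \<open>B\<close> may
    be any set, in particular a thin part.\<close>
  case False
  then show ?thesis by (simp add: emeasure_notin_sets)
qed

lemma hilbert_vol_ge:
  assumes U: "U \<in> sets HH_vol" and inj: "\<And>g u. g \<in> Gam \<Longrightarrow> u \<in> U \<Longrightarrow> act g u \<in> U \<Longrightarrow> act g u = u"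
  shows "emeasure HH_vol U \<le> emeasure (hilbert_modular_vol K) (hilbert_modular_surface K)"
proof -
  have UH: "U \<subseteq> HH" using sets.sets_into_space[OF U] by simp
  have sp: "hilbert_modular_surface K = space (hilbert_modular_vol K)"
    by (simp add: hilbert_modular_surface_def hilbert_modular_vol_def)
  have "inj_on orb U"
  proof (rule inj_onI)
    fix u v assume uv: "u \<in> U" "v \<in> U" "orb u = orb v"
    then have "v \<in> HH" using UH by blast
    then obtain g where "g \<in> Gam" "v = act g u" using orb_eqD[of v u] uv(3) by blast
    then show "u = v" using inj uv by metis
  qed
  then have "emeasure HH_vol U \<le> quotient_volume (hilbert_act K) (hilbert_modular_group K) HH_vol (hilbert_modular_surface K)"
    unfolding quotient_volume_def using U UH
    by (intro SUP_upper) (auto simp: hilbert_modular_surface_def quotient_space_def)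
  also have "\<dots> = emeasure (hilbert_modular_vol K) (hilbert_modular_surface K)"
    unfolding hilbert_modular_vol_def
    by (rule emeasure_quotient_measure[symmetric]) (metis sp hilbert_modular_vol_def sets.top)
  finally show ?thesis .
qed

text \<open>The injectivity radius is evaluated at an arbitrarily selected lift, which
  \<open>h\<close> reaches from \<open>z\<close>. The infimum, at most \<open>2 * R\<close>, need
  not be attained; the slack 1 provides an actual group element.\<close>

lemma thin_point:
  assumes z: "z \<in> HH" and t: "orb z \<in> thin_part K R"
  shows "\<exists>h\<in>Gam. \<exists>g\<in>Gam. g \<noteq> (1, 0, 0, 1) \<and> g \<noteq> (-1, 0, 0, -1) \<and> HH_dist (act h z) (act g (act h z)) < 2 * R + 1"
proof -
  define w where "w = (SOME w. w \<in> HH \<and> orb w = orb z)"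
  have w: "w \<in> HH" "orb w = orb z" using someI[of "\<lambda>w. w \<in> HH \<and> orb w = orb z" z] z by (auto simp: w_def)
  obtain h where h: "h \<in> Gam" "w = act h z" using orb_eqD[OF w(1) w(2)[symmetric]] by blast
  let ?G = "{\<gamma> \<in> hilbert_modular_group K. \<exists>y\<in>HH. hilbert_act K \<gamma> y \<noteq> y}"
  have "injectivity_radius K (orb z) \<le> R" using t by (simp add: thin_part_def)
  then have lt: "(INF \<gamma>\<in>?G. HH_dist w (hilbert_act K \<gamma> w)) < 2 * R + 1"
    unfolding injectivity_radius_def w_def[symmetric] Let_def by simp
  \<comment> \<open>A bound on an infimum yields an element only for a non-empty set; the
    translation by 1 is a witness.\<close>
  have "?G \<noteq> {}"
  proof -
    have "(1, 1, 0, 1) \<in> entries ` SL2 Zs" unfolding entries_SL2 by (simp add: Gam_def)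
    then obtain A where A: "A \<in> SL2 Zs" "entries A = (1, 1, 0, 1)" by (metis imageE)
    have "hilbert_act K A (\<i>, \<i>) \<noteq> (\<i>, \<i>)" using A by (simp add: hilbert_act_entries act_def mob_def)
    moreover have "(\<i>, \<i>) \<in> HH" by (simp add: HH_iff UH_iff)
    ultimately show ?thesis using A(1) ring_of_integers_K by auto
  qed
  then obtain \<gamma> where \<gamma>: "\<gamma> \<in> ?G" "HH_dist w (hilbert_act K \<gamma> w) < 2 * R + 1"
    using cInf_lessD[OF _ lt] by auto
  then have S: "\<gamma> \<in> SL2 Zs" using ring_of_integers_K by auto
  have "entries \<gamma> \<in> Gam" using S entries_SL2 by blast
  moreover have "entries \<gamma> \<noteq> (1, 0, 0, 1)" "entries \<gamma> \<noteq> (-1, 0, 0, -1)"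
  proof -
    have m: "mob (-1) 0 0 (-1) z = z" for z by (simp add: mob_def)
    have c: "cj (- 1) = - 1" using cj_of_int[of "-1"] by simp
    show "entries \<gamma> \<noteq> (1, 0, 0, 1)" "entries \<gamma> \<noteq> (-1, 0, 0, -1)"
      using \<gamma>(1) hilbert_act_entries[OF S] by (auto simp: act_1 act_def mob_id m c)
  qed
  ultimately show ?thesis using \<gamma>(2) h hilbert_act_entries[OF S] by auto
qed

lemma HH_dist_near:
  assumes "z \<in> HH" "w \<in> HH" "HH_dist z w < r" "\<kappa> = 2 * (cosh r - 1)"
  shows "near \<kappa> (fst z) (fst w) \<and> near \<kappa> (snd z) (snd w)"
proof -
  have "hyp_dist (fst z) (fst w) \<le> HH_dist z w" "hyp_dist (snd z) (snd w) \<le> HH_dist z w"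
    unfolding HH_dist_def by (intro real_le_rsqrt; simp)+
  then show ?thesis using assms by (intro conjI near_if_dist[of _ _ r]) (auto simp: HH_iff)
qed

subsection \<open>Cusp coordinates\<close>

text \<open>The data of a matrix \<open>(y, - x, c, d)\<close> of determinant 1 whose upper row lies
  in the inverse of the ideal of the lower row. This is what keeps the diagonal integral in
  \<open>conjugate_to_cusp\<close>.\<close>

definition cusp :: "real \<Rightarrow> real \<Rightarrow> real \<Rightarrow> real \<Rightarrow> bool" where
  "cusp c d x y \<longleftrightarrow> c \<in> Zs \<and> d \<in> Zs \<and> (c \<noteq> 0 \<or> d \<noteq> 0) \<and> x \<in> inv1 c d \<and> y \<in> inv1 c d \<and> x * c + y * d = 1"

text \<open>For every ideal with two generators one pair of generators \<open>(c, d)\<close> is selected; \<open>(c, d)\<close> is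
  the bottom row of the matrix \<open>cusp_matrix\<close>, which moves the cusp \<open>- d / c\<close> to infinity.\<close>

definition cusp_matrix :: "real set \<Rightarrow> real \<times> real \<times> real \<times> real" where
  "cusp_matrix a = (SOME g. \<exists>c d x y. cusp c d x y \<and> idl c d = a \<and> g = (y, - x, c, d))"

lemma cuspD:
  assumes "cusp c d x y"
  shows "c \<in> Zs" "d \<in> Zs" "c \<noteq> 0 \<or> d \<noteq> 0" "x \<in> inv1 c d" "y \<in> inv1 c d" "x * c + y * d = 1"
    "x \<in> K" "y \<in> K" "c \<in> K" "d \<in> K" "x * c \<in> Zs" "x * d \<in> Zs" "y * c \<in> Zs" "y * d \<in> Zs"
  using assms by (auto simp: cusp_def inv1_def Zs_K)

lemma cusp_GK: "cusp c d x y \<Longrightarrow> (y, - x, c, d) \<in> GK"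
  using cuspD[of c d x y] by (simp add: GK_def algebra_simps)

lemma cusp_matrix:
  assumes cd: "c \<in> Zs" "d \<in> Zs" "c \<noteq> 0 \<or> d \<noteq> 0"
  shows "\<exists>c' d' x y. cusp c' d' x y \<and> idl c' d' = idl c d \<and> cusp_matrix (idl c d) = (y, - x, c', d')"
proof -
  obtain x y where "x \<in> inv1 c d" "y \<in> inv1 c d" "x * c + y * d = 1" using bezout_inv1[OF cd] by blast
  then have "cusp c d x y" using cd by (simp add: cusp_def)
  then have "\<exists>g c' d' x y. cusp c' d' x y \<and> idl c' d' = idl c d \<and> g = (y, - x, c', d')" by blast
  then show ?thesis unfolding cusp_matrix_def by (rule someI_ex)
qed

lemma J_act:
  assumes "h = (\<alpha>, \<beta>, \<gamma>, \<delta>)" "h \<in> GK" "z \<in> HH" "c \<in> K" "d \<in> K"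
  shows "J c d (fst (act h z)) = J (c * \<alpha> + d * \<gamma>) (c * \<beta> + d * \<delta>) (fst z)"
    "J (cj c) (cj d) (snd (act h z)) = J (cj (c * \<alpha> + d * \<gamma>)) (cj (c * \<beta> + d * \<delta>)) (snd z)"
proof -
  have h: "\<alpha> \<in> K" "\<beta> \<in> K" "\<gamma> \<in> K" "\<delta> \<in> K" "\<alpha> * \<delta> - \<beta> * \<gamma> = 1" using assms by (auto simp: GK_def)
  show "J c d (fst (act h z)) = J (c * \<alpha> + d * \<gamma>) (c * \<beta> + d * \<delta>) (fst z)"
    "J (cj c) (cj d) (snd (act h z)) = J (cj (c * \<alpha> + d * \<gamma>)) (cj (c * \<beta> + d * \<delta>)) (snd z)"
    using assms h cj_det[OF h] by (simp_all add: act_def J_mob HH_iff)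
qed

lemma Im_cusp:
  assumes "cusp c d x y" "z \<in> HH"
  shows "Im (fst (act (y, - x, c, d) z)) = 1 / J c d (fst z)"
    "Im (snd (act (y, - x, c, d) z)) = 1 / J (cj c) (cj d) (snd z)"
proof -
  have K: "y \<in> K" "- x \<in> K" "c \<in> K" "d \<in> K" "y * d - (- x) * c = 1" using cuspD[OF assms(1)] by (auto simp: algebra_simps)
  show "Im (fst (act (y, - x, c, d) z)) = 1 / J c d (fst z)"
    "Im (snd (act (y, - x, c, d) z)) = 1 / J (cj c) (cj d) (snd z)"
    using assms K(5) cj_det[OF K] unfolding act_def by (simp_all add: Im_mob_J HH_iff)
qed

text \<open>\<open>h\<close> is the matrix of \<open>SL2_transitive\<close> that turns the selected
  row \<open>(c', d')\<close> into \<open>(c, d)\<close>. Thus bounds on \<open>J\<close> found for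
  any pair become bounds on the heights in the selected coordinates of its ideal.\<close>

lemma move_to_cusp:
  assumes cd: "c \<in> Zs" "d \<in> Zs" "c \<noteq> 0 \<or> d \<noteq> 0" and cs: "cusp c' d' x y" and e: "idl c' d' = idl c d"
  shows "\<exists>h\<in>Gam. \<exists>\<alpha> \<beta> \<gamma> \<delta>. h = (\<alpha>, \<beta>, \<gamma>, \<delta>) \<and> c' * \<alpha> + d' * \<gamma> = c \<and> c' * \<beta> + d' * \<delta> = d \<and>
    (\<forall>z\<in>HH. Im (fst (act (y, - x, c', d') (act h z))) = 1 / J c d (fst z) \<and>
            Im (snd (act (y, - x, c', d') (act h z))) = 1 / J (cj c) (cj d) (snd z))"
proof -
  note C = cuspD[OF cs]
  obtain \<alpha> \<beta> \<gamma> \<delta> where h: "\<alpha> \<in> Zs" "\<beta> \<in> Zs" "\<gamma> \<in> Zs" "\<delta> \<in> Zs" "\<alpha> * \<delta> - \<beta> * \<gamma> = 1"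
    "c' * \<alpha> + d' * \<gamma> = c" "c' * \<beta> + d' * \<delta> = d"
    using SL2_transitive[OF C(1-3) cd e] by blast
  have G: "(\<alpha>, \<beta>, \<gamma>, \<delta>) \<in> Gam" using h by (simp add: Gam_def)
  show ?thesis
  proof (intro bexI[OF _ G] exI conjI ballI)
    fix z assume z: "z \<in> HH"
    note I = Im_cusp[OF cs act_HH[OF Gam_GK[OF G] z]] and JJ = J_act[OF refl Gam_GK[OF G] z C(9,10)]
    show "Im (fst (act (y, - x, c', d') (act (\<alpha>, \<beta>, \<gamma>, \<delta>) z))) = 1 / J c d (fst z)"
      unfolding I(1) JJ(1) h ..
    show "Im (snd (act (y, - x, c', d') (act (\<alpha>, \<beta>, \<gamma>, \<delta>) z))) = 1 / J (cj c) (cj d) (snd z)"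
      unfolding I(2) JJ(2) h ..
  qed (use h in auto)
qed

lemma cusp_translation:
  assumes cs: "cusp c d x y" and t: "t \<in> inv2 c d"
  shows "\<exists>h\<in>Gam. \<forall>z\<in>HH. act (y, - x, c, d) (act h z) =
    (of_real t + fst (act (y, - x, c, d) z), of_real (cj t) + snd (act (y, - x, c, d) z))"
proof -
  note C = cuspD[OF cs]
  have tK: "t \<in> K" "t * (c * c) \<in> Zs" "t * (c * d) \<in> Zs" "t * (d * d) \<in> Zs" using t by (auto simp: inv2_def)
  \<comment> \<open>\<open>?h\<close> is the translation by \<open>t\<close> conjugated back by
    \<open>?g\<close>; the three conditions in \<open>inv2\<close> make its entries
    integral.\<close>
  let ?g = "(y, - x, c, d)" and ?h = "(1 + t * (c * d), t * (d * d), - (t * (c * c)), 1 - t * (c * d))"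
  have h: "?h \<in> Gam" using tK by (simp add: Gam_def algebra_simps)
  have n: "(1, t, 0, 1) \<in> GK" using tK by (simp add: GK_def)
  have g: "?g \<in> GK" by (rule cusp_GK[OF cs])
  have e: "gmul ?g ?h = gmul (1, t, 0, 1) ?g"
  proof -
    have "y * (t * (c * d)) + x * (t * (c * c)) = t * c * (x * c + y * d)"
      "y * (t * (d * d)) + x * (t * (c * d)) = t * d * (x * c + y * d)" by (simp_all add: algebra_simps)
    then have "y * (t * (c * d)) + x * (t * (c * c)) = t * c" "y * (t * (d * d)) + x * (t * (c * d)) = t * d"
      using C(6) by simp_all
    then show ?thesis by (simp add: gmul_def algebra_simps)
  qed
  show ?thesis
  proof (intro bexI[OF _ h] ballI)
    fix z assume z: "z \<in> HH"
    have "act ?g (act ?h z) = act (gmul (1, t, 0, 1) ?g) z" using act_gmul[OF g Gam_GK[OF h] z] e by simp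
    also have "\<dots> = act (1, t, 0, 1) (act ?g z)" using act_gmul[OF n g z] by simp
    also have "\<dots> = (of_real t + fst (act ?g z), of_real (cj t) + snd (act ?g z))"
      by (simp add: act_def mob_def add.commute)
    finally show "act ?g (act ?h z) = (of_real t + fst (act ?g z), of_real (cj t) + snd (act ?g z))" .
  qed
qed

definition small_ideals :: "real set set" where
  "small_ideals = {idl c d | c d. c \<in> Zs \<and> d \<in> Zs \<and> (c \<noteq> 0 \<or> d \<noteq> 0) \<and> of_int (idl_norm c d) \<le> 4 * s}"

lemma idl_norm_in_idl: "c \<in> Zs \<Longrightarrow> d \<in> Zs \<Longrightarrow> of_int (idl_norm c d) \<in> idl c d"
proof -
  assume cd: "c \<in> Zs" "d \<in> Zs"
  obtain i j l where k: "real_of_int (idl_norm c d) =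
      of_int i * (c * cj c) + of_int j * (d * cj d) + of_int l * (c * cj d + d * cj c)"
    using idl_norm_generators[OF cd] by blast
  then have "real_of_int (idl_norm c d) = (of_int i * cj c + of_int l * cj d) * c + (of_int j * cj d + of_int l * cj c) * d"
    by (simp add: algebra_simps)
  then show ?thesis unfolding idl_def using cd
    by (intro CollectI exI[of _ "of_int i * cj c + of_int l * cj d"] exI[of _ "of_int j * cj d + of_int l * cj c"]) simp
qed

text \<open>An ideal of norm \<open>n\<close> contains \<open>n\<close> and hence belongs to
  \<open>ideals n\<close>.\<close>

lemma small_ideals_card:
  "finite small_ideals" "card small_ideals \<le> (\<Sum>n=1..nat \<lfloor>4 * s\<rfloor>. 7 * ndiv n ^ 3)"
proof -
  have sub: "small_ideals \<subseteq> (\<Union>n\<in>{1..nat \<lfloor>4 * s\<rfloor>}. ideals n)"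
  proof
    fix a assume "a \<in> small_ideals"
    then obtain c d where cd: "a = idl c d" "c \<in> Zs" "d \<in> Zs" "c \<noteq> 0 \<or> d \<noteq> 0" "of_int (idl_norm c d) \<le> 4 * s"
      by (auto simp: small_ideals_def)
    let ?n = "nat (idl_norm c d)"
    have "?n \<in> {1..nat \<lfloor>4 * s\<rfloor>}" using idl_norm_pos[OF cd(2-4)] cd(5) by (simp add: le_floor_iff nat_mono)
    moreover have "a \<in> ideals ?n"
      using isideal_idl[OF cd(2,3)] idl_norm_in_idl[OF cd(2,3)] idl_norm_pos[OF cd(2-4)] cd(1)
      by (simp add: ideals_def)
    ultimately show "a \<in> (\<Union>n\<in>{1..nat \<lfloor>4 * s\<rfloor>}. ideals n)" by blast
  qed
  have fin: "finite (\<Union>n\<in>{1..nat \<lfloor>4 * s\<rfloor>}. ideals n)" using ideals_finite_card by auto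
  then show "finite small_ideals" using sub finite_subset by blast
  have "card small_ideals \<le> card (\<Union>n\<in>{1..nat \<lfloor>4 * s\<rfloor>}. ideals n)" by (rule card_mono[OF fin sub])
  also have "\<dots> \<le> (\<Sum>n\<in>{1..nat \<lfloor>4 * s\<rfloor>}. card (ideals n))" by (rule card_UN_le) simp
  also have "\<dots> \<le> (\<Sum>n=1..nat \<lfloor>4 * s\<rfloor>. 7 * ndiv n ^ 3)" by (intro sum_mono) (use ideals_finite_card in auto)
  finally show "card small_ideals \<le> (\<Sum>n=1..nat \<lfloor>4 * s\<rfloor>. 7 * ndiv n ^ 3)" .
qed

lemma small_ideal_cusp:
  assumes "a \<in> small_ideals"
  obtains c d x y where "cusp c d x y" "idl c d = a" "cusp_matrix a = (y, - x, c, d)"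
  using assms cusp_matrix unfolding small_ideals_def by blast

subsection \<open>Finiteness of the volume\<close>

text \<open>Only translations by elements of \<open>l * Zs\<close> are used: after division by
  \<open>l\<close> and \<open>cj l\<close> this is \<open>Zs_translate_into_rectangle\<close>.
  Minima and maxima account for the unknown signs of \<open>l\<close> and
  \<open>cj l\<close>.\<close>

lemma cusp_region:
  assumes cs: "cusp c d x y" and z: "z \<in> HH" and l: "l \<in> inv2 c d" "l \<noteq> 0"
  shows "\<exists>h\<in>Gam. Re (fst (act (y, - x, c, d) (act h z))) \<in> {min 0 l..max 0 l} \<and>
    Re (snd (act (y, - x, c, d) (act h z))) \<in> {min (- 2 * s * cj l) (cj l)..max (- 2 * s * cj l) (cj l)} \<and>
    Im (fst (act (y, - x, c, d) (act h z))) = Im (fst (act (y, - x, c, d) z)) \<and>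
    Im (snd (act (y, - x, c, d) (act h z))) = Im (snd (act (y, - x, c, d) z))"
proof -
  have lK: "l \<in> K" using l by (simp add: inv2_def)
  have cl: "cj l \<noteq> 0" using l lK by simp
  let ?w = "act (y, - x, c, d) z"
  obtain t where t: "t \<in> Zs" "Re (fst ?w) / l + t \<in> {0..1}" "Re (snd ?w) / cj l + cj t \<in> {- 2 * s..1}"
    using Zs_translate_into_rectangle by blast
  obtain h where h: "h \<in> Gam" "act (y, - x, c, d) (act h z) = (of_real (t * l) + fst ?w, of_real (cj (t * l)) + snd ?w)"
    using cusp_translation[OF cs inv2_mult[OF l(1) t(1)]] z by blast
  have iv: "m * u \<in> {min (m * p) (m * q)..max (m * p) (m * q)}" if "u \<in> {p..q}" for m u p q :: real
    using that by (cases "m \<ge> 0") (auto simp: min_le_iff_disj le_max_iff_disj mult_left_mono mult_left_mono_neg)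
  have "l * (Re (fst ?w) / l + t) = Re (fst ?w) + t * l" using l by (simp add: field_simps)
  then have 1: "Re (fst ?w) + t * l \<in> {min 0 l..max 0 l}" using iv[OF t(2), of l] by simp
  have "cj l * (Re (snd ?w) / cj l + cj t) = Re (snd ?w) + cj (t * l)"
    using cl lK t(1) by (simp add: field_simps Zs_K)
  then have 2: "Re (snd ?w) + cj (t * l) \<in> {min (- 2 * s * cj l) (cj l)..max (- 2 * s * cj l) (cj l)}"
    using iv[OF t(3), of "cj l"] by (simp add: mult_ac)
  show ?thesis using 1 2 by (intro bexI[OF _ h(1)]) (simp add: h(2) add.commute)
qed

lemma cusp_set:
  assumes g: "g \<in> GK" and r: "a1 \<le> b1" "a2 \<le> b2" "h1 > 0" "h2 > 0"
  shows "act g -` (strip a1 b1 h1 \<times> strip a2 b2 h2) \<inter> HH \<in> sets HH_vol"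
    "emeasure HH_vol (act g -` (strip a1 b1 h1 \<times> strip a2 b2 h2) \<inter> HH) = ennreal ((b1 - a1) / h1 * ((b2 - a2) / h2))"
  using act_vimage_Times[OF g strip_area(1)[OF r(1,3)] strip_area(1)[OF r(2,4)]] strip_area(2)[OF r(1,3)] strip_area(2)[OF r(2,4)] r
  by (simp_all add: ennreal_mult[symmetric])

text \<open>A short vector, reduced to norm at most \<open>4 * s\<close>, places every point in one
  of finitely many cusp regions with heights at least \<open>1 / (6 * s)\<close> and widths
  \<open>1\<close> and \<open>2 * s + 1\<close>. Besides finiteness this settles the small
  \<open>p\<close>.\<close>

lemma total_volume_le:
  "emeasure (hilbert_modular_vol K) B \<le> ennreal (real (card small_ideals) * (36 * s\<^sup>2 * (2 * s + 1)))"
proof -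
  define S where "S a = act (cusp_matrix a) -` (strip 0 1 (1 / (6 * s)) \<times> strip (- 2 * s) 1 (1 / (6 * s))) \<inter> HH" for a
  have S: "S a \<in> sets HH_vol" "emeasure HH_vol (S a) = ennreal (36 * s\<^sup>2 * (2 * s + 1))" if a: "a \<in> small_ideals" for a
  proof -
    obtain c d x y where cs: "cusp c d x y" "cusp_matrix a = (y, - x, c, d)" using small_ideal_cusp[OF a] by metis
    note m = cusp_set[OF cusp_GK[OF cs(1)], of 0 1 "- 2 * s" 1 "1 / (6 * s)" "1 / (6 * s)"]
    show "S a \<in> sets HH_vol" unfolding S_def cs(2) by (rule m(1)) (use s_pos in auto)
    have "emeasure HH_vol (S a) = ennreal ((1 - 0) / (1 / (6 * s)) * ((1 - (- 2 * s)) / (1 / (6 * s))))"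
      unfolding S_def cs(2) by (rule m(2)) (use s_pos in auto)
    also have "(1 - 0) / (1 / (6 * s)) * ((1 - (- 2 * s)) / (1 / (6 * s))) = 36 * s\<^sup>2 * (2 * s + 1)"
      by (simp add: power2_eq_square algebra_simps)
    finally show "emeasure HH_vol (S a) = ennreal (36 * s\<^sup>2 * (2 * s + 1))" .
  qed
  have "emeasure (hilbert_modular_vol K) B \<le> (\<Sum>a\<in>small_ideals. emeasure HH_vol (S a))"
  proof (rule hilbert_vol_le[OF small_ideals_card(1) S(1)])
    fix z assume z: "z \<in> HH"
    let ?P = "\<lambda>c d. c \<in> Zs \<and> d \<in> Zs \<and> (c \<noteq> 0 \<or> d \<noteq> 0) \<and> J c d (fst z) \<le> 6 * s \<and> J (cj c) (cj d) (snd z) \<le> 6 * s"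
    obtain c0 d0 where ex: "?P c0 d0" using short_vector z by (metis HH_iff)
    have "\<exists>c d. ?P c d \<and> real_of_int (idl_norm c d) \<le> 4 * s"
    proof (rule exists_small_norm[of ?P])
      fix c d t assume h: "?P c d" "t \<in> K" "t \<noteq> 0" "\<bar>t\<bar> \<le> 1" "\<bar>cj t\<bar> \<le> 1" "t * c \<in> Zs" "t * d \<in> Zs"
      have "t\<^sup>2 \<le> 1" "(cj t)\<^sup>2 \<le> 1" using h by (simp_all add: abs_square_le_1)
      moreover have "0 \<le> J c d (fst z)" "0 \<le> J (cj c) (cj d) (snd z)" using z J_nonneg by (auto simp: HH_iff)
      ultimately have "t\<^sup>2 * J c d (fst z) \<le> 6 * s" "(cj t)\<^sup>2 * J (cj c) (cj d) (snd z) \<le> 6 * s"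
        using h(1) by (meson mult_left_le_one_le order_trans zero_le_power2)+
      then show "?P (t * c) (t * d)" using h Zs_K by (auto simp: J_scale)
    qed (use ex in auto)
    then obtain c d where cd: "?P c d" "real_of_int (idl_norm c d) \<le> 4 * s" by blast
    let ?a = "idl c d"
    have a: "?a \<in> small_ideals" unfolding small_ideals_def using cd by blast
    obtain c' d' x y where cs: "cusp c' d' x y" "idl c' d' = ?a" "cusp_matrix ?a = (y, - x, c', d')"
      using small_ideal_cusp[OF a] by metis
    obtain h where h: "h \<in> Gam" "Im (fst (act (y, - x, c', d') (act h z))) = 1 / J c d (fst z)"
       "Im (snd (act (y, - x, c', d') (act h z))) = 1 / J (cj c) (cj d) (snd z)"
      using move_to_cusp[OF _ _ _ cs(1,2)] cd(1) z by meson
    have hz: "act h z \<in> HH" using act_HH[OF Gam_GK[OF h(1)] z] .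
    obtain h' where h': "h' \<in> Gam" "Re (fst (act (y, - x, c', d') (act h' (act h z)))) \<in> {min 0 1..max 0 1}"
      "Re (snd (act (y, - x, c', d') (act h' (act h z)))) \<in> {min (- 2 * s * cj 1) (cj 1)..max (- 2 * s * cj 1) (cj 1)}"
      "Im (fst (act (y, - x, c', d') (act h' (act h z)))) = 1 / J c d (fst z)"
      "Im (snd (act (y, - x, c', d') (act h' (act h z)))) = 1 / J (cj c) (cj d) (snd z)"
      using cusp_region[OF cs(1) hz Zs_inv2[OF cuspD(1,2)[OF cs(1)] Zs_1]] unfolding h by auto
    have "J c d (fst z) > 0" "J (cj c) (cj d) (snd z) > 0"
      using cd(1) z Zs_K by (auto intro!: J_pos simp: HH_iff)
    then have "1 / (6 * s) \<le> 1 / J c d (fst z)" "1 / (6 * s) \<le> 1 / J (cj c) (cj d) (snd z)"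
      using cd(1) by (auto intro!: divide_left_mono mult_pos_pos s_pos)
    then have "act (gmul h' h) z \<in> S ?a"
      using h' act_HH[OF Gam_GK[OF gmul_Gam[OF h'(1) h(1)]] z] s_pos
      unfolding act_gmul[OF Gam_GK[OF h'(1)] Gam_GK[OF h(1)] z, symmetric]
      by (simp add: S_def cs(3) strip_def mem_Times_iff)
    then show "\<exists>a\<in>small_ideals. \<exists>g\<in>Gam. act g z \<in> S a" using a gmul_Gam[OF h'(1) h(1)] by blast
  qed
  also have "\<dots> = ennreal (real (card small_ideals) * (36 * s\<^sup>2 * (2 * s + 1)))"
    using S(2) s_pos by (simp add: ennreal_of_nat_eq_real_of_nat ennreal_mult)
  finally show ?thesis .
qed

text \<open>The conjugates of \<open>u + v * s\<close> differ by \<open>2 * v * s\<close>, which has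
  size at least \<open>2 * s\<close> unless \<open>v = 0\<close>.\<close>

lemma bounded_Zs_Ints:
  assumes T: "T \<in> Zs" "\<bar>T\<bar> \<le> b" "\<bar>cj T\<bar> \<le> b" "b < s"
  shows "\<exists>t. T = of_int t \<and> cj T = of_int t"
proof -
  obtain u v where uv: "T = of_int u + of_int v * s" "cj T = of_int u - of_int v * s" using T(1) by (rule Zs_E)
  have "2 * (\<bar>real_of_int v\<bar> * s) = \<bar>T - cj T\<bar>" unfolding uv(2) unfolding uv(1) using s_pos by (simp add: abs_mult)
  then have "\<bar>real_of_int v\<bar> * s < 1 * s" using T by linarith
  then have "\<bar>real_of_int v\<bar> < 1" using s_pos by (simp only: mult_less_cancel_right_pos)
  then have "v = 0" by linarith
  then show ?thesis using uv by simp
qed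

subsection \<open>Matrices in cusp coordinates\<close>

text \<open>Conjugation by the cusp matrix of an ideal sends the modular group to matrices with
  integral diagonal, upper right entry in the inverse square of the ideal and lower left entry in
  the square. The latter is recorded as integrality of \<open>e * \<tau>\<close>.\<close>

lemma conjugate_to_cusp:
  assumes cs: "cusp c d x y" and \<gamma>: "(p', q, r, u) \<in> Gam"
  defines "A \<equiv> (y * p' - x * r) * d - (y * q - x * u) * c"
    and "B \<equiv> (y * p' - x * r) * x + (y * q - x * u) * y"
    and "e \<equiv> (c * p' + d * r) * d - (c * q + d * u) * c"
    and "k \<equiv> (c * p' + d * r) * x + (c * q + d * u) * y"
  shows "A * k - B * e = 1" "A \<in> Zs" "B \<in> inv2 c d" "e \<in> Zs" "k \<in> Zs" "A + k = p' + u"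
    "e \<in> idl c d" "\<And>\<tau>. \<tau> \<in> inv2 c d \<Longrightarrow> e * \<tau> \<in> Zs"
    "(A, B, e, k) \<in> GK"
    "\<And>z. z \<in> HH \<Longrightarrow> act (A, B, e, k) (act (y, - x, c, d) z) = act (y, - x, c, d) (act (p', q, r, u) z)"
proof -
  note C = cuspD[OF cs]
  have G: "p' \<in> Zs" "q \<in> Zs" "r \<in> Zs" "u \<in> Zs" "p' * u - q * r = 1" using \<gamma> by (auto simp: Gam_def)
  have GZ: "(p', q, r, u) \<in> GK" using Gam_GK[OF \<gamma>] .
  have gG: "(y, - x, c, d) \<in> GK" by (rule cusp_GK[OF cs])
  have m: "gmul (gmul (y, - x, c, d) (p', q, r, u)) (ginv (y, - x, c, d)) = (A, B, e, k)"
    by (simp add: gmul_def ginv_def A_def B_def e_def k_def algebra_simps)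
  show M: "(A, B, e, k) \<in> GK" unfolding m[symmetric] by (intro gmul_GK ginv_GK gG GZ)
  then show det: "A * k - B * e = 1" by (simp add: GK_def)
  have A: "A = p' * (y * d) - r * (x * d) - q * (y * c) + u * (x * c)" unfolding A_def by (simp add: algebra_simps)
  show "A \<in> Zs" unfolding A using G C by simp
  have k: "k = p' * (x * c) + r * (x * d) + q * (y * c) + u * (y * d)" unfolding k_def by (simp add: algebra_simps)
  show "k \<in> Zs" unfolding k using G C by simp
  have e: "e = p' * (c * d) + r * (d * d) - q * (c * c) - u * (c * d)" unfolding e_def by (simp add: algebra_simps)
  show "e \<in> Zs" unfolding e using G C by simp
  have "e = (p' * d - q * c - u * d) * c + (r * d) * d" unfolding e by (simp add: algebra_simps)
  moreover have "p' * d - q * c - u * d \<in> Zs" "r * d \<in> Zs" using G C by simp_all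
  ultimately show "e \<in> idl c d" unfolding idl_def by blast
  show "e * \<tau> \<in> Zs" if t: "\<tau> \<in> inv2 c d" for \<tau>
  proof -
    have "e * \<tau> = p' * (\<tau> * (c * d)) + r * (\<tau> * (d * d)) - q * (\<tau> * (c * c)) - u * (\<tau> * (c * d))"
      unfolding e by (simp add: algebra_simps)
    then show ?thesis using t G by (simp add: inv2_def)
  qed
  have "A + k = (p' + u) * (x * c + y * d)" unfolding A k by (simp add: algebra_simps)
  then show "A + k = p' + u" using C(6) by simp
  have BK: "B \<in> K" using M by (simp add: GK_def)
  have "B * (c * c) = p' * ((x * c) * (y * c)) - r * ((x * c) * (x * c)) + q * ((y * c) * (y * c)) - u * ((x * c) * (y * c))"
    "B * (c * d) = p' * ((x * c) * (y * d)) - r * ((x * c) * (x * d)) + q * ((y * c) * (y * d)) - u * ((x * c) * (y * d))"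
    "B * (d * d) = p' * ((x * d) * (y * d)) - r * ((x * d) * (x * d)) + q * ((y * d) * (y * d)) - u * ((x * d) * (y * d))"
    unfolding B_def by (simp_all add: algebra_simps)
  then show "B \<in> inv2 c d" unfolding inv2_def using G C BK by simp
  show "act (A, B, e, k) (act (y, - x, c, d) z) = act (y, - x, c, d) (act (p', q, r, u) z)" if z: "z \<in> HH" for z
  proof -
    have "gmul (A, B, e, k) (y, - x, c, d) = gmul (y, - x, c, d) (p', q, r, u)"
      unfolding m[symmetric] gmul_assoc gmul_ginv(2)[OF gG] gmul_1 ..
    then show ?thesis using act_gmul[OF M gG z] act_gmul[OF gG GZ z] by simp
  qed
qed

definition nearHH :: "real \<Rightarrow> complex \<times> complex \<Rightarrow> complex \<times> complex \<Rightarrow> bool" where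
  "nearHH \<kappa> z w \<longleftrightarrow> near \<kappa> (fst z) (fst w) \<and> near \<kappa> (snd z) (snd w)"

lemma nearHH_act: "g \<in> GK \<Longrightarrow> z \<in> HH \<Longrightarrow> w \<in> HH \<Longrightarrow> nearHH \<kappa> z w \<Longrightarrow> nearHH \<kappa> (act g z) (act g w)"
  by (elim GK_E) (simp add: nearHH_def act_def near_mob HH_iff)

lemma conjugate_near:
  assumes "g \<in> Gam" "h \<in> Gam" "z \<in> HH" "nearHH \<kappa> z (act g z)"
  shows "gmul (gmul h g) (ginv h) \<in> Gam" "nearHH \<kappa> (act h z) (act (gmul (gmul h g) (ginv h)) (act h z))"
proof -
  show G: "gmul (gmul h g) (ginv h) \<in> Gam" using assms by (intro gmul_Gam ginv_Gam)
  have hz: "act h z \<in> HH" "act g z \<in> HH" using assms by (auto intro: act_HH Gam_GK)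
  have "gmul (gmul (gmul h g) (ginv h)) h = gmul h g"
    using gmul_ginv(2)[OF Gam_GK[OF assms(2)]] by (simp add: gmul_assoc gmul_1)
  then have "act (gmul (gmul h g) (ginv h)) (act h z) = act h (act g z)"
    using assms act_gmul[OF Gam_GK[OF G] Gam_GK[OF assms(2)] assms(3)] act_gmul[OF Gam_GK[OF assms(2)] Gam_GK[OF assms(1)] assms(3)]
    by simp
  then show "nearHH \<kappa> (act h z) (act (gmul (gmul h g) (ginv h)) (act h z))"
    using nearHH_act[OF Gam_GK[OF assms(2)] assms(3) hz(2) assms(4)] by simp
qed

definition trace :: "real \<times> real \<times> real \<times> real \<Rightarrow> real" where
  "trace = (\<lambda>(a, b, c, d). a + d)"

lemma trace_conj: "h \<in> GK \<Longrightarrow> trace (gmul (gmul h g) (ginv h)) = trace g"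
proof -
  assume "h \<in> GK"
  then obtain a b c d where h: "h = (a, b, c, d)" "a * d - b * c = 1" by (rule GK_E)
  obtain p' q r u where g: "g = (p', q, r, u)" by (cases g)
  have "trace (gmul (gmul h g) (ginv h)) = (a * d - b * c) * (p' + u)"
    unfolding g h(1) by (simp add: trace_def gmul_def ginv_def algebra_simps)
  then show ?thesis using h by (simp add: g trace_def)
qed

lemma displacement_bounds_HH:
  assumes M: "(A, B, e, k) \<in> GK" and w: "w \<in> HH" and n: "nearHH \<kappa> w (act (A, B, e, k) w)" and k0: "\<kappa> \<ge> 0"
  shows "\<bar>e\<bar> * Im (fst w) \<le> \<kappa> + 2" "\<bar>cj e\<bar> * Im (snd w) \<le> \<kappa> + 2"
    "\<bar>2 * e * Re (fst w) + k - A\<bar> \<le> \<kappa> + 2" "\<bar>2 * cj e * Re (snd w) + cj k - cj A\<bar> \<le> \<kappa> + 2"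
    "\<bar>A + k\<bar> \<le> 3 * (\<kappa> + 2)" "\<bar>cj A + cj k\<bar> \<le> 3 * (\<kappa> + 2)"
    "e = 0 \<Longrightarrow> \<bar>k\<bar> \<le> \<kappa> + 2" "e = 0 \<Longrightarrow> \<bar>cj k\<bar> \<le> \<kappa> + 2"
    "e = 0 \<Longrightarrow> A = k \<Longrightarrow> \<bar>B\<bar> \<le> (\<kappa> + 2) * Im (fst w)"
    "e = 0 \<Longrightarrow> A = k \<Longrightarrow> \<bar>cj B\<bar> \<le> (\<kappa> + 2) * Im (snd w)"
proof -
  have K: "A \<in> K" "B \<in> K" "e \<in> K" "k \<in> K" and det: "A * k - B * e = 1" using M by (auto simp: GK_def)
  have det': "cj A * cj k - cj B * cj e = 1" by (rule cj_det[OF K det])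
  have w': "fst w \<in> UH" "snd w \<in> UH" using w by (auto simp: HH_iff)
  have n': "near \<kappa> (fst w) (mob A B e k (fst w))" "near \<kappa> (snd w) (mob (cj A) (cj B) (cj e) (cj k) (snd w))"
    using n by (auto simp: nearHH_def act_def)
  note b1 = displacement_bounds[OF det w'(1) n'(1) k0] and b2 = displacement_bounds[OF det' w'(2) n'(2) k0]
  show "\<bar>e\<bar> * Im (fst w) \<le> \<kappa> + 2" "\<bar>cj e\<bar> * Im (snd w) \<le> \<kappa> + 2"
    "\<bar>2 * e * Re (fst w) + k - A\<bar> \<le> \<kappa> + 2" "\<bar>2 * cj e * Re (snd w) + cj k - cj A\<bar> \<le> \<kappa> + 2"
    "\<bar>A + k\<bar> \<le> 3 * (\<kappa> + 2)" "\<bar>cj A + cj k\<bar> \<le> 3 * (\<kappa> + 2)"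
    "e = 0 \<Longrightarrow> \<bar>k\<bar> \<le> \<kappa> + 2" "e = 0 \<Longrightarrow> \<bar>cj k\<bar> \<le> \<kappa> + 2"
    "e = 0 \<Longrightarrow> A = k \<Longrightarrow> \<bar>B\<bar> \<le> (\<kappa> + 2) * Im (fst w)"
    "e = 0 \<Longrightarrow> A = k \<Longrightarrow> \<bar>cj B\<bar> \<le> (\<kappa> + 2) * Im (snd w)"
    using b1 b2 by auto
qed

subsection \<open>The thin part away from the parabolic elements\<close>

text \<open>\<open>\<delta>\<close> times the inverse square of the ideal: the modulus of the
  quadratic congruence for the lower right entry.\<close>

definition bset :: "real \<Rightarrow> real \<Rightarrow> real \<Rightarrow> real set" where
  "bset c d \<delta> = {\<delta> * \<tau> | \<tau>. \<tau> \<in> inv2 c d}"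

definition abs_norm :: "real \<Rightarrow> nat" where "abs_norm \<delta> = nat \<lfloor>\<bar>\<delta> * cj \<delta>\<bar>\<rfloor>"

lemma abs_norm: assumes "\<delta> \<in> Zs" "\<delta> \<noteq> 0" shows "real (abs_norm \<delta>) = \<bar>\<delta> * cj \<delta>\<bar>" "abs_norm \<delta> > 0"
proof -
  obtain m :: int where m: "\<delta> * cj \<delta> = of_int m" using norm_Ints[OF assms(1)] by (rule Ints_cases)
  have "\<delta> * cj \<delta> \<noteq> 0" using assms Zs_K by simp
  then have "m \<noteq> 0" using m by auto
  have "\<lfloor>\<bar>\<delta> * cj \<delta>\<bar>\<rfloor> = \<bar>m\<bar>" unfolding m of_int_abs[symmetric] floor_of_int ..
  then show "real (abs_norm \<delta>) = \<bar>\<delta> * cj \<delta>\<bar>" "abs_norm \<delta> > 0" using m \<open>m \<noteq> 0\<close> unfolding abs_norm_def by auto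
qed

lemma abs_norm_multiple: assumes "\<delta> \<in> Zs" "\<delta> \<noteq> 0" shows "\<exists>r\<in>Zs. real (abs_norm \<delta>) = r * \<delta>"
proof (cases "\<delta> * cj \<delta> \<ge> 0")
  case True
  then show ?thesis using assms abs_norm(1)[OF assms] by (intro bexI[of _ "cj \<delta>"]) (auto simp: mult.commute)
next
  case False
  then show ?thesis using assms abs_norm(1)[OF assms] by (intro bexI[of _ "- cj \<delta>"]) (auto simp: mult.commute)
qed

definition good_reps :: "int \<Rightarrow> real \<Rightarrow> real set \<Rightarrow> real set \<Rightarrow> bool" where
  "good_reps t \<delta> a R \<longleftrightarrow> finite R \<and> card R \<le> 7 * ndiv (abs_norm \<delta>) ^ 3 * (nat \<bar>t\<^sup>2 - 4\<bar>)\<^sup>2 \<and> R \<subseteq> Zs \<and>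
    (case cusp_matrix a of (_, _, c, d) \<Rightarrow>
      \<forall>k\<in>Zs. k\<^sup>2 - of_int t * k + 1 \<in> bset c d \<delta> \<longrightarrow> (\<exists>\<kappa>0\<in>R. k - \<kappa>0 \<in> bset c d \<delta>))"

text \<open>A fixed choice makes the index set of the cover depend on \<open>t\<close>,
  \<open>\<delta>\<close> and \<open>a\<close> alone; the default \<open>{}\<close> keeps the
  cardinality bound valid for all arguments.\<close>

definition reps :: "int \<Rightarrow> real \<Rightarrow> real set \<Rightarrow> real set" where
  "reps t \<delta> a = (if \<exists>R. good_reps t \<delta> a R then SOME R. good_reps t \<delta> a R else {})"

lemma reps_finite_card:
  "finite (reps t \<delta> a)" "card (reps t \<delta> a) \<le> 7 * ndiv (abs_norm \<delta>) ^ 3 * (nat \<bar>t\<^sup>2 - 4\<bar>)\<^sup>2" "reps t \<delta> a \<subseteq> Zs"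
proof -
  have "good_reps t \<delta> a (reps t \<delta> a) \<or> reps t \<delta> a = {}"
    unfolding reps_def using someI_ex[of "good_reps t \<delta> a"] by auto
  then show "finite (reps t \<delta> a)" "card (reps t \<delta> a) \<le> 7 * ndiv (abs_norm \<delta>) ^ 3 * (nat \<bar>t\<^sup>2 - 4\<bar>)\<^sup>2" "reps t \<delta> a \<subseteq> Zs"
    by (auto simp: good_reps_def)
qed

definition cusp_ideals :: "nat \<Rightarrow> real set set" where
  "cusp_ideals n = {a \<in> ideals n. \<exists>c d x y. cusp c d x y \<and> idl c d = a}"

lemma cusp_idealsE:
  assumes "a \<in> cusp_ideals n"
  obtains c d x y where "cusp c d x y" "idl c d = a" "cusp_matrix a = (y, - x, c, d)"
proof -
  obtain c d x y where c: "cusp c d x y" "idl c d = a" using assms by (auto simp: cusp_ideals_def)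
  show ?thesis using cusp_matrix[OF cuspD(1-3)[OF c(1)]] c(2) that by metis
qed

definition box_elements :: "real \<Rightarrow> real set" where
  "box_elements b = {\<delta> \<in> Zs. \<delta> \<noteq> 0 \<and> \<bar>\<delta>\<bar> \<le> b \<and> \<bar>cj \<delta>\<bar> \<le> b}"

text \<open>In cusp coordinates: rectangles above the midpoints of the fixed points of an element with trace
  \<open>t\<close> and lower row \<open>(\<delta>, \<kappa>0)\<close>.\<close>

definition nonparabolic_set :: "real \<Rightarrow> int \<Rightarrow> real \<Rightarrow> real set \<Rightarrow> real \<Rightarrow> (complex \<times> complex) set" where
  "nonparabolic_set L t \<delta> a \<kappa>0 = act (cusp_matrix a) -`
     (strip ((of_int t - 2 * \<kappa>0) / (2 * \<delta>) - L / (2 * \<bar>\<delta>\<bar>)) ((of_int t - 2 * \<kappa>0) / (2 * \<delta>) + L / (2 * \<bar>\<delta>\<bar>)) (1 / (6 * s)) \<times>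
      strip ((of_int t - 2 * cj \<kappa>0) / (2 * cj \<delta>) - L / (2 * \<bar>cj \<delta>\<bar>)) ((of_int t - 2 * cj \<kappa>0) / (2 * cj \<delta>) + L / (2 * \<bar>cj \<delta>\<bar>)) (1 / (6 * s))) \<inter> HH"

lemma nonparabolic_set:
  assumes a: "a \<in> cusp_ideals n" and \<delta>: "\<delta> \<in> Zs" "\<delta> \<noteq> 0" and L: "L \<ge> 0"
  shows "nonparabolic_set L t \<delta> a \<kappa>0 \<in> sets HH_vol"
    "emeasure HH_vol (nonparabolic_set L t \<delta> a \<kappa>0) = ennreal (36 * L\<^sup>2 * real p / real (abs_norm \<delta>))"
proof -
  obtain c d x y where cs: "cusp c d x y" "cusp_matrix a = (y, - x, c, d)" using cusp_idealsE[OF a] by metis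
  have cd: "cj \<delta> \<noteq> 0" using \<delta> Zs_K by simp
  let ?u = "(of_int t - 2 * \<kappa>0) / (2 * \<delta>)" and ?v = "(of_int t - 2 * cj \<kappa>0) / (2 * cj \<delta>)"
  have le: "?u - L / (2 * \<bar>\<delta>\<bar>) \<le> ?u + L / (2 * \<bar>\<delta>\<bar>)" "?v - L / (2 * \<bar>cj \<delta>\<bar>) \<le> ?v + L / (2 * \<bar>cj \<delta>\<bar>)" "1 / (6 * s) > 0"
    using L s_pos by simp_all
  note m = cusp_set[OF cusp_GK[OF cs(1)] le(1,2,3,3)]
  show "nonparabolic_set L t \<delta> a \<kappa>0 \<in> sets HH_vol" unfolding nonparabolic_set_def cs(2) by (rule m(1))
  have "emeasure HH_vol (nonparabolic_set L t \<delta> a \<kappa>0) =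
    ennreal (((?u + L / (2 * \<bar>\<delta>\<bar>)) - (?u - L / (2 * \<bar>\<delta>\<bar>))) / (1 / (6 * s)) * (((?v + L / (2 * \<bar>cj \<delta>\<bar>)) - (?v - L / (2 * \<bar>cj \<delta>\<bar>))) / (1 / (6 * s))))"
    unfolding nonparabolic_set_def cs(2) by (rule m(2))
  also have "((?u + L / (2 * \<bar>\<delta>\<bar>)) - (?u - L / (2 * \<bar>\<delta>\<bar>))) / (1 / (6 * s)) = 6 * L * s / \<bar>\<delta>\<bar>" by simp
  also have "((?v + L / (2 * \<bar>cj \<delta>\<bar>)) - (?v - L / (2 * \<bar>cj \<delta>\<bar>))) / (1 / (6 * s)) = 6 * L * s / \<bar>cj \<delta>\<bar>" by simp
  also have "6 * L * s / \<bar>\<delta>\<bar> * (6 * L * s / \<bar>cj \<delta>\<bar>) = 36 * L\<^sup>2 * real p / real (abs_norm \<delta>)"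
    unfolding abs_norm(1)[OF \<delta>] s_sq[symmetric] using \<delta> cd by (simp add: abs_mult power2_eq_square)
  finally show "emeasure HH_vol (nonparabolic_set L t \<delta> a \<kappa>0) = ennreal (36 * L\<^sup>2 * real p / real (abs_norm \<delta>))" .
qed

lemma isideal_bset:
  assumes "c \<in> Zs" "d \<in> Zs" and e: "\<And>\<tau>. \<tau> \<in> inv2 c d \<Longrightarrow> \<delta> * \<tau> \<in> Zs" and \<delta>: "\<delta> \<in> Zs" "\<delta> \<noteq> 0"
  shows "isideal (bset c d \<delta>)" "real (abs_norm \<delta>) \<in> bset c d \<delta>"
proof -
  show "isideal (bset c d \<delta>)"
    unfolding isideal_def
  proof (intro conjI ballI)
    show "bset c d \<delta> \<subseteq> Zs" using e by (auto simp: bset_def)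
    show "0 \<in> bset c d \<delta>" using Zs_inv2[OF assms(1,2) Zs_0] unfolding bset_def by force
    fix x y r assume x: "x \<in> bset c d \<delta>"
    then obtain \<tau> where \<tau>: "x = \<delta> * \<tau>" "\<tau> \<in> inv2 c d" by (auto simp: bset_def)
    { assume "y \<in> bset c d \<delta>"
      then obtain \<tau>' where \<tau>': "y = \<delta> * \<tau>'" "\<tau>' \<in> inv2 c d" by (auto simp: bset_def)
      have "x + y = \<delta> * (\<tau> + \<tau>')" using \<tau> \<tau>' by (simp add: algebra_simps)
      then show "x + y \<in> bset c d \<delta>" unfolding bset_def using inv2_add \<tau> \<tau>' by blast }
    { assume "r \<in> Zs"
      have "r * x = \<delta> * (r * \<tau>)" using \<tau> by simp
      then show "r * x \<in> bset c d \<delta>" unfolding bset_def using inv2_mult \<tau> \<open>r \<in> Zs\<close> by blast }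
  qed
  obtain r where r: "r \<in> Zs" "real (abs_norm \<delta>) = r * \<delta>" using abs_norm_multiple[OF \<delta>] by blast
  then show "real (abs_norm \<delta>) \<in> bset c d \<delta>"
    unfolding bset_def using Zs_inv2[OF assms(1,2) r(1)] by (auto simp: mult.commute)
qed

lemma nonparabolic_cover:
  assumes z: "z \<in> HH" and g: "g \<in> Gam" "trace g = of_int t" "t\<^sup>2 \<noteq> 4" and n: "nearHH \<kappa> z (act g z)"
    and k0: "\<kappa> \<ge> 0" and L: "L = \<kappa> + 2" "L < s"
  shows "\<exists>\<delta>\<in>box_elements (6 * L * s). \<exists>a\<in>cusp_ideals (abs_norm \<delta>). \<exists>\<kappa>0\<in>reps t \<delta> a. \<exists>h\<in>Gam. act h z \<in> nonparabolic_set L t \<delta> a \<kappa>0"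
proof -
  obtain c0 d0 where v: "c0 \<in> Zs" "d0 \<in> Zs" "c0 \<noteq> 0 \<or> d0 \<noteq> 0" "J c0 d0 (fst z) \<le> 6 * s" "J (cj c0) (cj d0) (snd z) \<le> 6 * s"
    using short_vector z by (metis HH_iff)
  let ?a = "idl c0 d0"
  obtain c d x y where cs: "cusp c d x y" "idl c d = ?a" "cusp_matrix ?a = (y, - x, c, d)"
    using cusp_matrix[OF v(1-3)] by blast
  note C = cuspD[OF cs(1)]
  obtain h where h: "h \<in> Gam" "Im (fst (act (y, - x, c, d) (act h z))) = 1 / J c0 d0 (fst z)"
     "Im (snd (act (y, - x, c, d) (act h z))) = 1 / J (cj c0) (cj d0) (snd z)"
    using move_to_cusp[OF v(1-3) cs(1,2)] z by meson
  have hz: "act h z \<in> HH" using act_HH[OF Gam_GK[OF h(1)] z] .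
  obtain p' q r u where g': "gmul (gmul h g) (ginv h) = (p', q, r, u)" by (metis prod_cases4)
  note cn = conjugate_near[OF g(1) h(1) z n, unfolded g']
  have tr: "p' + u = of_int t" using trace_conj[OF Gam_GK[OF h(1)], of g] g(2) unfolding g' by (simp add: trace_def)
  define A where "A = (y * p' - x * r) * d - (y * q - x * u) * c"
  define B where "B = (y * p' - x * r) * x + (y * q - x * u) * y"
  define e where "e = (c * p' + d * r) * d - (c * q + d * u) * c"
  define k where "k = (c * p' + d * r) * x + (c * q + d * u) * y"
  note M = conjugate_to_cusp[OF cs(1) cn(1), folded A_def B_def e_def k_def]
  let ?w = "act (y, - x, c, d) (act h z)"
  have wHH: "?w \<in> HH" by (rule act_HH[OF cusp_GK[OF cs(1)] hz])
  have "nearHH \<kappa> ?w (act (A, B, e, k) ?w)"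
    unfolding M(10)[OF hz]
    by (intro nearHH_act cusp_GK[OF cs(1)] hz cn(2) act_HH Gam_GK[OF cn(1)])
  note b = displacement_bounds_HH[OF M(9) wHH this k0, folded L(1)]
  have J0: "J c0 d0 (fst z) > 0" "J (cj c0) (cj d0) (snd z) > 0"
    using v z Zs_K by (auto intro!: J_pos simp: HH_iff)
  then have Im: "Im (fst ?w) \<ge> 1 / (6 * s)" "Im (snd ?w) \<ge> 1 / (6 * s)"
    using v unfolding h by (auto intro!: divide_left_mono mult_pos_pos s_pos)
  have L2: "L \<ge> 2" using L k0 by simp
  have kA: "A = of_int t - k" using M(6) tr by simp
  \<comment> \<open>Were the lower left entry 0, the diagonal entries would be rational integers
    with product 1, and the trace would be \<open>2\<close> or \<open>-2\<close>.\<close>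
  have e0: "e \<noteq> 0"
  proof
    assume e0: "e = 0"
    obtain k' where k': "k = of_int k'" using bounded_Zs_Ints[OF M(5) b(7,8)[OF e0] L(2)] by blast
    have "real_of_int ((t - k') * k') = of_int 1" using M(1) e0 unfolding kA k' by simp
    then have "(t - k') * k' = 1" using of_int_eq_iff by blast
    then have "t - k' = k' \<and> (k' = 1 \<or> k' = -1)" by (auto simp: zmult_eq_1_iff)
    then have "t = 2 \<or> t = -2" by auto
    then show False using g(3) by auto
  qed
  \<comment> \<open>The displacement bounds \<open>e\<close> times the height; heights at least
    \<open>1 / (6 * s)\<close> turn this into a bound on \<open>e\<close> and on its
    conjugate.\<close>
  have eb: "\<bar>e'\<bar> \<le> 6 * L * s" if "\<bar>e'\<bar> * i \<le> L" "i \<ge> 1 / (6 * s)" for e' i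
  proof -
    have "\<bar>e'\<bar> * (1 / (6 * s)) \<le> \<bar>e'\<bar> * i" using that(2) by (intro mult_left_mono) auto
    then have "\<bar>e'\<bar> * (1 / (6 * s)) \<le> L" using that(1) by linarith
    then show ?thesis using s_pos by (simp add: field_simps)
  qed
  have box: "e \<in> box_elements (6 * L * s)"
    unfolding box_elements_def using M(4) e0 eb[OF b(1) Im(1)] eb[OF b(2) Im(2)] by simp
  have "real (abs_norm e) \<in> ?a"
  proof -
    obtain \<rho> where \<rho>: "\<rho> \<in> Zs" "real (abs_norm e) = \<rho> * e" using abs_norm_multiple[OF M(4) e0] by blast
    then show ?thesis using isidealD(5)[OF isideal_idl[OF v(1,2)], of e \<rho>] M(7) cs(2) by simp
  qed
  then have a: "?a \<in> cusp_ideals (abs_norm e)"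
    unfolding cusp_ideals_def ideals_def using isideal_idl[OF v(1,2)] cs by blast
  note bs = isideal_bset[OF C(1,2) M(8) M(4) e0]
  have ex: "\<exists>R. good_reps t e ?a R"
    using quadratic_roots_mod_ideal[OF bs abs_norm(2)[OF M(4) e0] g(3)] unfolding good_reps_def cs(3) by auto
  then have good: "good_reps t e ?a (reps t e ?a)" unfolding reps_def using someI_ex[OF ex] by simp
  \<comment> \<open>The determinant condition with \<open>A = t - k\<close>; as \<open>B\<close>
    lies in \<open>inv2 c d\<close>, it is a congruence modulo \<open>bset c d e\<close>.\<close>
  have "k\<^sup>2 - of_int t * k + 1 = e * (- B)"
  proof -
    have "k\<^sup>2 - of_int t * k + 1 = 1 - A * k" unfolding kA by (simp add: power2_eq_square algebra_simps)
    then show ?thesis using M(1) by (simp add: algebra_simps)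
  qed
  moreover have "- B \<in> inv2 c d" using inv2_mult[OF M(3), of "-1"] Zs_uminus[OF Zs_1] by simp
  ultimately have "k\<^sup>2 - of_int t * k + 1 \<in> bset c d e" unfolding bset_def by blast
  then obtain \<kappa>0 where \<kappa>0: "\<kappa>0 \<in> reps t e ?a" "k - \<kappa>0 \<in> bset c d e"
    using good M(5) unfolding good_reps_def cs(3) by auto
  then obtain \<tau> where \<tau>: "k - \<kappa>0 = e * \<tau>" "\<tau> \<in> inv2 c d" unfolding bset_def by auto
  have \<kappa>K: "\<kappa>0 \<in> K" using \<kappa>0(1) reps_finite_card(3) Zs_K by blast
  have eK: "e \<in> K" "k \<in> K" "\<tau> \<in> K" using M \<tau> Zs_K by (auto simp: inv2_def)
  \<comment> \<open>Translating by \<open>\<tau>\<close> replaces \<open>k\<close> by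
    \<open>k - e * \<tau> = \<kappa>0\<close>, so the midpoint of the fixed points moves from
    \<open>(t - 2 * k) / (2 * e)\<close> to \<open>(t - 2 * \<kappa>0) / (2 * e)\<close>.\<close>
  obtain h' where h': "h' \<in> Gam" "act (y, - x, c, d) (act h' (act h z)) = (of_real \<tau> + fst ?w, of_real (cj \<tau>) + snd ?w)"
    using cusp_translation[OF cs(1) \<tau>(2)] hz by blast
  have mem: "(T - 2 * \<kappa>') / (2 * e') - L / (2 * \<bar>e'\<bar>) \<le> \<tau>' + X \<and> \<tau>' + X \<le> (T - 2 * \<kappa>') / (2 * e') + L / (2 * \<bar>e'\<bar>)"
    if h: "\<bar>2 * e' * X + k' - (T - k')\<bar> \<le> L" "k' - \<kappa>' = e' * \<tau>'" "e' \<noteq> 0" for T \<kappa>' e' \<tau>' X k' :: real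
  proof -
    have "\<tau>' + X - (T - 2 * \<kappa>') / (2 * e') = (2 * (e' * \<tau>') + 2 * e' * X - T + 2 * \<kappa>') / (2 * e')"
      using h(3) by (simp add: field_simps)
    also have "2 * (e' * \<tau>') + 2 * e' * X - T + 2 * \<kappa>' = 2 * e' * X + k' - (T - k')"
      unfolding h(2)[symmetric] by simp
    finally have "\<bar>\<tau>' + X - (T - 2 * \<kappa>') / (2 * e')\<bar> = \<bar>2 * e' * X + k' - (T - k')\<bar> / (2 * \<bar>e'\<bar>)"
      by (simp only: abs_divide abs_mult abs_numeral)
    also have "\<dots> \<le> L / (2 * \<bar>e'\<bar>)" using h by (intro divide_right_mono) auto
    finally show ?thesis by (simp add: abs_le_iff)
  qed
  have e0': "cj e \<noteq> 0" using e0 eK by simp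
  have m1: "\<bar>2 * e * Re (fst ?w) + k - (of_int t - k)\<bar> \<le> L" using b(3) kA by simp
  have m2: "\<bar>2 * cj e * Re (snd ?w) + cj k - (of_int t - cj k)\<bar> \<le> L" using b(4) kA eK by simp
  have \<tau>2: "cj k - cj \<kappa>0 = cj e * cj \<tau>" using arg_cong[OF \<tau>(1), of cj] eK \<kappa>K by simp
  have "act (gmul h' h) z \<in> HH" by (intro act_HH Gam_GK gmul_Gam h' h z)
  then have "act (gmul h' h) z \<in> nonparabolic_set L t e ?a \<kappa>0"
    using mem[OF m1 \<tau>(1) e0] mem[OF m2 \<tau>2 e0'] Im
    unfolding nonparabolic_set_def cs(3) act_gmul[OF Gam_GK[OF h'(1)] Gam_GK[OF h(1)] z, symmetric]
    by (simp add: h'(2) strip_def)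
  then show ?thesis using box a \<kappa>0(1) gmul_Gam[OF h'(1) h(1)] by blast
qed

subsection \<open>The parabolic elements\<close>

text \<open>Cutting a cusp down by the translations in \<open>l * Zs\<close> gives an area
  proportional to the norm of \<open>l\<close>, while a parabolic element translates by some
  \<open>B\<close> of at least that norm. With the minimal choice the two cancel, whatever the ideal
  is.\<close>

definition min_inv2 :: "real \<Rightarrow> real \<Rightarrow> real \<Rightarrow> bool" where
  "min_inv2 c d l \<longleftrightarrow> l \<in> inv2 c d \<and> l \<noteq> 0 \<and> (\<forall>B\<in>inv2 c d. B \<noteq> 0 \<longrightarrow> \<bar>l * cj l\<bar> \<le> \<bar>B * cj B\<bar>)"

lemma min_inv2_exists:
  assumes cd: "c \<in> Zs" "d \<in> Zs" "c \<noteq> 0 \<or> d \<noteq> 0"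
  shows "\<exists>l. min_inv2 c d l"
proof -
  \<comment> \<open>Multiplication by the square of a non-zero generator makes all absolute norms
    natural numbers, among which there is a least one.\<close>
  obtain e where e: "e \<noteq> 0" "e \<in> Zs" "\<And>l. l \<in> inv2 c d \<Longrightarrow> l * (e * e) \<in> Zs"
    using cd by (auto simp: inv2_def)
  define m where "m l = abs_norm (l * (e * e))" for l
  have "1 \<in> inv2 c d \<and> (1::real) \<noteq> 0" using Zs_inv2[OF cd(1,2) Zs_1] by simp
  then obtain l where l: "l \<in> inv2 c d" "l \<noteq> 0" "\<And>B. B \<in> inv2 c d \<Longrightarrow> B \<noteq> 0 \<Longrightarrow> m l \<le> m B"
    using ex_has_least_nat[of "\<lambda>l. l \<in> inv2 c d \<and> l \<noteq> 0" 1 m] by blast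
  have eK: "e \<in> K" "cj e \<noteq> 0" using e Zs_K by auto
  have m: "real (m B) = \<bar>B * cj B\<bar> * (\<bar>e * cj e\<bar> * \<bar>e * cj e\<bar>)" if "B \<in> inv2 c d" "B \<noteq> 0" for B
  proof -
    have "B \<in> K" using that by (simp add: inv2_def)
    then show ?thesis unfolding m_def using abs_norm(1)[OF e(3)[OF that(1)]] that e(1) eK
      by (simp add: abs_mult mult_ac)
  qed
  have "\<bar>l * cj l\<bar> \<le> \<bar>B * cj B\<bar>" if B: "B \<in> inv2 c d" "B \<noteq> 0" for B
  proof -
    have "real (m l) \<le> real (m B)" using l(3)[OF B] by simp
    moreover have "\<bar>e * cj e\<bar> > 0" using e eK by simp
    then have "\<bar>e * cj e\<bar> * \<bar>e * cj e\<bar> > 0" by (rule mult_pos_pos) fact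
    ultimately show ?thesis unfolding m[OF l(1,2)] m[OF B] by (simp only: mult_le_cancel_right_pos)
  qed
  then show ?thesis using l unfolding min_inv2_def by blast
qed

definition cusp_width :: "real set \<Rightarrow> real" where
  "cusp_width a = (case cusp_matrix a of (_, _, c, d) \<Rightarrow> SOME l. min_inv2 c d l)"

lemma cusp_width:
  assumes cs: "cusp c d x y" "cusp_matrix a = (y, - x, c, d)"
  shows "min_inv2 c d (cusp_width a)"
  unfolding cusp_width_def cs(2) prod.case
  using min_inv2_exists[OF cuspD(1-3)[OF cs(1)]] by (rule someI_ex)

text \<open>The cusp fixed by \<open>g\<close> has to be used, and a short vector need not belong to
  it; applying \<open>g - \<epsilon>\<close> to the short vector yields one that does, unless it
  already was an eigenvector. In the coordinates of that cusp \<open>g\<close> is, up to sign, a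
  translation.\<close>

lemma parabolic_cusp_region:
  assumes z: "z \<in> HH" and g: "g \<in> Gam" "trace g = 2 * \<epsilon>" "\<epsilon> = 1 \<or> \<epsilon> = -1" "g \<noteq> (\<epsilon>, 0, 0, \<epsilon>)"
    and n: "nearHH \<kappa> z (act g z)" and k0: "\<kappa> \<ge> 0" and L: "L = \<kappa> + 2"
  defines "\<rho> \<equiv> (48 * L + 12) * s"
  shows "\<exists>a\<in>small_ideals. \<exists>h\<in>Gam. Re (fst (act (cusp_matrix a) (act h z))) \<in> {min 0 (cusp_width a)..max 0 (cusp_width a)} \<and>
    Re (snd (act (cusp_matrix a) (act h z))) \<in>
      {min (- 2 * s * cj (cusp_width a)) (cj (cusp_width a))..max (- 2 * s * cj (cusp_width a)) (cj (cusp_width a))} \<and>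
    1 / \<rho> \<le> Im (fst (act (cusp_matrix a) (act h z))) \<and> 1 / \<rho> \<le> Im (snd (act (cusp_matrix a) (act h z))) \<and>
    \<bar>cusp_width a * cj (cusp_width a)\<bar> \<le> L\<^sup>2 * (Im (fst (act (cusp_matrix a) (act h z))) * Im (snd (act (cusp_matrix a) (act h z))))"
proof -
  have L2: "L \<ge> 2" using L k0 by simp
  have zz: "fst z \<in> UH" "snd z \<in> UH" using z by (auto simp: HH_iff)
  have \<epsilon>: "\<epsilon> * \<epsilon> = 1" "\<epsilon> \<noteq> 0" "\<epsilon> \<in> Zs" "cj \<epsilon> = \<epsilon>" using g(3) Zs_of_int[of "-1"] cj_of_int[of "-1"] by auto
  obtain p q r u where gg: "g = (p, q, r, u)" by (metis prod_cases4)
  have G: "p \<in> Zs" "q \<in> Zs" "r \<in> Zs" "u \<in> Zs" "p * u - q * r = 1" "p + u = 2 * \<epsilon>"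
    using g unfolding gg by (auto simp: Gam_def trace_def)
  have GK: "p \<in> K" "q \<in> K" "r \<in> K" "u \<in> K" using G Zs_K by auto
  obtain c0 d0 where v: "c0 \<in> Zs" "d0 \<in> Zs" "c0 \<noteq> 0 \<or> d0 \<noteq> 0" "J c0 d0 (fst z) \<le> 6 * s" "J (cj c0) (cj d0) (snd z) \<le> 6 * s"
    using short_vector z by (metis HH_iff)
  have vK: "c0 \<in> K" "d0 \<in> K" using v Zs_K by auto
  let ?P = "\<lambda>c d. c \<in> Zs \<and> d \<in> Zs \<and> (c \<noteq> 0 \<or> d \<noteq> 0) \<and> J c d (fst z) \<le> \<rho> \<and> J (cj c) (cj d) (snd z) \<le> \<rho> \<and>
      c * p + d * r = \<epsilon> * c \<and> c * q + d * u = \<epsilon> * d"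
  have \<rho>6: "6 * s \<le> \<rho>" unfolding \<rho>_def using L2 s_pos by (intro mult_right_mono) auto
  text \<open>Since \<open>(g - \<epsilon>)\<^sup>2 = 0\<close>, the vector \<open>(c1, d1)\<close> is an eigenvector of \<open>g\<close> unless it vanishes.\<close>
  define c1 where "c1 = c0 * p + d0 * r - \<epsilon> * c0"
  define d1 where "d1 = c0 * q + d0 * u - \<epsilon> * d0"
  \<comment> \<open>\<open>J_near\<close> multiplies the bound \<open>6 * s\<close> by
    \<open>4 * L\<close>, and \<open>J_add\<close> doubles:
    \<open>2 * (4 * L * (6 * s)) + 2 * (6 * s) = \<rho>\<close>.\<close>
  have J1: "J c1 d1 (fst z) \<le> \<rho>" "J (cj c1) (cj d1) (snd z) \<le> \<rho>"
  proof -
    have gz: "act g z \<in> HH" using act_HH[OF Gam_GK[OF g(1)] z] .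
    have b: "J (a + - \<epsilon> * c) (b + - \<epsilon> * d) w \<le> \<rho>" if "w \<in> UH" "J a b w \<le> 4 * (\<kappa> + 2) * (6 * s)" "J c d w \<le> 6 * s" for a b c d w
    proof -
      have "J (a + - \<epsilon> * c) (b + - \<epsilon> * d) w \<le> 2 * J a b w + 2 * J (- \<epsilon> * c) (- \<epsilon> * d) w" by (rule J_add[OF that(1)])
      also have "J (- \<epsilon> * c) (- \<epsilon> * d) w = J c d w" unfolding J_scale using \<epsilon> by (simp add: power2_eq_square)
      finally have "J (a + - \<epsilon> * c) (b + - \<epsilon> * d) w \<le> 2 * (4 * (\<kappa> + 2) * (6 * s)) + 2 * (6 * s)" using that by linarith
      then show ?thesis by (simp add: \<rho>_def L algebra_simps)
    qed
    have abs_norm: "near \<kappa> (fst z) (fst (act g z))" "near \<kappa> (snd z) (snd (act g z))" using n by (auto simp: nearHH_def)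
    have gzz: "fst (act g z) \<in> UH" "snd (act g z) \<in> UH" using gz by (auto simp: HH_iff)
    note JJ = J_act[OF gg Gam_GK[OF g(1)] z vK]
    have "4 * (\<kappa> + 2) * J c0 d0 (fst z) \<le> 4 * (\<kappa> + 2) * (6 * s)" "4 * (\<kappa> + 2) * J (cj c0) (cj d0) (snd z) \<le> 4 * (\<kappa> + 2) * (6 * s)"
      using v k0 by (auto intro!: mult_left_mono)
    then have e: "J (c0 * p + d0 * r) (c0 * q + d0 * u) (fst z) \<le> 4 * (\<kappa> + 2) * (6 * s)"
      "J (cj (c0 * p + d0 * r)) (cj (c0 * q + d0 * u)) (snd z) \<le> 4 * (\<kappa> + 2) * (6 * s)"
      using J_near[OF zz(1) gzz(1) abs_norm(1) k0, of c0 d0] J_near[OF zz(2) gzz(2) abs_norm(2) k0, of "cj c0" "cj d0"]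
      unfolding JJ by linarith+
    show "J c1 d1 (fst z) \<le> \<rho>" using b[OF zz(1) e(1) v(4)] unfolding c1_def d1_def by simp
    have "cj c1 = cj (c0 * p + d0 * r) + - \<epsilon> * cj c0" "cj d1 = cj (c0 * q + d0 * u) + - \<epsilon> * cj d0"
      unfolding c1_def d1_def using vK GK \<epsilon> Zs_K by simp_all
    then show "J (cj c1) (cj d1) (snd z) \<le> \<rho>" using b[OF zz(2) e(2) v(5)] by simp
  qed
  have "\<exists>c d. ?P c d"
  proof (cases "c1 = 0 \<and> d1 = 0")
    case True
    then have "c0 * p + d0 * r = \<epsilon> * c0" "c0 * q + d0 * u = \<epsilon> * d0" by (auto simp: c1_def d1_def)
    moreover have "J c0 d0 (fst z) \<le> \<rho>" "J (cj c0) (cj d0) (snd z) \<le> \<rho>" using v \<rho>6 by linarith+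
    ultimately show ?thesis using v by blast
  next
    case False
    have u: "u = 2 * \<epsilon> - p" using G(6) by simp
    have qr: "q * r = 2 * \<epsilon> * p - p * p - \<epsilon> * \<epsilon>" using G(5) \<epsilon>(1) unfolding u by (simp add: algebra_simps)
    have "c1 * p + d1 * r - \<epsilon> * c1 = c0 * (p * p + q * r - 2 * \<epsilon> * p + \<epsilon> * \<epsilon>) + d0 * (r * (p + u - 2 * \<epsilon>))"
      "c1 * q + d1 * u - \<epsilon> * d1 = c0 * (q * (p + u - 2 * \<epsilon>)) + d0 * (q * r + u * u - 2 * \<epsilon> * u + \<epsilon> * \<epsilon>)"
      by (simp_all add: c1_def d1_def algebra_simps)
    moreover have "p * p + q * r - 2 * \<epsilon> * p + \<epsilon> * \<epsilon> = 0" "q * r + u * u - 2 * \<epsilon> * u + \<epsilon> * \<epsilon> = 0"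
      unfolding qr u by (simp_all add: algebra_simps)
    ultimately have "c1 * p + d1 * r - \<epsilon> * c1 = 0" "c1 * q + d1 * u - \<epsilon> * d1 = 0" using G(6) by simp_all
    moreover have "c1 \<in> Zs" "d1 \<in> Zs" unfolding c1_def d1_def using v G \<epsilon> by simp_all
    ultimately have "?P c1 d1" using J1 False by simp
    then show ?thesis by blast
  qed
  then obtain c2 d2 where ex: "?P c2 d2" by blast
  \<comment> \<open>Being an eigenvector survives scaling, so the descent to a small ideal stays at
    the same cusp.\<close>
  have "\<exists>c d. ?P c d \<and> real_of_int (idl_norm c d) \<le> 4 * s"
  proof (rule exists_small_norm[of ?P])
    fix c d t assume h: "?P c d" "t \<in> K" "t \<noteq> 0" "\<bar>t\<bar> \<le> 1" "\<bar>cj t\<bar> \<le> 1" "t * c \<in> Zs" "t * d \<in> Zs"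
    have "t\<^sup>2 \<le> 1" "(cj t)\<^sup>2 \<le> 1" using h by (simp_all add: abs_square_le_1)
    moreover have "0 \<le> J c d (fst z)" "0 \<le> J (cj c) (cj d) (snd z)" using zz J_nonneg by auto
    ultimately have J: "t\<^sup>2 * J c d (fst z) \<le> \<rho>" "(cj t)\<^sup>2 * J (cj c) (cj d) (snd z) \<le> \<rho>"
      using h(1) by (meson mult_left_le_one_le order_trans zero_le_power2)+
    have "t * c * p + t * d * r = t * (c * p + d * r)" "t * c * q + t * d * u = t * (c * q + d * u)" by (simp_all add: algebra_simps)
    then have "t * c * p + t * d * r = \<epsilon> * (t * c)" "t * c * q + t * d * u = \<epsilon> * (t * d)" using h(1) by simp_all
    then show "?P (t * c) (t * d)" using h Zs_K J by (auto simp: J_scale)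
  qed (use ex in auto)
  then obtain c3 d3 where cd: "?P c3 d3" "real_of_int (idl_norm c3 d3) \<le> 4 * s" by blast
  have cdZ: "c3 \<in> Zs" "d3 \<in> Zs" "c3 \<noteq> 0 \<or> d3 \<noteq> 0" using cd by auto
  let ?a = "idl c3 d3"
  have a: "?a \<in> small_ideals" unfolding small_ideals_def using cd by blast
  obtain c d x y where cs: "cusp c d x y" "idl c d = ?a" "cusp_matrix ?a = (y, - x, c, d)"
    using small_ideal_cusp[OF a] by metis
  note C = cuspD[OF cs(1)]
  obtain h \<alpha> \<beta> \<gamma> \<delta> where h: "h \<in> Gam" "h = (\<alpha>, \<beta>, \<gamma>, \<delta>)" "c * \<alpha> + d * \<gamma> = c3" "c * \<beta> + d * \<delta> = d3"
    "Im (fst (act (y, - x, c, d) (act h z))) = 1 / J c3 d3 (fst z)"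
    "Im (snd (act (y, - x, c, d) (act h z))) = 1 / J (cj c3) (cj d3) (snd z)"
    using move_to_cusp[OF cdZ cs(1,2)] z by meson
  have hd: "\<alpha> * \<delta> - \<beta> * \<gamma> = 1" using h(1,2) by (simp add: Gam_def)
  have hz: "act h z \<in> HH" using act_HH[OF Gam_GK[OF h(1)] z] .
  obtain p' q' r' u' where g': "gmul (gmul h g) (ginv h) = (p', q', r', u')" by (metis prod_cases4)
  note cn = conjugate_near[OF g(1) h(1) z n, unfolded g']
  have tr: "p' + u' = 2 * \<epsilon>" using trace_conj[OF Gam_GK[OF h(1)], of g] g(2) unfolding g' by (simp add: trace_def)
  \<comment> \<open>Since \<open>h\<close> turns the row \<open>(c, d)\<close> into the eigenvector
    \<open>(c3, d3)\<close> of \<open>g\<close>, the conjugate of \<open>g\<close> by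
    \<open>h\<close> has \<open>(c, d)\<close> as eigenvector.\<close>
  have eig: "c * p' + d * r' = \<epsilon> * c" "c * q' + d * u' = \<epsilon> * d"
  proof -
    have e: "p' = (\<alpha> * p + \<beta> * r) * \<delta> - (\<alpha> * q + \<beta> * u) * \<gamma>" "r' = (\<gamma> * p + \<delta> * r) * \<delta> - (\<gamma> * q + \<delta> * u) * \<gamma>"
      "q' = (\<alpha> * q + \<beta> * u) * \<alpha> - (\<alpha> * p + \<beta> * r) * \<beta>" "u' = (\<gamma> * q + \<delta> * u) * \<alpha> - (\<gamma> * p + \<delta> * r) * \<beta>"
      using g' unfolding h(2) gg by (auto simp: gmul_def ginv_def algebra_simps)
    have "c * p' + d * r' = (c3 * p + d3 * r) * \<delta> - (c3 * q + d3 * u) * \<gamma>"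
      "c * q' + d * u' = (c3 * q + d3 * u) * \<alpha> - (c3 * p + d3 * r) * \<beta>"
      unfolding e h(3,4)[symmetric] by (simp_all add: algebra_simps)
    then have "c * p' + d * r' = \<epsilon> * (c3 * \<delta> - d3 * \<gamma>)" "c * q' + d * u' = \<epsilon> * (d3 * \<alpha> - c3 * \<beta>)"
      using cd(1) by (simp_all add: algebra_simps)
    moreover have "c3 * \<delta> - d3 * \<gamma> = c * (\<alpha> * \<delta> - \<beta> * \<gamma>)" "d3 * \<alpha> - c3 * \<beta> = d * (\<alpha> * \<delta> - \<beta> * \<gamma>)"
      unfolding h(3,4)[symmetric] by (simp_all add: algebra_simps)
    ultimately show "c * p' + d * r' = \<epsilon> * c" "c * q' + d * u' = \<epsilon> * d" using hd by simp_all
  qed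
  define A where "A = (y * p' - x * r') * d - (y * q' - x * u') * c"
  define B where "B = (y * p' - x * r') * x + (y * q' - x * u') * y"
  define e where "e = (c * p' + d * r') * d - (c * q' + d * u') * c"
  define k where "k = (c * p' + d * r') * x + (c * q' + d * u') * y"
  note M = conjugate_to_cusp[OF cs(1) cn(1), folded A_def B_def e_def k_def]
  have e0: "e = 0" unfolding e_def eig by (simp add: algebra_simps)
  have "k = \<epsilon> * (x * c + y * d)" unfolding k_def eig by (simp add: algebra_simps)
  then have k: "k = \<epsilon>" using C(6) by simp
  have Ak: "A = k" using M(6) tr k by simp
  let ?w = "act (y, - x, c, d) (act h z)"
  have wHH: "?w \<in> HH" by (rule act_HH[OF cusp_GK[OF cs(1)] hz])
  have "nearHH \<kappa> ?w (act (A, B, e, k) ?w)"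
    unfolding M(10)[OF hz]
    by (intro nearHH_act cusp_GK[OF cs(1)] hz cn(2) act_HH Gam_GK[OF cn(1)])
  note b = displacement_bounds_HH[OF M(9) wHH this k0, folded L(1)]
  have BK: "B \<in> K" using M(3) by (simp add: inv2_def)
  \<comment> \<open>Otherwise both conjugates, and with them \<open>g\<close>, would be the central
    matrix \<open>\<epsilon>\<close>.\<close>
  have B0: "B \<noteq> 0"
  proof
    assume B0: "B = 0"
    have gG: "(y, - x, c, d) \<in> GK" by (rule cusp_GK[OF cs(1)])
    have sc: "gmul (\<epsilon>, 0, 0, \<epsilon>) f = gmul f (\<epsilon>, 0, 0, \<epsilon>)" for f by (cases f) (simp add: gmul_def mult.commute)
    have "gmul (gmul (y, - x, c, d) (p', q', r', u')) (ginv (y, - x, c, d)) = (A, B, e, k)"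
      by (simp add: gmul_def ginv_def A_def B_def e_def k_def algebra_simps)
    then have m: "gmul (gmul (y, - x, c, d) (p', q', r', u')) (ginv (y, - x, c, d)) = (\<epsilon>, 0, 0, \<epsilon>)"
      using B0 e0 k Ak by simp
    have un: "f = (\<epsilon>, 0, 0, \<epsilon>)" if f: "gmul (gmul g0 f) (ginv g0) = (\<epsilon>, 0, 0, \<epsilon>)" "g0 \<in> GK" for f g0
    proof -
      have inv: "gmul (ginv g0) (gmul g0 f') = f'" for f'
        unfolding gmul_assoc[symmetric] gmul_ginv(2)[OF f(2)] gmul_1 ..
      have "gmul (gmul (gmul g0 f) (ginv g0)) g0 = gmul g0 f"
        unfolding gmul_assoc gmul_ginv(2)[OF f(2)] gmul_1 ..
      then have "gmul g0 f = gmul g0 (\<epsilon>, 0, 0, \<epsilon>)" unfolding f(1) sc by (rule sym)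
      then show ?thesis using inv by metis
    qed
    have "(p', q', r', u') = (\<epsilon>, 0, 0, \<epsilon>)" by (rule un[OF m gG])
    then have "gmul (gmul h g) (ginv h) = (\<epsilon>, 0, 0, \<epsilon>)" using g' by simp
    then have "g = (\<epsilon>, 0, 0, \<epsilon>)" by (rule un[OF _ Gam_GK[OF h(1)]])
    then show False using g(4) by simp
  qed
  have min: "min_inv2 c d (cusp_width ?a)" by (rule cusp_width[OF cs(1,3)])
  let ?l = "cusp_width ?a"
  have Jpos: "J c3 d3 (fst z) > 0" "J (cj c3) (cj d3) (snd z) > 0"
    using cdZ zz Zs_K by (auto intro!: J_pos)
  have \<rho>0: "\<rho> > 0" using \<rho>6 s_pos by linarith
  have Im: "1 / \<rho> \<le> Im (fst ?w)" "1 / \<rho> \<le> Im (snd ?w)"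
    using cd(1) Jpos \<rho>0 unfolding h(5,6) by (auto intro!: divide_left_mono mult_pos_pos)
  \<comment> \<open>Small displacement bounds \<open>B\<close> by \<open>L\<close> times the height
    in each factor; minimality of the cusp width turns this into a bound free of
    \<open>B\<close>.\<close>
  have "\<bar>?l * cj ?l\<bar> \<le> \<bar>B * cj B\<bar>" using min M(3) B0 unfolding min_inv2_def by blast
  also have "\<dots> \<le> (L * Im (fst ?w)) * (L * Im (snd ?w))"
    unfolding abs_mult using b(9,10)[OF e0 Ak] by (intro mult_mono) auto
  finally have nl: "\<bar>?l * cj ?l\<bar> \<le> L\<^sup>2 * (Im (fst ?w) * Im (snd ?w))" by (simp add: power2_eq_square mult_ac)
  obtain h' where h': "h' \<in> Gam" "Re (fst (act (y, - x, c, d) (act h' (act h z)))) \<in> {min 0 ?l..max 0 ?l}"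
    "Re (snd (act (y, - x, c, d) (act h' (act h z)))) \<in> {min (- 2 * s * cj ?l) (cj ?l)..max (- 2 * s * cj ?l) (cj ?l)}"
    "Im (fst (act (y, - x, c, d) (act h' (act h z)))) = Im (fst ?w)"
    "Im (snd (act (y, - x, c, d) (act h' (act h z)))) = Im (snd ?w)"
    using cusp_region[OF cs(1) hz] min unfolding min_inv2_def by blast
  show ?thesis
    using h' Im nl unfolding act_gmul[OF Gam_GK[OF h'(1)] Gam_GK[OF h(1)] z]
    by (intro bexI[OF _ a] bexI[OF _ gmul_Gam[OF h'(1) h(1)]]) (simp add: cs(3))
qed

text \<open>A translation by \<open>B\<close> has small displacement only where the product of the two heights is
  \<open>\<ge> \<bar>B * cj B\<bar> / L\<^sup>2\<close>; this region is decomposed dyadically according to the height in the first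
  coordinate.\<close>

definition parabolic_set :: "real \<Rightarrow> real \<Rightarrow> nat \<Rightarrow> real set \<Rightarrow> nat \<Rightarrow> (complex \<times> complex) set" where
  "parabolic_set L \<rho> m a j = (let l = cusp_width a in act (cusp_matrix a) -`
     (strip (min 0 l) (max 0 l) (2 ^ j / \<rho>) \<times>
      strip (min (- 2 * s * cj l) (cj l)) (max (- 2 * s * cj l) (cj l))
        (if j < m then \<bar>l * cj l\<bar> * \<rho> / (L\<^sup>2 * 2 ^ Suc j) else 1 / \<rho>)) \<inter> HH)"

text \<open>For \<open>j < m\<close> the product of the two lower heights is
  \<open>N / (2 * L\<^sup>2)\<close>, so the norm \<open>N\<close> of the cusp width cancels. In the
  last piece the second height is only \<open>1 / \<rho>\<close>, and
  \<open>\<rho>\<^sup>2 \<le> 2 ^ m\<close> with \<open>N \<le> 1\<close> takes over.\<close>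

lemma parabolic_set:
  assumes a: "a \<in> small_ideals" and L: "L > 0" and \<rho>: "\<rho> > 0" and m: "\<rho>\<^sup>2 \<le> 2 ^ m" and j: "j \<le> m"
  shows "parabolic_set L \<rho> m a j \<in> sets HH_vol"
    "emeasure HH_vol (parabolic_set L \<rho> m a j) \<le> ennreal (if j < m then 2 * L\<^sup>2 * (2 * s + 1) else 2 * s + 1)"
proof -
  obtain c d x y where cs: "cusp c d x y" "cusp_matrix a = (y, - x, c, d)" using small_ideal_cusp[OF a] by metis
  note C = cuspD[OF cs(1)]
  define l where "l = cusp_width a"
  have min: "min_inv2 c d l" unfolding l_def by (rule cusp_width[OF cs])
  then have lK: "l \<in> K" "l \<noteq> 0" by (auto simp: min_inv2_def inv2_def)
  then have cl: "cj l \<noteq> 0" by simp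
  define N where "N = \<bar>l * cj l\<bar>"
  \<comment> \<open>The number 1 lies in \<open>inv2 c d\<close> and competes for the minimal
    norm.\<close>
  have N: "N > 0" "N \<le> 1"
    using min lK cl Zs_inv2[OF C(1,2) Zs_1] unfolding min_inv2_def N_def by force+
  define h2 where "h2 = (if j < m then N * \<rho> / (L\<^sup>2 * 2 ^ Suc j) else 1 / \<rho>)"
  have h: "2 ^ j / \<rho> > 0" "h2 > 0" unfolding h2_def using \<rho> L N by auto
  have le: "min 0 l \<le> max 0 l" "min (- 2 * s * cj l) (cj l) \<le> max (- 2 * s * cj l) (cj l)" by auto
  note r = cusp_set[OF cusp_GK[OF cs(1)] le h]
  have S: "parabolic_set L \<rho> m a j = act (y, - x, c, d) -` (strip (min 0 l) (max 0 l) (2 ^ j / \<rho>) \<times>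
      strip (min (- 2 * s * cj l) (cj l)) (max (- 2 * s * cj l) (cj l)) h2) \<inter> HH"
    by (simp add: parabolic_set_def Let_def cs(2) h2_def N_def l_def)
  show "parabolic_set L \<rho> m a j \<in> sets HH_vol" unfolding S by (rule r(1))
  have w: "max 0 l - min 0 l = \<bar>l\<bar>" by auto
  have w2: "max (- 2 * s * cj l) (cj l) - min (- 2 * s * cj l) (cj l) = \<bar>cj l\<bar> * (2 * s + 1)"
  proof (cases "cj l \<ge> 0")
    case True
    then have "s * cj l \<ge> 0" using s_pos by simp
    then have "- 2 * s * cj l \<le> cj l" using True by linarith
    then show ?thesis using True by (simp add: max_absorb2 min_absorb1 distrib_left mult.commute)
  next
    case False
    then have "s * cj l \<le> 0" using s_pos by (simp add: mult_le_0_iff)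
    then have "- 2 * s * cj l \<ge> cj l" using False by linarith
    then show ?thesis using False by (simp add: max_absorb1 min_absorb2 distrib_left mult.commute)
  qed
  have "emeasure HH_vol (parabolic_set L \<rho> m a j) = ennreal (\<bar>l\<bar> / (2 ^ j / \<rho>) * (\<bar>cj l\<bar> * (2 * s + 1) / h2))"
    unfolding S r(2) w w2 ..
  also have "\<bar>l\<bar> / (2 ^ j / \<rho>) * (\<bar>cj l\<bar> * (2 * s + 1) / h2) = N * (2 * s + 1) * \<rho> / (2 ^ j * h2)"
    unfolding N_def abs_mult by simp
  also have "\<dots> \<le> (if j < m then 2 * L\<^sup>2 * (2 * s + 1) else 2 * s + 1)"
  proof (cases "j < m")
    case True
    have gen: "N' * W * r / (P * (N' * r / (L2 * (2 * P)))) = 2 * L2 * W"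
      if "N' > 0" "r > 0" "P > 0" "L2 > 0" for N' W r P L2 :: real
      using that by simp
    have "N * (2 * s + 1) * \<rho> / (2 ^ j * h2) = 2 * L\<^sup>2 * (2 * s + 1)"
      unfolding h2_def power_Suc if_P[OF True] by (rule gen) (use N \<rho> L in auto)
    then show ?thesis using True by simp
  next
    case False
    then have jm: "j = m" using j by simp
    have "N * (2 * s + 1) * \<rho> / (2 ^ j * h2) = (2 * s + 1) * (N * (\<rho>\<^sup>2 / 2 ^ m))"
      unfolding h2_def jm using \<rho> by (simp add: power2_eq_square)
    also have "\<dots> \<le> (2 * s + 1) * (1 * 1)"
      using N m s_pos by (intro mult_left_mono mult_mono) auto
    finally show ?thesis using False by simp
  qed
  finally show "emeasure HH_vol (parabolic_set L \<rho> m a j) \<le> ennreal (if j < m then 2 * L\<^sup>2 * (2 * s + 1) else 2 * s + 1)"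
    by (simp add: ennreal_leI)
qed

text \<open>\<open>j\<close> is the dyadic scale of \<open>\<rho>\<close> times the first height,
  capped at \<open>m\<close>. Below the cap the first height is less than
  \<open>2 ^ Suc j / \<rho>\<close>, and the bound on the product of the heights forces the second
  one up.\<close>

lemma parabolic_cover:
  assumes z: "z \<in> HH" and g: "g \<in> Gam" "trace g = 2 * \<epsilon>" "\<epsilon> = 1 \<or> \<epsilon> = -1" "g \<noteq> (\<epsilon>, 0, 0, \<epsilon>)"
    and n: "nearHH \<kappa> z (act g z)" and k0: "\<kappa> \<ge> 0" and L: "L = \<kappa> + 2" and \<rho>: "\<rho> = (48 * L + 12) * s"
  shows "\<exists>a\<in>small_ideals. \<exists>j\<in>{..m}. \<exists>h\<in>Gam. act h z \<in> parabolic_set L \<rho> m a j"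
proof -
  obtain a h where ah: "a \<in> small_ideals" "h \<in> Gam"
    "Re (fst (act (cusp_matrix a) (act h z))) \<in> {min 0 (cusp_width a)..max 0 (cusp_width a)}"
    "Re (snd (act (cusp_matrix a) (act h z))) \<in>
      {min (- 2 * s * cj (cusp_width a)) (cj (cusp_width a))..max (- 2 * s * cj (cusp_width a)) (cj (cusp_width a))}"
    "1 / \<rho> \<le> Im (fst (act (cusp_matrix a) (act h z)))" "1 / \<rho> \<le> Im (snd (act (cusp_matrix a) (act h z)))"
    "\<bar>cusp_width a * cj (cusp_width a)\<bar> \<le> L\<^sup>2 * (Im (fst (act (cusp_matrix a) (act h z))) * Im (snd (act (cusp_matrix a) (act h z))))"
    using parabolic_cusp_region[OF z g n k0 L] unfolding \<rho> by blast
  let ?y1 = "Im (fst (act (cusp_matrix a) (act h z)))" and ?y2 = "Im (snd (act (cusp_matrix a) (act h z)))"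
  have \<rho>0: "\<rho> > 0" and L0: "L > 0" using L k0 s_pos unfolding \<rho> by auto
  have hz: "act h z \<in> HH" using act_HH[OF Gam_GK[OF ah(2)] z] .
  have "\<exists>j\<le>m. 2 ^ j \<le> \<rho> * ?y1 \<and> (j < m \<longrightarrow> \<rho> * ?y1 < 2 ^ Suc j)"
  proof (induction m)
    case 0
    have "\<rho> * ?y1 \<ge> \<rho> * (1 / \<rho>)" using ah(5) \<rho>0 by (intro mult_left_mono) auto
    then show ?case using \<rho>0 by simp
  next
    case (Suc m)
    then obtain j where j: "j \<le> m" "2 ^ j \<le> \<rho> * ?y1" "j < m \<longrightarrow> \<rho> * ?y1 < 2 ^ Suc j" by blast
    show ?case
    proof (cases "\<rho> * ?y1 < 2 ^ Suc j")
      case True then show ?thesis using j by (intro exI[of _ j]) auto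
    next
      case False
      then have "j = m" using j by auto
      then show ?thesis using False by (intro exI[of _ "Suc m"]) auto
    qed
  qed
  then obtain j where j: "j \<le> m" "2 ^ j \<le> \<rho> * ?y1" "j < m \<longrightarrow> \<rho> * ?y1 < 2 ^ Suc j" by blast
  have h1: "2 ^ j / \<rho> \<le> ?y1" using j(2) \<rho>0 by (simp add: field_simps)
  have h2: "(if j < m then \<bar>cusp_width a * cj (cusp_width a)\<bar> * \<rho> / (L\<^sup>2 * 2 ^ Suc j) else 1 / \<rho>) \<le> ?y2"
  proof (cases "j < m")
    case True
    have y2: "?y2 > 0" using ah(6) \<rho>0 by (smt (verit) divide_pos_pos)
    have "\<bar>cusp_width a * cj (cusp_width a)\<bar> * \<rho> \<le> L\<^sup>2 * (?y1 * ?y2) * \<rho>" using ah(7) \<rho>0 by (intro mult_right_mono) auto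
    also have "\<dots> = L\<^sup>2 * ?y2 * (\<rho> * ?y1)" by (simp add: mult_ac)
    also have "\<dots> \<le> L\<^sup>2 * ?y2 * 2 ^ Suc j" using j(3) True y2 by (intro mult_left_mono) auto
    finally show ?thesis using True L0 by (simp add: field_simps)
  qed (use ah in auto)
  have "act h z \<in> parabolic_set L \<rho> m a j"
    using ah(3,4) h1 h2 hz unfolding parabolic_set_def Let_def by (simp add: strip_def mem_Times_iff)
  then show ?thesis using ah(1,2) j(1) by blast
qed

subsection \<open>A lower bound for the volume\<close>

lemma s_sq_ge_3: "s * s \<ge> 3" using p_ge_3 unfolding s_sq by simp

lemma s_gt_3_halves: "s > 3 / 2"
proof (rule ccontr)
  assume "\<not> s > 3 / 2"
  then have "s * s \<le> 3 / 2 * (3 / 2)" using s_pos by (intro mult_mono) auto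
  then show False using s_sq_ge_3 by simp
qed

lemma rational_coordinate_zero:
  assumes "T = of_int u + of_int v * s" "T' = of_int u - of_int v * s" "\<bar>T\<bar> \<le> b" "\<bar>T'\<bar> \<le> b'" "b + b' < 2 * s"
  shows "v = 0"
proof -
  have "2 * (\<bar>real_of_int v\<bar> * s) = \<bar>T - T'\<bar>" unfolding assms(1,2) using s_pos by (simp add: abs_mult)
  then have "\<bar>real_of_int v\<bar> * s < 1 * s" using assms(3-5) by linarith
  then have "\<bar>real_of_int v\<bar> < 1" using s_pos by (simp only: mult_less_cancel_right_pos)
  then show ?thesis by linarith
qed

definition box1 :: "real \<Rightarrow> real \<Rightarrow> complex set" where
  "box1 b A = {z. 0 \<le> Re z \<and> Re z \<le> b \<and> Im z \<in> {1 / A..2 / A}}"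

lemma box1_area:
  assumes "b \<ge> 0" "A > 0"
  shows "box1 b A \<in> sets hyp_area" "emeasure hyp_area (box1 b A) = ennreal (b * (A / 2))"
  using rect_area[of 0 b "1 / A" "2 / A"] assms unfolding box1_def by (simp_all add: divide_right_mono)

definition diagonal_band :: "real \<Rightarrow> real \<Rightarrow> real \<Rightarrow> (complex \<times> complex) set" where
  "diagonal_band A q l = {w \<in> box1 (1 / 2) A \<times> box1 s A. \<bar>Re (fst w) - Re (snd w) + q\<bar> \<le> l}"

lemma Re_measurable_hyp_area [measurable]: "Re \<in> borel_measurable hyp_area"
  unfolding measurable_cong_sets[OF sets_hyp_area refl]
  by (rule measurable_restrict_space1) simp

lemma diagonal_band_measure:
  assumes A: "A > 0" and l: "l \<ge> 0"
  shows "diagonal_band A q l \<in> sets HH_vol" "emeasure HH_vol (diagonal_band A q l) \<le> ennreal (A\<^sup>2 * l / 4)"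
proof -
  have [measurable]: "box1 (1 / 2) A \<in> sets hyp_area" "box1 s A \<in> sets hyp_area"
    using box1_area(1) A s_pos by auto
  have "diagonal_band A q l = (box1 (1 / 2) A \<times> box1 s A) \<inter> {w \<in> space (hyp_area \<Otimes>\<^sub>M hyp_area). \<bar>Re (fst w) - Re (snd w) + q\<bar> \<le> l}"
    using sets.sets_into_space[of "box1 (1 / 2) A" hyp_area] sets.sets_into_space[of "box1 s A" hyp_area]
    unfolding diagonal_band_def by (auto simp: space_pair_measure)
  also have "\<dots> \<in> sets (hyp_area \<Otimes>\<^sub>M hyp_area)" by measurable
  finally show m: "diagonal_band A q l \<in> sets HH_vol" unfolding HH_vol_def .
  have "emeasure HH_vol (diagonal_band A q l) = (\<integral>\<^sup>+z. emeasure hyp_area (Pair z -` diagonal_band A q l) \<partial>hyp_area)"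
    using m unfolding HH_vol_def by (rule hyp.emeasure_pair_measure_alt)
  also have "\<dots> \<le> (\<integral>\<^sup>+z. ennreal (l * A) * indicator (box1 (1 / 2) A) z \<partial>hyp_area)"
  proof (rule nn_integral_mono)
    fix z
    show "emeasure hyp_area (Pair z -` diagonal_band A q l) \<le> ennreal (l * A) * indicator (box1 (1 / 2) A) z"
    proof (cases "z \<in> box1 (1 / 2) A")
      case True
      let ?R = "{w. Re z + q - l \<le> Re w \<and> Re w \<le> Re z + q + l \<and> Im w \<in> {1 / A..2 / A}}"
      have R: "?R \<in> sets hyp_area" "emeasure hyp_area ?R = ennreal (l * A)"
        using rect_area[of "Re z + q - l" "Re z + q + l" "1 / A" "2 / A"] A l
        by (simp_all add: divide_right_mono)
      have "Pair z -` diagonal_band A q l \<subseteq> ?R" by (auto simp: diagonal_band_def box1_def abs_le_iff)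
      then have "emeasure hyp_area (Pair z -` diagonal_band A q l) \<le> emeasure hyp_area ?R" by (rule emeasure_mono[OF _ R(1)])
      then show ?thesis using True R(2) by simp
    next
      case False
      then have "Pair z -` diagonal_band A q l = {}" by (auto simp: diagonal_band_def)
      then show ?thesis by simp
    qed
  qed
  also have "\<dots> = ennreal (l * A) * ennreal (1 / 2 * (A / 2))"
    using box1_area[of "1 / 2" A] A by (simp add: nn_integral_cmult_indicator)
  also have "\<dots> = ennreal (A\<^sup>2 * l / 4)" using A l by (simp add: ennreal_mult[symmetric] power2_eq_square mult_ac)
  finally show "emeasure HH_vol (diagonal_band A q l) \<le> ennreal (A\<^sup>2 * l / 4)" .
qed

text \<open>On the region below, a non-trivial \<open>(a, b, c, d)\<close> in the Hilbert modular group that maps a point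
  of the region into the region has \<open>c\<close> a non-zero rational integer of absolute value at most \<open>3 A / 2\<close>,
  and the point lies in one of the sets \<open>diagonal_band\<close>, the union of which has at most half of the volume.\<close>

lemma surface_volume_ge:
  "ennreal (s ^ 3 / 331776) \<le> emeasure (hilbert_modular_vol K) (hilbert_modular_surface K)"
proof -
  \<comment> \<open>The region has volume \<open>A\<^sup>2 * s / 8\<close> and the bands together at
    most \<open>45 / 8 * A ^ 3\<close>, so any \<open>A \<le> s / 90\<close> leaves half of it. The
    constant 331776 is \<open>16 * 144\<^sup>2\<close>.\<close>
  define A where "A = s / 144"
  have A: "A > 0" using s_pos by (simp add: A_def)
  \<comment> \<open>\<open>u\<close> will be the absolute value of \<open>c\<close>, and
    \<open>m\<close>, up to sign, the coefficient of \<open>s\<close> in \<open>d\<close>.\<close>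
  define I where "I = (SIGMA u:{1..nat \<lfloor>3 / 2 * A\<rfloor>}. {- 2 * int u..2 * int u})"
  define X where "X = (\<lambda>(u::nat, m::int). diagonal_band A (2 * of_int m * s / real u) (3 / real u))"
  define Q where "Q = box1 (1 / 2) A \<times> box1 s A"
  define U where "U = Q - (\<Union>i\<in>I. X i)"
  have fin: "finite I" unfolding I_def by simp
  have Xm: "X i \<in> sets HH_vol" for i unfolding X_def by (cases i) (simp add: diagonal_band_measure(1)[OF A])
  have Q: "Q \<in> sets HH_vol" "emeasure HH_vol Q = ennreal (A\<^sup>2 * s / 8)"
    using emeasure_HH_vol_Times[of "box1 (1 / 2) A" "box1 s A"] box1_area[of "1 / 2" A] box1_area[of s A] A s_pos
    by (simp_all add: Q_def ennreal_mult[symmetric] power2_eq_square mult_ac)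
  have Um: "U \<in> sets HH_vol" unfolding U_def using Q(1) Xm fin by auto
  have "emeasure HH_vol (\<Union>i\<in>I. X i) \<le> (\<Sum>i\<in>I. emeasure HH_vol (X i))"
    using Xm fin by (intro emeasure_subadditive_finite) auto
  also have "\<dots> = (\<Sum>u=1..nat \<lfloor>3 / 2 * A\<rfloor>. \<Sum>m\<in>{- 2 * int u..2 * int u}. emeasure HH_vol (X (u, m)))"
    unfolding I_def by (subst sum.Sigma) auto
  also have "\<dots> \<le> (\<Sum>u=1..nat \<lfloor>3 / 2 * A\<rfloor>. ennreal (15 / 4 * A\<^sup>2))"
  proof (rule sum_mono)
    fix u :: nat assume u: "u \<in> {1..nat \<lfloor>3 / 2 * A\<rfloor>}"
    have "(\<Sum>m\<in>{- 2 * int u..2 * int u}. emeasure HH_vol (X (u, m))) \<le> (\<Sum>m\<in>{- 2 * int u..2 * int u}. ennreal (A\<^sup>2 * (3 / real u) / 4))"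
      unfolding X_def by (intro sum_mono) (simp only: prod.case, intro diagonal_band_measure(2)[OF A], simp)
    also have "\<dots> = ennreal (\<Sum>m\<in>{- 2 * int u..2 * int u}. A\<^sup>2 * (3 / real u) / 4)"
      by (rule sum_ennreal) simp
    also have "(\<Sum>m\<in>{- 2 * int u..2 * int u}. A\<^sup>2 * (3 / real u) / 4) = real (4 * u + 1) * (A\<^sup>2 * (3 / real u) / 4)"
    proof -
      have "card {- 2 * int u..2 * int u} = 4 * u + 1" by simp
      then show ?thesis by (simp only: sum_constant)
    qed
    also have "\<dots> \<le> ennreal (15 / 4 * A\<^sup>2)"
    proof (rule ennreal_leI)
      have "real (4 * u + 1) * (A\<^sup>2 * (3 / real u) / 4) = 3 / 4 * A\<^sup>2 * (real (4 * u + 1) / real u)" by (simp add: mult_ac)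
      also have "real (4 * u + 1) / real u \<le> 5" using u by (simp add: field_simps)
      then have "3 / 4 * A\<^sup>2 * (real (4 * u + 1) / real u) \<le> 3 / 4 * A\<^sup>2 * 5" by (intro mult_left_mono) auto
      finally show "real (4 * u + 1) * (A\<^sup>2 * (3 / real u) / 4) \<le> 15 / 4 * A\<^sup>2" by simp
    qed
    finally show "(\<Sum>m\<in>{- 2 * int u..2 * int u}. emeasure HH_vol (X (u, m))) \<le> ennreal (15 / 4 * A\<^sup>2)" .
  qed
  also have "\<dots> = ennreal (\<Sum>u=1..nat \<lfloor>3 / 2 * A\<rfloor>. 15 / 4 * A\<^sup>2)"
    by (rule sum_ennreal) simp
  also have "(\<Sum>u=1..nat \<lfloor>3 / 2 * A\<rfloor>. 15 / 4 * A\<^sup>2) = real (nat \<lfloor>3 / 2 * A\<rfloor>) * (15 / 4 * A\<^sup>2)"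
    by simp
  also have "\<dots> \<le> ennreal (A\<^sup>2 * s / 16)"
  proof (rule ennreal_leI)
    have "real (nat \<lfloor>3 / 2 * A\<rfloor>) \<le> 3 / 2 * A" by (rule of_nat_floor) (use A in simp)
    then have "real (nat \<lfloor>3 / 2 * A\<rfloor>) * (15 / 4 * A\<^sup>2) \<le> 3 / 2 * A * (15 / 4 * A\<^sup>2)" by (intro mult_right_mono) auto
    also have "\<dots> = 45 / 8 * A * A\<^sup>2" by simp
    also have "\<dots> \<le> s / 16 * A\<^sup>2" unfolding A_def using s_pos by (intro mult_right_mono) auto
    finally show "real (nat \<lfloor>3 / 2 * A\<rfloor>) * (15 / 4 * A\<^sup>2) \<le> A\<^sup>2 * s / 16" by (simp add: mult.commute)
  qed
  finally have bd: "emeasure HH_vol (\<Union>i\<in>I. X i) \<le> ennreal (A\<^sup>2 * s / 16)" .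
  have "ennreal (A\<^sup>2 * s / 8) \<le> emeasure HH_vol (U \<union> (\<Union>i\<in>I. X i))"
    unfolding Q(2)[symmetric] using Q(1) Um Xm fin by (intro emeasure_mono) (auto simp: U_def)
  also have "\<dots> \<le> emeasure HH_vol U + emeasure HH_vol (\<Union>i\<in>I. X i)"
    using Um Xm fin by (intro emeasure_subadditive) auto
  also have "\<dots> \<le> emeasure HH_vol U + ennreal (A\<^sup>2 * s / 16)" using bd by (intro add_left_mono)
  finally have "ennreal (A\<^sup>2 * s / 8) - ennreal (A\<^sup>2 * s / 16) \<le> emeasure HH_vol U"
    by (subst ennreal_minus_le_iff) (auto simp: add.commute)
  moreover have "ennreal (A\<^sup>2 * s / 8) - ennreal (A\<^sup>2 * s / 16) = ennreal (s ^ 3 / 331776)"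
    using s_pos by (subst ennreal_minus) (simp_all add: A_def power2_eq_square power3_eq_cube)
  moreover have "emeasure HH_vol U \<le> emeasure (hilbert_modular_vol K) (hilbert_modular_surface K)"
  proof (rule hilbert_vol_ge[OF Um])
    fix g w assume g: "g \<in> Gam" and w: "w \<in> U" and gw: "act g w \<in> U"
    obtain a b c d where gg: "g = (a, b, c, d)" "a \<in> Zs" "b \<in> Zs" "c \<in> Zs" "d \<in> Zs" and det: "a * d - b * c = 1"
      using g by (auto simp: Gam_def)
    have KK: "a \<in> K" "b \<in> K" "c \<in> K" "d \<in> K" using gg Zs_K by auto
    have det': "cj a * cj d - cj b * cj c = 1" by (rule cj_det[OF KK det])
    have w1: "fst w \<in> box1 (1 / 2) A" "snd w \<in> box1 s A" using w by (auto simp: U_def Q_def)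
    have gw1: "mob a b c d (fst w) \<in> box1 (1 / 2) A" "mob (cj a) (cj b) (cj c) (cj d) (snd w) \<in> box1 s A"
      using gw by (auto simp: U_def Q_def gg act_def)
    \<comment> \<open>Both heights lie in \<open>{1 / A..2 / A}\<close>, so the squared absolute
      value of the denominator is at most 2, which is less than
      \<open>(3 / 2)\<^sup>2\<close>.\<close>
    have bnd: "\<bar>c'\<bar> \<le> 3 / 2 * A \<and> \<bar>c' * Re z + d'\<bar> \<le> 3 / 2"
      if h: "a' * d' - b' * c' = 1" "z \<in> box1 r A" "mob a' b' c' d' z \<in> box1 r' A" for a' b' c' d' z r r'
    proof -
      have z: "1 / A \<le> Im z" "Im z \<le> 2 / A" using h by (auto simp: box1_def)
      have zp: "Im z > 0" using z A by (smt (verit) divide_pos_pos)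
      let ?D = "of_real c' * z + of_real d' :: complex"
      have D: "?D \<noteq> 0" using h(1) zp by (intro denom_nonzero) auto
      have "1 / A \<le> Im z / (cmod ?D)\<^sup>2" using h(3) Im_mob[OF h(1) zp] by (simp add: box1_def)
      then have "(cmod ?D)\<^sup>2 \<le> A * Im z" using A D by (simp add: field_simps)
      also have "\<dots> \<le> 2" using z(2) A by (simp add: field_simps)
      finally have "(cmod ?D)\<^sup>2 \<le> (3 / 2)\<^sup>2" by (simp add: power2_eq_square)
      then have Dle: "cmod ?D \<le> 3 / 2" by (rule power2_le_imp_le) simp
      have "\<bar>c' * Im z\<bar> \<le> 3 / 2" using abs_Im_le_cmod[of ?D] Dle by simp
      then have "\<bar>c'\<bar> * Im z \<le> 3 / 2" using zp by (simp add: abs_mult)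
      moreover have "\<bar>c'\<bar> * (1 / A) \<le> \<bar>c'\<bar> * Im z" using z(1) by (intro mult_left_mono) auto
      ultimately have "\<bar>c'\<bar> * (1 / A) \<le> 3 / 2" by linarith
      then have "\<bar>c'\<bar> \<le> 3 / 2 * A" using A by (simp add: field_simps)
      moreover have "\<bar>c' * Re z + d'\<bar> \<le> 3 / 2" using abs_Re_le_cmod[of ?D] Dle by simp
      ultimately show ?thesis by simp
    qed
    note b1 = bnd[OF det w1(1) gw1(1)] and b2 = bnd[OF det' w1(2) gw1(2)]
    obtain u v where uv: "c = of_int u + of_int v * s" "cj c = of_int u - of_int v * s" using gg(4) by (rule Zs_E)
    have "v = 0" by (rule rational_coordinate_zero[OF uv]) (use b1 b2 s_pos in \<open>auto simp: A_def\<close>)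
    then have cu: "c = of_int u" "cj c = of_int u" using uv by auto
    obtain e f where ef: "d = of_int e + of_int f * s" "cj d = of_int e - of_int f * s" using gg(5) by (rule Zs_E)
    \<comment> \<open>The rational part of \<open>d\<close> cancels in the difference of the two
      conjugate denominators, so the bands need not be indexed by it.\<close>
    have diff: "\<bar>of_int u * (Re (fst w) - Re (snd w)) + 2 * of_int f * s\<bar> \<le> 3"
    proof -
      have "of_int u * (Re (fst w) - Re (snd w)) + 2 * of_int f * s = (c * Re (fst w) + d) - (cj c * Re (snd w) + cj d)"
        unfolding cu ef(2) by (simp add: algebra_simps) (simp add: ef(1) algebra_simps)
      then show ?thesis using b1 b2 by linarith
    qed
    have u0: "u = 0"
    proof (rule ccontr)
      assume u: "u \<noteq> 0"
      define n where "n = nat \<bar>u\<bar>"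
      define m where "m = sgn u * f"
      have n: "n \<ge> 1" "real n = \<bar>of_int u\<bar>" using u by (auto simp: n_def)
      have e: "\<bar>real n * (Re (fst w) - Re (snd w)) + 2 * of_int m * s\<bar> \<le> 3"
      proof (cases "u > 0")
        case True then show ?thesis using diff by (simp add: n m_def)
      next
        case False
        then have "real n * (Re (fst w) - Re (snd w)) + 2 * of_int m * s = - (of_int u * (Re (fst w) - Re (snd w)) + 2 * of_int f * s)"
          using u by (simp add: n m_def algebra_simps)
        then show ?thesis using diff by simp
      qed
      have nA: "n \<le> nat \<lfloor>3 / 2 * A\<rfloor>" using b1 n(2) unfolding cu by (simp add: le_nat_floor)
      have "\<bar>Re (fst w) - Re (snd w)\<bar> \<le> s" using w1 s_gt_3_halves by (auto simp: box1_def abs_le_iff)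
      then have "real n * \<bar>Re (fst w) - Re (snd w)\<bar> \<le> real n * s" by (intro mult_left_mono) auto
      then have "\<bar>real n * (Re (fst w) - Re (snd w))\<bar> \<le> real n * s" by (simp add: abs_mult)
      then have "\<bar>2 * of_int m * s\<bar> \<le> 3 + real n * s" using e by linarith
      moreover have "\<bar>2 * of_int m * s\<bar> = 2 * (\<bar>real_of_int m\<bar> * s)" using s_pos by (simp add: abs_mult)
      ultimately have "2 * (\<bar>real_of_int m\<bar> * s) \<le> (2 + real n) * s" using s_gt_3_halves by (simp add: algebra_simps)
      then have "(2 * \<bar>real_of_int m\<bar>) * s \<le> (2 + real n) * s" by simp
      then have "2 * \<bar>real_of_int m\<bar> \<le> 2 + real n" using s_pos by (simp only: mult_le_cancel_right_pos)
      then have "- 2 * int n \<le> m" "m \<le> 2 * int n" using n(1) by linarith+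
      then have I: "(n, m) \<in> I" using n(1) nA by (simp add: I_def)
      have "Re (fst w) - Re (snd w) + 2 * of_int m * s / real n = (real n * (Re (fst w) - Re (snd w)) + 2 * of_int m * s) / real n"
        using n(1) by (simp add: field_simps)
      then have "\<bar>Re (fst w) - Re (snd w) + 2 * of_int m * s / real n\<bar> \<le> 3 / real n"
        using e n(1) by (simp add: divide_right_mono)
      then have "w \<in> X (n, m)" using w1 by (simp add: X_def diagonal_band_def mem_Times_iff)
      then show False using w I unfolding U_def by blast
    qed
    have c0: "c = 0" "cj c = 0" using cu u0 by auto
    have d32: "\<bar>d\<bar> \<le> 3 / 2" "\<bar>cj d\<bar> \<le> 3 / 2" using b1 b2 unfolding c0 by auto
    have "f = 0" by (rule rational_coordinate_zero[OF ef d32]) (use s_gt_3_halves in simp)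
    then have de: "d = of_int e" using ef by simp
    have ad: "a * d = 1" using det c0 by simp
    then have "e \<noteq> 0" using de by auto
    moreover have "\<bar>real_of_int e\<bar> \<le> 3 / 2" using d32 de by simp
    then have "\<bar>e\<bar> \<le> 1" by linarith
    ultimately have d1: "d = 1 \<or> d = - 1" using de by (auto simp: abs_le_iff)
    then have "a = d" using ad by auto
    define \<beta> where "\<beta> = b * d"
    have \<beta>: "\<beta> \<in> Zs" unfolding \<beta>_def using gg by simp
    have cd1: "cj d = d" using d1 cj_of_int[of "-1"] by auto
    have cb: "cj \<beta> = cj b * d" unfolding \<beta>_def using KK cd1 by simp
    have m1: "mob a b c d (fst w) = fst w + of_real \<beta>" "mob (cj a) (cj b) (cj c) (cj d) (snd w) = snd w + of_real (cj \<beta>)"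
      using d1 unfolding c0 cb cd1 \<open>a = d\<close> by (auto simp: mob_def \<beta>_def)
    \<comment> \<open>The widths \<open>1 / 2\<close> and \<open>s\<close> of the region are made
      for this: an integer with such conjugates is rational and then 0.\<close>
    have bb: "\<bar>\<beta>\<bar> \<le> 1 / 2" "\<bar>cj \<beta>\<bar> \<le> s" using w1 gw1 unfolding m1 by (auto simp: box1_def abs_le_iff)
    obtain i j where ij: "\<beta> = of_int i + of_int j * s" "cj \<beta> = of_int i - of_int j * s" using \<beta> by (rule Zs_E)
    have "j = 0" by (rule rational_coordinate_zero[OF ij bb]) (use s_gt_3_halves in simp)
    then have "\<beta> = of_int i" "cj \<beta> = of_int i" using ij by auto
    moreover have "i = 0"
    proof -
      have "\<bar>real_of_int i\<bar> \<le> 1 / 2" using bb calculation by simp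
      then show ?thesis by linarith
    qed
    ultimately show "act g w = w" using m1 by (simp add: gg act_def)
  qed
  ultimately show ?thesis by simp
qed

end

lemma sum_Sigma_4:
  fixes f :: "'a \<Rightarrow> 'b \<Rightarrow> 'c \<Rightarrow> 'd \<Rightarrow> 'e::comm_monoid_add"
  assumes "finite A" "finite B" "\<And>b. b \<in> B \<Longrightarrow> finite (C b)" "\<And>a b c. finite (D a b c)"
  shows "(\<Sum>(a, b, c, d)\<in>(SIGMA a:A. SIGMA b:B. SIGMA c:C b. D a b c). f a b c d)
    = (\<Sum>a\<in>A. \<Sum>b\<in>B. \<Sum>c\<in>C b. \<Sum>d\<in>D a b c. f a b c d)"
proof -
  have 1: "(\<Sum>c\<in>C b. \<Sum>d\<in>D a b c. f a b c d) = (\<Sum>(c, d)\<in>(SIGMA c:C b. D a b c). f a b c d)" if "b \<in> B" for a b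
    using assms that by (intro sum.Sigma) auto
  have 2: "(\<Sum>b\<in>B. \<Sum>c\<in>C b. \<Sum>d\<in>D a b c. f a b c d)
      = (\<Sum>(b, c, d)\<in>(SIGMA b:B. SIGMA c:C b. D a b c). f a b c d)" for a
  proof -
    have "(\<Sum>b\<in>B. \<Sum>c\<in>C b. \<Sum>d\<in>D a b c. f a b c d) = (\<Sum>b\<in>B. \<Sum>(c, d)\<in>(SIGMA c:C b. D a b c). f a b c d)"
      by (rule sum.cong[OF refl 1])
    also have "\<dots> = (\<Sum>(b, c, d)\<in>(SIGMA b:B. SIGMA c:C b. D a b c). f a b c d)"
      using assms by (intro sum.Sigma) auto
    finally show ?thesis .
  qed
  show ?thesis unfolding 2 using assms by (subst sum.Sigma) auto
qed

context real_quadratic begin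

subsection \<open>The volume of the thin part\<close>

lemma finite_box_elements: "finite (box_elements b)"
proof (rule finite_subset)
  let ?N = "\<lceil>b\<rceil>"
  show "box_elements b \<subseteq> (\<lambda>(u, v). of_int u + of_int v * s) ` ({- ?N..?N} \<times> {- ?N..?N})"
  proof
    fix \<delta> assume "\<delta> \<in> box_elements b"
    then have d: "\<delta> \<in> Zs" "\<bar>\<delta>\<bar> \<le> b" "\<bar>cj \<delta>\<bar> \<le> b" by (auto simp: box_elements_def)
    obtain u v where uv: "\<delta> = of_int u + of_int v * s" "cj \<delta> = of_int u - of_int v * s" using d(1) by (rule Zs_E)
    have "2 * of_int u = \<delta> + cj \<delta>" "2 * (of_int v * s) = \<delta> - cj \<delta>" unfolding uv(2) unfolding uv(1) by simp_all
    then have 1: "\<bar>real_of_int u\<bar> \<le> b" "\<bar>of_int v * s\<bar> \<le> b" using d(2,3) by linarith+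
    have "\<bar>real_of_int v\<bar> * 1 \<le> \<bar>real_of_int v\<bar> * s" using s_gt_1 by (intro mult_left_mono) auto
    then have "\<bar>real_of_int v\<bar> \<le> b" using 1(2) s_pos by (simp add: abs_mult)
    then have "u \<in> {- ?N..?N}" "v \<in> {- ?N..?N}" using 1(1) by (simp_all add: abs_le_iff) linarith+
    then show "\<delta> \<in> (\<lambda>(u, v). of_int u + of_int v * s) ` ({- ?N..?N} \<times> {- ?N..?N})" using uv(1) by force
  qed
qed simp

text \<open>The coefficient of \<open>s\<close> takes at most \<open>2 * V + 1\<close> values; with
  the norm it determines the square of the rational part, and the signs of norm and trace settle the
  rest. For \<open>b = 6 * L * s\<close> the bound is independent of \<open>p\<close>, which
  replaces a count of units.\<close>

lemma norm_fiber_card: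
  assumes V: "b \<le> real V * s"
  shows "card {\<delta> \<in> box_elements b. abs_norm \<delta> = n} \<le> 4 * (2 * V + 1)"
proof -
  define \<phi> where "\<phi> \<delta> = (\<lfloor>(\<delta> - cj \<delta>) / (2 * s)\<rfloor>, \<delta> + cj \<delta> \<ge> 0, \<delta> * cj \<delta> \<ge> 0)" for \<delta>
  have co: "\<lfloor>(\<delta> - cj \<delta>) / (2 * s)\<rfloor> = v" if "\<delta> = of_int u + of_int v * s" "cj \<delta> = of_int u - of_int v * s" for \<delta> u v
  proof -
    have "\<delta> - cj \<delta> = of_int v * (2 * s)" unfolding that(2) unfolding that(1) by simp
    then show ?thesis using s_pos by simp
  qed
  have "inj_on \<phi> {\<delta> \<in> box_elements b. abs_norm \<delta> = n}"
  proof (rule inj_onI)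
    fix x y assume x: "x \<in> {\<delta> \<in> box_elements b. abs_norm \<delta> = n}" and y: "y \<in> {\<delta> \<in> box_elements b. abs_norm \<delta> = n}" and e: "\<phi> x = \<phi> y"
    have xZ: "x \<in> Zs" "x \<noteq> 0" and yZ: "y \<in> Zs" "y \<noteq> 0" using x y by (auto simp: box_elements_def)
    obtain u v where uv: "x = of_int u + of_int v * s" "cj x = of_int u - of_int v * s" using xZ(1) by (rule Zs_E)
    obtain u' v' where uv': "y = of_int u' + of_int v' * s" "cj y = of_int u' - of_int v' * s" using yZ(1) by (rule Zs_E)
    have v: "v = v'" using e co[OF uv] co[OF uv'] by (simp add: \<phi>_def)
    have "\<bar>x * cj x\<bar> = \<bar>y * cj y\<bar>" using abs_norm(1)[OF xZ] abs_norm(1)[OF yZ] x y by simp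
    then have "x * cj x = y * cj y" using e by (auto simp: \<phi>_def abs_if split: if_splits)
    moreover have "x * cj x = of_int u * of_int u - of_int v * of_int v * (s * s)" unfolding uv(2) unfolding uv(1) by (simp add: algebra_simps)
    moreover have "y * cj y = of_int u' * of_int u' - of_int v' * of_int v' * (s * s)" unfolding uv'(2) unfolding uv'(1) by (simp add: algebra_simps)
    ultimately have "real_of_int (u * u) = real_of_int (u' * u')" unfolding v by simp
    then have "u * u = u' * u'" using of_int_eq_iff by blast
    then have "u = u' \<or> u = - u'" by (simp add: square_eq_iff)
    moreover have "x + cj x = 2 * of_int u" "y + cj y = 2 * of_int u'" unfolding uv(2) uv'(2) unfolding uv(1) uv'(1) by simp_all
    then have "u \<ge> 0 \<longleftrightarrow> u' \<ge> 0" using e by (simp add: \<phi>_def)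
    ultimately have "u = u'" by auto
    then show "x = y" using uv uv' v by simp
  qed
  moreover have "\<phi> ` {\<delta> \<in> box_elements b. abs_norm \<delta> = n} \<subseteq> {- int V..int V} \<times> UNIV"
  proof (rule image_subsetI)
    fix x assume "x \<in> {\<delta> \<in> box_elements b. abs_norm \<delta> = n}"
    then have x: "x \<in> Zs" "\<bar>x\<bar> \<le> b" "\<bar>cj x\<bar> \<le> b" by (auto simp: box_elements_def)
    obtain u v where uv: "x = of_int u + of_int v * s" "cj x = of_int u - of_int v * s" using x(1) by (rule Zs_E)
    have "2 * (of_int v * s) = x - cj x" unfolding uv(2) unfolding uv(1) by simp
    then have "\<bar>of_int v * s\<bar> \<le> real V * s" using x(2,3) V by linarith
    then have "\<bar>real_of_int v\<bar> * s \<le> real V * s" using s_pos by (simp add: abs_mult)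
    then have "\<bar>real_of_int v\<bar> \<le> real V" using s_pos by (simp only: mult_le_cancel_right_pos)
    then have "v \<in> {- int V..int V}" by (simp add: abs_le_iff)
    then show "\<phi> x \<in> {- int V..int V} \<times> UNIV" using co[OF uv] by (simp add: \<phi>_def)
  qed
  ultimately have "card {\<delta> \<in> box_elements b. abs_norm \<delta> = n} \<le> card ({- int V..int V} \<times> (UNIV :: (bool \<times> bool) set))"
    by (intro card_inj_on_le) auto
  also have "\<dots> = 4 * (2 * V + 1)" by (simp add: card_cartesian_product UNIV_Times_UNIV[symmetric] del: UNIV_Times_UNIV)
  finally show ?thesis .
qed

lemma sum_box_elements:
  fixes F :: "nat \<Rightarrow> real"
  assumes V: "b \<le> real V * s" and M: "b * b \<le> real M" and F: "\<And>n. F n \<ge> 0"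
  shows "(\<Sum>\<delta>\<in>box_elements b. F (abs_norm \<delta>)) \<le> 4 * (2 * real V + 1) * (\<Sum>n=1..M. F n)"
proof -
  have "abs_norm ` box_elements b \<subseteq> {1..M}"
  proof (rule image_subsetI)
    fix \<delta> assume "\<delta> \<in> box_elements b"
    then have d: "\<delta> \<in> Zs" "\<delta> \<noteq> 0" "\<bar>\<delta>\<bar> \<le> b" "\<bar>cj \<delta>\<bar> \<le> b" by (auto simp: box_elements_def)
    have "\<bar>\<delta> * cj \<delta>\<bar> \<le> b * b" unfolding abs_mult using d by (intro mult_mono) auto
    then have "real (abs_norm \<delta>) \<le> real M" using abs_norm(1)[OF d(1,2)] M by linarith
    then show "abs_norm \<delta> \<in> {1..M}" using abs_norm(2)[OF d(1,2)] by simp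
  qed
  then have "(\<Sum>\<delta>\<in>box_elements b. F (abs_norm \<delta>)) = (\<Sum>n=1..M. \<Sum>\<delta>\<in>{\<delta> \<in> box_elements b. abs_norm \<delta> = n}. F (abs_norm \<delta>))"
    using finite_box_elements by (intro sum.group[symmetric]) auto
  also have "\<dots> = (\<Sum>n=1..M. real (card {\<delta> \<in> box_elements b. abs_norm \<delta> = n}) * F n)" by simp
  also have "\<dots> \<le> (\<Sum>n=1..M. real (4 * (2 * V + 1)) * F n)"
    using norm_fiber_card[OF V] F by (intro sum_mono mult_right_mono) (simp_all only: of_nat_le_iff)
  also have "\<dots> = real (4 * (2 * V + 1)) * (\<Sum>n=1..M. F n)" by (rule sum_distrib_left[symmetric])
  also have "\<dots> = 4 * (2 * real V + 1) * (\<Sum>n=1..M. F n)" by simp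
  finally show ?thesis .
qed

text \<open>First summand: \<open>2 * N + 1\<close> traces and, for \<open>\<delta>\<close> of norm
  \<open>n\<close>, at most \<open>7 * ndiv n ^ 3\<close> ideals with at most
  \<open>7 * ndiv n ^ 3 * (N\<^sup>2 + 4)\<^sup>2\<close> solutions each. Second summand:
  \<open>m\<close> dyadic pieces and a last one for every small ideal.\<close>

lemma thin_part_volume_le:
  assumes R: "R > 0" and \<kappa>: "\<kappa> = 2 * (cosh (2 * R + 1) - 1)" and L: "L = \<kappa> + 2" and large: "3 * L < s"
    and m: "((48 * L + 12) * s)\<^sup>2 \<le> 2 ^ m" and N: "3 * L \<le> real N" and V: "6 * L \<le> real V"
    and M: "36 * L\<^sup>2 * real p \<le> real M"
  shows "emeasure (hilbert_modular_vol K) (thin_part K R) \<le> ennreal (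
     (2 * real N + 1) * (4 * (2 * real V + 1) * (\<Sum>n=1..M. 49 * real (ndiv n) ^ 6 * (real N ^ 2 + 4)\<^sup>2 * (36 * L\<^sup>2 * real p / real n))) +
     real (card small_ideals) * ((2 * real m * L\<^sup>2 + 1) * (2 * s + 1)))"
proof -
  have k0: "\<kappa> \<ge> 0" unfolding \<kappa> using cosh_real_ge_1[of "2 * R + 1"] by simp
  then have L2: "L \<ge> 2" by (simp add: L)
  define \<rho> where "\<rho> = (48 * L + 12) * s"
  have \<rho>0: "\<rho> > 0" using L2 s_pos by (simp add: \<rho>_def)
  define D where "D = box_elements (6 * L * s)"
  define T where "T = {- int N..int N}"
  define I1 where "I1 = (SIGMA t:T. SIGMA \<delta>:D. SIGMA a:cusp_ideals (abs_norm \<delta>). reps t \<delta> a)"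
  define I2 where "I2 = small_ideals \<times> {..m}"
  define S1 where "S1 = (\<lambda>(t, \<delta>, a, \<kappa>0). nonparabolic_set L t \<delta> a \<kappa>0)"
  define S2 where "S2 = (\<lambda>(a, j). parabolic_set L \<rho> m a j)"
  have DD: "\<delta> \<in> Zs" "\<delta> \<noteq> 0" "abs_norm \<delta> > 0" if "\<delta> \<in> D" for \<delta>
    using that abs_norm(2) by (auto simp: D_def box_elements_def)
  have finD: "finite D" unfolding D_def by (rule finite_box_elements)
  have ci: "finite (cusp_ideals (abs_norm \<delta>))" "card (cusp_ideals (abs_norm \<delta>)) \<le> 7 * ndiv (abs_norm \<delta>) ^ 3" if "\<delta> \<in> D" for \<delta>
  proof -
    have sub: "cusp_ideals (abs_norm \<delta>) \<subseteq> ideals (abs_norm \<delta>)" by (auto simp: cusp_ideals_def)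
    note i = ideals_finite_card[OF DD(3)[OF that]]
    show "finite (cusp_ideals (abs_norm \<delta>))" using sub i finite_subset by blast
    show "card (cusp_ideals (abs_norm \<delta>)) \<le> 7 * ndiv (abs_norm \<delta>) ^ 3" using card_mono[OF _ sub] i by linarith
  qed
  have fin1: "finite I1" unfolding I1_def using finD ci(1) reps_finite_card(1) by (auto simp: T_def)
  have fin2: "finite I2" unfolding I2_def using small_ideals_card(1) by simp
  have m\<rho>: "\<rho>\<^sup>2 \<le> 2 ^ m" using m by (simp add: \<rho>_def)
  have "emeasure (hilbert_modular_vol K) (thin_part K R) \<le> (\<Sum>i\<in>I1 <+> I2. emeasure HH_vol (case i of Inl i \<Rightarrow> S1 i | Inr i \<Rightarrow> S2 i))"
  proof (rule hilbert_vol_le)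
    show "finite (I1 <+> I2)" using fin1 fin2 by simp
    show "(case i of Inl i \<Rightarrow> S1 i | Inr i \<Rightarrow> S2 i) \<in> sets HH_vol" if "i \<in> I1 <+> I2" for i
      using that nonparabolic_set(1)[OF _ DD(1,2)] parabolic_set(1)[OF _ _ \<rho>0 m\<rho>] L2
      by (auto simp: I1_def I2_def S1_def S2_def)
    fix z assume z: "z \<in> HH" and t: "orb z \<in> thin_part K R"
    obtain h g where hg: "h \<in> Gam" "g \<in> Gam" "g \<noteq> (1, 0, 0, 1)" "g \<noteq> (-1, 0, 0, -1)" "HH_dist (act h z) (act g (act h z)) < 2 * R + 1"
      using thin_point[OF z t] by blast
    let ?w = "act h z"
    have w: "?w \<in> HH" by (rule act_HH[OF Gam_GK[OF hg(1)] z])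
    have n: "nearHH \<kappa> ?w (act g ?w)"
      unfolding nearHH_def by (rule HH_dist_near[OF w act_HH[OF Gam_GK[OF hg(2)] w] hg(5) \<kappa>])
    obtain A B e k where g: "g = (A, B, e, k)" by (metis prod_cases4)
    have GG: "A \<in> Zs" "k \<in> Zs" using hg(2) unfolding g by (auto simp: Gam_def)
    note b = displacement_bounds_HH(5,6)[OF Gam_GK[OF hg(2), unfolded g] w n[unfolded g] k0, folded L]
    \<comment> \<open>This is where \<open>3 * L < s\<close> makes the trace rational.\<close>
    obtain \<tau> where \<tau>: "A + k = of_int \<tau>"
      using bounded_Zs_Ints[of "A + k" "3 * L"] GG b large Zs_K by auto
    have trc: "trace g = of_int \<tau>" using \<tau> by (simp add: g trace_def)
    have hc: "act h2 z' \<in> S \<Longrightarrow> h2 \<in> Gam \<Longrightarrow> z' = ?w \<Longrightarrow> \<exists>f\<in>Gam. act f z \<in> S" for h2 S z'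
      using act_gmul[OF Gam_GK Gam_GK[OF hg(1)] z] gmul_Gam[OF _ hg(1)] by metis
    show "\<exists>i\<in>I1 <+> I2. \<exists>g\<in>Gam. act g z \<in> (case i of Inl i \<Rightarrow> S1 i | Inr i \<Rightarrow> S2 i)"
    proof (cases "\<tau>\<^sup>2 = 4")
      case False
      have "\<exists>\<delta>\<in>D. \<exists>a\<in>cusp_ideals (abs_norm \<delta>). \<exists>\<kappa>0\<in>reps \<tau> \<delta> a. \<exists>h\<in>Gam. act h ?w \<in> nonparabolic_set L \<tau> \<delta> a \<kappa>0"
        unfolding D_def by (rule nonparabolic_cover[OF w hg(2) trc False n k0 L]) (use large L2 in linarith)
      then obtain \<delta> a \<kappa>0 h2 where o: "\<delta> \<in> D" "a \<in> cusp_ideals (abs_norm \<delta>)" "\<kappa>0 \<in> reps \<tau> \<delta> a" "h2 \<in> Gam" "act h2 ?w \<in> nonparabolic_set L \<tau> \<delta> a \<kappa>0"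
        by blast
      have "\<bar>real_of_int \<tau>\<bar> \<le> real N" using b(1) \<tau> N by simp
      then have "\<tau> \<in> T" unfolding T_def by (simp add: abs_le_iff)
      then have "Inl (\<tau>, \<delta>, a, \<kappa>0) \<in> I1 <+> I2" using o by (auto simp: I1_def)
      moreover have "\<exists>f\<in>Gam. act f z \<in> S1 (\<tau>, \<delta>, a, \<kappa>0)" unfolding S1_def prod.case by (rule hc[OF o(5,4) refl])
      ultimately show ?thesis by (intro bexI[of _ "Inl (\<tau>, \<delta>, a, \<kappa>0)"]) auto
    next
      case True
      then have "\<tau>\<^sup>2 = 2\<^sup>2" by simp
      then have "\<tau> = 2 \<or> \<tau> = -2" by (simp only: power2_eq_iff)
      then obtain \<epsilon> :: real where \<epsilon>: "\<epsilon> = 1 \<or> \<epsilon> = -1" "trace g = 2 * \<epsilon>" using trc by fastforce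
      have "g \<noteq> (\<epsilon>, 0, 0, \<epsilon>)" using \<epsilon>(1) hg(3,4) by auto
      then obtain a j h2 where o: "a \<in> small_ideals" "j \<in> {..m}" "h2 \<in> Gam" "act h2 ?w \<in> parabolic_set L \<rho> m a j"
        using parabolic_cover[OF w hg(2) \<epsilon>(2,1) _ n k0 L \<rho>_def, of m] by blast
      have "Inr (a, j) \<in> I1 <+> I2" using o by (auto simp: I2_def)
      moreover have "\<exists>f\<in>Gam. act f z \<in> S2 (a, j)" unfolding S2_def prod.case by (rule hc[OF o(4,3) refl])
      ultimately show ?thesis by (intro bexI[of _ "Inr (a, j)"]) auto
    qed
  qed
  also have "\<dots> = (\<Sum>i\<in>I1. emeasure HH_vol (S1 i)) + (\<Sum>i\<in>I2. emeasure HH_vol (S2 i))"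
    using fin1 fin2 by (simp add: sum.Plus o_def)
  also have "(\<Sum>i\<in>I1. emeasure HH_vol (S1 i)) \<le> ennreal ((2 * real N + 1) *
      (4 * (2 * real V + 1) * (\<Sum>n=1..M. 49 * real (ndiv n) ^ 6 * (real N ^ 2 + 4)\<^sup>2 * (36 * L\<^sup>2 * real p / real n))))"
  proof -
    define F where "F n = 49 * real (ndiv n) ^ 6 * (real N ^ 2 + 4)\<^sup>2 * (36 * L\<^sup>2 * real p / real n)" for n
    have F0: "F n \<ge> 0" for n unfolding F_def by simp
    have "(\<Sum>i\<in>I1. emeasure HH_vol (S1 i)) = (\<Sum>i\<in>I1. case i of (t, \<delta>, a, \<kappa>0) \<Rightarrow> ennreal (36 * L\<^sup>2 * real p / real (abs_norm \<delta>)))"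
      using nonparabolic_set(2)[OF _ DD(1,2)] L2 by (intro sum.cong refl) (auto simp: I1_def S1_def)
    also have "\<dots> = (\<Sum>t\<in>T. \<Sum>\<delta>\<in>D. \<Sum>a\<in>cusp_ideals (abs_norm \<delta>). \<Sum>\<kappa>0\<in>reps t \<delta> a. ennreal (36 * L\<^sup>2 * real p / real (abs_norm \<delta>)))"
      unfolding I1_def using finD ci(1) reps_finite_card(1) by (intro sum_Sigma_4) (auto simp: T_def)
    also have "\<dots> \<le> (\<Sum>t\<in>T. \<Sum>\<delta>\<in>D. ennreal (F (abs_norm \<delta>)))"
    proof (intro sum_mono)
      fix t \<delta> assume t: "t \<in> T" and \<delta>: "\<delta> \<in> D"
      let ?x = "36 * L\<^sup>2 * real p / real (abs_norm \<delta>)" and ?d = "ndiv (abs_norm \<delta>)"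
      have x0: "?x \<ge> 0" by simp
      have "(nat \<bar>t\<^sup>2 - 4\<bar>) \<le> N\<^sup>2 + 4"
      proof -
        have "\<bar>t\<bar> \<le> int N" using t by (auto simp: T_def)
        then have "t\<^sup>2 \<le> (int N)\<^sup>2" by (metis abs_le_square_iff abs_of_nat)
        moreover have "t\<^sup>2 \<ge> 0" by simp
        moreover have "int (N\<^sup>2 + 4) = (int N)\<^sup>2 + 4" by simp
        ultimately have "\<bar>t\<^sup>2 - 4\<bar> \<le> int (N\<^sup>2 + 4)" by linarith
        then show ?thesis by linarith
      qed
      then have W: "(nat \<bar>t\<^sup>2 - 4\<bar>)\<^sup>2 \<le> (N\<^sup>2 + 4)\<^sup>2" by (rule power_mono) simp
      have "(\<Sum>\<kappa>0\<in>reps t \<delta> a. ennreal ?x) = ennreal (real (card (reps t \<delta> a)) * ?x)" for a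
        using sum_ennreal[of "reps t \<delta> a" "\<lambda>_. ?x"] x0 by simp
      then have "(\<Sum>a\<in>cusp_ideals (abs_norm \<delta>). \<Sum>\<kappa>0\<in>reps t \<delta> a. ennreal ?x)
          = (\<Sum>a\<in>cusp_ideals (abs_norm \<delta>). ennreal (real (card (reps t \<delta> a)) * ?x))" by (simp only:)
      also have "\<dots> = ennreal (\<Sum>a\<in>cusp_ideals (abs_norm \<delta>). real (card (reps t \<delta> a)) * ?x)"
        by (rule sum_ennreal) simp
      also have "\<dots> \<le> ennreal (F (abs_norm \<delta>))"
      proof (rule ennreal_leI)
        have "(\<Sum>a\<in>cusp_ideals (abs_norm \<delta>). real (card (reps t \<delta> a)) * ?x) \<le> (\<Sum>a\<in>cusp_ideals (abs_norm \<delta>). real (7 * ?d ^ 3 * (N\<^sup>2 + 4)\<^sup>2) * ?x)"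
        proof (intro sum_mono mult_right_mono x0)
          fix a
          have "card (reps t \<delta> a) \<le> 7 * ?d ^ 3 * (nat \<bar>t\<^sup>2 - 4\<bar>)\<^sup>2" by (rule reps_finite_card(2))
          also have "\<dots> \<le> 7 * ?d ^ 3 * (N\<^sup>2 + 4)\<^sup>2" using W by (intro mult_left_mono) auto
          finally show "real (card (reps t \<delta> a)) \<le> real (7 * ?d ^ 3 * (N\<^sup>2 + 4)\<^sup>2)" by (simp only: of_nat_le_iff)
        qed
        also have "\<dots> = real (card (cusp_ideals (abs_norm \<delta>))) * (real (7 * ?d ^ 3 * (N\<^sup>2 + 4)\<^sup>2) * ?x)" by simp
        also have "\<dots> \<le> real (7 * ?d ^ 3) * (real (7 * ?d ^ 3 * (N\<^sup>2 + 4)\<^sup>2) * ?x)"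
          using ci(2)[OF \<delta>] x0 by (intro mult_right_mono) (simp_all only: of_nat_le_iff mult_nonneg_nonneg of_nat_0_le_iff)
        also have "\<dots> = F (abs_norm \<delta>)" unfolding F_def by (simp add: power_numeral_reduce)
        finally show "(\<Sum>a\<in>cusp_ideals (abs_norm \<delta>). real (card (reps t \<delta> a)) * ?x) \<le> F (abs_norm \<delta>)" .
      qed
      finally show "(\<Sum>a\<in>cusp_ideals (abs_norm \<delta>). \<Sum>\<kappa>0\<in>reps t \<delta> a. ennreal ?x) \<le> ennreal (F (abs_norm \<delta>))" .
    qed
    also have "\<dots> = ennreal (\<Sum>t\<in>T. \<Sum>\<delta>\<in>D. F (abs_norm \<delta>))" using F0 by (simp add: sum_ennreal sum_nonneg del: sum_constant)
    also have "\<dots> \<le> ennreal ((2 * real N + 1) * (4 * (2 * real V + 1) * (\<Sum>n=1..M. F n)))"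
    proof (rule ennreal_leI)
      have "6 * L * s \<le> real V * s" using V s_pos by (intro mult_right_mono) auto
      moreover have "6 * L * s * (6 * L * s) \<le> real M" using M unfolding s_sq[symmetric] by (simp add: power2_eq_square mult_ac)
      ultimately have "(\<Sum>\<delta>\<in>D. F (abs_norm \<delta>)) \<le> 4 * (2 * real V + 1) * (\<Sum>n=1..M. F n)"
        unfolding D_def using F0 by (rule sum_box_elements)
      then have "(2 * real N + 1) * (\<Sum>\<delta>\<in>D. F (abs_norm \<delta>)) \<le> (2 * real N + 1) * (4 * (2 * real V + 1) * (\<Sum>n=1..M. F n))"
        by (rule mult_left_mono) simp
      moreover have "real (card T) = 2 * real N + 1" by (simp add: T_def)
      ultimately show "(\<Sum>t\<in>T. \<Sum>\<delta>\<in>D. F (abs_norm \<delta>)) \<le> (2 * real N + 1) * (4 * (2 * real V + 1) * (\<Sum>n=1..M. F n))"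
        by (simp only: sum_constant)
    qed
    finally show ?thesis unfolding F_def .
  qed
  also have "(\<Sum>i\<in>I2. emeasure HH_vol (S2 i)) \<le> ennreal (real (card small_ideals) * ((2 * real m * L\<^sup>2 + 1) * (2 * s + 1)))"
  proof -
    have "(\<Sum>i\<in>I2. emeasure HH_vol (S2 i)) = (\<Sum>a\<in>small_ideals. \<Sum>j\<le>m. emeasure HH_vol (parabolic_set L \<rho> m a j))"
      unfolding I2_def S2_def by (subst sum.cartesian_product) (simp add: case_prod_unfold)
    also have "\<dots> \<le> (\<Sum>a\<in>small_ideals. \<Sum>j\<le>m. ennreal (if j < m then 2 * L\<^sup>2 * (2 * s + 1) else 2 * s + 1))"
      using parabolic_set(2)[OF _ _ \<rho>0 m\<rho>] L2 by (intro sum_mono) auto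
    also have "\<dots> = ennreal (\<Sum>a\<in>small_ideals. \<Sum>j\<le>m. if j < m then 2 * L\<^sup>2 * (2 * s + 1) else 2 * s + 1)"
      using s_pos by (simp add: sum_ennreal sum_nonneg del: sum_constant)
    also have "(\<Sum>j\<le>m. if j < m then 2 * L\<^sup>2 * (2 * s + 1) else 2 * s + 1) = (2 * real m * L\<^sup>2 + 1) * (2 * s + 1)"
      by (simp add: lessThan_Suc_atMost[symmetric] algebra_simps)
    finally show ?thesis by simp
  qed
  finally show ?thesis
    using s_pos L2 by (simp add: ennreal_plus sum_nonneg add_mono)
qed

end

section \<open>Divisor bound and elementary sums\<close>

lemma ndiv_mult_le: assumes "a > 0" "b > 0" shows "ndiv (a * b) \<le> ndiv a * ndiv b"
proof -
  have "{d. d dvd a * b} \<subseteq> (\<lambda>(x, y). x * y) ` ({d. d dvd a} \<times> {d. d dvd b})"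
  proof
    fix d assume "d \<in> {d. d dvd a * b}"
    then obtain x y where "d = x * y" "x dvd a" "y dvd b" using division_decomp[of d a b] by blast
    then show "d \<in> (\<lambda>(x, y). x * y) ` ({d. d dvd a} \<times> {d. d dvd b})" by force
  qed
  then have "card {d. d dvd a * b} \<le> card ({d. d dvd a} \<times> {d. d dvd b})"
    using finite_divs assms by (intro surj_card_le[of _ _ "\<lambda>(x, y). x * y"]) auto
  then show ?thesis by (simp add: ndiv_def card_cartesian_product)
qed

lemma ndiv_prime_power: assumes "prime q" shows "ndiv (q ^ e) \<le> e + 1"
proof -
  have "{d. d dvd q ^ e} \<subseteq> (\<lambda>i. q ^ i) ` {..e}" using divides_primepow_nat[OF assms] by auto
  then have "card {d. d dvd q ^ e} \<le> card {..e}" by (intro surj_card_le) auto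
  then show ?thesis by (simp add: ndiv_def)
qed

text \<open>The classical product bound: a prime power \<open>q ^ e\<close> contributes
  \<open>e + 1\<close>, which is at most \<open>(q powr \<epsilon>) ^ e\<close> unless
  \<open>q powr \<epsilon> < 2\<close>; each of the finitely many exceptional primes costs a factor
  \<open>B\<close>.\<close>

lemma ndiv_bound:
  fixes \<epsilon> :: real assumes \<epsilon>: "\<epsilon> > 0"
  shows "\<exists>C>0. \<forall>n>0. real (ndiv n) \<le> C * real n powr \<epsilon>"
proof -
  \<comment> \<open>Chosen so that \<open>e + 1 \<le> B * (1 + e * (\<epsilon> * ln 2))\<close>,
    which is then combined with Bernoulli's inequality.\<close>
  define B where "B = max 1 (1 / (\<epsilon> * ln 2))"
  define Q where "Q = {q::nat. prime q \<and> real q powr \<epsilon> < 2}"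
  have B: "B \<ge> 1" "B * (\<epsilon> * ln 2) \<ge> 1"
  proof -
    show "B \<ge> 1" unfolding B_def by simp
    have k: "\<epsilon> * ln 2 > 0" using \<epsilon> by simp
    have "1 / (\<epsilon> * ln 2) \<le> B" unfolding B_def by simp
    then show "B * (\<epsilon> * ln 2) \<ge> 1" using k by (simp only: pos_divide_le_eq)
  qed
  have Qfin: "finite Q"
  proof (rule finite_subset)
    show "Q \<subseteq> {..nat \<lceil>2 powr (1 / \<epsilon>)\<rceil>}"
    proof
      fix q assume "q \<in> Q"
      then have q: "real q powr \<epsilon> < 2" by (simp add: Q_def)
      have "real q \<le> 2 powr (1 / \<epsilon>)"
      proof (rule ccontr)
        assume "\<not> ?thesis"
        then have "(2 powr (1 / \<epsilon>)) powr \<epsilon> \<le> real q powr \<epsilon>" using \<epsilon> by (intro powr_mono2) auto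
        then show False using q \<epsilon> by (simp add: powr_powr)
      qed
      then show "q \<in> {..nat \<lceil>2 powr (1 / \<epsilon>)\<rceil>}" by (simp add: le_nat_iff) linarith
    qed
  qed simp
  have pp: "real (e + 1) \<le> (if q \<in> Q then B else 1) * (real q powr \<epsilon>) ^ e" if q: "prime q" for q e :: nat
  proof (cases "q \<in> Q")
    case True
    have "1 + real e * (\<epsilon> * ln 2) \<le> (1 + \<epsilon> * ln 2) ^ e"
      using Bernoulli_inequality[of "\<epsilon> * ln 2" e] \<epsilon> by (simp add: order_trans[of _ 0])
    also have "\<dots> \<le> (real q powr \<epsilon>) ^ e"
    proof (intro power_mono)
      have "1 + \<epsilon> * ln 2 \<le> exp (\<epsilon> * ln 2)" by (rule exp_ge_add_one_self)
      also have "\<dots> = 2 powr \<epsilon>" by (simp add: powr_def)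
      also have "\<dots> \<le> real q powr \<epsilon>" using \<epsilon> prime_ge_2_nat[OF q] by (intro powr_mono2) auto
      finally show "1 + \<epsilon> * ln 2 \<le> real q powr \<epsilon>" .
    qed (use \<epsilon> in simp)
    finally have "B * (1 + real e * (\<epsilon> * ln 2)) \<le> B * (real q powr \<epsilon>) ^ e" using B by (intro mult_left_mono) auto
    moreover have "real e + 1 \<le> B * (1 + real e * (\<epsilon> * ln 2))"
    proof -
      have "real e * 1 \<le> real e * (B * (\<epsilon> * ln 2))" using B by (intro mult_left_mono) auto
      then show ?thesis using B by (simp add: algebra_simps)
    qed
    ultimately show ?thesis using True by simp
  next
    case False
    have "e + 1 \<le> 2 ^ e" by (induction e) auto
    then have "real (e + 1) \<le> real (2 ^ e)" by (simp only: of_nat_le_iff)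
    also have "\<dots> \<le> (real q powr \<epsilon>) ^ e" using False q by (simp add: Q_def power_mono)
    finally show ?thesis using False by simp
  qed
  have "real (ndiv n) \<le> B ^ card {q \<in> Q. q dvd n} * real n powr \<epsilon>" if "n > 0" for n
    using that
  proof (induction n rule: less_induct)
    case (less n)
    show ?case
    proof (cases "n = 1")
      case True
      then show ?thesis by (simp add: ndiv_def) (use B(1) in \<open>simp add: one_le_power\<close>)
    next
      case False
      then obtain q where q: "prime q" "q dvd n" using prime_factor_nat by blast
      define e where "e = multiplicity q n"
      have "\<not> is_unit q" using q(1) not_prime_unit by blast
      then obtain m where m: "n = q ^ e * m" "\<not> q dvd m"
        using less.prems multiplicity_decompose'[of n q] unfolding e_def by auto
      have m0: "m > 0" using m less.prems by (auto intro: Nat.gr0I)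
      have e0: "e > 0" unfolding e_def using q less.prems by (simp add: prime_multiplicity_gt_zero_iff)
      have "q ^ e > 1" by (rule one_less_power[OF prime_gt_1_nat[OF q(1)] e0])
      then have mn: "m < n" using m m0 by simp
      have fin: "finite {q \<in> Q. q dvd k}" for k using Qfin by simp
      have "real (ndiv n) \<le> real (ndiv (q ^ e)) * real (ndiv m)"
        using ndiv_mult_le[of "q ^ e" m] m m0 q by (metis of_nat_le_iff of_nat_mult prime_gt_0_nat zero_less_power)
      also have "\<dots> \<le> real (e + 1) * real (ndiv m)"
        using ndiv_prime_power[OF q(1), of e] by (intro mult_right_mono) auto
      also have "\<dots> \<le> ((if q \<in> Q then B else 1) * (real q powr \<epsilon>) ^ e) * (B ^ card {q \<in> Q. q dvd m} * real m powr \<epsilon>)"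
        using pp[OF q(1)] less.IH[OF mn m0] B by (intro mult_mono) auto
      also have "\<dots> = ((if q \<in> Q then B else 1) * B ^ card {q \<in> Q. q dvd m}) * real n powr \<epsilon>"
      proof -
        have "(real q powr \<epsilon>) ^ e * real m powr \<epsilon> = real n powr \<epsilon>"
          unfolding m(1) using q by (simp add: powr_mult powr_power powr_realpow[symmetric] powr_powr prime_gt_0_nat mult.commute)
        then show ?thesis by (simp add: mult_ac)
      qed
      also have "\<dots> \<le> B ^ card {q \<in> Q. q dvd n} * real n powr \<epsilon>"
      proof (rule mult_right_mono)
        show "(if q \<in> Q then B else 1) * B ^ card {q \<in> Q. q dvd m} \<le> B ^ card {q \<in> Q. q dvd n}"
        proof (cases "q \<in> Q")
          case True
          have "card (insert q {q \<in> Q. q dvd m}) = Suc (card {q \<in> Q. q dvd m})" using fin m by (intro card_insert_disjoint) auto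
          moreover have "card (insert q {q \<in> Q. q dvd m}) \<le> card {q \<in> Q. q dvd n}"
            using True q m fin by (intro card_mono) auto
          ultimately have "B ^ Suc (card {q \<in> Q. q dvd m}) \<le> B ^ card {q \<in> Q. q dvd n}" using B by (intro power_increasing) auto
          then show ?thesis using True by simp
        next
          case False
          have "card {q \<in> Q. q dvd m} \<le> card {q \<in> Q. q dvd n}" using m fin by (intro card_mono) auto
          then show ?thesis using False B by (simp add: power_increasing)
        qed
      qed simp
      finally show ?thesis .
    qed
  qed
  moreover have "B ^ card {q \<in> Q. q dvd n} \<le> B ^ card Q" for n
    using B Qfin by (intro power_increasing card_mono) auto
  ultimately have "real (ndiv n) \<le> B ^ card Q * real n powr \<epsilon>" if "n > 0" for n
    using that by (meson mult_right_mono order_trans powr_ge_zero)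
  then show ?thesis using B by (intro exI[of _ "B ^ card Q"]) auto
qed

lemma sum_inverse_le: "(\<Sum>n=1..Suc N. 1 / real n) \<le> 1 + ln (real (Suc N))"
proof (induction N)
  case (Suc N)
  let ?x = "real (Suc N) / real (Suc (Suc N))"
  have "ln ?x \<le> ?x - 1" by (rule ln_le_minus_one) simp
  also have "?x - 1 = - (1 / real (Suc (Suc N)))" by (simp add: field_simps)
  finally have "1 / real (Suc (Suc N)) \<le> ln (real (Suc (Suc N))) - ln (real (Suc N))" by (simp add: ln_div)
  then show ?case using Suc by simp
qed simp

text \<open>The power is pulled out at its maximum, and the logarithm from the harmonic sum is
  absorbed into a second power \<open>1/10\<close>.\<close>

lemma sum_powr_le: assumes "M > 0" shows "(\<Sum>n=1..M. real n powr (1/10) / real n) \<le> 11 * real M powr (1/5)"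
proof -
  have "(\<Sum>n=1..M. real n powr (1/10) / real n) \<le> (\<Sum>n=1..M. real M powr (1/10) * (1 / real n))"
  proof (rule sum_mono)
    fix n assume n: "n \<in> {1..M}"
    have "real n powr (1/10) \<le> real M powr (1/10)" using n by (intro powr_mono2) auto
    then show "real n powr (1/10) / real n \<le> real M powr (1/10) * (1 / real n)" by (simp add: divide_right_mono)
  qed
  also have "\<dots> = real M powr (1/10) * (\<Sum>n=1..M. 1 / real n)" by (rule sum_distrib_left[symmetric])
  also have "\<dots> \<le> real M powr (1/10) * (11 * real M powr (1/10))"
  proof (rule mult_left_mono)
    have "(\<Sum>n=1..M. 1 / real n) \<le> 1 + ln (real M)" using sum_inverse_le[of "M - 1"] assms by simp
    also have "\<dots> \<le> real M powr (1/10) + 10 * real M powr (1/10)"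
      using ln_powr_bound[of "real M" "1/10"] ge_one_powr_ge_zero[of "real M" "1/10"] assms by simp
    finally show "(\<Sum>n=1..M. 1 / real n) \<le> 11 * real M powr (1/10)" by simp
  qed simp
  also have "\<dots> = 11 * (real M powr (1/10) * real M powr (1/10))" by simp
  also have "real M powr (1/10) * real M powr (1/10) = real M powr (1/5)" by (simp flip: powr_add)
  finally show ?thesis .
qed

section \<open>Volume bounds as powers of the prime\<close>

context real_quadratic begin

lemma p_powr_mono: "a \<le> b \<Longrightarrow> real p powr a \<le> real p powr b"
  using p_ge_3 by (intro powr_mono) auto

lemma p_powr_ge_1: "a \<ge> 0 \<Longrightarrow> 1 \<le> real p powr a"
  using p_ge_3 by (intro ge_one_powr_ge_zero) auto

text \<open>The exponent \<open>1/60\<close> becomes \<open>1/20\<close> for the cube here and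
  \<open>1/10\<close> for the sixth power in \<open>thin_part_bound_large\<close>. The factor 112 is
  \<open>7 * 4 * 4\<close>: at most \<open>4 * s\<close> norms, and a crude 4 for
  \<open>4 powr (1/20)\<close>.\<close>

lemma small_ideals_bound:
  assumes C: "C > 0" "\<And>n. n > 0 \<Longrightarrow> real (ndiv n) \<le> C * real n powr (1/60)"
  shows "real (card small_ideals) \<le> 112 * C ^ 3 * s * real p powr (1/20)"
proof -
  define X where "X = nat \<lfloor>4 * s\<rfloor>"
  have X: "real X \<le> 4 * s" unfolding X_def using s_pos by (intro of_nat_floor) simp
  have sp: "s \<le> real p" unfolding s_sq[symmetric] using s_gt_1 by simp
  have "real (card small_ideals) \<le> (\<Sum>n=1..X. real (7 * ndiv n ^ 3))"
    using small_ideals_card(2) unfolding X_def[symmetric] by (metis of_nat_le_iff of_nat_sum)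
  also have "\<dots> \<le> (\<Sum>n=1..X. 28 * C ^ 3 * real p powr (1/20))"
  proof (rule sum_mono)
    fix n assume n: "n \<in> {1..X}"
    have "real (ndiv n) ^ 3 \<le> (C * real n powr (1/60)) ^ 3" using C(2)[of n] n by (intro power_mono) auto
    also have "\<dots> = C ^ 3 * real n powr (1/20)" using n by (simp add: power_mult_distrib powr_power)
    also have "\<dots> \<le> C ^ 3 * (4 * real p powr (1/20))"
    proof (rule mult_left_mono)
      have "real n \<le> 4 * real p" using n X sp by auto
      then have "real n powr (1/20) \<le> (4 * real p) powr (1/20)" by (intro powr_mono2) auto
      also have "\<dots> = 4 powr (1/20) * real p powr (1/20)" by (simp add: powr_mult)
      also have "(4::real) powr (1/20) \<le> 4 powr 1" by (intro powr_mono) auto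
      then have "4 powr (1/20) * real p powr (1/20) \<le> 4 * real p powr (1/20)" by (intro mult_right_mono) auto
      finally show "real n powr (1/20) \<le> 4 * real p powr (1/20)" .
    qed (use C in simp)
    finally show "real (7 * ndiv n ^ 3) \<le> 28 * C ^ 3 * real p powr (1/20)" by simp
  qed
  also have "\<dots> = real X * (28 * C ^ 3 * real p powr (1/20))" by simp
  also have "\<dots> \<le> 4 * s * (28 * C ^ 3 * real p powr (1/20))" using X C by (intro mult_right_mono) auto
  finally show ?thesis by (simp add: mult_ac)
qed

lemma log_bound:
  assumes E: "E \<ge> 1"
  shows "real (nat \<lceil>log 2 (E * real p)\<rceil>) \<le> (10 * E powr (1/10) / ln 2 + 1) * real p powr (1/10)"
proof -
  have "1 * 1 \<le> E * real p" using E p_ge_3 by (intro mult_mono) auto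
  then have Ep: "E * real p \<ge> 1" by simp
  have l0: "log 2 (E * real p) \<ge> 0" using Ep by simp
  have 1: "real (nat \<lceil>log 2 (E * real p)\<rceil>) \<le> log 2 (E * real p) + 1" using l0 by linarith
  have "log 2 (E * real p) = ln (E * real p) / ln 2" by (simp only: log_def)
  also have "\<dots> \<le> ((E * real p) powr (1/10) / (1/10)) / ln 2"
    using ln_powr_bound[OF Ep, of "1/10"] by (intro divide_right_mono) auto
  also have "\<dots> = 10 * E powr (1/10) / ln 2 * real p powr (1/10)" using E by (simp add: powr_mult)
  finally have "log 2 (E * real p) \<le> 10 * E powr (1/10) / ln 2 * real p powr (1/10)" .
  then show ?thesis using 1 p_powr_ge_1[of "1/10"] unfolding distrib_right mult_1_left by linarith
qed

lemma p_powr_mult: "real p powr a * real p powr b = real p powr (a + b)"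
  by (simp add: powr_add)

text \<open>Elements with trace other than \<open>2\<close> and \<open>-2\<close> give
  \<open>p\<close> from the heights times \<open>p powr (1/5)\<close> from
  \<open>sum_powr_le\<close>. Parabolic elements give \<open>s * p powr (1/20)\<close> ideals,
  \<open>p powr (1/10)\<close> dyadic pieces and a width of order \<open>s\<close>, in total
  \<open>p powr (23/20)\<close>.\<close>

lemma thin_part_bound_large:
  assumes C: "C > 0" "\<And>n. n > 0 \<Longrightarrow> real (ndiv n) \<le> C * real n powr (1/60)"
    and R: "R > 0" and L: "L = 2 * (cosh (2 * R + 1) - 1) + 2" and large: "3 * L < s"
    and N: "N = nat \<lceil>3 * L\<rceil>" and V: "V = nat \<lceil>6 * L\<rceil>"
    and K2: "K2 = 10 * ((48 * L + 12)\<^sup>2) powr (1/10) / ln 2 + 1"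
  shows "emeasure (hilbert_modular_vol K) (thin_part K R) \<le> ennreal (
    ((2 * real N + 1) * (4 * (2 * real V + 1) * (49 * C ^ 6 * (real N ^ 2 + 4)\<^sup>2 * (36 * L\<^sup>2) * (11 * (37 * L\<^sup>2) powr (1/5))))
      + 112 * C ^ 3 * (2 * K2 * L\<^sup>2 + 1) * 3) * real p powr (6/5))"
proof -
  have L2: "L \<ge> 2" unfolding L using cosh_real_ge_1[of "2 * R + 1"] by simp
  have LL: "L\<^sup>2 \<ge> 2\<^sup>2" using L2 by (intro power_mono) auto
  have p1: "real p \<ge> 1" using p_ge_3 by simp
  define E where "E = (48 * L + 12)\<^sup>2"
  have "1\<^sup>2 \<le> (48 * L + 12)\<^sup>2" using L2 by (intro power_mono) auto
  then have E1: "E \<ge> 1" by (simp add: E_def)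
  define m where "m = nat \<lceil>log 2 (E * real p)\<rceil>"
  have Ep: "E * real p > 0" using E1 p1 by simp
  have m1: "((48 * L + 12) * s)\<^sup>2 \<le> 2 ^ m"
  proof -
    have "((48 * L + 12) * s)\<^sup>2 = E * real p" unfolding E_def s_sq[symmetric] by (simp add: power2_eq_square)
    also have "\<dots> = 2 powr log 2 (E * real p)" using Ep by simp
    also have "\<dots> \<le> 2 powr real m" unfolding m_def by (intro powr_mono real_nat_ceiling_ge) auto
    finally show ?thesis by (simp add: powr_realpow)
  qed
  have m2: "real m \<le> K2 * real p powr (1/10)" unfolding m_def K2 E_def[symmetric] by (rule log_bound[OF E1])
  define M where "M = nat \<lceil>36 * L\<^sup>2 * real p\<rceil>"
  have Lp: "L\<^sup>2 * real p \<ge> 1"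
  proof -
    have "1 * 1 \<le> L\<^sup>2 * real p" using LL p1 by (intro mult_mono) auto
    then show ?thesis by simp
  qed
  have M1: "36 * L\<^sup>2 * real p \<le> real M" unfolding M_def by (rule real_nat_ceiling_ge)
  have M2: "real M \<le> 37 * L\<^sup>2 * real p" unfolding M_def using Lp by linarith
  have M0: "M > 0"
  proof -
    have "36 * L\<^sup>2 * real p = 36 * (L\<^sup>2 * real p)" by simp
    then have "real M > 0" using M1 Lp by linarith
    then show ?thesis by simp
  qed
  define F where "F n = 49 * real (ndiv n) ^ 6 * (real N ^ 2 + 4)\<^sup>2 * (36 * L\<^sup>2 * real p / real n)" for n
  define Q where "Q = 49 * C ^ 6 * (real N ^ 2 + 4)\<^sup>2 * (36 * L\<^sup>2)"
  have Q0: "Q \<ge> 0" unfolding Q_def using C by simp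
  have K20: "K2 \<ge> 0" unfolding K2 by simp
  have "(\<Sum>n=1..M. F n) \<le> (\<Sum>n=1..M. (Q * real p) * (real n powr (1/10) / real n))"
  proof (rule sum_mono)
    fix n assume n: "n \<in> {1..M}"
    have "real (ndiv n) ^ 6 \<le> (C * real n powr (1/60)) ^ 6" using C(2)[of n] n by (intro power_mono) auto
    also have "\<dots> = C ^ 6 * real n powr (1/10)" using n by (simp add: power_mult_distrib powr_power)
    finally have "49 * real (ndiv n) ^ 6 * (real N ^ 2 + 4)\<^sup>2 * (36 * L\<^sup>2 * real p / real n)
        \<le> 49 * (C ^ 6 * real n powr (1/10)) * (real N ^ 2 + 4)\<^sup>2 * (36 * L\<^sup>2 * real p / real n)"
      by (intro mult_right_mono mult_left_mono) auto
    then show "F n \<le> (Q * real p) * (real n powr (1/10) / real n)" unfolding F_def Q_def by (simp add: mult_ac)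
  qed
  also have "\<dots> = (Q * real p) * (\<Sum>n=1..M. real n powr (1/10) / real n)" by (rule sum_distrib_left[symmetric])
  also have "\<dots> \<le> (Q * real p) * (11 * ((37 * L\<^sup>2) powr (1/5) * real p powr (1/5)))"
  proof (rule mult_left_mono)
    have "real M powr (1/5) \<le> (37 * L\<^sup>2 * real p) powr (1/5)" using M2 by (intro powr_mono2) auto
    also have "\<dots> = (37 * L\<^sup>2) powr (1/5) * real p powr (1/5)" by (simp add: powr_mult)
    finally show "(\<Sum>n=1..M. real n powr (1/10) / real n) \<le> 11 * ((37 * L\<^sup>2) powr (1/5) * real p powr (1/5))"
      using sum_powr_le[OF M0] by linarith
  qed (use Q0 in simp)
  also have "\<dots> = Q * (11 * (37 * L\<^sup>2) powr (1/5)) * (real p powr 1 * real p powr (1/5))" using p1 by simp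
  also have "real p powr 1 * real p powr (1/5) = real p powr (6/5)" unfolding p_powr_mult by simp
  finally have sumF: "(\<Sum>n=1..M. F n) \<le> Q * (11 * (37 * L\<^sup>2) powr (1/5)) * real p powr (6/5)" .
  have A: "(2 * real N + 1) * (4 * (2 * real V + 1) * (\<Sum>n=1..M. F n))
      \<le> (2 * real N + 1) * (4 * (2 * real V + 1) * (Q * (11 * (37 * L\<^sup>2) powr (1/5)) * real p powr (6/5)))"
    by (intro mult_left_mono sumF) auto
  have B: "real (card small_ideals) * ((2 * real m * L\<^sup>2 + 1) * (2 * s + 1))
      \<le> 112 * C ^ 3 * (2 * K2 * L\<^sup>2 + 1) * 3 * real p powr (6/5)"
  proof -
    have ss: "s * s = real p powr 1" unfolding s_sq using p1 by simp
    have "2 * real m * L\<^sup>2 + 1 \<le> 2 * (K2 * real p powr (1/10)) * L\<^sup>2 + real p powr (1/10)"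
      using m2 p_powr_ge_1[of "1/10"] by (intro add_mono mult_right_mono) auto
    also have "\<dots> = (2 * K2 * L\<^sup>2 + 1) * real p powr (1/10)" by (simp add: algebra_simps)
    finally have 1: "2 * real m * L\<^sup>2 + 1 \<le> (2 * K2 * L\<^sup>2 + 1) * real p powr (1/10)" .
    have "real (card small_ideals) * ((2 * real m * L\<^sup>2 + 1) * (2 * s + 1))
      \<le> (112 * C ^ 3 * s * real p powr (1/20)) * (((2 * K2 * L\<^sup>2 + 1) * real p powr (1/10)) * (3 * s))"
      using small_ideals_bound[OF C] 1 s_gt_1 C K20 by (intro mult_mono) auto
    also have "\<dots> = 112 * C ^ 3 * (2 * K2 * L\<^sup>2 + 1) * 3 * ((s * s) * (real p powr (1/20) * real p powr (1/10)))"
      by (simp add: mult_ac)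
    also have "(s * s) * (real p powr (1/20) * real p powr (1/10)) = real p powr 1 * real p powr (1/20 + 1/10)"
      by (simp only: ss p_powr_mult)
    also have "\<dots> = real p powr (1 + (1/20 + 1/10))" by (rule p_powr_mult)
    also have "112 * C ^ 3 * (2 * K2 * L\<^sup>2 + 1) * 3 * real p powr (1 + (1/20 + 1/10))
      \<le> 112 * C ^ 3 * (2 * K2 * L\<^sup>2 + 1) * 3 * real p powr (6/5)"
      using C K20 by (intro mult_left_mono p_powr_mono) auto
    finally show ?thesis .
  qed
  have "emeasure (hilbert_modular_vol K) (thin_part K R) \<le> ennreal (
     (2 * real N + 1) * (4 * (2 * real V + 1) * (\<Sum>n=1..M. F n)) + real (card small_ideals) * ((2 * real m * L\<^sup>2 + 1) * (2 * s + 1)))"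
    unfolding F_def using thin_part_volume_le[OF R refl L large m1 _ _ M1, of N V] unfolding N V
    by (simp add: real_nat_ceiling_ge)
  also have "\<dots> \<le> ennreal ((2 * real N + 1) * (4 * (2 * real V + 1) * (Q * (11 * (37 * L\<^sup>2) powr (1/5)) * real p powr (6/5)))
      + 112 * C ^ 3 * (2 * K2 * L\<^sup>2 + 1) * 3 * real p powr (6/5))"
    using A B by (intro ennreal_leI add_mono)
  also have "(2 * real N + 1) * (4 * (2 * real V + 1) * (Q * (11 * (37 * L\<^sup>2) powr (1/5)) * real p powr (6/5)))
      + 112 * C ^ 3 * (2 * K2 * L\<^sup>2 + 1) * 3 * real p powr (6/5)
    = ((2 * real N + 1) * (4 * (2 * real V + 1) * (Q * (11 * (37 * L\<^sup>2) powr (1/5)))) + 112 * C ^ 3 * (2 * K2 * L\<^sup>2 + 1) * 3) * real p powr (6/5)"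
    by (simp add: algebra_simps)
  finally show ?thesis unfolding Q_def .
qed

text \<open>For bounded \<open>s\<close> only a constant matters; the power of \<open>p\<close>
  gives the bound the same shape as for large \<open>p\<close>.\<close>

lemma volume_bound_small:
  assumes C: "C > 0" "\<And>n. n > 0 \<Longrightarrow> real (ndiv n) \<le> C * real n powr (1/60)" and small: "s \<le> b"
  shows "emeasure (hilbert_modular_vol K) B \<le> ennreal (112 * C ^ 3 * b * (36 * b\<^sup>2 * (2 * b + 1)) * real p powr (6/5))"
proof -
  have b: "b > 0" using small s_pos by linarith
  have "real (card small_ideals) * (36 * s\<^sup>2 * (2 * s + 1)) \<le> (112 * C ^ 3 * b * real p powr (6/5)) * (36 * b\<^sup>2 * (2 * b + 1))"
  proof (rule mult_mono)
    have "112 * C ^ 3 * s * real p powr (1/20) \<le> 112 * C ^ 3 * b * real p powr (6/5)"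
      using C b small s_pos by (intro mult_mono p_powr_mono) auto
    then show "real (card small_ideals) \<le> 112 * C ^ 3 * b * real p powr (6/5)" using small_ideals_bound[OF C] by linarith
    show "36 * s\<^sup>2 * (2 * s + 1) \<le> 36 * b\<^sup>2 * (2 * b + 1)"
      using small s_pos by (intro mult_mono power_mono) auto
  qed (use C b s_pos in auto)
  also have "\<dots> = 112 * C ^ 3 * b * (36 * b\<^sup>2 * (2 * b + 1)) * real p powr (6/5)" by (simp only: mult_ac)
  finally have "ennreal (real (card small_ideals) * (36 * s\<^sup>2 * (2 * s + 1))) \<le> ennreal (112 * C ^ 3 * b * (36 * b\<^sup>2 * (2 * b + 1)) * real p powr (6/5))"
    by (rule ennreal_leI)
  then show ?thesis using total_volume_le[of B] by (rule order_trans[rotated])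
qed

lemma surface_volume_lower:
  "real p powr (3/2) / 331776 \<le> measure (hilbert_modular_vol K) (hilbert_modular_surface K)"
proof -
  have "s = real p powr (1/2)" by (simp add: s_def powr_half_sqrt)
  then have "s ^ 3 = real p powr (3/2)" using p_ge_3 by (simp add: powr_power)
  then have "ennreal (real p powr (3/2) / 331776) \<le> emeasure (hilbert_modular_vol K) (hilbert_modular_surface K)"
    using surface_volume_ge by simp
  \<comment> \<open>\<open>measure\<close> is 0 on sets of infinite \<open>emeasure\<close>, so the
    lower bound for it depends on finiteness of the volume.\<close>
  moreover have "emeasure (hilbert_modular_vol K) (hilbert_modular_surface K) \<noteq> \<infinity>"
    using total_volume_le[of "hilbert_modular_surface K"] by (metis ennreal_less_top infinity_ennreal_def leD)
  ultimately have "ennreal (real p powr (3/2) / 331776) \<le> ennreal (measure (hilbert_modular_vol K) (hilbert_modular_surface K))"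
    by (simp add: emeasure_eq_ennreal_measure)
  then show ?thesis by (subst (asm) ennreal_le_iff) auto
qed

end

section \<open>Infinitely many distinct fields and the conclusion\<close>

text \<open>Euclid's argument with \<open>4 * P - 1\<close>: a number congruent to 3 modulo 4 has a
  prime factor congruent to 3, since products of numbers congruent to 1 are congruent to 1.\<close>

lemma infinite_primes_3_mod_4: "infinite {p::nat. prime p \<and> p mod 4 = 3}"
proof
  assume fin: "finite {p::nat. prime p \<and> p mod 4 = 3}"
  define P where "P = \<Prod>{p::nat. prime p \<and> p mod 4 = 3}"
  have P0: "P > 0" unfolding P_def by (intro prod_pos) (auto simp: prime_gt_0_nat)
  define n where "n = 4 * P - 1"
  have n: "n mod 4 = 3" "n > 0" 
  proof -
    obtain Q where "P = Suc Q" using P0 by (cases P) auto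
    then have "n = 3 + 4 * Q" by (simp add: n_def)
    then show "n mod 4 = 3" "n > 0" by (simp_all only: mod_mult_self2) simp_all
  qed
  have *: "\<exists>q. prime q \<and> q dvd k \<and> q mod 4 = 3" if "k mod 4 = 3" for k :: nat
    using that
  proof (induction k rule: less_induct)
    case (less k)
    have k1: "k \<noteq> 1" "k > 0" using less.prems by (auto intro: Nat.gr0I)
    obtain q where q: "prime q" "q dvd k" using prime_factor_nat[OF k1(1)] by blast
    obtain r where r: "k = q * r" using q(2) by blast
    have "odd k" using less.prems by presburger
    then have odd: "odd q" using r by simp
    show ?case
    proof (cases "q mod 4 = 3")
      case False
      then have "q mod 4 = 1" using odd by presburger
      then have "r mod 4 = 3" using less.prems unfolding r by (metis mod_mult_left_eq mult_1)
      moreover have "r < k" using prime_gt_1_nat[OF q(1)] r k1(2) by simp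
      ultimately show ?thesis using less.IH r by (metis dvd_mult)
    qed (use q in blast)
  qed
  obtain q where q: "prime q" "q dvd n" "q mod 4 = 3" using *[OF n(1)] by blast
  have "q dvd P" unfolding P_def using q fin by (intro dvd_prodI) auto
  then have "q dvd 4 * P" by simp
  moreover have "4 * P = n + 1" using P0 by (simp add: n_def)
  ultimately have "q dvd 1" using q(2) by (metis dvd_add_right_iff)
  then show False using q(1) by simp
qed

text \<open>Comparing coordinates in the square of \<open>P.s = a + b * Q.s\<close> gives
  \<open>a * b = 0\<close>, and irrationality of \<open>P.s\<close> excludes \<open>b = 0\<close>;
  hence \<open>q\<close> divides \<open>p\<close>.\<close>

lemma real_quadratic_field_inj:
  assumes "real_quadratic p" "real_quadratic q" and e: "real_quadratic.K p = real_quadratic.K q"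
  shows "p = q"
proof -
  interpret P: real_quadratic p by fact
  interpret Q: real_quadratic q by fact
  have "P.s \<in> P.Zs" by simp
  then have "P.s \<in> Q.Zs" using P.ring_of_integers_K Q.ring_of_integers_K e by simp
  then obtain a b where ab: "P.s = of_int a + of_int b * Q.s" by (rule Q.Zs_E)
  have "real p = P.s * P.s" by (simp add: P.s_sq)
  also have "\<dots> = of_int (a * a + b * b * int q) + of_int (2 * a * b) * Q.s"
    unfolding ab by (simp add: algebra_simps flip: Q.s_sq)
  finally have "of_int (int p) + of_int 0 * Q.s = of_int (a * a + b * b * int q) + of_int (2 * a * b) * Q.s" by simp
  then have h: "int p = a * a + b * b * int q" "a * b = 0" unfolding Q.Zs_rep_eq by auto
  have "b \<noteq> 0"
  proof
    assume "b = 0"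
    then have "P.s \<in> \<rat>" using ab by simp
    then show False using P.s_notin_Rats by simp
  qed
  then have "int q dvd int p" using h by simp
  then have "q dvd p" by simp
  then show ?thesis using P.prime_p Q.prime_p by (metis primes_dvd_imp_eq)
qed

theorem theoremD:
  shows "\<exists>F :: nat \<Rightarrow> real set. inj F \<and> (\<forall>n. real_quadratic_field (F n)) \<and>
    (\<forall>R::real. R > 0 \<longrightarrow> (\<forall>\<epsilon>::real. \<epsilon> > 0 \<longrightarrow> (\<exists>C::real. C > 0 \<and> (\<forall>n.
       emeasure (hilbert_modular_vol (F n)) (thin_part (F n) R)
         \<le> ennreal (C * measure (hilbert_modular_vol (F n)) (hilbert_modular_surface (F n))
                          powr (1 - 1 / 10 + \<epsilon>))))))"
proof -
  let ?S = "{p::nat. prime p \<and> p mod 4 = 3}"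
  define pr where "pr = enumerate ?S"
  have pr: "real_quadratic (pr n)" for n
    using enumerate_in_set[OF infinite_primes_3_mod_4, of n] unfolding pr_def by unfold_locales auto
  define F where "F n = real_quadratic.K (pr n)" for n
  have "inj F"
  proof (rule injI)
    fix m n assume "F m = F n"
    then have "pr m = pr n" unfolding F_def by (rule real_quadratic_field_inj[OF pr pr])
    then show "m = n" using strict_mono_eq[OF strict_mono_enumerate[OF infinite_primes_3_mod_4]] unfolding pr_def by blast
  qed
  moreover have "real_quadratic_field (F n)" for n
    unfolding F_def by (rule real_quadratic.real_quadratic_field_K[OF pr])
  moreover have "\<exists>C::real. C > 0 \<and> (\<forall>n. emeasure (hilbert_modular_vol (F n)) (thin_part (F n) R)
         \<le> ennreal (C * measure (hilbert_modular_vol (F n)) (hilbert_modular_surface (F n)) powr (1 - 1 / 10 + \<epsilon>)))"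
    if R: "R > 0" and \<epsilon>: "\<epsilon> > 0" for R \<epsilon> :: real
  proof -
    obtain C where C: "C > 0" "\<And>n. n > 0 \<Longrightarrow> real (ndiv n) \<le> C * real n powr (1/60)"
      using ndiv_bound[of "1/60"] by auto
    define L where "L = 2 * (cosh (2 * R + 1) - 1) + 2"
    define N where "N = nat \<lceil>3 * L\<rceil>"
    define V where "V = nat \<lceil>6 * L\<rceil>"
    define K2 where "K2 = 10 * ((48 * L + 12)\<^sup>2) powr (1/10) / ln 2 + 1"
    define C1 where "C1 = (2 * real N + 1) * (4 * (2 * real V + 1) * (49 * C ^ 6 * (real N ^ 2 + 4)\<^sup>2 * (36 * L\<^sup>2) * (11 * (37 * L\<^sup>2) powr (1/5))))
      + 112 * C ^ 3 * (2 * K2 * L\<^sup>2 + 1) * 3"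
    define C2 where "C2 = 112 * C ^ 3 * (3 * L) * (36 * (3 * L)\<^sup>2 * (2 * (3 * L) + 1))"
    define C3 where "C3 = max 1 (max C1 C2)"
    \<comment> \<open>The first power of 331776 converts \<open>p powr (6/5)\<close> into volume,
      the second pays for raising the exponent \<open>4/5\<close> to
      \<open>9/10 + \<epsilon>\<close>.\<close>
    define D where "D = C3 * 331776 powr (4/5) * 331776 powr (1/10 + \<epsilon>)"
    have "D > 0" unfolding D_def C3_def by simp
    moreover have "emeasure (hilbert_modular_vol (F n)) (thin_part (F n) R)
         \<le> ennreal (D * measure (hilbert_modular_vol (F n)) (hilbert_modular_surface (F n)) powr (1 - 1 / 10 + \<epsilon>))" for n
    proof -
      interpret real_quadratic "pr n" by (rule pr)
      let ?p = "real (pr n)" and ?v = "measure (hilbert_modular_vol K) (hilbert_modular_surface K)"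
      have le: "ennreal (c * ?p powr (6/5)) \<le> ennreal (C3 * ?p powr (6/5))" if "c \<le> C3" for c
        using that by (intro ennreal_leI mult_right_mono) auto
      have "emeasure (hilbert_modular_vol K) (thin_part K R) \<le> ennreal (C3 * ?p powr (6/5))"
      proof (cases "3 * L < s")
        case True
        have "C1 \<le> C3" by (simp add: C3_def)
        then show ?thesis
          using thin_part_bound_large[OF C R L_def True N_def V_def K2_def, folded C1_def] le order_trans by blast
      next
        case False
        have "C2 \<le> C3" by (simp add: C3_def)
        moreover have "s \<le> 3 * L" using False by simp
        ultimately show ?thesis
          using volume_bound_small[OF C, of "3 * L" "thin_part K R", folded C2_def] le order_trans by blast
      qed
      also have "\<dots> \<le> ennreal (D * ?v powr (1 - 1 / 10 + \<epsilon>))"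
      proof (rule ennreal_leI)
        have v: "?p powr (3/2) \<le> 331776 * ?v" using surface_volume_lower by simp
        have "1 \<le> 331776 * ?v" using v p_powr_ge_1[of "3/2"] by linarith
        then have v0: "?v > 0" by (simp add: zero_less_mult_iff)
        have "?p powr (6/5) = (?p powr (3/2)) powr (4/5)" by (simp add: powr_powr)
        also have "\<dots> \<le> (331776 * ?v) powr (4/5)" using v by (intro powr_mono2) auto
        also have "\<dots> = 331776 powr (4/5) * ?v powr (4/5)" using v0 by (simp add: powr_mult)
        \<comment> \<open>As \<open>331776 * ?v \<ge> 1\<close>, a positive power of it may be
          inserted; this fills the gap between the exponents.\<close>
        also have "?v powr (4/5) \<le> ?v powr (4/5) * (331776 * ?v) powr (1/10 + \<epsilon>)"
          using ge_one_powr_ge_zero[OF \<open>1 \<le> 331776 * ?v\<close>, of "1/10 + \<epsilon>"] \<epsilon> by (simp add: mult_le_cancel_left1)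
        also have "\<dots> = 331776 powr (1/10 + \<epsilon>) * (?v powr (4/5) * ?v powr (1/10 + \<epsilon>))"
          using v0 by (simp add: powr_mult)
        also have "?v powr (4/5) * ?v powr (1/10 + \<epsilon>) = ?v powr (1 - 1/10 + \<epsilon>)" by (simp flip: powr_add)
        finally have "?p powr (6/5) \<le> 331776 powr (4/5) * (331776 powr (1/10 + \<epsilon>) * ?v powr (1 - 1/10 + \<epsilon>))" by simp
        moreover have "C3 \<ge> 0" by (simp add: C3_def)
        ultimately have "C3 * ?p powr (6/5) \<le> C3 * (331776 powr (4/5) * (331776 powr (1/10 + \<epsilon>) * ?v powr (1 - 1/10 + \<epsilon>)))"
          by (rule mult_left_mono)
        then show "C3 * ?p powr (6/5) \<le> D * ?v powr (1 - 1/10 + \<epsilon>)" by (simp add: D_def mult_ac)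
      qed
      finally show ?thesis unfolding F_def .
    qed
    ultimately show ?thesis by blast
  qed
  ultimately show ?thesis by blast
qed

end
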